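(* Let $(W,S)$ be the Weyl group of a split Kac--Moody group and $H$ its generic Hecke algebra over $\mathbb Z[\mathbf q^{\pm1}]$. For each $w\in W$ there exist uniquely determined polynomials $f_{w,\mathcal O}\in\mathbb N[\mathbf q-1]$, for $\mathcal O\in\mathrm{Cl}(W)$, such that $f_{w,\mathcal O}=0$ for all but finitely many $\mathcal O$ and $$T_w\equiv\sum_{\mathcal O\in\mathrm{Cl}(W)}f_{w,\mathcal O}\,T_{\mathcal O}\pmod{[H,H]}.$$
   Context: $(W,S)$ is a crystallographic Coxeter system ($S$ finite, orders of products of two distinct simple reflections in $\{2,3,4,6,\infty\}$). $H$ is the $\mathbb Z[\mathbf q^{\pm1}]$-algebra with generators $T_s$ ($s\in S$), relations $(T_s+1)(T_s-\mathbf q)=0$ and the braid relations; $T_w=T_{s_1}\cdots T_{s_\ell}$ for $w=s_1\cdots s_\ell$ reduced. $[H,H]$ is the $\mathbb Z[\mathbf q^{\pm1}]$-span of all commutators and $\overline H=H/[H,H]$. $\mathrm{Cl}(W)$ is the set of conjugacy classes of $W$; $T_{\mathcal O}\in\overline H$ is the image of $T_v$ for any element $v$ of minimal length in $\mathcal O$ (known to be independent of $v$). $\mathbb N$ contains $0$; $\mathbb N[\mathbf q-1]$ is the set of polynomials in $\mathbf q-1$ with coefficients in $\mathbb N$. *)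

theory Defs
  imports
    "HOL-Algebra.Algebra"
    "HOL-Algebra.Algebraic_Closure_Type"
    "HOL-Library.Poly_Mapping"
    "HOL-Library.FuncSet"
    "HOL-Computational_Algebra.Polynomial"
begin

section \<open>Coxeter systems\<close>

definition word_prod :: "('w, 'm) monoid_scheme \<Rightarrow> 'w list \<Rightarrow> 'w" where
  "word_prod W xs = foldr (\<otimes>\<^bsub>W\<^esub>) xs \<one>\<^bsub>W\<^esub>"

text \<open>
  \<^const>\<open>group.ord\<close> is \<open>0\<close> on elements of infinite order, so the value \<open>0\<close> encodes \<open>\<infinity>\<close>.
\<close>
definition coxeter_order :: "('w, 'm) monoid_scheme \<Rightarrow> 'w \<Rightarrow> 'w \<Rightarrow> nat" where
  "coxeter_order W s t = group.ord W (s \<otimes>\<^bsub>W\<^esub> t)"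

text \<open>
  Insertion of a Coxeter relator \<open>(s t)\<^sup>m\<close>, where \<open>m\<close> is the order of \<open>s t\<close>, into a word over \<open>S\<close>.
  For infinite order the relator is the empty word, i.e. there is no relation; for \<open>s = t\<close> it is
  \<open>s s\<close>.  The relators \<open>s s\<close> make the monoid of words modulo these insertions a group, so the monoid
  presentation is the usual group presentation.
\<close>
definition coxeter_step :: "('w, 'm) monoid_scheme \<Rightarrow> 'w set \<Rightarrow> 'w list \<Rightarrow> 'w list \<Rightarrow> bool" where
  "coxeter_step W S xs ys \<longleftrightarrow>
    (\<exists>us\<in>lists S. \<exists>vs\<in>lists S. \<exists>s\<in>S. \<exists>t\<in>S.
       xs = us @ vs \<and> ys = us @ concat (replicate (coxeter_order W s t) [s, t]) @ vs)"

locale coxeter_system = group W for W :: "('w, 'm) monoid_scheme" (structure) +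
  fixes S :: "'w set"
  assumes simple_carrier: "S \<subseteq> carrier W"
    and simple_generate: "generate W S = carrier W"
    and simple_involution: "s \<in> S \<Longrightarrow> ord s = 2"
    and presentation: "\<lbrakk>xs \<in> lists S; ys \<in> lists S\<rbrakk> \<Longrightarrow>
      word_prod W xs = word_prod W ys \<longleftrightarrow> equivclp (coxeter_step W S) xs ys"

locale crystallographic_coxeter_system = coxeter_system +
  assumes finite_simple: "finite S"
    and crystallographic: "\<lbrakk>s \<in> S; t \<in> S; s \<noteq> t\<rbrakk> \<Longrightarrow> coxeter_order W s t \<in> {2, 3, 4, 6, 0}"

definition cox_length :: "('w, 'm) monoid_scheme \<Rightarrow> 'w set \<Rightarrow> 'w \<Rightarrow> nat" where
  "cox_length W S w = (LEAST n. \<exists>xs\<in>lists S. length xs = n \<and> word_prod W xs = w)"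

definition reduced_words :: "('w, 'm) monoid_scheme \<Rightarrow> 'w set \<Rightarrow> 'w \<Rightarrow> 'w list set" where
  "reduced_words W S w =
    {xs \<in> lists S. word_prod W xs = w \<and> length xs = cox_length W S w}"

definition conj_classes :: "('w, 'm) monoid_scheme \<Rightarrow> 'w set set" where
  "conj_classes W =
    orbits W (carrier W) (\<lambda>g. \<lambda>h\<in>carrier W. g \<otimes>\<^bsub>W\<^esub> h \<otimes>\<^bsub>W\<^esub> inv\<^bsub>W\<^esub> g)"

definition min_length_elements :: "('w, 'm) monoid_scheme \<Rightarrow> 'w set \<Rightarrow> 'w set \<Rightarrow> 'w set" where
  "min_length_elements W S C = {v \<in> C. \<forall>u\<in>C. cox_length W S v \<le> cox_length W S u}"


section \<open>The coefficient ring\<close>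

text \<open>\<open>\<int>[q\<^sup>\<plusminus>\<^sup>1]\<close> as the group ring over \<open>\<int>\<close> of the additive group \<open>\<int>\<close> of exponents.\<close>
type_synonym laurent = "int \<Rightarrow>\<^sub>0 int"

definition laurent_q :: laurent where
  "laurent_q = Poly_Mapping.single 1 1"

abbreviation laurent_ring :: "laurent ring" where
  "laurent_ring \<equiv> ring_of_type_algebra"

text \<open>\<open>\<nat>[q - 1]\<close>, as a subset of \<open>\<int>[q\<^sup>\<plusminus>\<^sup>1]\<close>.\<close>
definition nat_polys_q_minus_1 :: "laurent set" where
  "nat_polys_q_minus_1 = range (\<lambda>p :: nat poly. poly (map_poly of_nat p) (laurent_q - 1))"


section \<open>The free associative algebra\<close>

text \<open>
  The free monoid, written additively because multiplication in \<^typ>\<open>'a \<Rightarrow>\<^sub>0 'b\<close> is convolution with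
  respect to addition of keys.  A separate type is used since \<open>+\<close> on lists has another meaning
  in the library.
\<close>
datatype 'a free_word = Word (letters: "'a list")

instantiation free_word :: (type) monoid_add
begin

definition zero_free_word :: "'a free_word" where
  "0 = Word []"

definition plus_free_word :: "'a free_word \<Rightarrow> 'a free_word \<Rightarrow> 'a free_word" where
  "u + v = Word (letters u @ letters v)"

instance
  by standard (simp_all add: zero_free_word_def plus_free_word_def)

end

definition monomial :: "'w list \<Rightarrow> 'w free_word \<Rightarrow>\<^sub>0 laurent" where
  "monomial xs = Poly_Mapping.single (Word xs) 1"

definition scalar :: "laurent \<Rightarrow> 'w free_word \<Rightarrow>\<^sub>0 laurent" where
  "scalar c = Poly_Mapping.single 0 c"

definition free_algebra :: "'w set \<Rightarrow> (laurent, 'w free_word \<Rightarrow>\<^sub>0 laurent) module" where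
  "free_algebra S =
    \<lparr>carrier = {x. \<forall>u\<in>Poly_Mapping.keys x. letters u \<in> lists S},
     monoid.mult = (*), one = 1, ring.zero = 0, add = (+), module.smult = (\<lambda>c x. scalar c * x)\<rparr>"


section \<open>The generic Hecke algebra\<close>

fun alternating :: "nat \<Rightarrow> 'w \<Rightarrow> 'w \<Rightarrow> 'w list" where
  "alternating 0 s t = []"
| "alternating (Suc n) s t = s # alternating n t s"

text \<open>If \<open>s t\<close> has infinite order, the corresponding braid relator is \<open>1 - 1 = 0\<close>.\<close>
definition hecke_relators ::
    "('w, 'm) monoid_scheme \<Rightarrow> 'w set \<Rightarrow> ('w free_word \<Rightarrow>\<^sub>0 laurent) set" where
  "hecke_relators W S =
    {(monomial [s] + 1) * (monomial [s] - scalar laurent_q) | s. s \<in> S} \<union>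
    {monomial (alternating (coxeter_order W s t) s t) -
       monomial (alternating (coxeter_order W s t) t s) | s t. s \<in> S \<and> t \<in> S \<and> s \<noteq> t}"

definition hecke_ideal ::
    "('w, 'm) monoid_scheme \<Rightarrow> 'w set \<Rightarrow> ('w free_word \<Rightarrow>\<^sub>0 laurent) set" where
  "hecke_ideal W S = Idl\<^bsub>free_algebra S\<^esub> (hecke_relators W S)"

text \<open>
  Scalar multiplication on the quotient \<open>M / N\<close>; all the cosets in the union coincide when \<open>N\<close> is a
  submodule.
\<close>
definition coset_smult :: "('r, 'a, 'm) module_scheme \<Rightarrow> 'a set \<Rightarrow> 'r \<Rightarrow> 'a set \<Rightarrow> 'a set" where
  "coset_smult M N c A = (\<Union>x\<in>A. N +>\<^bsub>M\<^esub> (c \<odot>\<^bsub>M\<^esub> x))"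

definition hecke_algebra ::
    "('w, 'm) monoid_scheme \<Rightarrow> 'w set \<Rightarrow> (laurent, ('w free_word \<Rightarrow>\<^sub>0 laurent) set) module" where
  "hecke_algebra W S =
    ring.extend (free_algebra S Quot hecke_ideal W S)
      (module.fields (coset_smult (free_algebra S) (hecke_ideal W S)))"

definition hecke_gen ::
    "('w, 'm) monoid_scheme \<Rightarrow> 'w set \<Rightarrow> 'w \<Rightarrow> ('w free_word \<Rightarrow>\<^sub>0 laurent) set" where
  "hecke_gen W S s = hecke_ideal W S +>\<^bsub>free_algebra S\<^esub> monomial [s]"

text \<open>
  \<open>T\<^sub>w\<close> is the common value of the products over all reduced words of \<open>w\<close>
  (a single value by Matsumoto's theorem).
\<close>
definition hecke_T ::
    "('w, 'm) monoid_scheme \<Rightarrow> 'w set \<Rightarrow> 'w \<Rightarrow> ('w free_word \<Rightarrow>\<^sub>0 laurent) set" where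
  "hecke_T W S w =
    the_elem ((\<lambda>xs. word_prod (hecke_algebra W S) (map (hecke_gen W S) xs)) ` reduced_words W S w)"


section \<open>The cocenter\<close>

definition module_span :: "('r, 'n) ring_scheme \<Rightarrow> ('r, 'a, 'm) module_scheme \<Rightarrow> 'a set \<Rightarrow> 'a set" where
  "module_span R M A = \<Inter>{N. submodule N R M \<and> A \<subseteq> N}"

text \<open>The submodule \<open>[H, H]\<close>, i.e. the span of the commutators.\<close>
definition hecke_commutators ::
    "('w, 'm) monoid_scheme \<Rightarrow> 'w set \<Rightarrow> ('w free_word \<Rightarrow>\<^sub>0 laurent) set set" where
  "hecke_commutators W S = (let H = hecke_algebra W S in
    module_span laurent_ring H
      {a \<otimes>\<^bsub>H\<^esub> b \<ominus>\<^bsub>H\<^esub> b \<otimes>\<^bsub>H\<^esub> a | a b. a \<in> carrier H \<and> b \<in> carrier H})"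

text \<open>
  The quotient module \<open>H / [H, H]\<close>.  It is not a ring; the fields \<open>mult\<close> and \<open>one\<close> that the
  record type of modules inherits are left unspecified.
\<close>
definition hecke_cocenter ::
    "('w, 'm) monoid_scheme \<Rightarrow> 'w set \<Rightarrow> (laurent, ('w free_word \<Rightarrow>\<^sub>0 laurent) set set) module" where
  "hecke_cocenter W S = (let H = hecke_algebra W S; K = hecke_commutators W S in
    \<lparr>carrier = a_rcosets\<^bsub>H\<^esub> K, monoid.mult = undefined, one = undefined,
     ring.zero = K, add = set_add H, module.smult = coset_smult H K\<rparr>)"

definition cocenter_proj ::
    "('w, 'm) monoid_scheme \<Rightarrow> 'w set \<Rightarrow> ('w free_word \<Rightarrow>\<^sub>0 laurent) set \<Rightarrow>
     ('w free_word \<Rightarrow>\<^sub>0 laurent) set set" where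
  "cocenter_proj W S h = hecke_commutators W S +>\<^bsub>hecke_algebra W S\<^esub> h"

text \<open>
  The common image in the cocenter of the \<open>T\<^sub>v\<close> for all \<open>v\<close> of minimal length in the class \<open>C\<close>.
\<close>
definition cocenter_T ::
    "('w, 'm) monoid_scheme \<Rightarrow> 'w set \<Rightarrow> 'w set \<Rightarrow> ('w free_word \<Rightarrow>\<^sub>0 laurent) set set" where
  "cocenter_T W S C =
    the_elem ((\<lambda>v. cocenter_proj W S (hecke_T W S v)) ` min_length_elements W S C)"

end

theory Submission
  imports Defs "HOL-Analysis.Continuum_Not_Denumerable"
begin

text \<open>
  A conjugate \<open>x\<^sup>-\<^sup>1wx\<close> is encoded by the chamber \<open>x\<close>; its length is the number of walls between \<open>x\<close>
  and \<open>wx\<close>, equivalently the number of sign changes that a point \<open>\<pi>\<close> of \<open>x\<close>, as a linear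
  functional on roots, has along the orbits of \<open>w\<close>.  Replacing \<open>\<pi>\<close> by \<open>2\<pi> + \<pi> \<circ> w\<^sup>-\<^sup>1\<close> does not
  increase this number, and iterating the replacement leaves at most one sign change on every orbit
  except the finitely many periodic ones with vanishing sum.  From there any two chambers are
  connected by cyclic shifts \<open>uy \<mapsto> yu\<close> and by steps \<open>v \<mapsto> v'\<close> with \<open>vu = uv'\<close>, all lengths being
  additive.  So every \<open>w\<close> reaches minimal length by such steps and by steps \<open>v \<mapsto> svs\<close> that drop the
  length, and two minimal conjugates of \<open>w\<close> are connected with a prescribed conjugating element.

  The steps of constant length do not change the class of \<open>T\<^sub>v\<close> in the cocenter, and when
  \<open>svs\<close> is shorter than \<open>v\<close>, \<open>T\<^sub>v \<equiv> (q - 1) T\<^sub>s\<^sub>v + q T\<^sub>s\<^sub>v\<^sub>s\<close>; this gives existence.  For uniqueness,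
  \<open>(g, z) \<mapsto> [T\<^sub>z, T\<^sub>y]\<close> with \<open>g = zy\<close> is a cocycle modulo \<open>(q - 1)[H, H]\<close> on the conjugation groupoid of
  \<open>W\<close>, and the connecting paths show that it vanishes on loops.  Being a coboundary it forces
  \<open>[H, H] \<inter> (q - 1)H = (q - 1)[H, H]\<close>, so a linear relation between the \<open>T\<^sub>O\<close> can be divided by
  powers of \<open>q - 1\<close> until it survives at \<open>q = 1\<close>, where class functions separate the classes.
\<close>

text \<open>The group may be infinite, so segments in the Tits cone become galleries only after a
  generic choice of their end points. Integrality pays for this: roots lie in a lattice, so the
  conditions to be avoided are countable. It also explains the weight 2 in 2\<pi> + \<pi> o w^-1:
  the operator 2 + w^-1 is injective on the lattice, while 1 + w^-1 kills every root that
  \<open>w\<close> negates. Moreover 2 + e^(ix) never vanishes and its modulus strictly decreases on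
  [0, pi], so on a periodic orbit the slowest surviving Fourier mode decides the signs. Paths join
  chambers and not merely conjugates, since two chambers with the same conjugate differ by a
  centralising element, and the cocycle has to be tested on exactly these loops. The coboundary
  gives the divisibility statement as follows. The additive map sending T_g to its potential takes H
  into [H, H] and is the identity on [H, H] modulo (q - 1)[H, H]. Hence an element (q - 1)x of
  [H, H] is congruent to (q - 1) times an element of [H, H].\<close>

context coxeter_system
begin

section \<open>Words, length and parity in a Coxeter group\<close>

abbreviation len :: "'w \<Rightarrow> nat" where "len \<equiv> cox_length W S"
abbreviation wprod :: "'w list \<Rightarrow> 'w" where "wprod \<equiv> word_prod W"

lemma S_carrier [simp, intro]: "s \<in> S \<Longrightarrow> s \<in> carrier W"
  using simple_carrier by blast

lemma lists_carrier: "xs \<in> lists S \<Longrightarrow> xs \<in> lists (carrier W)"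
  using simple_carrier by blast

lemma wprod_Nil [simp]: "wprod [] = \<one>"
  by (simp add: word_prod_def)

lemma wprod_Cons [simp]: "wprod (x # xs) = x \<otimes> wprod xs"
  by (simp add: word_prod_def)

lemma wprod_closed [simp, intro]: "xs \<in> lists (carrier W) \<Longrightarrow> wprod xs \<in> carrier W"
  by (induction xs) auto

lemma wprod_closed_S [simp, intro]: "xs \<in> lists S \<Longrightarrow> wprod xs \<in> carrier W"
  using lists_carrier wprod_closed by blast

lemma wprod_append:
  "\<lbrakk>xs \<in> lists S; ys \<in> lists S\<rbrakk> \<Longrightarrow> wprod (xs @ ys) = wprod xs \<otimes> wprod ys"
  by (induction xs) (auto simp: m_assoc)

lemma simple_sq [simp]: "s \<in> S \<Longrightarrow> s \<otimes> s = \<one>"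
  using simple_involution[of s] pow_ord_eq_1[of s] by (simp add: numeral_2_eq_2)

lemma simple_inv [simp]: "s \<in> S \<Longrightarrow> inv s = s"
  using inv_equality by force

lemma simple_cancel [simp]:
  "\<lbrakk>s \<in> S; x \<in> carrier W\<rbrakk> \<Longrightarrow> s \<otimes> (s \<otimes> x) = x"
  "\<lbrakk>s \<in> S; x \<in> carrier W\<rbrakk> \<Longrightarrow> x \<otimes> s \<otimes> s = x"
  by (simp add: m_assoc[symmetric]) (simp add: m_assoc)

lemma wprod_rev: "xs \<in> lists S \<Longrightarrow> wprod (rev xs) = inv (wprod xs)"
proof (induction xs)
  case (Cons s xs)
  then show ?case
    by (simp add: wprod_append inv_mult_group in_lists_conv_set)
qed simp

lemma wprod_surj: "w \<in> carrier W \<Longrightarrow> \<exists>xs\<in>lists S. wprod xs = w"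
proof -
  have "\<exists>xs\<in>lists S. wprod xs = w" if "w \<in> generate W S" for w
    using that
  proof induction
    case one
    then show ?case by (intro bexI[of _ "[]"]) auto
  next
    case (incl h)
    then show ?case by (intro bexI[of _ "[h]"]) auto
  next
    case (inv h)
    then show ?case by (intro bexI[of _ "[h]"]) auto
  next
    case (eng h1 h2)
    then obtain xs ys where "xs \<in> lists S" "wprod xs = h1" "ys \<in> lists S" "wprod ys = h2"
      by blast
    then show ?case
      by (intro bexI[of _ "xs @ ys"]) (auto simp: wprod_append)
  qed
  then show "w \<in> carrier W \<Longrightarrow> \<exists>xs\<in>lists S. wprod xs = w"
    by (simp add: simple_generate)
qed

lemma coxeter_stepE:
  assumes "coxeter_step W S xs ys"
  obtains us vs s t where "us \<in> lists S" "vs \<in> lists S" "s \<in> S" "t \<in> S" "xs = us @ vs"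
    "ys = us @ concat (replicate (coxeter_order W s t) [s, t]) @ vs"
  using assms unfolding coxeter_step_def Bex_def by (elim exE conjE) (rule that)

text \<open>The presentation enters only in this form: a map on words that ignores inserted relators
  is a map on the group. Parity of the length and the reflection representation are both obtained
  from it.\<close>

lemma word_invariant:
  assumes "\<And>xs ys. coxeter_step W S xs ys \<Longrightarrow> f xs = f ys"
    and "xs \<in> lists S" "ys \<in> lists S" "wprod xs = wprod ys"
  shows "f xs = f ys"
proof -
  have "equivclp (coxeter_step W S) xs ys"
    using presentation assms(2-4) by blast
  then show ?thesis
    by (induction rule: equivclp_induct) (auto dest: assms(1))
qed

lemma len_le: "xs \<in> lists S \<Longrightarrow> len (wprod xs) \<le> length xs"
  unfolding cox_length_def by (rule Least_le) blast

lemma reduced_word_ex: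
  assumes "w \<in> carrier W"
  obtains xs where "xs \<in> lists S" "wprod xs = w" "length xs = len w"
proof -
  obtain xs where "xs \<in> lists S" "wprod xs = w"
    using wprod_surj assms by blast
  then have "\<exists>n. \<exists>xs\<in>lists S. length xs = n \<and> wprod xs = w" by blast
  from LeastI_ex[OF this] show ?thesis
    using that unfolding cox_length_def by blast
qed

lemma len_one [simp]: "len \<one> = 0"
  using len_le[of "[]"] by simp

lemma len_eq_0: "w \<in> carrier W \<Longrightarrow> len w = 0 \<longleftrightarrow> w = \<one>"
  by (metis len_one length_0_conv reduced_word_ex wprod_Nil)

lemma len_simple_le: "s \<in> S \<Longrightarrow> len s \<le> 1"
  using len_le[of "[s]"] by simp

lemma len_mult_le: "\<lbrakk>x \<in> carrier W; y \<in> carrier W\<rbrakk> \<Longrightarrow> len (x \<otimes> y) \<le> len x + len y"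
proof -
  assume "x \<in> carrier W" "y \<in> carrier W"
  then obtain xs ys where "xs \<in> lists S" "wprod xs = x" "length xs = len x"
    "ys \<in> lists S" "wprod ys = y" "length ys = len y"
    by (metis reduced_word_ex)
  then show ?thesis
    using len_le[of "xs @ ys"] by (simp add: wprod_append)
qed

lemma len_inv_le: "x \<in> carrier W \<Longrightarrow> len (inv x) \<le> len x"
proof -
  assume "x \<in> carrier W"
  then obtain xs where "xs \<in> lists S" "wprod xs = x" "length xs = len x"
    using reduced_word_ex by metis
  then show ?thesis
    using len_le[of "rev xs"] wprod_rev[of xs] by (simp add: in_lists_conv_set)
qed

lemma len_inv [simp]: "x \<in> carrier W \<Longrightarrow> len (inv x) = len x"
  by (metis inv_closed inv_inv le_antisym len_inv_le)

lemma length_relator: "length (concat (replicate m [s, t])) = 2 * m"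
  by (induction m) auto

text \<open>Every relator has even length, so the parity of a word depends on its product only.
  Multiplication by a simple reflection therefore never preserves the length.\<close>

lemma len_parity:
  assumes "xs \<in> lists S"
  shows "even (len (wprod xs)) = even (length xs)"
proof -
  obtain ys where ys: "ys \<in> lists S" "wprod ys = wprod xs" "length ys = len (wprod xs)"
    using reduced_word_ex[of "wprod xs"] assms by blast
  have step: "even (length us) = even (length vs)" if "coxeter_step W S us vs" for us vs
  proof -
    from that obtain as bs s t where eq: "us = as @ bs"
      "vs = as @ concat (replicate (coxeter_order W s t) [s, t]) @ bs"
      by (rule coxeter_stepE)
    show ?thesis
      unfolding eq length_append length_relator by simp
  qed
  have "even (length ys) = even (length xs)"
    using word_invariant[of "\<lambda>xs. even (length xs)", OF step ys(1) assms ys(2)] .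
  then show ?thesis using ys by simp
qed

lemma len_mult_parity:
  assumes "x \<in> carrier W" "y \<in> carrier W"
  shows "even (len (x \<otimes> y)) = even (len x + len y)"
proof -
  obtain xs where xs: "xs \<in> lists S" "wprod xs = x" "length xs = len x"
    using reduced_word_ex assms by metis
  obtain ys where ys: "ys \<in> lists S" "wprod ys = y" "length ys = len y"
    using reduced_word_ex assms by metis
  have "even (len (wprod (xs @ ys))) = even (length (xs @ ys))"
    using xs ys by (intro len_parity) simp
  then show ?thesis
    using xs ys by (simp only: wprod_append length_append)
qed

lemma len_simple: "s \<in> S \<Longrightarrow> len s = 1"
proof -
  assume s: "s \<in> S"
  have "even (len s) = even (1::nat)"
    using len_parity[of "[s]"] s by simp
  then show ?thesis using len_simple_le[OF s] by (cases "len s") auto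
qed

lemma len_mult_simple:
  assumes "w \<in> carrier W" "s \<in> S"
  shows "len (w \<otimes> s) = len w + 1 \<or> len w = len (w \<otimes> s) + 1"
proof -
  have "len (w \<otimes> s) \<le> len w + 1"
    using len_mult_le[of w s] len_simple_le[of s] assms by auto
  moreover have "len w \<le> len (w \<otimes> s) + 1"
    using len_mult_le[of "w \<otimes> s" s] len_simple_le[of s] assms by (auto simp: m_assoc)
  moreover have "even (len (w \<otimes> s)) \<noteq> even (len w)"
    using len_mult_parity[of w s] len_simple[of s] assms by auto
  ultimately show ?thesis by presburger
qed

lemma len_simple_mult:
  assumes "w \<in> carrier W" "s \<in> S"
  shows "len (s \<otimes> w) = len w + 1 \<or> len w = len (s \<otimes> w) + 1"
proof -
  have "len (s \<otimes> w) = len (inv w \<otimes> s)"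
    using len_inv[of "s \<otimes> w"] assms by (simp add: inv_mult_group)
  then show ?thesis
    using len_mult_simple[of "inv w" s] assms by simp
qed

lemma right_descent_ex:
  assumes "w \<in> carrier W" "w \<noteq> \<one>"
  obtains s where "s \<in> S" "len w = len (w \<otimes> s) + 1"
proof -
  obtain xs where xs: "xs \<in> lists S" "wprod xs = w" "length xs = len w"
    using reduced_word_ex assms by metis
  then have "xs \<noteq> []" using assms by auto
  then obtain ys s where [simp]: "xs = ys @ [s]" by (meson rev_exhaust)
  have *: "ys \<in> lists S" "s \<in> S" "w = wprod ys \<otimes> s"
    using xs by (auto simp: wprod_append)
  then have "w \<otimes> s = wprod ys" by (simp add: m_assoc)
  then have "len (w \<otimes> s) < len w"
    using len_le[of ys] * xs by simp
  then have "len w = len (w \<otimes> s) + 1"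
    using len_mult_simple[of w s] assms * by linarith
  then show ?thesis using that * by blast
qed

lemma simple_word_induct [consumes 1, case_names one mult]:
  assumes "w \<in> carrier W" "P \<one>"
    "\<And>w s. \<lbrakk>w \<in> carrier W; s \<in> S; len (w \<otimes> s) = len w + 1; P w\<rbrakk> \<Longrightarrow> P (w \<otimes> s)"
  shows "P w"
  using assms(1)
proof (induction "len w" arbitrary: w rule: less_induct)
  case less
  show ?case
  proof (cases "w = \<one>")
    case False
    then obtain s where s: "s \<in> S" "len w = len (w \<otimes> s) + 1"
      using right_descent_ex less.prems by metis
    then have "P (w \<otimes> s)" using less by auto
    from assms(3)[OF _ s(1) _ this] show ?thesis
      using s less.prems by (simp add: m_assoc)
  qed (use assms in simp)
qed

section \<open>Alternating words and braid relations\<close>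

lemma alternating_relator:
  "alternating m s t @ rev (alternating m t s) = concat (replicate m [s, t])"
proof (induction m arbitrary: s t)
  case (Suc m)
  have *: "s # concat (replicate m [t, s]) @ [t] = concat (replicate (Suc m) [s, t])" for s t :: 'b
    by (induction m) auto
  show ?case using Suc[of t s] *[of s t] by (simp flip: append_assoc)
qed simp

lemma alternating_in_lists: "\<lbrakk>s \<in> S; t \<in> S\<rbrakk> \<Longrightarrow> alternating n s t \<in> lists S"
  by (induction n arbitrary: s t) auto

lemma length_alternating [simp]: "length (alternating n s t) = n"
  by (induction n arbitrary: s t) auto

lemma wprod_relator:
  assumes "s \<in> S" "t \<in> S"
  shows "wprod (concat (replicate m [s, t])) = (s \<otimes> t) [^] m"
proof (induction m)
  case (Suc m)
  show ?case using Suc assms nat_pow_mult[of "s \<otimes> t" 1 m] by (simp add: m_assoc)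
qed simp

lemma wprod_braid:
  assumes "s \<in> S" "t \<in> S"
  shows "wprod (alternating (coxeter_order W s t) s t) = wprod (alternating (coxeter_order W s t) t s)"
proof -
  let ?m = "coxeter_order W s t"
  have l: "alternating ?m s t \<in> lists S" "alternating ?m t s \<in> lists S"
    "rev (alternating ?m t s) \<in> lists S"
    using assms alternating_in_lists[of s t] alternating_in_lists[of t s] by (auto simp: in_lists_conv_set)
  have "wprod (alternating ?m s t @ rev (alternating ?m t s)) = \<one>"
    unfolding alternating_relator using assms by (simp add: wprod_relator coxeter_order_def)
  then have "wprod (alternating ?m s t) \<otimes> inv (wprod (alternating ?m t s)) = \<one>"
    using l by (simp only: wprod_append wprod_rev)
  then show ?thesis
    using l by (metis inv_equality inv_inv inv_closed wprod_closed_S)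
qed

lemma coxeter_order_sym: "\<lbrakk>s \<in> S; t \<in> S\<rbrakk> \<Longrightarrow> coxeter_order W s t = coxeter_order W t s"
  unfolding coxeter_order_def using ord_inv[of "s \<otimes> t"] by (simp add: inv_mult_group)

lemma alternating_snoc:
  "alternating (Suc n) s t = alternating n s t @ [if even n then s else t]"
  by (induction n arbitrary: s t) auto

lemma alternating_append:
  "\<exists>zs. alternating (m + n) s t = alternating m s t @ zs \<and> set zs \<subseteq> {s, t}"
proof (induction n)
  case (Suc n)
  then obtain zs where "alternating (m + n) s t = alternating m s t @ zs" "set zs \<subseteq> {s, t}"
    by blast
  then show ?case
    by (intro exI[of _ "zs @ [if even (m + n) then s else t]"])
       (simp only: add_Suc_right alternating_snoc append_assoc, auto)
qed simp

lemma alternating_char: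
  assumes "set xs \<subseteq> {s, t}" "distinct_adj xs" "xs = [] \<or> hd xs = t"
  shows "xs = alternating (length xs) t s"
  using assms
proof (induction xs arbitrary: s t)
  case (Cons a xs)
  have "xs = [] \<or> hd xs = s"
    using Cons.prems by (cases xs) auto
  then have "xs = alternating (length xs) s t"
    using Cons.prems by (intro Cons.IH) (auto simp: distinct_adj_Cons)
  then show ?case using Cons.prems by simp
qed simp

end

section \<open>An integral reflection representation\<close>

context crystallographic_coxeter_system
begin

text \<open>An arbitrary numbering of the generators. It only decides, for orders 4 and 6, which of
  the two off-diagonal Cartan entries is -1.\<close>

definition simple_index :: "'a \<Rightarrow> nat" where
  "simple_index = (SOME f. inj_on f S)"

lemma inj_simple_index: "inj_on simple_index S"
  unfolding simple_index_def
  using someI_ex[of "\<lambda>f :: 'a \<Rightarrow> nat. inj_on f S"] finite_imp_inj_to_nat_seg[OF finite_simple] by blast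

text \<open>A generalised Cartan matrix: the two entries at s and t have product 4 cos^2(pi/m), that
  is 0, 1, 2, 3 for m = 2, 3, 4, 6, and 4 for infinite order. The finite orders allowed are those
  for which this number is an integer, and integral entries keep all roots in a lattice.\<close>

definition cartan :: "'a \<Rightarrow> 'a \<Rightarrow> real" where
  "cartan s t = (let m = coxeter_order W s t in
     if s = t then 2 else if m = 2 then 0 else if m = 3 then -1 else if m = 0 then -2
     else if simple_index s < simple_index t then -1 else if m = 4 then -2 else -3)"

lemma cartan_cases:
  assumes "s \<in> S" "t \<in> S" "s \<noteq> t"
  shows "(coxeter_order W s t = 2 \<and> cartan s t = 0 \<and> cartan t s = 0) \<or>
    (coxeter_order W s t = 3 \<and> cartan s t = -1 \<and> cartan t s = -1) \<or>
    (coxeter_order W s t = 4 \<and> (cartan s t = -1 \<and> cartan t s = -2 \<or> cartan s t = -2 \<and> cartan t s = -1)) \<or>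
    (coxeter_order W s t = 6 \<and> (cartan s t = -1 \<and> cartan t s = -3 \<or> cartan s t = -3 \<and> cartan t s = -1)) \<or>
    (coxeter_order W s t = 0 \<and> cartan s t = -2 \<and> cartan t s = -2)"
proof -
  have "simple_index s \<noteq> simple_index t"
    using inj_simple_index assms by (auto dest: inj_onD)
  then show ?thesis
    using crystallographic[of s t] assms coxeter_order_sym[of s t]
    by (auto simp: cartan_def Let_def)
qed

lemma cartan_Ints [simp]: "cartan s t \<in> \<int>"
  by (simp add: cartan_def Let_def)

definition coroot :: "'a \<Rightarrow> ('a \<Rightarrow> real) \<Rightarrow> real" where
  "coroot s v = (\<Sum>r\<in>S. cartan s r * v r)"

definition refl :: "'a \<Rightarrow> ('a \<Rightarrow> real) \<Rightarrow> 'a \<Rightarrow> real" where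
  "refl s v = (\<lambda>r. if r = s then v s - coroot s v else v r)"

definition srt :: "'a \<Rightarrow> 'a \<Rightarrow> real" where
  "srt s = (\<lambda>r. if r = s then 1 else 0)"

lemma srt_simps [simp]: "srt s s = 1" "r \<noteq> s \<Longrightarrow> srt s r = 0"
  by (auto simp: srt_def)

lemma coroot_linear:
  "coroot s (\<lambda>r. a * u r + b * v r) = a * coroot s u + b * coroot s v"
  by (simp add: coroot_def sum.distrib sum_distrib_left algebra_simps)

lemma coroot_srt: "r \<in> S \<Longrightarrow> coroot s (srt r) = cartan s r"
proof -
  assume r: "r \<in> S"
  have "coroot s (srt r) = (\<Sum>x\<in>S. if r = x then cartan s x else 0)"
    unfolding coroot_def by (intro sum.cong) (auto simp: srt_def)
  then show ?thesis
    using r finite_simple by simp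
qed

lemma refl_linear:
  "refl s (\<lambda>r. a * u r + b * v r) = (\<lambda>r. a * refl s u r + b * refl s v r)"
  by (auto simp: refl_def coroot_linear algebra_simps)

lemma refl_alt: "refl s v = (\<lambda>r. 1 * v r + (- coroot s v) * srt s r)"
  by (auto simp: refl_def srt_def)

definition wact :: "'a list \<Rightarrow> ('a \<Rightarrow> real) \<Rightarrow> 'a \<Rightarrow> real" where
  "wact xs v = foldr refl xs v"

lemma wact_simps [simp]:
  "wact [] v = v" "wact (x # xs) v = refl x (wact xs v)" "wact (xs @ ys) v = wact xs (wact ys v)"
  by (simp_all add: wact_def)

lemma wact_linear:
  "wact xs (\<lambda>r. a * u r + b * v r) = (\<lambda>r. a * wact xs u r + b * wact xs v r)"
  by (induction xs) (simp_all add: refl_linear)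

context
  fixes s t
  assumes st: "s \<in> S" "t \<in> S"
begin

text \<open>Both reflections preserve each affine plane through v spanned by the two simple roots
  and act there by explicit affine maps of the coefficients, so words in s and t can be evaluated by
  arithmetic alone.\<close>

lemma refl_plane:
  "refl s (\<lambda>r. v r + a * srt s r + b * srt t r) =
    (\<lambda>r. v r + (- a - coroot s v - cartan s t * b) * srt s r + b * srt t r)"
  "refl t (\<lambda>r. v r + a * srt s r + b * srt t r) =
    (\<lambda>r. v r + a * srt s r + (- b - coroot t v - cartan t s * a) * srt t r)"
proof -
  have c: "coroot x (\<lambda>r. v r + a * srt s r + b * srt t r) =
      coroot x v + a * cartan x s + b * cartan x t" for x
    using coroot_linear[of x 1 "\<lambda>r. 1 * v r + a * srt s r" b "srt t"] coroot_linear[of x 1 v a "srt s"] st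
    by (simp add: coroot_srt)
  have [simp]: "cartan x x = 2" for x by (simp add: cartan_def)
  show "refl s (\<lambda>r. v r + a * srt s r + b * srt t r) =
    (\<lambda>r. v r + (- a - coroot s v - cartan s t * b) * srt s r + b * srt t r)"
    unfolding refl_alt c by (auto simp: algebra_simps)
  show "refl t (\<lambda>r. v r + a * srt s r + b * srt t r) =
    (\<lambda>r. v r + a * srt s r + (- b - coroot t v - cartan t s * a) * srt t r)"
    unfolding refl_alt c by (auto simp: algebra_simps)
qed

lemma refl_self: "refl s (refl s v) = v"
  using refl_plane(1)[of v 0 0] refl_plane(1)[of v "- coroot s v" 0]
  by (simp add: refl_alt)

text \<open>For each possible order the relator, of at most 12 reflections, is multiplied out in the
  plane. Infinite order gives the empty word, and s = t gives order 1.\<close>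

lemma wact_relator: "wact (concat (replicate (coxeter_order W s t) [s, t])) v = v"
proof (cases "s = t")
  case True
  then have "coxeter_order W s t = 1"
    using st by (simp add: coxeter_order_def)
  then show ?thesis using True refl_self by simp
next
  case False
  have v: "v = (\<lambda>r. v r + 0 * srt s r + 0 * srt t r)" by simp
  show ?thesis
    using cartan_cases[OF st False]
    apply (subst v)
    apply (elim disjE conjE)
    apply (simp_all only: eval_nat_numeral replicate.simps concat.simps append.simps wact_simps refl_plane
       BitM.simps)
    apply (simp_all add: algebra_simps)
    done
qed

end

definition act :: "'a \<Rightarrow> ('a \<Rightarrow> real) \<Rightarrow> 'a \<Rightarrow> real" where
  "act w = wact (SOME xs. xs \<in> lists S \<and> wprod xs = w)"

lemma act_wprod:
  assumes "xs \<in> lists S"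
  shows "act (wprod xs) = wact xs"
proof -
  let ?ys = "SOME ys. ys \<in> lists S \<and> wprod ys = wprod xs"
  have ys: "?ys \<in> lists S \<and> wprod ?ys = wprod xs"
    by (rule someI[of _ xs]) (use assms in simp)
  have step: "wact us = wact vs" if "coxeter_step W S us vs" for us vs
  proof -
    from that obtain as bs s t where eq: "s \<in> S" "t \<in> S" "us = as @ bs"
      "vs = as @ concat (replicate (coxeter_order W s t) [s, t]) @ bs"
      by (rule coxeter_stepE)
    show ?thesis
      unfolding eq(3,4) fun_eq_iff by (simp only: wact_simps wact_relator[OF eq(1,2)]) simp
  qed
  show ?thesis
    unfolding act_def using word_invariant[of wact, OF step _ assms] ys by blast
qed

lemma act_one [simp]: "act \<one> v = v"
  using act_wprod[of "[]"] by (simp add: fun_eq_iff)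

lemma act_simple: "s \<in> S \<Longrightarrow> act s = refl s"
  using act_wprod[of "[s]"] by (simp add: fun_eq_iff)

lemma act_mult: "\<lbrakk>x \<in> carrier W; y \<in> carrier W\<rbrakk> \<Longrightarrow> act (x \<otimes> y) v = act x (act y v)"
proof -
  assume "x \<in> carrier W" "y \<in> carrier W"
  then obtain xs ys where *: "xs \<in> lists S" "wprod xs = x" "ys \<in> lists S" "wprod ys = y"
    using wprod_surj by metis
  then show ?thesis
    using act_wprod[of "xs @ ys"] act_wprod[of xs] act_wprod[of ys] by (simp add: wprod_append)
qed

lemma act_inv_act [simp]:
  "x \<in> carrier W \<Longrightarrow> act (inv x) (act x v) = v"
  "x \<in> carrier W \<Longrightarrow> act x (act (inv x) v) = v"
  by (simp_all flip: act_mult)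

lemma act_linear:
  "act w (\<lambda>r. a * u r + b * v r) = (\<lambda>r. a * act w u r + b * act w v r)"
  unfolding act_def by (rule wact_linear)

lemma act_scale: "act w (\<lambda>r. a * v r) = (\<lambda>r. a * act w v r)"
  using act_linear[of w a v 0 v] by simp

lemma act_uminus: "act w (\<lambda>r. - v r) = (\<lambda>r. - act w v r)"
  using act_scale[of w "-1" v] by simp

lemma act_zero [simp]: "act w (\<lambda>r. 0) = (\<lambda>r. 0)"
  using act_scale[of w 0] by simp

lemma act_sum: "act w (\<lambda>r. \<Sum>i\<in>A. c i * v i r) = (\<lambda>r. \<Sum>i\<in>A. c i * act w (v i) r)"
proof (induction A rule: infinite_finite_induct)
  case (insert x F)
  then show ?case
    using act_linear[of w "c x" "v x" 1 "\<lambda>r. \<Sum>i\<in>F. c i * v i r"] by simp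
qed auto

text \<open>The root lattice. Vectors are functions on the whole type, so vanishing outside
  \<open>S\<close> has to be part of the definition.\<close>

definition intvec :: "('a \<Rightarrow> real) \<Rightarrow> bool" where
  "intvec v \<longleftrightarrow> (\<forall>r. v r \<in> \<int>) \<and> (\<forall>r. r \<notin> S \<longrightarrow> v r = 0)"

lemma intvec_srt: "s \<in> S \<Longrightarrow> intvec (srt s)"
  by (auto simp: intvec_def srt_def)

lemma intvec_combine: "\<lbrakk>intvec u; intvec v; a \<in> \<int>; b \<in> \<int>\<rbrakk> \<Longrightarrow> intvec (\<lambda>r. a * u r + b * v r)"
  by (auto simp: intvec_def)

lemma intvec_sum: "(\<And>i. i \<in> A \<Longrightarrow> intvec (v i)) \<Longrightarrow> intvec (\<lambda>r. \<Sum>i\<in>A. v i r)"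
  by (auto simp: intvec_def intro!: Ints_sum sum.neutral)

lemma intvec_refl:
  assumes "intvec v" "s \<in> S"
  shows "intvec (refl s v)"
proof -
  have "coroot s v \<in> \<int>"
    unfolding coroot_def using assms by (auto simp: intvec_def intro!: Ints_sum)
  then show ?thesis
    using assms by (auto simp: intvec_def refl_def)
qed

lemma intvec_act:
  assumes "w \<in> carrier W" "intvec v"
  shows "intvec (act w v)"
proof -
  obtain xs where xs: "xs \<in> lists S" "wprod xs = w"
    using wprod_surj assms by blast
  have "intvec (wact xs v)"
    using xs(1) by (induction xs) (auto simp: assms intro: intvec_refl)
  then show ?thesis
    using act_wprod[OF xs(1)] xs(2) by simp
qed

section \<open>Sign coherence of roots\<close>

definition nonneg :: "('a \<Rightarrow> real) \<Rightarrow> bool" where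
  "nonneg v \<longleftrightarrow> (\<forall>r. 0 \<le> v r)"

lemma refl_srt [simp]: "s \<in> S \<Longrightarrow> refl s (srt s) = (\<lambda>r. - srt s r)"
  using coroot_srt[of s s] by (auto simp: refl_def srt_def cartan_def)

text \<open>The orbit of a simple root under the dihedral group is listed explicitly: a few
  numerical values for finite order, and coefficients k and k + 1 for infinite order.\<close>

lemma rank_two_positive:
  assumes st: "s \<in> S" "t \<in> S" "s \<noteq> t"
    and k: "coxeter_order W s t = 0 \<or> k < coxeter_order W s t"
  shows "\<exists>a\<ge>0. \<exists>b\<ge>0. wact (rev (alternating k t s)) (srt s) = (\<lambda>r. a * srt s r + b * srt t r)"
proof -
  \<comment> \<open>\<open>P k\<close> holds the two coefficients after k reflections; t acts at
    even steps, beginning with step 0.\<close>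
  define P :: "nat \<Rightarrow> real \<times> real" where "P = rec_nat (1, 0) (\<lambda>k (a, b).
    if even k then (a, - b - cartan t s * a) else (- a - cartan s t * b, b))"
  have P0: "P 0 = (1, 0)"
    by (simp add: P_def)
  have PS: "P (Suc k) = (let (a, b) = P k in
      if even k then (a, - b - cartan t s * a) else (- a - cartan s t * b, b))" for k
    by (simp add: P_def Let_def)
  have coroot0: "coroot x (\<lambda>r. 0) = 0" for x by (simp add: coroot_def)
  have w: "wact (rev (alternating k t s)) (srt s) = (\<lambda>r. fst (P k) * srt s r + snd (P k) * srt t r)" for k
  proof (induction k)
    case (Suc k)
    show ?case
      using refl_plane[OF st(1,2), of "\<lambda>r. 0" "fst (P k)" "snd (P k)"]
      by (simp add: alternating_snoc Suc PS coroot0 split: prod.splits del: alternating.simps)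
  qed (simp add: P0)
  have inf: "cartan s t = -2 \<and> cartan t s = -2 \<Longrightarrow>
      P k = (if even k then (real k + 1, real k) else (real k, real k + 1))" for k
    by (induction k) (auto simp: P0 PS)
  have fin: "k < n \<Longrightarrow> n \<le> 6 \<Longrightarrow> k = 0 \<or> k = 1 \<or> k = 2 \<or> k = 3 \<or> k = 4 \<or> k = 5" for n
    by linarith
  have "0 \<le> fst (P k) \<and> 0 \<le> snd (P k)"
    using cartan_cases[OF st]
  proof (elim disjE conjE)
    assume "coxeter_order W s t = 0" "cartan s t = -2" "cartan t s = -2"
    then show ?thesis using inf[of k] by simp
  qed (use k fin[of "coxeter_order W s t"] in
      \<open>auto simp: P0 PS eval_nat_numeral BitM.simps less_Suc_eq\<close>)
  then show ?thesis using w by blast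
qed

lemma not_distinct_adj_split: "\<not> distinct_adj xs \<Longrightarrow> \<exists>as x bs. xs = as @ [x, x] @ bs"
proof (induction xs rule: induct_list012)
  case (3 x y zs)
  show ?case
  proof (cases "x = y")
    case True
    then show ?thesis by (intro exI[of _ "[]"]) simp
  next
    case False
    then obtain as u bs where "y # zs = as @ [u, u] @ bs" using 3 by auto
    then show ?thesis by (intro exI[of _ "x # as"]) auto
  qed
qed auto

text \<open>The word z is a longest word in s and t that splits off w with additive length.
  Maximality makes s and t ascents of v, and reducedness excludes equal neighbours in z.\<close>

lemma dihedral_quotient:
  assumes "w \<in> carrier W" "s \<in> S" "t \<in> S"
  shows "\<exists>v\<in>carrier W. \<exists>z\<in>lists {s, t}. w = v \<otimes> wprod z \<and> len w = len v + length z \<and>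
    distinct_adj (rev z) \<and> len v < len (v \<otimes> s) \<and> len v < len (v \<otimes> t)"
proof -
  define Z where "Z = {z. z \<in> lists {s, t} \<and> (\<exists>v\<in>carrier W. w = v \<otimes> wprod z \<and> len w = len v + length z)}"
  have Z1: "[] \<in> Z" using assms by (auto simp: Z_def)
  have bound: "length z \<le> len w" if "z \<in> Z" for z
    using that by (auto simp: Z_def)
  obtain z where z: "z \<in> Z" "\<And>y. y \<in> Z \<Longrightarrow> length y \<le> length z"
    using ex_has_greatest_nat[of "\<lambda>z. z \<in> Z" "[]" length "len w + 1"] Z1 bound by (metis Suc_eq_plus1 le_imp_less_Suc)
  obtain v where v: "v \<in> carrier W" "w = v \<otimes> wprod z" "len w = len v + length z"
    using z(1) by (auto simp: Z_def)
  have z_lists: "z \<in> lists {s, t}" "z \<in> lists S"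
    using z(1) assms by (auto simp: Z_def)
  then have zc: "wprod z \<in> carrier W" by blast
  have v_asc: "len v < len (v \<otimes> u)" if "u \<in> {s, t}" for u
  proof (rule ccontr)
    have u: "u \<in> S" using that assms by auto
    assume "\<not> len v < len (v \<otimes> u)"
    then have "len v = len (v \<otimes> u) + 1"
      using len_mult_simple[OF v(1) u] by auto
    moreover have "w = (v \<otimes> u) \<otimes> wprod (u # z)"
      using v(1,2) u zc by (simp add: m_assoc)
    ultimately have "u # z \<in> Z"
      using z_lists(1) v u that unfolding Z_def
      by (intro CollectI conjI bexI[of _ "v \<otimes> u"]) simp_all
    then show False using z(2)[of "u # z"] by simp
  qed
  have "distinct_adj (rev z)"
  proof (rule ccontr)
    assume "\<not> distinct_adj (rev z)"
    then obtain as x bs where z_eq: "z = as @ [x, x] @ bs"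
      using not_distinct_adj_split[of z] by auto
    then have "w = v \<otimes> wprod (as @ bs)" "as @ bs \<in> lists S"
      using v z_lists by (auto simp: wprod_append)
    then show False
      using len_mult_le[of v "wprod (as @ bs)"] len_le[of "as @ bs"] v z_eq by simp
  qed
  then show ?thesis using v z_lists(1) v_asc by blast
qed

text \<open>Induction through rank two. Take a right descent t of w and split w = v z over the
  letters s and t. Since s is an ascent, z ends in t; it is alternating and shorter than the order
  of st, so it maps the simple root of s to a nonnegative combination of the two simple roots. The
  shorter element v ascends at both letters, and the induction hypothesis applies to it
  twice.\<close>

theorem nonneg_if_len_less:
  assumes "w \<in> carrier W" "s \<in> S" "len (w \<otimes> s) > len w"
  shows "nonneg (act w (srt s))"
  using assms
proof (induction "len w" arbitrary: w s rule: less_induct)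
  case less
  show ?case
  proof (cases "w = \<one>")
    case True
    then show ?thesis by (auto simp: nonneg_def srt_def)
  next
    case False
    obtain t where t: "t \<in> S" "len w = len (w \<otimes> t) + 1"
      using right_descent_ex less.prems False by metis
    have ts: "s \<noteq> t" using t less.prems by auto
    obtain v z where z: "z \<in> lists {s, t}" and v: "v \<in> carrier W" "w = v \<otimes> wprod z" "len w = len v + length z"
      and adj: "distinct_adj (rev z)" and v_asc: "len v < len (v \<otimes> s)" "len v < len (v \<otimes> t)"
      using dihedral_quotient[OF less.prems(1,2) t(1)] by blast
    have z_lists: "z \<in> lists {s, t}" "z \<in> lists S" using z less.prems t by auto
    then have zc: "wprod z \<in> carrier W" by blast
    have short: "len (v \<otimes> wprod y) \<le> len v + length y" if "y \<in> lists S" for y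
      using that len_mult_le[of v "wprod y"] len_le[of y] v by simp
    have pos: "length z \<ge> 1" using v t v_asc by (cases z) auto
    have last: "hd (rev z) = t"
    proof (rule ccontr)
      assume "hd (rev z) \<noteq> t"
      moreover have "hd (rev z) \<in> {s, t}" using z_lists(1) pos
        by (metis One_nat_def hd_in_set in_lists_conv_set list.size(3) not_one_le_zero rev_is_Nil_conv set_rev)
      ultimately have "hd (rev z) = s" by blast
      then have z_eq: "z = butlast z @ [s]"
        using pos by (metis append_butlast_last_id hd_rev list.size(3) not_one_le_zero)
      have bl: "butlast z \<in> lists S"
        using z_lists by (auto dest: in_set_butlastD)
      then have "wprod z = wprod (butlast z) \<otimes> s"
        using z_eq less.prems wprod_append[of "butlast z" "[s]"] by simp
      then have "w \<otimes> s = v \<otimes> wprod (butlast z)"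
        using v(1,2) bl less.prems by (simp add: m_assoc)
      then show False
        using short[of "butlast z"] v(3) less.prems bl by simp
    qed
    define k where "k = length z"
    have z_alt: "z = rev (alternating k t s)"
      using alternating_char[of "rev z" s t] z_lists adj last k_def
      by (metis in_lists_conv_set length_rev rev_rev_ident set_rev subsetI)
    \<comment> \<open>If z were as long as the order, the braid relation would rewrite part of it to
      end in s, and \<open>w \<otimes> s\<close> would be shorter than w.\<close>
    have "coxeter_order W s t = 0 \<or> k < coxeter_order W s t"
    proof (rule ccontr)
      let ?m = "coxeter_order W s t"
      assume "\<not> ?thesis"
      then have m: "?m \<le> k" "?m > 0" by auto
      then obtain zs where zs: "alternating k t s = alternating ?m t s @ zs" "set zs \<subseteq> {s, t}"
        using alternating_append[of ?m "k - ?m" t s] by auto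
      obtain m' where m': "?m = Suc m'" using m by (cases ?m) auto
      have l: "rev zs \<in> lists S" "alternating ?m t s \<in> lists S" "rev (alternating m' t s) \<in> lists S"
         "alternating m' t s \<in> lists S" "rev (alternating ?m t s) \<in> lists S"
        using zs(2) less.prems t alternating_in_lists[of t s] by (auto simp: in_lists_conv_set)
      have "wprod (alternating ?m t s) = s \<otimes> wprod (alternating m' t s)"
        using wprod_braid[of s t] m' less.prems t by simp
      then have "wprod (rev (alternating ?m t s)) = wprod (rev (alternating m' t s)) \<otimes> s"
        using l less.prems by (simp add: wprod_rev inv_mult_group)
      then have "w = v \<otimes> (wprod (rev zs) \<otimes> (wprod (rev (alternating m' t s)) \<otimes> s))"
        using v(2) z_alt zs(1) wprod_append[OF l(1,5)] by simp
      then have "w \<otimes> s = v \<otimes> wprod (rev zs @ rev (alternating m' t s))"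
        using l v less.prems by (simp add: wprod_append m_assoc)
      then have "len (w \<otimes> s) \<le> len v + length (rev zs @ rev (alternating m' t s))"
        using short[of "rev zs @ rev (alternating m' t s)"] l by simp
      also have "\<dots> < len w"
        using v(3) z_alt zs(1) m' by simp
      finally show False using less.prems by simp
    qed
    then obtain a b where ab: "0 \<le> a" "0 \<le> b"
      "wact z (srt s) = (\<lambda>r. a * srt s r + b * srt t r)"
      using rank_two_positive[of s t k] less.prems t ts z_alt by blast
    have "act w (srt s) = act v (wact z (srt s))"
      using v z_lists act_mult act_wprod by simp
    also have "\<dots> = (\<lambda>r. a * act v (srt s) r + b * act v (srt t) r)"
      by (simp add: ab act_linear)
    finally have eq: "act w (srt s) = (\<lambda>r. a * act v (srt s) r + b * act v (srt t) r)" .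
    have "len v < len w" using v(3) pos by linarith
    then have "nonneg (act v (srt s))" "nonneg (act v (srt t))"
      using less.hyps[of v s] less.hyps[of v t] v_asc v(1) less.prems t by auto
    then show ?thesis
      unfolding eq nonneg_def using ab by simp
  qed
qed

section \<open>Real roots, inversions and faithfulness\<close>

definition roots :: "('a \<Rightarrow> real) set" where
  "roots = {act w (srt s) | w s. w \<in> carrier W \<and> s \<in> S}"

abbreviation negv :: "('a \<Rightarrow> real) \<Rightarrow> 'a \<Rightarrow> real" where
  "negv v \<equiv> (\<lambda>r. - v r)"

lemma rootE:
  assumes "\<alpha> \<in> roots"
  obtains w s where "w \<in> carrier W" "s \<in> S" "\<alpha> = act w (srt s)"
  using assms unfolding roots_def by blast

lemma root_intvec: "\<alpha> \<in> roots \<Longrightarrow> intvec \<alpha>"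
  by (auto simp: roots_def intro: intvec_act intvec_srt)

lemma srt_root [intro]: "s \<in> S \<Longrightarrow> srt s \<in> roots"
  unfolding roots_def using act_one[of "srt s"] by (metis (mono_tags, lifting) mem_Collect_eq one_closed)

lemma act_root [intro]: "\<lbrakk>w \<in> carrier W; \<alpha> \<in> roots\<rbrakk> \<Longrightarrow> act w \<alpha> \<in> roots"
  by (erule rootE) (auto simp: roots_def act_mult[symmetric])

lemma act_root_iff: "w \<in> carrier W \<Longrightarrow> act w \<alpha> \<in> roots \<longleftrightarrow> \<alpha> \<in> roots"
  using act_root[of w \<alpha>] act_root[of "inv w" "act w \<alpha>"] by auto

lemma negv_root [intro]: "\<alpha> \<in> roots \<Longrightarrow> negv \<alpha> \<in> roots"
proof (erule rootE)
  fix w s assume *: "w \<in> carrier W" "s \<in> S" "\<alpha> = act w (srt s)"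
  have "negv \<alpha> = act (w \<otimes> s) (srt s)"
    using * by (simp add: act_mult act_simple act_uminus)
  then show ?thesis using * unfolding roots_def by blast
qed

lemma root_nonzero: "\<alpha> \<in> roots \<Longrightarrow> \<exists>r. \<alpha> r \<noteq> 0"
proof (rule ccontr)
  assume a: "\<alpha> \<in> roots" "\<nexists>r. \<alpha> r \<noteq> 0"
  from a(1) obtain w s where *: "w \<in> carrier W" "s \<in> S" "\<alpha> = act w (srt s)"
    by (rule rootE)
  have "srt s = act (inv w) \<alpha>" using * by simp
  also have "\<alpha> = (\<lambda>r. 0)" using a by auto
  finally have "srt s s = 0" by (metis act_zero)
  then show False by simp
qed

lemma nonneg_act_srt_iff:
  assumes "w \<in> carrier W" "s \<in> S"
  shows "nonneg (act w (srt s)) \<longleftrightarrow> len w < len (w \<otimes> s)"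
    and "nonneg (negv (act w (srt s))) \<longleftrightarrow> len (w \<otimes> s) < len w"
proof -
  have neg: "negv (act w (srt s)) = act (w \<otimes> s) (srt s)"
    using assms by (simp add: act_mult act_simple act_uminus)
  have 1: "len (w \<otimes> s) < len w \<Longrightarrow> nonneg (negv (act w (srt s)))"
    unfolding neg using assms by (intro nonneg_if_len_less) auto
  have 2: "len w < len (w \<otimes> s) \<Longrightarrow> nonneg (act w (srt s))"
    using assms by (intro nonneg_if_len_less) auto
  have 3: "\<not> (nonneg (act w (srt s)) \<and> nonneg (negv (act w (srt s))))"
  proof
    assume "nonneg (act w (srt s)) \<and> nonneg (negv (act w (srt s)))"
    then have "act w (srt s) r = 0" for r
      unfolding nonneg_def by (metis antisym neg_0_le_iff_le)
    then show False using root_nonzero[of "act w (srt s)"] assms by (auto simp: roots_def)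
  qed
  have 4: "len w < len (w \<otimes> s) \<or> len (w \<otimes> s) < len w"
    using len_mult_simple[OF assms] by linarith
  show "nonneg (act w (srt s)) \<longleftrightarrow> len w < len (w \<otimes> s)"
    and "nonneg (negv (act w (srt s))) \<longleftrightarrow> len (w \<otimes> s) < len w"
    using 1 2 3 4 by auto
qed

lemma root_sign: "\<alpha> \<in> roots \<Longrightarrow> nonneg (negv \<alpha>) \<longleftrightarrow> \<not> nonneg \<alpha>"
  by (erule rootE) (use len_mult_simple nonneg_act_srt_iff in fastforce)

lemma root_sign': "\<alpha> \<in> roots \<Longrightarrow> \<alpha> r > 0 \<Longrightarrow> nonneg \<alpha>"
  using root_sign[of \<alpha>] unfolding nonneg_def by (metis neg_0_le_iff_le not_le)

lemma nonneg_srt [simp]: "nonneg (srt s)"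
  by (auto simp: nonneg_def srt_def)

text \<open>Moving one root to a simple root, which has a coordinate 1, shows that c times an
  integer is 1. Exchanging the roots shows the same for 1/c, so c is an invertible integer.\<close>

lemma root_multiple:
  assumes "\<alpha> \<in> roots" "\<beta> \<in> roots" "\<alpha> = (\<lambda>r. c * \<beta> r)"
  shows "c = 1 \<or> c = -1"
proof -
  have int: "\<exists>k\<in>\<int>. 1 = c * k" if "\<alpha> \<in> roots" "\<beta> \<in> roots" "\<alpha> = (\<lambda>r. c * \<beta> r)" for \<alpha> \<beta> c
  proof -
    from that(1) obtain w s where *: "w \<in> carrier W" "s \<in> S" "\<alpha> = act w (srt s)"
      by (rule rootE)
    have "srt s = act (inv w) \<alpha>" using * by simp
    also have "\<dots> = (\<lambda>r. c * act (inv w) \<beta> r)" by (simp add: that(3) act_scale)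
    finally have "1 = c * act (inv w) \<beta> s" by (metis srt_simps(1))
    moreover have "act (inv w) \<beta> s \<in> \<int>"
      using intvec_act[of "inv w" \<beta>] root_intvec[OF that(2)] * by (auto simp: intvec_def)
    ultimately show ?thesis by blast
  qed
  obtain k where k: "k \<in> \<int>" "1 = c * k" using int[OF assms] by blast
  have "c \<noteq> 0" using k by auto
  then have "\<beta> = (\<lambda>r. (1 / c) * \<alpha> r)" using assms(3) by simp
  then obtain k' where k': "k' \<in> \<int>" "1 = (1 / c) * k'" using int[of \<beta> \<alpha> "1 / c"] assms by blast
  then have "c = k'" using k by (auto simp: field_simps)
  then obtain m n where "c = of_int m" "k = of_int n" using k k' by (auto elim!: Ints_cases)
  then have "m * n = 1" using k(2) by (metis of_int_1 of_int_eq_iff of_int_mult)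
  then show ?thesis using \<open>c = of_int m\<close> by (auto simp: zmult_eq_1_iff)
qed

lemma root_eq_srt:
  assumes "\<alpha> \<in> roots" "nonneg \<alpha>" "s \<in> S" "\<And>r. r \<noteq> s \<Longrightarrow> \<alpha> r = 0"
  shows "\<alpha> = srt s"
proof -
  have eq: "\<alpha> = (\<lambda>r. \<alpha> s * srt s r)" using assms(4) by (auto simp: srt_def)
  then have "\<alpha> s = 1 \<or> \<alpha> s = -1"
    using root_multiple[OF assms(1) srt_root[OF assms(3)]] by blast
  moreover have "\<alpha> s \<ge> 0" using assms(2) by (simp add: nonneg_def)
  ultimately show ?thesis by (subst eq) auto
qed

lemma refl_root: "\<lbrakk>s \<in> S; \<alpha> \<in> roots\<rbrakk> \<Longrightarrow> refl s \<alpha> \<in> roots"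
  using act_root[of s \<alpha>] by (simp add: act_simple)

text \<open>The reflection alters only the coordinate at s. A positive root other than the simple
  one has another positive coordinate, and one positive coordinate decides the sign of a
  root.\<close>

lemma refl_nonneg:
  assumes "\<alpha> \<in> roots" "nonneg \<alpha>" "s \<in> S" "\<alpha> \<noteq> srt s"
  shows "nonneg (refl s \<alpha>)"
proof -
  obtain r where "r \<noteq> s" "\<alpha> r \<noteq> 0" using root_eq_srt assms by blast
  then have "refl s \<alpha> r > 0"
    using assms(2) by (auto simp: refl_def nonneg_def less_le)
  then show ?thesis
    using root_sign' refl_root assms by blast
qed

definition inversions :: "'a \<Rightarrow> ('a \<Rightarrow> real) set" where
  "inversions w = {\<alpha> \<in> roots. nonneg \<alpha> \<and> \<not> nonneg (act w \<alpha>)}"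

lemma inversions_mult_simple:
  assumes "w \<in> carrier W" "s \<in> S" "len (w \<otimes> s) = len w + 1"
  shows "inversions (w \<otimes> s) = insert (srt s) (refl s ` inversions w)" "srt s \<notin> refl s ` inversions w"
proof -
  have pos: "nonneg (act w (srt s))"
    using assms nonneg_act_srt_iff by simp
  have neg_srt: "\<not> nonneg (negv (srt s))"
    by (auto simp: nonneg_def intro!: exI[of _ s])
  have act': "act (w \<otimes> s) \<alpha> = act w (refl s \<alpha>)" for \<alpha>
    using assms by (simp add: act_mult act_simple)
  have rr: "refl s (refl s \<alpha>) = \<alpha>" for \<alpha>
    using refl_self assms(2) by blast
  have "\<not> nonneg (act w (negv (srt s)))"
    using pos root_sign[of "act w (srt s)"] assms by (auto simp: act_uminus roots_def)
  then have 1: "srt s \<in> inversions (w \<otimes> s)"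
    using assms by (auto simp: inversions_def act')
  have 2: "refl s \<alpha> \<in> inversions (w \<otimes> s)" if "\<alpha> \<in> inversions w" for \<alpha>
  proof -
    have "\<alpha> \<noteq> srt s" using that pos by (auto simp: inversions_def)
    then show ?thesis
      using that refl_nonneg refl_root assms by (auto simp: inversions_def act' rr)
  qed
  have 3: "\<alpha> \<in> refl s ` inversions w" if "\<alpha> \<in> inversions (w \<otimes> s)" "\<alpha> \<noteq> srt s" for \<alpha>
    using that refl_nonneg refl_root assms rr[of \<alpha>]
    by (auto simp: inversions_def act' intro!: image_eqI[of _ _ "refl s \<alpha>"])
  show "inversions (w \<otimes> s) = insert (srt s) (refl s ` inversions w)"
    using 1 2 3 by blast
  show "srt s \<notin> refl s ` inversions w"
  proof
    assume "srt s \<in> refl s ` inversions w"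
    then obtain \<alpha> where "\<alpha> \<in> inversions w" "srt s = refl s \<alpha>" by blast
    then have "\<alpha> = negv (srt s)" using rr[of \<alpha>] assms(2) by (metis refl_srt)
    then show False using \<open>\<alpha> \<in> inversions w\<close> neg_srt by (auto simp: inversions_def)
  qed
qed

lemma inversions_one: "inversions \<one> = {}"
  by (auto simp: inversions_def)

lemma inversions_card:
  assumes "w \<in> carrier W"
  shows "finite (inversions w) \<and> card (inversions w) = len w"
  using assms
proof (induction rule: simple_word_induct)
  case (mult w s)
  have "inj_on (refl s) (inversions w)"
    using refl_self[OF mult(2,2)] by (intro inj_onI) metis
  then show ?case
    using inversions_mult_simple[OF mult(1-3)] mult by (simp add: card_image)
qed (simp add: inversions_one)

lemma act_faithful:
  assumes "w \<in> carrier W" "\<And>\<alpha>. \<alpha> \<in> roots \<Longrightarrow> nonneg \<alpha> \<Longrightarrow> nonneg (act w \<alpha>)"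
  shows "w = \<one>"
proof -
  have "inversions w = {}" using assms by (auto simp: inversions_def)
  then show ?thesis using inversions_card[OF assms(1)] len_eq_0 assms(1) by simp
qed

lemma countable_roots: "countable roots"
proof -
  have "countable (lists S)" using finite_simple by (simp add: countable_finite)
  then have "countable (wprod ` lists S)" by (rule countable_image)
  moreover have "carrier W \<subseteq> wprod ` lists S" using wprod_surj by blast
  ultimately have "countable (carrier W)" using countable_subset by blast
  then have "countable ((\<lambda>(w, s). act w (srt s)) ` (carrier W \<times> S))"
    using finite_simple by (intro countable_image countable_SIGMA) (auto intro: countable_finite)
  moreover have "roots = (\<lambda>(w, s). act w (srt s)) ` (carrier W \<times> S)"
    by (auto simp: roots_def)
  ultimately show ?thesis by simp
qed

text \<open>The transvection \<open>s w t w\<^sup>-\<^sup>1\<close> is trivial, since its powers would otherwise violate the sign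
  coherence of roots.\<close>

lemma exchange:
  assumes w: "w \<in> carrier W" "s \<in> S" "t \<in> S" and eq: "act w (srt t) = srt s"
  shows "s \<otimes> w = w \<otimes> t"
proof -
  define f where "f v = coroot t (act (inv w) v)" for v
  define g where "g = s \<otimes> w \<otimes> t \<otimes> inv w"
  have g: "g \<in> carrier W" using w by (simp add: g_def)
  have refl_w: "act (w \<otimes> t \<otimes> inv w) v = (\<lambda>r. 1 * v r + (- f v) * srt s r)" for v
  proof -
    have "act (w \<otimes> t \<otimes> inv w) v = act w (refl t (act (inv w) v))"
      using w by (simp add: act_mult act_simple)
    also have "\<dots> = (\<lambda>r. 1 * act w (act (inv w) v) r + (- f v) * act w (srt t) r)"
      unfolding refl_alt act_linear f_def by simp
    finally show ?thesis using w eq by simp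
  qed
  have gact: "act g v = (\<lambda>r. v r + (f v - coroot s v) * srt s r)" for v
  proof -
    have "act g v = refl s (act (w \<otimes> t \<otimes> inv w) v)"
      using w act_mult[of s "w \<otimes> t \<otimes> inv w" v] by (simp add: g_def m_assoc act_simple)
    also have "\<dots> = (\<lambda>r. 1 * refl s v r + (- f v) * refl s (srt s) r)"
      unfolding refl_w refl_linear by simp
    finally show ?thesis
      using w by (auto simp: refl_alt[of s v] algebra_simps)
  qed
  \<comment> \<open>Both functionals are 2 on \<open>srt s\<close>, so their difference vanishes
    there and \<open>g\<close> is a transvection along \<open>srt s\<close>; its powers grow
    linearly.\<close>
  have f_srt: "f (srt s) = 2" "coroot s (srt s) = 2"
  proof -
    have "act (inv w) (srt s) = srt t" using w eq by (metis act_inv_act(1))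
    then show "f (srt s) = 2" "coroot s (srt s) = 2"
      using w by (simp_all add: f_def coroot_srt cartan_def)
  qed
  have gpow: "act (g [^] (n::nat)) v = (\<lambda>r. v r + real n * (f v - coroot s v) * srt s r)" for n v
  proof (induction n)
    case (Suc n)
    let ?d = "f v - coroot s v"
    have lin: "f (\<lambda>r. 1 * v r + c * srt s r) - coroot s (\<lambda>r. 1 * v r + c * srt s r) = ?d" for c
      unfolding f_def act_linear coroot_linear using f_srt unfolding f_def by simp
    have "act (g [^] Suc n) v = act g (act (g [^] n) v)"
      using g by (simp only: nat_pow_Suc2[OF g] act_mult nat_pow_closed)
    also have "\<dots> = (\<lambda>r. v r + real n * ?d * srt s r + ?d * srt s r)"
      using lin[of "real n * ?d"] unfolding Suc gact by simp
    finally show ?case by (auto simp: algebra_simps)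
  qed simp
  have zero: "f (srt r) = coroot s (srt r)" if r: "r \<in> S" for r
  proof (rule ccontr)
    assume ne: "f (srt r) \<noteq> coroot s (srt r)"
    then have rs: "r \<noteq> s" using f_srt by auto
    define d where "d = f (srt r) - coroot s (srt r)"
    have pow: "(\<lambda>x. srt r x + of_int n * d * srt s x) \<in> roots" for n :: int
    proof (cases n rule: int_cases2)
      case (nonneg m)
      then show ?thesis
        using gpow[of m "srt r"] act_root[of "g [^] m" "srt r"] g srt_root[OF r] by (simp add: d_def)
    next
      case (nonpos m)
      have lin: "act (g [^] m) (\<lambda>x. 1 * srt r x + c * srt s x) = (\<lambda>x. srt r x + (c + real m * d) * srt s x)" for c
        unfolding gpow
        unfolding f_def act_linear coroot_linear using f_srt
        unfolding f_def d_def by (auto simp: algebra_simps)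
      have "act (g [^] m) (\<lambda>x. srt r x + (- real m * d) * srt s x) = srt r"
        using lin[of "- real m * d"] by simp
      then have "(\<lambda>x. srt r x + (- real m * d) * srt s x) \<in> roots"
        using act_root_iff[of "g [^] m"] g srt_root[OF r] by (metis nat_pow_closed)
      then show ?thesis using nonpos by simp
    qed
    \<comment> \<open>The coordinate at r is 1, so all members of the family are positive roots,
      although their coordinate at s is n d for every integer n.\<close>
    have "nonneg (\<lambda>x. srt r x + of_int n * d * srt s x)" for n :: int
      using root_sign'[OF pow[of n], of r] rs by simp
    then have "0 \<le> of_int n * d" for n :: int
      unfolding nonneg_def using rs by (metis add_0 mult.right_neutral srt_simps)
    from this[of 1] this[of "-1"] show False using ne d_def by simp
  qed
  have triv: "act g \<alpha> = \<alpha>" if "\<alpha> \<in> roots" for \<alpha>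
  proof -
    have "\<alpha> r = 0" if "r \<notin> S" for r
      using root_intvec[OF \<open>\<alpha> \<in> roots\<close>] that by (simp add: intvec_def)
    moreover have "(\<Sum>r\<in>S. \<alpha> r * srt r x) = (\<Sum>r\<in>S. if r = x then \<alpha> x else 0)" for x
      by (rule sum.cong) (auto simp: srt_def)
    ultimately have dec: "\<alpha> = (\<lambda>x. \<Sum>r\<in>S. \<alpha> r * srt r x)"
      using finite_simple by auto
    have "act g (srt r) = srt r" if "r \<in> S" for r
      using zero[OF that] by (simp add: gact)
    note fix_srt = this
    have "act g \<alpha> = act g (\<lambda>x. \<Sum>r\<in>S. \<alpha> r * srt r x)"
      using arg_cong[OF dec, of "act g"] .
    also have "\<dots> = (\<lambda>x. \<Sum>r\<in>S. \<alpha> r * srt r x)"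
      unfolding act_sum by (auto simp: fix_srt intro!: sum.cong)
    also have "\<dots> = \<alpha>" using dec by (rule sym)
    finally show ?thesis .
  qed
  have "g = \<one>"
    using act_faithful[OF g] triv by auto
  then have "s \<otimes> (w \<otimes> t \<otimes> inv w) = \<one>"
    using w by (simp add: g_def m_assoc)
  then have "w \<otimes> t \<otimes> inv w = s"
    using w by (metis inv_closed inv_equality inv_inv m_closed S_carrier simple_inv)
  then show ?thesis
    using w by (metis inv_closed inv_solve_right' m_closed S_carrier)
qed

end

section \<open>Smoothing of two-sided sequences\<close>

text \<open>What one replacement of \<pi> does to the sequence of its values along an orbit. A mode
  of frequency x is multiplied by 2 + e^(ix).\<close>

definition smooth :: "(int \<Rightarrow> 'a::comm_ring_1) \<Rightarrow> int \<Rightarrow> 'a" where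
  "smooth a n = 2 * a n + a (n + 1)"

abbreviation smooths :: "nat \<Rightarrow> (int \<Rightarrow> 'a::comm_ring_1) \<Rightarrow> int \<Rightarrow> 'a" where
  "smooths m \<equiv> (smooth ^^ m)"

lemma smooths_mono:
  fixes a b :: "int \<Rightarrow> real"
  assumes "\<And>n. a n \<le> b n"
  shows "smooths m a n \<le> smooths m b n"
  by (induction m arbitrary: n) (auto simp: smooth_def assms add_mono)

lemma smooths_add:
  "smooths m (\<lambda>n. c * a n + d * b n) = (\<lambda>n. c * smooths m a n + d * smooths m b n)"
  by (induction m) (auto simp: smooth_def algebra_simps)

lemma smooths_sum:
  "smooths m (\<lambda>n. \<Sum>k\<in>K. f k n) = (\<lambda>n. \<Sum>k\<in>K. smooths m (f k) n)"
  by (induction m) (auto simp: smooth_def algebra_simps sum.distrib sum_distrib_left)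

lemma smooths_of_real: "smooths m (\<lambda>n. complex_of_real (a n)) = (\<lambda>n. complex_of_real (smooths m a n))"
  by (induction m) (auto simp: smooth_def)

lemma smooths_cis:
  "smooths m (\<lambda>n. C * cis (x * real_of_int n)) = (\<lambda>n. C * (2 + cis x) ^ m * cis (x * real_of_int n))"
  by (induction m) (auto simp: smooth_def algebra_simps cis_mult[symmetric])

text \<open>The binomial theorem for (2 + E)^m, with E the shift of sequences.\<close>

lemma smooths_binomial:
  fixes a :: "int \<Rightarrow> real"
  shows "smooths m a n = (\<Sum>i\<le>m. real (m choose i) * 2 ^ (m - i) * a (n + int i))"
proof (induction m arbitrary: n)
  case (Suc m)
  let ?t = "\<lambda>i. a (n + int i)"
  have s1: "(\<Sum>i\<le>Suc m. real (m choose i) * 2 ^ (Suc m - i) * ?t i)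
      = 2 * (\<Sum>i\<le>m. real (m choose i) * 2 ^ (m - i) * ?t i)"
    by (auto simp: sum_distrib_left Suc_diff_le binomial_eq_0 intro!: sum.cong)
  have s2: "(\<Sum>i\<le>m. real (m choose i) * 2 ^ (m - i) * ?t (Suc i))
      = (\<Sum>i=1..Suc m. real (m choose (i - 1)) * 2 ^ (Suc m - i) * ?t i)"
    by (rule sum.reindex_bij_witness[of _ "\<lambda>i. i - 1" Suc]) auto
  have "(\<Sum>i\<le>Suc m. real (Suc m choose i) * 2 ^ (Suc m - i) * ?t i)
      = (\<Sum>i\<le>Suc m. real (m choose i) * 2 ^ (Suc m - i) * ?t i)
      + (\<Sum>i=1..Suc m. real (m choose (i - 1)) * 2 ^ (Suc m - i) * ?t i)"
  proof -
    have "{..Suc m} = insert 0 {1..Suc m}" by auto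
    then have split: "(\<Sum>i\<le>Suc m. f i) = f 0 + (\<Sum>i=1..Suc m. f i)" for f :: "nat \<Rightarrow> real"
      by simp
    have "real (Suc m choose i) = real (m choose i) + real (m choose (i - 1))" if "i \<in> {1..Suc m}" for i
      using that by (cases i) auto
    then show ?thesis
      unfolding split by (simp add: sum.distrib[symmetric] algebra_simps)
  qed
  also have "\<dots> = 2 * smooths m a n + smooths m a (n + 1)"
    unfolding s1 s2[symmetric] Suc by (simp add: algebra_simps)
  finally show ?case
    by (simp add: smooth_def[of "smooths m a"] del: sum.atMost_Suc binomial_Suc_Suc)
qed simp

subsection \<open>Periodic sequences\<close>

definition dft :: "nat \<Rightarrow> (int \<Rightarrow> real) \<Rightarrow> nat \<Rightarrow> complex" where
  "dft d a k = (\<Sum>j<d. a (int j) * cis (- (2 * pi * real k / real d) * real j))"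

lemma periodic_int:
  fixes a :: "int \<Rightarrow> 'b"
  assumes "\<And>n. a (n + int d) = a n"
  shows "a (n + int d * k) = a n"
proof (induction k rule: int_induct[of _ 0])
  case (step1 i)
  then show ?case using assms[of "n + int d * i"] by (simp add: algebra_simps)
next
  case (step2 i)
  then show ?case using assms[of "n + int d * (i - 1)"] by (simp add: algebra_simps)
qed simp

lemma sum_roots_of_unity:
  assumes "d > 0"
  shows "(\<Sum>k<d. cis (2 * pi * real k / real d * real_of_int m)) = (if int d dvd m then of_nat d else 0)"
proof -
  let ?w = "cis (2 * pi / real d * real_of_int m)"
  have pow: "cis (2 * pi * real k / real d * real_of_int m) = ?w ^ k" for k
    by (simp add: Complex.DeMoivre mult.commute mult.left_commute)
  show ?thesis
  proof (cases "int d dvd m")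
    case True
    then obtain j where "m = int d * j" by auto
    then have arg: "2 * pi / real d * real_of_int m = 2 * pi * real_of_int j" using assms by simp
    have "?w = 1" unfolding arg by (rule cis_multiple_2pi) simp
    then have "(\<Sum>k<d. ?w ^ k) = of_nat d" by (simp only: power_one) simp
    then show ?thesis using True unfolding pow by simp
  next
    case False
    have "?w \<noteq> 1"
    proof
      assume "?w = 1"
      then have "cos (2 * pi / real d * real_of_int m) = 1" by (simp add: cis.code complex_eq_iff)
      then obtain j :: int where "2 * pi / real d * real_of_int m = of_int j * 2 * pi"
        using cos_one_2pi_int by auto
      then have "real_of_int m = real_of_int (int d * j)" using assms by (simp add: field_simps)
      then have "m = int d * j" using of_int_eq_iff by blast
      then show False using False by simp
    qed
    moreover have "?w ^ d = 1"
    proof -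
      have "real d * (2 * pi / real d * real_of_int m) = 2 * pi * real_of_int m" using assms by simp
      then have "?w ^ d = cis (2 * pi * real_of_int m)" by (simp only: Complex.DeMoivre)
      also have "\<dots> = 1" by (rule cis_multiple_2pi) simp
      finally show ?thesis .
    qed
    ultimately show ?thesis using False unfolding pow by (simp add: geometric_sum)
  qed
qed

lemma dft_inversion:
  assumes d: "d > 0" and per: "\<And>n. a (n + int d) = a n"
  shows "complex_of_real (a n) =
    (\<Sum>k<d. dft d a k / of_nat d * cis ((2 * pi * real k / real d) * real_of_int n))"
proof -
  define n' where "n' = nat (n mod int d)"
  have n': "n' < d" "n = int n' + int d * (n div int d)"
    using d by (auto simp: n'_def nat_less_iff)
  have "(\<Sum>k<d. dft d a k * cis ((2 * pi * real k / real d) * real_of_int n))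
      = (\<Sum>k<d. \<Sum>j<d. a (int j) * cis (2 * pi * real k / real d * real_of_int (n - int j)))"
    unfolding dft_def sum_distrib_right
    by (intro sum.cong refl) (simp add: mult.assoc cis_mult diff_divide_distrib algebra_simps)
  also have "\<dots> = (\<Sum>j<d. a (int j) * (\<Sum>k<d. cis (2 * pi * real k / real d * real_of_int (n - int j))))"
    by (subst sum.swap) (simp add: sum_distrib_left)
  also have "\<dots> = (\<Sum>j<d. if j = n' then complex_of_real (a (int n')) * of_nat d else 0)"
  proof (rule sum.cong)
    fix j assume j: "j \<in> {..<d}"
    have "int d dvd n - int j \<longleftrightarrow> int d dvd int n' - int j"
      using n'(2) by (metis add_diff_eq diff_add_eq dvd_add_left_iff dvd_triv_left)
    also have "\<dots> \<longleftrightarrow> j = n'"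
    proof (rule iffI)
      assume "int d dvd int n' - int j"
      then have "int d dvd \<bar>int n' - int j\<bar>" by simp
      moreover have "\<bar>int n' - int j\<bar> < int d" using j n'(1) by auto
      ultimately have "int n' = int j" using zdvd_not_zless[of "\<bar>int n' - int j\<bar>" "int d"] by linarith
      then show "j = n'" by simp
    qed simp
    finally show "complex_of_real (a (int j)) * (\<Sum>k<d. cis (2 * pi * real k / real d * real_of_int (n - int j)))
        = (if j = n' then complex_of_real (a (int n')) * of_nat d else 0)"
      unfolding sum_roots_of_unity[OF d] by auto
  qed simp
  also have "\<dots> = complex_of_real (a (int n')) * of_nat d" using n' by simp
  also have "a (int n') = a n"
    using periodic_int[of a d "int n'" "n div int d", OF per] n'(2) by metis
  finally show ?thesis using d by (simp add: sum_divide_distrib[symmetric] field_simps)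
qed

lemma dft_cnj:
  assumes "k \<le> d" "d > 0"
  shows "dft d a (d - k) = cnj (dft d a k)"
proof -
  have "cis (- (2 * pi * real (d - k) / real d) * real j) = cis (2 * pi * real k / real d * real j)" for j
  proof -
    have "- (2 * pi * real (d - k) / real d) * real j =
        2 * pi * real k / real d * real j + 2 * pi * real_of_int (- int j)"
      using assms by (simp add: field_simps)
    then show ?thesis
      by (metis cis_mult cis_multiple_2pi Ints_of_int mult_1_right)
  qed
  then show ?thesis by (simp add: dft_def cis_cnj)
qed

lemma norm_two_plus_cis: "(cmod (2 + cis x))\<^sup>2 = 5 + 4 * cos x"
proof -
  have "(cmod (2 + cis x))\<^sup>2 = (2 + cos x)\<^sup>2 + (sin x)\<^sup>2"
    by (simp add: cmod_power2)
  also have "\<dots> = 4 + 4 * cos x + ((sin x)\<^sup>2 + (cos x)\<^sup>2)"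
    by (simp add: power2_eq_square algebra_simps)
  finally show ?thesis by simp
qed

lemma norm_mode_less:
  assumes "k < j" "j < d - k"
  shows "cmod (2 + cis (2 * pi * real j / real d)) < cmod (2 + cis (2 * pi * real k / real d))"
proof -
  have "cos (2 * pi * real j / real d) < cos (2 * pi * real k / real d)"
  proof (cases "2 * j \<le> d")
    case True
    then show ?thesis
      using assms by (intro cos_monotone_0_pi) (auto simp: field_simps simp flip: of_nat_mult)
  next
    case False
    \<comment> \<open>A mode beyond d/2 has the cosine of its mirror d - j, which lies where the
      cosine is monotone.\<close>
    have "2 * pi * real j / real d = 2 * pi - 2 * pi * real (d - j) / real d"
      using assms by (simp add: field_simps)
    then have "cos (2 * pi * real j / real d) = cos (2 * pi * real (d - j) / real d)"
      by (simp add: cos_diff)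
    also have "\<dots> < cos (2 * pi * real k / real d)"
    proof (rule cos_monotone_0_pi)
      have *: "k < d - j" "2 * (d - j) \<le> d" "0 < d" using assms False by auto
      then have "2 * real (d - j) \<le> real d" by linarith
      then show "2 * pi * real (d - j) / real d \<le> pi" using * by (simp add: field_simps)
      show "2 * pi * real k / real d < 2 * pi * real (d - j) / real d"
        using * by (intro divide_strict_right_mono mult_strict_left_mono) auto
    qed simp
    finally show ?thesis .
  qed
  then have "(cmod (2 + cis (2 * pi * real j / real d)))\<^sup>2 < (cmod (2 + cis (2 * pi * real k / real d)))\<^sup>2"
    unfolding norm_two_plus_cis by simp
  then show ?thesis by (simp add: power_mono_iff flip: not_le)
qed

text \<open>A mode \<open>k\<close> and its mirror \<open>d - k\<close> dominate all modes strictly between them, because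
  \<open>\<bar>2 + e\<^sup>i\<^sup>x\<bar>\<close> decreases on \<open>[0, \<pi>]\<close>.\<close>

lemma modes_negligible:
  assumes "\<epsilon> > 0"
  shows "\<exists>m0. \<forall>m\<ge>m0. (\<Sum>j\<in>{k<..<d - k}. K j * cmod (2 + cis (2 * pi * real j / real d)) ^ m)
    \<le> \<epsilon> * cmod (2 + cis (2 * pi * real k / real d)) ^ m"
proof -
  let ?r = "\<lambda>j. cmod (2 + cis (2 * pi * real j / real d))"
  have pos: "?r j > 0" for j
  proof -
    have "(?r j)\<^sup>2 > 0"
      unfolding norm_two_plus_cis using cos_ge_minus_one[of "2 * pi * real j / real d"] by linarith
    then show ?thesis by (simp add: zero_less_power2)
  qed
  have "(\<lambda>m. \<Sum>j\<in>{k<..<d - k}. K j * (?r j / ?r k) ^ m) \<longlonglongrightarrow> (\<Sum>j\<in>{k<..<d - k}. K j * 0)"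
    using norm_mode_less[of k _ d] pos
    by (intro tendsto_sum tendsto_mult tendsto_const LIMSEQ_realpow_zero) (auto simp: less_imp_le)
  then have "eventually (\<lambda>m. (\<Sum>j\<in>{k<..<d - k}. K j * (?r j / ?r k) ^ m) < \<epsilon>) sequentially"
    using assms by (intro order_tendstoD(2)) auto
  then obtain m0 where m0: "\<And>m. m \<ge> m0 \<Longrightarrow> (\<Sum>j\<in>{k<..<d - k}. K j * (?r j / ?r k) ^ m) < \<epsilon>"
    by (auto simp: eventually_sequentially)
  show ?thesis
  proof (intro exI[of _ m0] allI impI)
    fix m assume "m \<ge> m0"
    have "(\<Sum>j\<in>{k<..<d - k}. K j * ?r j ^ m) = (\<Sum>j\<in>{k<..<d - k}. K j * (?r j / ?r k) ^ m) * ?r k ^ m"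
      unfolding sum_distrib_right using pos[of k] by (intro sum.cong) (auto simp: power_divide)
    also have "\<dots> \<le> \<epsilon> * ?r k ^ m"
      using m0[OF \<open>m \<ge> m0\<close>] pos[of k] by (intro mult_right_mono) auto
    finally show "(\<Sum>j\<in>{k<..<d - k}. K j * ?r j ^ m) \<le> \<epsilon> * ?r k ^ m" .
  qed
qed

lemma smooths_dft:
  fixes a :: "int \<Rightarrow> real"
  assumes d: "d > 0" and per: "\<And>n. a (n + int d) = a n"
  shows "complex_of_real (smooths m a n) = (\<Sum>k<d. dft d a k / of_nat d *
    (2 + cis (2 * pi * real k / real d)) ^ m * cis ((2 * pi * real k / real d) * real_of_int n))"
proof -
  have "(\<lambda>n. complex_of_real (a n)) = (\<lambda>n. \<Sum>k<d. dft d a k / of_nat d *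
      cis ((2 * pi * real k / real d) * real_of_int n))"
    by (intro ext dft_inversion assms)
  then have "smooths m (\<lambda>n. complex_of_real (a n)) n = smooths m (\<lambda>n. \<Sum>k<d. dft d a k / of_nat d *
      cis ((2 * pi * real k / real d) * real_of_int n)) n"
    by simp
  then show ?thesis
    unfolding smooths_of_real smooths_sum smooths_cis .
qed

text \<open>The mode 0 carries the mean and the multiplier 3, which strictly exceeds the modulus of
  every other multiplier. Eventually all values have the sign of the mean, with a threshold
  independent of n.\<close>

lemma smooths_periodic_pos:
  fixes a :: "int \<Rightarrow> real"
  assumes d: "d > 0" and per: "\<And>n. a (n + int d) = a n" and pos: "(\<Sum>j<d. a (int j)) > 0"
  shows "\<exists>m0. \<forall>m\<ge>m0. \<forall>n. smooths m a n > 0"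
proof -
  let ?r = "\<lambda>j. cmod (2 + cis (2 * pi * real j / real d))"
  let ?A = "\<Sum>j<d. a (int j)"
  obtain m0 where m0: "\<And>m. m \<ge> m0 \<Longrightarrow>
      (\<Sum>j\<in>{0<..<d - 0}. cmod (dft d a j) * ?r j ^ m) \<le> (?A / 2) * ?r 0 ^ m"
    using modes_negligible[where \<epsilon> = "?A / 2" and K = "\<lambda>j. cmod (dft d a j)" and k = 0 and d = d] pos by auto
  have A: "dft d a 0 = ?A" by (simp add: dft_def)
  have "smooths m a n > 0" if m: "m \<ge> m0" for m n
  proof -
    let ?E = "\<Sum>k\<in>{0<..<d}. dft d a k *
      (2 + cis (2 * pi * real k / real d)) ^ m * cis ((2 * pi * real k / real d) * real_of_int n)"
    have split: "{..<d} = insert 0 {0<..<d}" using d by auto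
    have "complex_of_real (real d * smooths m a n) = (\<Sum>k<d. dft d a k *
      (2 + cis (2 * pi * real k / real d)) ^ m * cis ((2 * pi * real k / real d) * real_of_int n))"
      using d by (simp add: smooths_dft[of d a, OF d per] sum_distrib_left)
    also have "\<dots> = ?A * 3 ^ m + ?E"
      by (subst split) (simp add: A)
    finally have eq: "complex_of_real (real d * smooths m a n - ?A * 3 ^ m) = ?E" by simp
    have "cmod ?E \<le> (\<Sum>j\<in>{0<..<d}. cmod (dft d a j) * ?r j ^ m)"
      by (rule sum_norm_le) (simp add: norm_mult norm_power)
    also have "\<dots> \<le> (?A / 2) * 3 ^ m"
      using m0[OF m] by simp
    finally have "\<bar>real d * smooths m a n - ?A * 3 ^ m\<bar> \<le> ?A * 3 ^ m / 2"
      unfolding eq[symmetric] norm_of_real by simp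
    moreover have "?A * 3 ^ m > 0" using pos by simp
    ultimately have "real d * smooths m a n > 0" by linarith
    then show ?thesis using d by (simp add: zero_less_mult_iff)
  qed
  then show ?thesis by blast
qed

text \<open>When the leading mode is not real, a zero of a smoothed sequence is a simple sign change,
  uniformly over all combinations of two sequences whose leading coefficients are independent over
  the reals.\<close>

lemma smooths_periodic_crossing:
  fixes a b :: "int \<Rightarrow> real"
  assumes d: "d > 0" and pa: "\<And>n. a (n + int d) = a n" and pb: "\<And>n. b (n + int d) = b n"
    and k: "0 < k" "2 * k < d"
    and low: "\<And>j. j < k \<Longrightarrow> dft d a j = 0" "\<And>j. j < k \<Longrightarrow> dft d b j = 0"
    and indep: "Im (dft d a k * cnj (dft d b k)) \<noteq> 0"
  shows "\<exists>m0. \<forall>m\<ge>m0. \<forall>x y. (x, y) \<noteq> (0, 0) \<longrightarrow> x * smooths m a 0 + y * smooths m b 0 = 0 \<longrightarrow>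
     (x * smooths m a (-1) + y * smooths m b (-1)) * (x * smooths m a 1 + y * smooths m b 1) < 0"
proof -
  let ?z = "\<lambda>j. 2 + cis (2 * pi * real j / real d)"
  let ?A = "dft d a" and ?B = "dft d b"
  define \<delta> where "\<delta> = \<bar>Im (?A k * cnj (?B k))\<bar>"
  \<comment> \<open>\<open>K j\<close> bounds the ratio of mode j to mode k for every combination of
    the two sequences: independence of the leading coefficients controls x and y by the size of
    \<open>C k\<close>, whatever the pair is.\<close>
  define K where "K j = (cmod (?B k) * cmod (?A j) + cmod (?A k) * cmod (?B j)) / \<delta>" for j
  define \<theta> where "\<theta> = 2 * pi * real k / real d"
  have \<delta>: "\<delta> > 0" using indep by (simp add: \<delta>_def)
  have \<theta>: "0 < \<theta>" "\<theta> < pi"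
    using k d by (auto simp: \<theta>_def field_simps simp flip: of_nat_mult)
  have sin: "sin \<theta> > 0" using \<theta> by (rule sin_gt_zero)
  obtain m0 where m0: "\<And>m. m \<ge> m0 \<Longrightarrow>
      (\<Sum>j\<in>{k<..<d - k}. K j * cmod (?z j) ^ m) \<le> (sin \<theta> / 2) * cmod (?z k) ^ m"
    using modes_negligible[where \<epsilon> = "sin \<theta> / 2" and K = K and k = k and d = d] sin by auto
  have main: "(x * smooths m a (-1) + y * smooths m b (-1)) * (x * smooths m a 1 + y * smooths m b 1) < 0"
    if m: "m \<ge> m0" and xy: "(x, y) \<noteq> (0, 0)" and zero: "x * smooths m a 0 + y * smooths m b 0 = 0" for m x y
  proof -
    define C where "C j = x * ?A j + y * ?B j" for j
    define c where "c n = x * smooths m a n + y * smooths m b n" for n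
    have Clow: "C j = 0" if "j < k" for j using low that by (simp add: C_def)
    have Ccnj: "C (d - j) = cnj (C j)" if "j \<le> d" for j
      using dft_cnj[OF that d] by (simp add: C_def)
    have x_le: "\<bar>x\<bar> * \<delta> \<le> cmod (C k) * cmod (?B k)"
    proof -
      have "Im (C k * cnj (?B k)) = x * Im (?A k * cnj (?B k))"
        by (simp add: C_def algebra_simps)
      then have "\<bar>x\<bar> * \<delta> = \<bar>Im (C k * cnj (?B k))\<bar>" by (simp add: \<delta>_def abs_mult)
      also have "\<dots> \<le> cmod (C k * cnj (?B k))" by (rule abs_Im_le_cmod)
      finally show ?thesis by (simp add: norm_mult)
    qed
    have y_le: "\<bar>y\<bar> * \<delta> \<le> cmod (C k) * cmod (?A k)"
    proof -
      have "Im (C k * cnj (?A k)) = - y * Im (?A k * cnj (?B k))"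
        by (simp add: C_def algebra_simps)
      then have "\<bar>y\<bar> * \<delta> = \<bar>Im (C k * cnj (?A k))\<bar>" by (simp add: \<delta>_def abs_mult)
      also have "\<dots> \<le> cmod (C k * cnj (?A k))" by (rule abs_Im_le_cmod)
      finally show ?thesis by (simp add: norm_mult)
    qed
    have Ck: "C k \<noteq> 0"
      using x_le y_le xy \<delta> by (auto simp: mult_le_0_iff)
    have CK: "cmod (C j) \<le> cmod (C k) * K j" for j
    proof -
      have "cmod (C j) \<le> \<bar>x\<bar> * cmod (?A j) + \<bar>y\<bar> * cmod (?B j)"
        unfolding C_def by (rule order_trans[OF norm_triangle_ineq]) (simp add: norm_mult)
      then have "cmod (C j) * \<delta> \<le> (\<bar>x\<bar> * \<delta>) * cmod (?A j) + (\<bar>y\<bar> * \<delta>) * cmod (?B j)"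
        using mult_right_mono[of _ _ \<delta>] \<delta> by (fastforce simp: algebra_simps)
      also have "\<dots> \<le> (cmod (C k) * cmod (?B k)) * cmod (?A j) + (cmod (C k) * cmod (?A k)) * cmod (?B j)"
        using x_le y_le by (intro add_mono mult_right_mono) auto
      finally show ?thesis using \<delta> by (simp add: K_def field_simps)
    qed
    define Z where "Z = C k * ?z k ^ m"
    define E where "E n = (\<Sum>j\<in>{k<..<d - k}. C j * ?z j ^ m * cis ((2 * pi * real j / real d) * real_of_int n))" for n
    have Z0: "cmod Z > 0"
    proof -
      have "(cmod (?z k))\<^sup>2 > 0"
        unfolding norm_two_plus_cis using cos_ge_minus_one[of "2 * pi * real k / real d"] by linarith
      then show ?thesis using Ck by (auto simp: Z_def)
    qed
    have E: "cmod (E n) \<le> (sin \<theta> / 2) * cmod Z" for n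
    proof -
      have "cmod (E n) \<le> (\<Sum>j\<in>{k<..<d - k}. cmod (C k) * (K j * cmod (?z j) ^ m))"
        unfolding E_def
        by (rule sum_norm_le) (simp add: norm_mult norm_power mult.assoc[symmetric] mult_right_mono CK)
      also have "\<dots> \<le> cmod (C k) * ((sin \<theta> / 2) * cmod (?z k) ^ m)"
        unfolding sum_distrib_left[symmetric] using m0[OF m] by (intro mult_left_mono) auto
      finally show ?thesis by (simp add: Z_def norm_mult norm_power algebra_simps)
    qed
    have c: "complex_of_real (real d * c n) = of_real (2 * Re (Z * cis (\<theta> * real_of_int n))) + E n" for n
    proof -
      let ?f = "\<lambda>j. C j * ?z j ^ m * cis ((2 * pi * real j / real d) * real_of_int n)"
      have "complex_of_real (real d * c n) = (\<Sum>j<d. ?f j)"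
        using d by (simp add: c_def C_def smooths_dft[of d a, OF d pa] smooths_dft[of d b, OF d pb] sum_distrib_left
            sum.distrib[symmetric] algebra_simps add_divide_distrib)
      \<comment> \<open>Modes below k vanish by hypothesis, modes above d - k by conjugate symmetry.
        The pair k, d - k yields twice a real part; everything strictly between goes into the error
        \<open>E\<close>.\<close>
      also have "\<dots> = (\<Sum>j\<in>insert k (insert (d - k) {k<..<d - k}). ?f j)"
      proof (rule sum.mono_neutral_right)
        show "\<forall>i\<in>{..<d} - insert k (insert (d - k) {k<..<d - k}). ?f i = 0"
        proof
          fix i assume i: "i \<in> {..<d} - insert k (insert (d - k) {k<..<d - k})"
          then have "i < k \<or> (d - i < k \<and> i \<le> d)" using k by auto
          then have "C i = 0" using Clow[of i] Clow[of "d - i"] Ccnj[of i] by auto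
          then show "?f i = 0" by simp
        qed
      qed (use k in auto)
      also have "\<dots> = ?f k + ?f (d - k) + E n"
        using k by (simp add: E_def)
      also have "?f (d - k) = cnj (?f k)"
      proof -
        have arg: "2 * pi * real (d - k) / real d = 2 * pi - 2 * pi * real k / real d"
          using k by (simp add: field_simps)
        have 1: "cis (2 * pi * real (d - k) / real d) = cnj (cis (2 * pi * real k / real d))"
          unfolding arg by (simp add: complex_eq_iff cos_diff sin_diff)
        have 2: "cis (2 * pi * real (d - k) / real d * real_of_int n)
            = cnj (cis (2 * pi * real k / real d * real_of_int n))"
        proof -
          have "2 * pi * real (d - k) / real d * real_of_int n =
             - (2 * pi * real k / real d * real_of_int n) + 2 * pi * real_of_int n"
            unfolding arg by (simp add: algebra_simps)
          then have "cis (2 * pi * real (d - k) / real d * real_of_int n) =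
             cis (- (2 * pi * real k / real d * real_of_int n)) * cis (2 * pi * real_of_int n)"
            by (simp only: cis_mult)
          then show ?thesis by (simp add: cis_multiple_2pi cis_cnj)
        qed
        show ?thesis unfolding 1 2 using Ccnj[of k] k by simp
      qed
      also have "?f k + cnj (?f k) = of_real (2 * Re (?f k))"
        by (rule complex_add_cnj)
      also have "?f k = Z * cis (\<theta> * real_of_int n)"
        by (simp add: Z_def \<theta>_def)
      finally show ?thesis .
    qed
    have cRe: "\<bar>real d * c n - 2 * Re (Z * cis (\<theta> * real_of_int n))\<bar> \<le> (sin \<theta> / 2) * cmod Z" for n
    proof -
      have "complex_of_real (real d * c n - 2 * Re (Z * cis (\<theta> * real_of_int n))) = E n"
        using c[of n] by simp
      then show ?thesis using E[of n] by (metis norm_of_real)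
    qed
    have "c 0 = 0" using zero by (simp add: c_def)
    \<comment> \<open>A zero at 0 makes Z almost imaginary: |Re Z| is at most |Z|/4, hence |Im Z| is
      at least 3|Z|/4. At 1 and -1 the main terms are -2 Im Z sin \<theta> and 2 Im Z sin \<theta>,
      of size at least (3/2) sin \<theta> |Z|, against two errors of at most (1/2) sin \<theta> |Z|
      each.\<close>
    then have ReZ: "\<bar>2 * Re Z\<bar> \<le> (sin \<theta> / 2) * cmod Z"
      using cRe[of 0] by simp
    have bounds: "\<bar>real d * c 1 - (2 * Re Z * cos \<theta> - 2 * Im Z * sin \<theta>)\<bar> \<le> (sin \<theta> / 2) * cmod Z"
      "\<bar>real d * c (-1) - (2 * Re Z * cos \<theta> + 2 * Im Z * sin \<theta>)\<bar> \<le> (sin \<theta> / 2) * cmod Z"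
      using cRe[of 1] cRe[of "-1"] by (simp_all add: algebra_simps)
    have recos: "\<bar>2 * Re Z * cos \<theta>\<bar> \<le> (sin \<theta> / 2) * cmod Z"
    proof -
      have "\<bar>2 * Re Z * cos \<theta>\<bar> \<le> \<bar>2 * Re Z\<bar> * 1"
        unfolding abs_mult by (intro mult_left_mono) (auto simp: abs_cos_le_one)
      then show ?thesis using ReZ by linarith
    qed
    have "cmod Z \<le> \<bar>Re Z\<bar> + \<bar>Im Z\<bar>" by (rule cmod_le)
    moreover have "(sin \<theta> / 2) * cmod Z \<le> cmod Z / 2"
      using mult_right_mono[of "sin \<theta> / 2" "1 / 2" "cmod Z"] by simp
    ultimately have ImZ: "cmod Z * (3 / 4) \<le> \<bar>Im Z\<bar>" using ReZ by linarith
    have ImZs: "(3 / 2) * (sin \<theta> * cmod Z) \<le> \<bar>2 * Im Z * sin \<theta>\<bar>"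
      using mult_right_mono[OF ImZ, of "2 * sin \<theta>"] sin by (simp add: abs_mult algebra_simps)
    have sZ: "sin \<theta> * cmod Z > 0" using sin Z0 by simp
    have "(real d * c 1) * (real d * c (-1)) < 0"
    proof (cases "Im Z \<ge> 0")
      case True
      then have "(3 / 2) * (sin \<theta> * cmod Z) \<le> 2 * Im Z * sin \<theta>" using ImZs sin by simp
      then have "real d * c 1 < 0" "real d * c (-1) > 0" using bounds recos sZ by linarith+
      then show ?thesis by (rule mult_neg_pos)
    next
      case False
      then have "(3 / 2) * (sin \<theta> * cmod Z) \<le> - (2 * Im Z * sin \<theta>)"
        using ImZs sin by (simp add: abs_mult)
      then have "real d * c 1 > 0" "real d * c (-1) < 0" using bounds recos sZ by linarith+
      then show ?thesis by (rule mult_pos_neg)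
    qed
    then have "(real d * real d) * (c (-1) * c 1) < 0" by (simp add: algebra_simps)
    then have "c (-1) * c 1 < 0" using d by (simp add: mult_less_0_iff)
    then show ?thesis by (simp add: c_def)
  qed
  show ?thesis
    by (intro exI[of _ m0] allI impI main)
qed

subsection \<open>Sequences of constant or opposite signs at infinity\<close>

text \<open>Comparison with a periodic sequence from below. It equals -C on a window covering the
  exceptional indices and \<delta> elsewhere; a long enough period makes its mean positive, and
  smoothing is monotone.\<close>

lemma smooths_even_pos:
  fixes a :: "int \<Rightarrow> real"
  assumes \<delta>: "\<delta> > 0" and far: "\<And>n. int N \<le> \<bar>n\<bar> \<Longrightarrow> a n \<ge> \<delta>"
  shows "\<exists>m0. \<forall>m\<ge>m0. \<forall>n. smooths m a n > 0"
proof -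
  define C where "C = (\<Sum>n\<in>{-int N..int N}. \<bar>a n\<bar>)"
  \<comment> \<open>The number of indices per period with value \<delta>, chosen so that M \<delta>
    exceeds the loss 2 N C in the window.\<close>
  define M where "M = nat \<lceil>real (2 * N) * C / \<delta>\<rceil> + 1"
  define d where "d = 2 * N + M"
  define b where "b n = (if (n + int N) mod int d < 2 * int N then - C else \<delta>)" for n
  have C0: "C \<ge> 0" by (auto simp: C_def intro: sum_nonneg)
  have M0: "M > 0" by (simp add: M_def)
  then have d0: "d > 0" by (simp add: d_def)
  have per: "b (n + int d) = b n" for n
  proof -
    have "n + int d + int N = (n + int N) + int d" by simp
    then show ?thesis by (simp only: b_def mod_add_self2)
  qed
  have le: "b n \<le> a n" for n
  proof (cases "int N \<le> \<bar>n\<bar>")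
    case True
    then show ?thesis using far[of n] C0 \<delta> by (auto simp: b_def)
  next
    case False
    then have n: "- int N < n" "n < int N" by auto
    then have "(n + int N) mod int d = n + int N"
      using M0 by (intro mod_pos_pos_trivial) (auto simp: d_def)
    moreover have "\<bar>a n\<bar> \<le> C"
      unfolding C_def using n by (intro member_le_sum) auto
    ultimately show ?thesis using n by (auto simp: b_def)
  qed
  have Md: "\<delta> * real M > real (2 * N) * C"
  proof -
    have "real (2 * N) * C / \<delta> < real M" unfolding M_def by linarith
    then show ?thesis using \<delta> by (simp add: field_simps)
  qed
  have "(\<Sum>j<d. b (int j)) > 0"
  proof -
    define c where "c j = (if j < 2 * N then - C else \<delta>)" for j :: nat
    have bc: "b (int j) = c ((j + N) mod d)" for j
      by (simp add: b_def c_def zmod_int[symmetric] flip: of_nat_add)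
    have bij: "bij_betw (\<lambda>j. (j + N) mod d) {..<d} {..<d}"
    proof (rule bij_betwI[where g = "\<lambda>j. (j + (d - N)) mod d"])
      have Nd: "N \<le> d" by (simp add: d_def)
      show "((j + N) mod d + (d - N)) mod d = j" if "j \<in> {..<d}" for j
        using that Nd unfolding mod_add_left_eq by simp
      show "((j + (d - N)) mod d + N) mod d = j" if "j \<in> {..<d}" for j
        using that Nd unfolding mod_add_left_eq by simp
    qed (use d0 in auto)
    have "(\<Sum>j<d. b (int j)) = (\<Sum>j<d. c j)"
      unfolding bc by (rule sum.reindex_bij_betw[OF bij])
    also have "\<dots> = (\<Sum>j\<in>{..<2 * N}. c j) + (\<Sum>j\<in>{2 * N..<d}. c j)"
      by (subst sum.union_disjoint[symmetric]) (auto simp: d_def intro: sum.cong)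
    also have "(\<Sum>j\<in>{..<2 * N}. c j) = - real (2 * N) * C"
      by (simp add: c_def)
    also have "(\<Sum>j\<in>{2 * N..<d}. c j) = real M * \<delta>"
      by (simp add: c_def d_def)
    finally show ?thesis using Md by (simp add: algebra_simps)
  qed
  then obtain m0 where "\<forall>m\<ge>m0. \<forall>n. smooths m b n > 0"
    using smooths_periodic_pos[of d b, OF d0 per] by blast
  then show ?thesis
    using smooths_mono[of b a] le by (metis less_le_trans)
qed

text \<open>The \<open>c i\<close> are the coefficients of (2 + x)^m. The minor of two consecutive
  pairs is a positive factor depending on m and k only, times the coefficient of (2 + x)^(m + 1) at
  i, times i - k. The last factor, linear in the position, is the point of the identity.\<close>

lemma binomial_exchange:
  fixes m i k :: nat
  defines "c \<equiv> \<lambda>i. real (m choose i) * 2 ^ (m - i)"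
  assumes "1 \<le> i" "i \<le> m" "1 \<le> k" "k \<le> m"
  shows "c k * c (i - 1) - c (k - 1) * c i = (real (Suc m choose k) * 2 ^ (m - k) / real (Suc m)) *
    (real (Suc m choose i) * 2 ^ (Suc m - i) * (real i - real k))"
proof -
  have 1: "real (m choose (j - 1)) = real j * real (Suc m choose j) / real (Suc m)" if "1 \<le> j" for j
    using Suc_times_binomial_eq[of m "j - 1"] that
    by (simp add: field_simps flip: of_nat_mult of_nat_Suc)
  have 2: "real (m choose j) = (real (Suc m) - real j) * real (Suc m choose j) / real (Suc m)" if "1 \<le> j" for j
  proof -
    have "Suc m choose j = (m choose (j - 1)) + (m choose j)"
      using that by (cases j) auto
    then have "real (m choose j) = real (Suc m choose j) - real (m choose (j - 1))" by simp
    also have "\<dots> = (real (Suc m) - real j) * real (Suc m choose j) / real (Suc m)"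
      unfolding 1[OF that] by (simp add: field_simps)
    finally show ?thesis .
  qed
  have p: "(2::real) ^ (m - k) * 2 ^ (m - (i - 1)) = 2 ^ (m - k) * 2 ^ (Suc m - i)"
    "(2::real) ^ (m - (k - 1)) * 2 ^ (m - i) = 2 ^ (m - k) * 2 ^ (Suc m - i)"
    using assms by (simp_all add: Suc_diff_le flip: power_add power_Suc)
  have "c k * c (i - 1) - c (k - 1) * c i =
    real (m choose k) * real (m choose (i - 1)) * (2 ^ (m - k) * 2 ^ (m - (i - 1)))
    - real (m choose (k - 1)) * real (m choose i) * (2 ^ (m - (k - 1)) * 2 ^ (m - i))"
    by (simp add: c_def)
  also have "\<dots> = (real (m choose k) * real (m choose (i - 1)) - real (m choose (k - 1)) * real (m choose i))
     * (2 ^ (m - k) * 2 ^ (Suc m - i))"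
    unfolding p by (simp add: algebra_simps)
  also have "real (m choose k) * real (m choose (i - 1)) - real (m choose (k - 1)) * real (m choose i)
     = real (Suc m choose k) * real (Suc m choose i) * (real i - real k) / real (Suc m)"
    unfolding 2[OF assms(4)] 1[OF assms(2)] 1[OF assms(4)] 2[OF assms(2)]
    by (simp add: divide_simps del: of_nat_Suc binomial_Suc_Suc) (simp add: algebra_simps)
  finally show ?thesis by simp
qed

text \<open>The combination of two consecutive smoothed values in the proof is, up to a positive factor,
  the smoothing of \<open>n \<mapsto> n \<cdot> a\<^sub>n\<close>, which has the same sign at both ends.\<close>

lemma smooths_odd:
  fixes a :: "int \<Rightarrow> real"
  assumes \<delta>: "\<delta> > 0" and right: "\<And>n. int N \<le> n \<Longrightarrow> a n \<ge> \<delta>" and left: "\<And>n. n \<le> - int N \<Longrightarrow> a n \<le> - \<delta>"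
  shows "\<exists>m0. \<forall>m\<ge>m0. \<forall>n. smooths m a n \<ge> 0 \<longrightarrow> smooths m a (n + 1) > 0"
proof -
  \<comment> \<open>\<open>u\<close> and \<open>v\<close> agree with a and -a on one half line and
    are \<delta> on the other, so they are positive at both ends; they serve the windows that lie on
    one side of 0.\<close>
  define u where "u n = (if n \<ge> 0 then a n else \<delta>)" for n
  define v where "v n = (if n \<le> 0 then - a n else \<delta>)" for n
  define b where "b n = real_of_int n * a n" for n
  have "\<exists>m0. \<forall>m\<ge>m0. \<forall>n. smooths m u n > 0"
    using right by (intro smooths_even_pos[OF \<delta>, of N]) (auto simp: u_def)
  then obtain m1 where m1: "\<And>m n. m \<ge> m1 \<Longrightarrow> smooths m u n > 0" by blast
  have "\<exists>m0. \<forall>m\<ge>m0. \<forall>n. smooths m v n > 0"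
  proof (rule smooths_even_pos[OF \<delta>])
    fix n assume "int N \<le> \<bar>n\<bar>"
    then show "\<delta> \<le> v n" using left[of n] by (cases "n \<le> 0") (auto simp: v_def)
  qed
  then obtain m2 where m2: "\<And>m n. m \<ge> m2 \<Longrightarrow> smooths m v n > 0" by blast
  have "\<exists>m0. \<forall>m\<ge>m0. \<forall>n. smooths m b n > 0"
  proof (rule smooths_even_pos[OF \<delta>, of "Suc N"])
    fix n assume n: "int (Suc N) \<le> \<bar>n\<bar>"
    show "\<delta> \<le> b n"
    proof (cases "n \<ge> 0")
      case True
      then have "1 * \<delta> \<le> real_of_int n * a n"
        using n \<delta> right[of n] by (intro mult_mono) auto
      then show ?thesis by (simp add: b_def)
    next
      case False
      then have "1 * \<delta> \<le> (- real_of_int n) * (- a n)"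
        using n \<delta> left[of n] by (intro mult_mono) auto
      then show ?thesis by (simp add: b_def)
    qed
  qed
  then obtain m3 where m3: "\<And>m n. m \<ge> m3 \<Longrightarrow> smooths m b n > 0" by blast
  have main: "smooths m a (n + 1) > 0" if m: "m \<ge> m1" "m \<ge> m2" "m \<ge> m3" and ge: "smooths m a n \<ge> 0" for m n
  proof -
    define c where "c i = real (m choose i) * 2 ^ (m - i)" for i
    consider "n + 1 \<ge> 0" | "n + int m \<le> 0" | "n < 0" "n + int m > 0" by linarith
    then show ?thesis
    proof cases
      case 1
      then have "smooths m a (n + 1) = smooths m u (n + 1)"
        unfolding smooths_binomial by (simp add: u_def)
      then show ?thesis using m1[OF m(1)] by simp
    next
      case 2
      then have "smooths m a n = - smooths m v n"
        unfolding smooths_binomial sum_negf[symmetric] by (auto simp: v_def intro!: sum.cong)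
      then show ?thesis using m2[OF m(2), of n] ge by simp
    next
      case 3
      \<comment> \<open>The place in the window where the index n + i is 0, so that i - k = n + i is
        the factor in \<open>b\<close>.\<close>
      define k where "k = nat (- n)"
      have k: "1 \<le> k" "k \<le> m" "n = - int k" using 3 by (auto simp: k_def)
      define \<kappa> where "\<kappa> = real (Suc m choose k) * 2 ^ (m - k) / real (Suc m)"
      define gg where "gg i = real (Suc m choose i) * 2 ^ (Suc m - i) * (real i - real k)" for i
      have \<kappa>: "\<kappa> > 0" using k by (simp add: \<kappa>_def zero_less_binomial del: binomial_Suc_Suc)
      let ?t = "\<lambda>i. a (n + int i)"
      have s1: "smooths m a (n + 1) = (\<Sum>i=1..Suc m. c (i - 1) * ?t i)"
        unfolding smooths_binomial c_def
        by (rule sum.reindex_bij_witness[of _ "\<lambda>i. i - 1" Suc]) (auto simp: algebra_simps)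
      have s0: "smooths m a n = c 0 * ?t 0 + (\<Sum>i=1..m. c i * ?t i)"
      proof -
        have "{..m} = insert 0 {1..m}" by auto
        then show ?thesis unfolding smooths_binomial c_def by simp
      qed
      have s2: "smooths (Suc m) b n =
        (\<Sum>i\<le>Suc m. gg i * ?t i)"
        unfolding smooths_binomial[of "Suc m"] b_def k(3) gg_def by (intro sum.cong) auto
      have split: "(\<Sum>i\<le>Suc m. f i) = f 0 + (\<Sum>i=1..m. f i) + f (Suc m)" for f :: "nat \<Rightarrow> real"
      proof -
        have "{..Suc m} = insert 0 (insert (Suc m) {1..m})" by auto
        then show ?thesis by simp
      qed
      \<comment> \<open>At i = 0 and i = m + 1 only one product of the minor is present; the same
        closed form still holds.\<close>
      have ends: "\<kappa> * gg 0 = - c (k - 1) * c 0"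
        "\<kappa> * gg (Suc m) = c k * c m"
      proof -
        have "real (Suc m) * real (m choose (k - 1)) = real k * real (Suc m choose k)"
          using Suc_times_binomial_eq[of m "k - 1"] k(1)
          by (simp add: mult.commute flip: of_nat_mult of_nat_Suc)
        moreover have "(2::real) ^ (m - (k - 1)) = 2 * 2 ^ (m - k)"
          using k by (simp add: Suc_diff_le flip: power_Suc)
        ultimately show "\<kappa> * gg 0 = - c (k - 1) * c 0"
          unfolding \<kappa>_def c_def gg_def by (simp add: field_simps del: binomial_Suc_Suc of_nat_Suc)
        have "(Suc m - k) * (Suc m choose k) = Suc m * (m choose k)"
          using binomial_absorb_comp[of "Suc m" k] by (simp only: diff_Suc_1)
        then have "real (Suc m - k) * real (Suc m choose k) = real (Suc m) * real (m choose k)"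
          by (metis of_nat_mult)
        then show "\<kappa> * gg (Suc m) = c k * c m"
          unfolding \<kappa>_def c_def gg_def binomial_n_n diff_self_eq_0 power_0 of_nat_1 using k
          by (simp add: field_simps of_nat_diff del: binomial_Suc_Suc of_nat_Suc)
            (metis (no_types) distrib_right mult.assoc)
      qed
      have mid: "(\<Sum>i=1..m. (c k * c (i - 1) - c (k - 1) * c i) * ?t i) = \<kappa> * (\<Sum>i=1..m. gg i * ?t i)"
        unfolding sum_distrib_left
      proof (rule sum.cong[OF refl])
        fix i assume "i \<in> {1..m}"
        then have "c k * c (i - 1) - c (k - 1) * c i = \<kappa> * gg i"
          unfolding c_def \<kappa>_def gg_def using k by (intro binomial_exchange) auto
        then show "(c k * c (i - 1) - c (k - 1) * c i) * ?t i = \<kappa> * (gg i * ?t i)" by simp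
      qed
      have "c k * smooths m a (n + 1) - c (k - 1) * smooths m a n =
          - c (k - 1) * c 0 * ?t 0 + (\<Sum>i=1..m. (c k * c (i - 1) - c (k - 1) * c i) * ?t i) + c k * c m * ?t (Suc m)"
        unfolding s0 s1 by (simp add: sum_distrib_left sum_subtractf algebra_simps)
      also have "\<dots> = \<kappa> * smooths (Suc m) b n"
        unfolding s2 split mid by (simp only: distrib_left mult.assoc[symmetric] ends)
      finally have "c k * smooths m a (n + 1) = c (k - 1) * smooths m a n + \<kappa> * smooths (Suc m) b n"
        by simp
      moreover have "c (k - 1) * smooths m a n \<ge> 0" using ge by (simp add: c_def)
      moreover have "\<kappa> * smooths (Suc m) b n > 0" using \<kappa> m3[of "Suc m" n] m by simp
      ultimately have "c k * smooths m a (n + 1) > 0" by linarith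
      moreover have "c k > 0" using k by (simp add: c_def)
      ultimately show ?thesis by (simp add: zero_less_mult_iff)
    qed
  qed
  show ?thesis
    using main by (intro exI[of _ "max m1 (max m2 m3)"]) auto
qed

section \<open>Generic vectors\<close>

text \<open>In base 3 a sum of two powers has no carry, so it determines its exponents even when
  they coincide.\<close>

lemma three_powers_eq:
  fixes a b c d :: nat
  assumes "(3::nat) ^ a + 3 ^ b = 3 ^ c + 3 ^ d"
  shows "(a = c \<and> b = d) \<or> (a = d \<and> b = c)"
proof -
  have lt: "(3::nat) ^ i + 3 ^ j < 3 ^ k" if "i < k" "j < k" for i j k :: nat
  proof -
    have "3 ^ Suc i \<le> (3::nat) ^ k" "3 ^ Suc j \<le> (3::nat) ^ k"
      using that by (auto intro: power_increasing simp del: power_Suc)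
    moreover have "(3::nat) ^ i > 0" "(3::nat) ^ j > 0" by auto
    ultimately show ?thesis unfolding power_Suc by linarith
  qed
  have max: "max a b = max c d"
  proof (rule ccontr)
    assume "max a b \<noteq> max c d"
    then consider "a < max c d" "b < max c d" | "c < max a b" "d < max a b" by linarith
    then show False
    proof cases
      case 1
      from lt[OF this] show False using assms by (auto simp: max_def split: if_splits)
    next
      case 2
      from lt[OF this] show False using assms by (auto simp: max_def split: if_splits)
    qed
  qed
  then show ?thesis using assms by (auto simp: max_def split: if_splits)
qed

text \<open>On the curve with coordinates x^(3^e) distinct monomials of degree two get distinct
  exponents. Each form becomes a nonzero polynomial in x, and countably many finite root sets cannot
  cover the interval (0, 1).\<close>

lemma generic_vector_exists:
  fixes \<F> :: "('a \<Rightarrow> 'a \<Rightarrow> real) set"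
  assumes fin: "finite S" and cnt: "countable \<F>"
    and nz: "\<And>Q. Q \<in> \<F> \<Longrightarrow> \<exists>t. (\<Sum>r\<in>S. \<Sum>s\<in>S. Q r s * t r * t s) \<noteq> 0"
  shows "\<exists>t. (\<forall>s. t s > 0) \<and> (\<forall>Q\<in>\<F>. (\<Sum>r\<in>S. \<Sum>s\<in>S. Q r s * t r * t s) \<noteq> 0)"
proof -
  obtain e :: "'a \<Rightarrow> nat" where e: "inj_on e S"
    using finite_imp_inj_to_nat_seg[OF fin] by blast
  define P where "P Q = (\<Sum>r\<in>S. \<Sum>s\<in>S. monom (Q r s) (3 ^ e r + 3 ^ e s))" for Q :: "'a \<Rightarrow> 'a \<Rightarrow> real"
  have P_poly: "poly (P Q) x = (\<Sum>r\<in>S. \<Sum>s\<in>S. Q r s * x ^ 3 ^ e r * x ^ 3 ^ e s)" for Q x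
    by (simp add: P_def poly_sum poly_monom power_add mult.assoc)
  have P_nz: "P Q \<noteq> 0" if Q: "Q \<in> \<F>" for Q
  proof
    assume zero: "P Q = 0"
    \<comment> \<open>One exponent collects both orders of a product, so \<open>P Q = 0\<close> only
      says that the coefficients are antisymmetric; the quadratic form then vanishes
      everywhere.\<close>
    have sym: "Q i j + Q j i = 0" if ij: "i \<in> S" "j \<in> S" for i j
    proof -
      have "0 = coeff (P Q) (3 ^ e i + 3 ^ e j)" using zero by simp
      also have "\<dots> = (\<Sum>r\<in>S. \<Sum>s\<in>S. if (r = i \<and> s = j) \<or> (r = j \<and> s = i) then Q r s else 0)"
        unfolding P_def coeff_sum coeff_monom
      proof (intro sum.cong refl)
        fix r s assume rs: "r \<in> S" "s \<in> S"
        have "3 ^ e r + 3 ^ e s = (3::nat) ^ e i + 3 ^ e j \<longleftrightarrow> (r = i \<and> s = j) \<or> (r = j \<and> s = i)"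
          using three_powers_eq[of "e r" "e s" "e i" "e j"] e rs ij by (auto dest: inj_onD)
        then show "(if 3 ^ e r + 3 ^ e s = (3::nat) ^ e i + 3 ^ e j then Q r s else 0)
            = (if r = i \<and> s = j \<or> r = j \<and> s = i then Q r s else 0)" by simp
      qed
      also have "\<dots> = (\<Sum>p\<in>S \<times> S. if p \<in> {(i, j), (j, i)} then Q (fst p) (snd p) else 0)"
        unfolding sum.cartesian_product
        by (rule sum.cong[OF refl]) (simp add: case_prod_unfold prod_eq_iff)
      also have "\<dots> = (\<Sum>p\<in>{(i, j), (j, i)}. Q (fst p) (snd p))"
        using ij fin by (subst sum.inter_restrict[symmetric]) (auto intro!: sum.cong)
      finally show ?thesis by (cases "i = j") auto
    qed
    obtain t where t: "(\<Sum>r\<in>S. \<Sum>s\<in>S. Q r s * t r * t s) \<noteq> 0" using nz[OF Q] by blast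
    have "2 * (\<Sum>r\<in>S. \<Sum>s\<in>S. Q r s * t r * t s)
        = (\<Sum>r\<in>S. \<Sum>s\<in>S. Q r s * t r * t s) + (\<Sum>r\<in>S. \<Sum>s\<in>S. Q s r * t s * t r)"
      by (subst (3) sum.swap) simp
    also have "\<dots> = (\<Sum>r\<in>S. \<Sum>s\<in>S. (Q r s + Q s r) * (t r * t s))"
      by (simp add: sum.distrib algebra_simps)
    also have "\<dots> = 0" by (intro sum.neutral ballI) (simp add: sym)
    finally show False using t by simp
  qed
  have "countable (\<Union>Q\<in>\<F>. {x. poly (P Q) x = 0})"
    by (rule countable_UN[OF cnt]) (auto intro!: countable_finite poly_roots_finite P_nz)
  moreover have "uncountable {0<..<1::real}" by (simp add: uncountable_open_interval)
  ultimately have "\<not> {0<..<1} \<subseteq> (\<Union>Q\<in>\<F>. {x. poly (P Q) x = 0})"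
    using countable_subset by blast
  then obtain x where "x \<in> {0<..<1}" "x \<notin> (\<Union>Q\<in>\<F>. {x. poly (P Q) x = 0})" by blast
  then have x: "x > 0" "\<And>Q. Q \<in> \<F> \<Longrightarrow> poly (P Q) x \<noteq> 0" by auto
  show ?thesis
    by (rule exI[of _ "\<lambda>s. x ^ 3 ^ e s"]) (use x in \<open>auto simp: P_poly\<close>)
qed

context crystallographic_coxeter_system
begin

section \<open>Points of the Tits cone\<close>

definition lin :: "(('a \<Rightarrow> real) \<Rightarrow> real) \<Rightarrow> bool" where
  "lin \<pi> \<longleftrightarrow> (\<forall>a b u v. \<pi> (\<lambda>r. a * u r + b * v r) = a * \<pi> u + b * \<pi> v)"

lemma linD: "lin \<pi> \<Longrightarrow> \<pi> (\<lambda>r. a * u r + b * v r) = a * \<pi> u + b * \<pi> v"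
  by (simp add: lin_def)

lemma lin_scale: "lin \<pi> \<Longrightarrow> \<pi> (\<lambda>r. a * u r) = a * \<pi> u"
  using linD[of \<pi> a u 0 u] by simp

lemma lin_zero: "lin \<pi> \<Longrightarrow> \<pi> (\<lambda>r. 0) = 0"
  using lin_scale[of \<pi> 0] by simp

lemma lin_negv: "lin \<pi> \<Longrightarrow> \<pi> (negv u) = - \<pi> u"
  using lin_scale[of \<pi> "-1" u] by simp

lemma lin_sum: "lin \<pi> \<Longrightarrow> \<pi> (\<lambda>r. \<Sum>i\<in>A. c i * v i r) = (\<Sum>i\<in>A. c i * \<pi> (v i))"
proof (induction A rule: infinite_finite_induct)
  case (insert x F)
  then show ?case using linD[of \<pi> "c x" "v x" 1 "\<lambda>r. \<Sum>i\<in>F. c i * v i r"] by simp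
qed (auto simp: lin_zero)

lemma lin_combine: "\<lbrakk>lin \<pi>; lin \<rho>\<rbrakk> \<Longrightarrow> lin (\<lambda>v. a * \<pi> v + b * \<rho> v)"
  by (simp add: lin_def algebra_simps)

lemma lin_sum_points: "(\<And>i. i \<in> A \<Longrightarrow> lin (\<pi> i)) \<Longrightarrow> lin (\<lambda>v. \<Sum>i\<in>A. \<pi> i v)"
  by (simp add: lin_def sum.distrib sum_distrib_left)

lemma lin_act: "lin \<pi> \<Longrightarrow> lin (\<lambda>v. \<pi> (act w v))"
  by (simp add: lin_def act_linear)

text \<open>The functional with value \<open>t s\<close> on the simple root of s; a positive t gives
  a point of the fundamental chamber.\<close>

definition pt :: "('a \<Rightarrow> real) \<Rightarrow> ('a \<Rightarrow> real) \<Rightarrow> real" where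
  "pt t v = (\<Sum>s\<in>S. v s * t s)"

lemma lin_pt: "lin (pt t)"
  by (simp add: lin_def pt_def sum.distrib sum_distrib_left algebra_simps)

lemma vec_expand:
  assumes "\<And>r. r \<notin> S \<Longrightarrow> v r = 0"
  shows "v = (\<lambda>x. \<Sum>r\<in>S. v r * srt r x)"
proof
  fix x
  have "(\<Sum>r\<in>S. v r * srt r x) = (\<Sum>r\<in>S. if r = x then v x else 0)"
    by (rule sum.cong) (auto simp: srt_def)
  then show "v x = (\<Sum>r\<in>S. v r * srt r x)"
    using assms finite_simple by auto
qed

lemma lin_expand:
  assumes "lin \<pi>" "\<alpha> \<in> roots"
  shows "\<pi> \<alpha> = (\<Sum>s\<in>S. \<alpha> s * \<pi> (srt s))"
proof -
  have "\<alpha> = (\<lambda>x. \<Sum>r\<in>S. \<alpha> r * srt r x)"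
    using root_intvec[OF assms(2)] by (intro vec_expand) (auto simp: intvec_def)
  then have "\<pi> \<alpha> = \<pi> (\<lambda>x. \<Sum>r\<in>S. \<alpha> r * srt r x)" by (rule arg_cong)
  then show ?thesis by (simp add: lin_sum assms)
qed

lemma root_support: "\<alpha> \<in> roots \<Longrightarrow> nonneg \<alpha> \<Longrightarrow> \<exists>s\<in>S. \<alpha> s \<ge> 1"
proof -
  assume a: "\<alpha> \<in> roots" "nonneg \<alpha>"
  then obtain r where r: "\<alpha> r \<noteq> 0" using root_nonzero by blast
  have int: "\<alpha> r \<in> \<int>" "r \<in> S" using root_intvec[OF a(1)] r by (auto simp: intvec_def)
  moreover have "\<alpha> r > 0" using a(2) r by (auto simp: nonneg_def less_le)
  ultimately show ?thesis by (auto elim!: Ints_cases intro!: bexI[of _ r])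
qed

text \<open>Points are linear functionals on the root space, and \<pi> is required to lie in the
  open chamber of x in the Tits cone: it is positive on the images under x of the positive
  roots.\<close>

definition inch :: "'a \<Rightarrow> (('a \<Rightarrow> real) \<Rightarrow> real) \<Rightarrow> bool" where
  "inch x \<pi> \<longleftrightarrow> x \<in> carrier W \<and> lin \<pi> \<and> (\<forall>\<alpha>\<in>roots. nonneg (act (inv x) \<alpha>) \<longrightarrow> \<pi> \<alpha> > 0)"

lemma inchD:
  assumes "inch x \<pi>"
  shows "x \<in> carrier W" "lin \<pi>" "\<And>\<alpha>. \<lbrakk>\<alpha> \<in> roots; nonneg (act (inv x) \<alpha>)\<rbrakk> \<Longrightarrow> \<pi> \<alpha> > 0"
  using assms by (auto simp: inch_def)

lemma inch_neg: "\<lbrakk>inch x \<pi>; \<alpha> \<in> roots; \<not> nonneg (act (inv x) \<alpha>)\<rbrakk> \<Longrightarrow> \<pi> \<alpha> < 0"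
proof -
  assume a: "inch x \<pi>" "\<alpha> \<in> roots" "\<not> nonneg (act (inv x) \<alpha>)"
  then have "nonneg (act (inv x) (negv \<alpha>))"
    using root_sign[of "act (inv x) \<alpha>"] inchD(1)[OF a(1)] by (auto simp: act_uminus)
  then have "\<pi> (negv \<alpha>) > 0" using a by (intro inchD(3)[OF a(1)]) auto
  then show ?thesis by (simp add: lin_negv[OF inchD(2)[OF a(1)]])
qed

lemma inch_pos_iff: "\<lbrakk>inch x \<pi>; \<alpha> \<in> roots\<rbrakk> \<Longrightarrow> \<pi> \<alpha> > 0 \<longleftrightarrow> nonneg (act (inv x) \<alpha>)"
  using inchD(3)[of x \<pi> \<alpha>] inch_neg[of x \<pi> \<alpha>] by fastforce

lemma inch_neg_iff: "\<lbrakk>inch x \<pi>; \<alpha> \<in> roots\<rbrakk> \<Longrightarrow> \<pi> \<alpha> < 0 \<longleftrightarrow> \<not> nonneg (act (inv x) \<alpha>)"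
  using inchD(3)[of x \<pi> \<alpha>] inch_neg[of x \<pi> \<alpha>] by fastforce

lemma inch_nonzero: "\<lbrakk>inch x \<pi>; \<alpha> \<in> roots\<rbrakk> \<Longrightarrow> \<pi> \<alpha> \<noteq> 0"
  using inchD(3)[of x \<pi> \<alpha>] inch_neg[of x \<pi> \<alpha>] by fastforce

lemma pt_ge:
  assumes "\<alpha> \<in> roots" "nonneg \<alpha>" "\<And>s. s \<in> S \<Longrightarrow> t s \<ge> \<delta>" "\<delta> > 0"
  shows "pt t \<alpha> \<ge> \<delta>"
proof -
  obtain s where s: "s \<in> S" "\<alpha> s \<ge> 1" using root_support assms by blast
  have nn: "\<alpha> r * t r \<ge> 0" if "r \<in> S" for r
    using assms(2) assms(3)[OF that] assms(4) by (auto simp: nonneg_def)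
  have "1 * \<delta> \<le> \<alpha> s * t s" using s assms(3)[OF s(1)] assms(4) by (intro mult_mono) auto
  also have "\<dots> \<le> pt t \<alpha>"
    unfolding pt_def using s nn finite_simple by (intro member_le_sum) auto
  finally show ?thesis by simp
qed

text \<open>Integral coordinates give one lower bound for all positive roots. Smoothing along
  infinite orbits needs such uniformity.\<close>

lemma pt_delta:
  assumes "\<And>s. t s > 0"
  obtains \<delta> where "\<delta> > 0" "\<And>\<alpha>. \<lbrakk>\<alpha> \<in> roots; nonneg \<alpha>\<rbrakk> \<Longrightarrow> pt t \<alpha> \<ge> \<delta>"
proof -
  define \<delta> where "\<delta> = Min (insert 1 (t ` S))"
  have "\<delta> > 0" using finite_simple assms by (simp add: \<delta>_def)
  moreover have "t s \<ge> \<delta>" if "s \<in> S" for s using that finite_simple by (simp add: \<delta>_def)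
  ultimately show ?thesis using that[of \<delta>] pt_ge[where t = t and \<delta> = \<delta>] by blast
qed

lemma inch_base:
  assumes "x \<in> carrier W" "\<And>s. t s > 0"
  shows "inch x (\<lambda>v. pt t (act (inv x) v))"
proof -
  obtain \<delta> where \<delta>: "\<delta> > 0" "\<And>\<alpha>. \<lbrakk>\<alpha> \<in> roots; nonneg \<alpha>\<rbrakk> \<Longrightarrow> pt t \<alpha> \<ge> \<delta>"
    using pt_delta[of t, OF assms(2)] by blast
  show ?thesis
    unfolding inch_def
  proof (intro conjI ballI impI)
    fix \<alpha> assume "\<alpha> \<in> roots" "nonneg (act (inv x) \<alpha>)"
    then have "pt t (act (inv x) \<alpha>) \<ge> \<delta>" using assms(1) by (intro \<delta>(2)) auto
    then show "pt t (act (inv x) \<alpha>) > 0" using \<delta>(1) by linarith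
  qed (use assms lin_act[OF lin_pt] in auto)
qed

lemma inch_unique:
  assumes "inch x \<pi>" "inch y \<pi>"
  shows "x = y"
proof -
  have xy: "x \<in> carrier W" "y \<in> carrier W" using assms inchD by auto
  have "inv y \<otimes> x = \<one>"
  proof (rule act_faithful)
    fix \<alpha> assume a: "\<alpha> \<in> roots" "nonneg \<alpha>"
    then have "\<pi> (act x \<alpha>) > 0" using assms(1) xy by (intro inchD(3)[of x]) auto
    then show "nonneg (act (inv y \<otimes> x) \<alpha>)"
      using inch_pos_iff[OF assms(2), of "act x \<alpha>"] a xy by (auto simp: act_mult)
  qed (use xy in auto)
  then show ?thesis using xy by (metis inv_closed inv_equality inv_inv)
qed

definition sep :: "(('a \<Rightarrow> real) \<Rightarrow> real) \<Rightarrow> (('a \<Rightarrow> real) \<Rightarrow> real) \<Rightarrow> ('a \<Rightarrow> real) set" where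
  "sep \<pi> \<rho> = {\<alpha> \<in> roots. \<pi> \<alpha> > 0 \<and> \<rho> \<alpha> < 0}"

text \<open>Transport by x turns the inversions of \<open>inv y \<otimes> x\<close> into the roots
  that separate the two chambers.\<close>

lemma sep_card:
  assumes "inch x \<pi>" "inch y \<rho>"
  shows "finite (sep \<pi> \<rho>)" "card (sep \<pi> \<rho>) = len (inv x \<otimes> y)"
proof -
  have xy: "x \<in> carrier W" "y \<in> carrier W" using assms inchD by auto
  have eq: "sep \<pi> \<rho> = act x ` inversions (inv y \<otimes> x)"
  proof (intro equalityI subsetI)
    fix \<alpha> assume "\<alpha> \<in> sep \<pi> \<rho>"
    then have "act (inv x) \<alpha> \<in> inversions (inv y \<otimes> x)" "\<alpha> = act x (act (inv x) \<alpha>)"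
      using xy inch_pos_iff[OF assms(1)] inch_neg_iff[OF assms(2)]
      by (auto simp: sep_def inversions_def act_mult)
    then show "\<alpha> \<in> act x ` inversions (inv y \<otimes> x)" by blast
  next
    fix \<alpha> assume "\<alpha> \<in> act x ` inversions (inv y \<otimes> x)"
    then show "\<alpha> \<in> sep \<pi> \<rho>"
      using xy by (auto simp: sep_def inversions_def act_mult act_root_iff
          inch_pos_iff[OF assms(1)] inch_neg_iff[OF assms(2)])
  qed
  have inj: "inj_on (act x) A" for A
    using xy by (intro inj_onI) (metis act_inv_act(1))
  have fin: "finite (inversions (inv y \<otimes> x))" "card (inversions (inv y \<otimes> x)) = len (inv y \<otimes> x)"
    using inversions_card[of "inv y \<otimes> x"] xy by auto
  have "len (inv y \<otimes> x) = len (inv x \<otimes> y)"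
    using len_inv[of "inv x \<otimes> y"] xy by (simp add: inv_mult_group)
  then show "finite (sep \<pi> \<rho>)" "card (sep \<pi> \<rho>) = len (inv x \<otimes> y)"
    using fin inj by (auto simp: eq card_image)
qed

text \<open>Descent on the number of positive roots negative at \<pi>. Reflecting in a simple root
  that is negative at \<pi> permutes the other positive roots and removes this one, so the number
  drops; when no simple root is negative, \<pi> is in the fundamental chamber.\<close>

lemma chamber_exists:
  assumes "lin \<pi>" "\<And>\<alpha>. \<alpha> \<in> roots \<Longrightarrow> \<pi> \<alpha> \<noteq> 0" "finite {\<alpha> \<in> roots. nonneg \<alpha> \<and> \<pi> \<alpha> < 0}"
  shows "\<exists>x. inch x \<pi>"
  using assms
proof (induction "card {\<alpha> \<in> roots. nonneg \<alpha> \<and> \<pi> \<alpha> < 0}" arbitrary: \<pi> rule: less_induct)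
  case less
  show ?case
  proof (cases "\<exists>s\<in>S. \<pi> (srt s) < 0")
    case False
    have "\<pi> \<alpha> > 0" if "\<alpha> \<in> roots" "nonneg \<alpha>" for \<alpha>
    proof -
      have "\<pi> \<alpha> \<ge> 0"
        unfolding lin_expand[OF less.prems(1) that(1)]
        using that(2) False by (intro sum_nonneg) (auto simp: nonneg_def not_less)
      then show ?thesis using less.prems(2)[OF that(1)] by simp
    qed
    then have "inch \<one> \<pi>" using less.prems by (auto simp: inch_def)
    then show ?thesis by blast
  next
    case True
    then obtain s where s: "s \<in> S" "\<pi> (srt s) < 0" by blast
    define \<pi>' where "\<pi>' = (\<lambda>v. \<pi> (refl s v))"
    have lin': "lin \<pi>'"
      using lin_act[OF less.prems(1), of s] s by (simp add: \<pi>'_def act_simple)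
    have inj: "inj_on (refl s) A" for A
      using refl_self[OF s(1) s(1)] by (intro inj_onI) metis
    have sub: "refl s ` {\<alpha> \<in> roots. nonneg \<alpha> \<and> \<pi>' \<alpha> < 0} \<subset> {\<alpha> \<in> roots. nonneg \<alpha> \<and> \<pi> \<alpha> < 0}"
    proof
      show "refl s ` {\<alpha> \<in> roots. nonneg \<alpha> \<and> \<pi>' \<alpha> < 0} \<subseteq> {\<alpha> \<in> roots. nonneg \<alpha> \<and> \<pi> \<alpha> < 0}"
      proof clarsimp
        fix \<alpha> assume a: "\<alpha> \<in> roots" "nonneg \<alpha>" "\<pi>' \<alpha> < 0"
        have "\<pi>' (srt s) > 0" using s by (simp add: \<pi>'_def lin_negv[OF less.prems(1)])
        then have "\<alpha> \<noteq> srt s" using a by auto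
        then show "refl s \<alpha> \<in> roots \<and> nonneg (refl s \<alpha>) \<and> \<pi> (refl s \<alpha>) < 0"
          using a s refl_nonneg refl_root by (auto simp: \<pi>'_def)
      qed
      have "srt s \<notin> refl s ` {\<alpha> \<in> roots. nonneg \<alpha> \<and> \<pi>' \<alpha> < 0}"
      proof
        assume "srt s \<in> refl s ` {\<alpha> \<in> roots. nonneg \<alpha> \<and> \<pi>' \<alpha> < 0}"
        then obtain \<alpha> where a: "nonneg \<alpha>" "srt s = refl s \<alpha>" by blast
        have "\<alpha> = refl s (refl s \<alpha>)" using refl_self[OF s(1) s(1)] by simp
        also have "\<dots> = negv (srt s)" using a(2)[symmetric] s by simp
        finally show False using a(1) by (auto simp: nonneg_def dest: spec[of _ s])
      qed
      then show "refl s ` {\<alpha> \<in> roots. nonneg \<alpha> \<and> \<pi>' \<alpha> < 0} \<noteq> {\<alpha> \<in> roots. nonneg \<alpha> \<and> \<pi> \<alpha> < 0}"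
        using s by auto
    qed
    have fin': "finite {\<alpha> \<in> roots. nonneg \<alpha> \<and> \<pi>' \<alpha> < 0}"
      using finite_subset[OF psubset_imp_subset[OF sub] less.prems(3)] finite_imageD[OF _ inj] by blast
    have "card {\<alpha> \<in> roots. nonneg \<alpha> \<and> \<pi>' \<alpha> < 0} < card {\<alpha> \<in> roots. nonneg \<alpha> \<and> \<pi> \<alpha> < 0}"
      using psubset_card_mono[OF less.prems(3) sub] card_image[OF inj] by metis
    then obtain x where x: "inch x \<pi>'"
      using less.hyps[of \<pi>'] lin' fin' less.prems(2) refl_root s by (auto simp: \<pi>'_def)
    have "inch (s \<otimes> x) \<pi>"
    proof -
      have "\<pi> \<alpha> > 0" if "\<alpha> \<in> roots" "nonneg (act (inv (s \<otimes> x)) \<alpha>)" for \<alpha>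
      proof -
        have "\<pi>' (refl s \<alpha>) > 0"
          using that x inchD(1)[OF x] s refl_root
          by (intro inchD(3)[OF x]) (auto simp: inv_mult_group act_mult act_simple)
        then show ?thesis using refl_self[OF s(1) s(1)] by (simp add: \<pi>'_def)
      qed
      then show ?thesis using less.prems inchD[OF x] s by (auto simp: inch_def)
    qed
    then show ?thesis by blast
  qed
qed

lemma inch_finite_neg: "inch x \<pi> \<Longrightarrow> finite {\<alpha> \<in> roots. nonneg \<alpha> \<and> \<pi> \<alpha> < 0}"
proof -
  assume x: "inch x \<pi>"
  have one: "inch \<one> (pt (\<lambda>_. 1))" using inch_base[of "\<one>" "\<lambda>_. 1"] by simp
  show ?thesis
    by (rule finite_subset[OF _ sep_card(1)[OF one x]]) (auto simp: sep_def inch_pos_iff[OF one])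
qed

text \<open>Convexity of the Tits cone: a root negative on the combination is negative at one of the
  two points.\<close>

lemma inch_combine:
  assumes "inch x \<pi>" "inch y \<rho>" "a \<ge> 0" "b \<ge> 0"
    and nz: "\<And>\<alpha>. \<alpha> \<in> roots \<Longrightarrow> a * \<pi> \<alpha> + b * \<rho> \<alpha> \<noteq> 0"
  shows "\<exists>z. inch z (\<lambda>v. a * \<pi> v + b * \<rho> v)"
proof (rule chamber_exists)
  have "{\<alpha> \<in> roots. nonneg \<alpha> \<and> a * \<pi> \<alpha> + b * \<rho> \<alpha> < 0} \<subseteq>
    {\<alpha> \<in> roots. nonneg \<alpha> \<and> \<pi> \<alpha> < 0} \<union> {\<alpha> \<in> roots. nonneg \<alpha> \<and> \<rho> \<alpha> < 0}"
  proof
    fix \<alpha> assume *: "\<alpha> \<in> {\<alpha> \<in> roots. nonneg \<alpha> \<and> a * \<pi> \<alpha> + b * \<rho> \<alpha> < 0}"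
    have "\<pi> \<alpha> < 0 \<or> \<rho> \<alpha> < 0"
    proof (rule ccontr)
      assume "\<not> (\<pi> \<alpha> < 0 \<or> \<rho> \<alpha> < 0)"
      then have "a * \<pi> \<alpha> \<ge> 0" "b * \<rho> \<alpha> \<ge> 0" using assms(3,4) by auto
      then show False using * by simp
    qed
    then show "\<alpha> \<in> {\<alpha> \<in> roots. nonneg \<alpha> \<and> \<pi> \<alpha> < 0} \<union> {\<alpha> \<in> roots. nonneg \<alpha> \<and> \<rho> \<alpha> < 0}"
      using * by blast
  qed
  then show "finite {\<alpha> \<in> roots. nonneg \<alpha> \<and> a * \<pi> \<alpha> + b * \<rho> \<alpha> < 0}"
    by (rule finite_subset) (simp add: inch_finite_neg[OF assms(1)] inch_finite_neg[OF assms(2)])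
  show "lin (\<lambda>v. a * \<pi> v + b * \<rho> v)"
    by (rule lin_combine[OF inchD(2)[OF assms(1)] inchD(2)[OF assms(2)]])
qed (rule nz)

text \<open>No root that separates \<pi> from \<rho> is crossed back on the way to \<sigma>, so the
  roots separating \<pi> from \<sigma> form the disjoint union of the two other separating
  sets.\<close>

lemma inch_additive:
  assumes "inch x \<pi>" "inch y \<rho>" "inch z \<sigma>"
    and no: "\<And>\<alpha>. \<lbrakk>\<alpha> \<in> roots; \<pi> \<alpha> > 0; \<rho> \<alpha> < 0\<rbrakk> \<Longrightarrow> \<sigma> \<alpha> < 0"
  shows "len (inv x \<otimes> z) = len (inv x \<otimes> y) + len (inv y \<otimes> z)"
proof -
  have "\<pi> \<alpha> > 0" if a: "\<alpha> \<in> roots" "\<rho> \<alpha> > 0" "\<sigma> \<alpha> < 0" for \<alpha>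
  proof (rule ccontr)
    assume "\<not> \<pi> \<alpha> > 0"
    then have "\<pi> (negv \<alpha>) > 0"
      using inch_nonzero[OF assms(1) a(1)] by (simp add: lin_negv[OF inchD(2)[OF assms(1)]])
    moreover have "\<rho> (negv \<alpha>) < 0" using a by (simp add: lin_negv[OF inchD(2)[OF assms(2)]])
    ultimately have "\<sigma> (negv \<alpha>) < 0" using no a by blast
    then show False using a by (simp add: lin_negv[OF inchD(2)[OF assms(3)]])
  qed
  moreover have "\<rho> \<alpha> > 0 \<or> \<rho> \<alpha> < 0" if "\<alpha> \<in> roots" for \<alpha>
    using inch_nonzero[OF assms(2) that] by linarith
  ultimately have eq: "sep \<pi> \<sigma> = sep \<pi> \<rho> \<union> sep \<rho> \<sigma>"
    using no by (auto simp: sep_def)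
  have "sep \<pi> \<rho> \<inter> sep \<rho> \<sigma> = {}" by (auto simp: sep_def)
  then show ?thesis
    using sep_card[OF assms(1,3)] sep_card[OF assms(1,2)] sep_card[OF assms(2,3)]
    unfolding eq by (metis card_Un_disjoint)
qed

subsection \<open>Galleries along generic segments\<close>

definition crosses :: "(('a \<Rightarrow> real) \<Rightarrow> real) \<Rightarrow> 'a \<Rightarrow> 'a \<Rightarrow> bool" where
  "crosses \<rho> z s \<longleftrightarrow> z \<in> carrier W \<and> s \<in> S \<and> lin \<rho> \<and> \<rho> (act z (srt s)) = 0 \<and>
    (\<forall>\<beta>\<in>roots. \<beta> \<noteq> act z (srt s) \<longrightarrow> nonneg (act (inv z) \<beta>) \<longrightarrow> \<rho> \<beta> > 0)"

text \<open>Positive combinations rather than convex ones: rescaling changes no sign, and replacing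
  one end by a combination stays inside.\<close>

definition between where
  "between \<pi> \<rho> \<sigma> \<longleftrightarrow> (\<exists>a>0. \<exists>b>0. \<sigma> = (\<lambda>v::'a \<Rightarrow> real. a * \<pi> v + b * \<rho> v :: real))"

text \<open>Besides the crossing point on a panel, a step records a point of the segment inside the
  new chamber, so that estimates for points of the segment apply to each chamber of the
  gallery.\<close>

definition gallery_step where
  "gallery_step \<pi> \<rho> z z' \<longleftrightarrow> (\<exists>s. z' = z \<otimes> s \<and> (\<exists>\<sigma>. between \<pi> \<rho> \<sigma> \<and> crosses \<sigma> z s) \<and>
    (\<exists>\<tau>. between \<pi> \<rho> \<tau> \<and> inch z' \<tau>))"

text \<open>Along \<pi> + t \<rho> a separating root \<alpha> vanishes at t = \<pi> \<alpha> / (-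
  \<rho> \<alpha>). Genericity makes these times distinct, so the walls are met one at a time, and
  the induction restarts just behind the earliest one.\<close>

lemma gallery:
  assumes "inch x \<pi>" "inch y \<rho>"
    and gen: "\<And>\<alpha> \<beta>. \<lbrakk>\<alpha> \<in> sep \<pi> \<rho>; \<beta> \<in> sep \<pi> \<rho>; \<alpha> \<noteq> \<beta>\<rbrakk> \<Longrightarrow> \<pi> \<alpha> * \<rho> \<beta> \<noteq> \<pi> \<beta> * \<rho> \<alpha>"
  shows "(gallery_step \<pi> \<rho>)\<^sup>*\<^sup>* x y"
  using assms(1) gen
proof (induction "card (sep \<pi> \<rho>)" arbitrary: x \<pi> rule: less_induct)
  case less
  note x = less.prems(1)
  have xc: "x \<in> carrier W" using inchD[OF x] by simp
  have fin: "finite (sep \<pi> \<rho>)" using sep_card x assms(2) by blast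
  have lin: "lin \<pi>" "lin \<rho>" using inchD x assms(2) by auto
  show ?case
  proof (cases "sep \<pi> \<rho> = {}")
    case True
    have "inch x \<rho>"
      unfolding inch_def
    proof (intro conjI ballI impI)
      fix \<alpha> assume a: "\<alpha> \<in> roots" "nonneg (act (inv x) \<alpha>)"
      then have "\<pi> \<alpha> > 0" using inchD(3)[OF x] by blast
      then have "\<not> \<rho> \<alpha> < 0" using True a by (auto simp: sep_def)
      then show "\<rho> \<alpha> > 0" using inch_nonzero[OF assms(2) a(1)] by simp
    qed (use xc lin in auto)
    then have "x = y" using inch_unique assms(2) by blast
    then show ?thesis by simp
  next
    case False
    define t where "t \<alpha> = \<pi> \<alpha> / (- \<rho> \<alpha>)" for \<alpha>
    have t_pos: "t \<alpha> > 0" if "\<alpha> \<in> sep \<pi> \<rho>" for \<alpha>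
      using that by (auto simp: sep_def t_def divide_pos_neg)
    have "Min (t ` sep \<pi> \<rho>) \<in> t ` sep \<pi> \<rho>"
      using fin False by (intro Min_in) auto
    then obtain \<alpha> where \<alpha>: "\<alpha> \<in> sep \<pi> \<rho>" "t \<alpha> = Min (t ` sep \<pi> \<rho>)" by (metis imageE)
    have t_less: "t \<alpha> < t \<beta>" if b: "\<beta> \<in> sep \<pi> \<rho>" "\<beta> \<noteq> \<alpha>" for \<beta>
    proof -
      have "t \<alpha> \<le> t \<beta>" using \<alpha> b fin by simp
      moreover have "t \<alpha> \<noteq> t \<beta>"
        using less.prems(2)[OF \<alpha>(1) b(1)] b \<alpha> by (auto simp: t_def sep_def field_simps)
      ultimately show ?thesis by simp
    qed
    obtain c where c: "t \<alpha> < c" "\<And>\<beta>. \<beta> \<in> sep \<pi> \<rho> \<Longrightarrow> \<beta> \<noteq> \<alpha> \<Longrightarrow> c < t \<beta>"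
    proof -
      let ?m = "Min (insert (t \<alpha> + 1) (t ` (sep \<pi> \<rho> - {\<alpha>})))"
      have "t \<alpha> < ?m" using fin t_less by simp
      then obtain c where "t \<alpha> < c" "c < ?m" using dense by blast
      then show thesis using that[of c] fin by simp
    qed
    have pos: "\<pi> \<beta> + e * \<rho> \<beta> > 0"
      if b: "\<beta> \<in> roots" "\<pi> \<beta> > 0" "\<beta> \<noteq> \<alpha>" and e: "e > 0" "e \<le> c" for \<beta> e
    proof (cases "\<rho> \<beta> < 0")
      case True
      then have bs: "\<beta> \<in> sep \<pi> \<rho>" using b by (simp add: sep_def)
      then have "e < t \<beta>" using c(2) b(3) e by force
      then show ?thesis using True by (simp add: t_def field_simps)
    next
      case False
      then show ?thesis using b e by (simp add: add_pos_nonneg)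
    qed
    have \<alpha>0: "\<pi> \<alpha> + t \<alpha> * \<rho> \<alpha> = 0" "\<pi> \<alpha> + c * \<rho> \<alpha> < 0"
    proof -
      have "\<rho> \<alpha> < 0" using \<alpha> by (simp add: sep_def)
      then show "\<pi> \<alpha> + t \<alpha> * \<rho> \<alpha> = 0" by (simp add: t_def)
      then show "\<pi> \<alpha> + c * \<rho> \<alpha> < 0"
        using mult_strict_right_mono_neg[OF c(1) \<open>\<rho> \<alpha> < 0\<close>] by linarith
    qed
    define \<sigma> where "\<sigma> = (\<lambda>v. 1 * \<pi> v + t \<alpha> * \<rho> v)"
    define \<pi>' where "\<pi>' = (\<lambda>v. 1 * \<pi> v + c * \<rho> v)"
    have lin': "lin \<sigma>" "lin \<pi>'" unfolding \<sigma>_def \<pi>'_def by (rule lin_combine[OF lin])+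
    have \<alpha>r: "\<alpha> \<in> roots" "\<pi> \<alpha> > 0" using \<alpha> by (auto simp: sep_def)
    \<comment> \<open>The earliest wall bounds the chamber: otherwise \<sigma> would be positive on
      all simple roots of x, hence on \<alpha>, a nonnegative combination of them.\<close>
    have "\<exists>s\<in>S. act (inv x) \<alpha> = srt s"
    proof (rule ccontr)
      assume no: "\<not> (\<exists>s\<in>S. act (inv x) \<alpha> = srt s)"
      let ?b = "act (inv x) \<alpha>"
      have b: "?b \<in> roots" "nonneg ?b" using \<alpha>r xc inch_pos_iff[OF x] by auto
      have p: "\<sigma> (act x (srt s)) > 0" if "s \<in> S" for s
      proof -
        have "act x (srt s) \<noteq> \<alpha>" using no that xc by auto
        moreover have "\<pi> (act x (srt s)) > 0" using that xc by (intro inchD(3)[OF x]) auto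
        ultimately show ?thesis
          using pos[of "act x (srt s)" "t \<alpha>"] that xc c t_pos[OF \<alpha>(1)] by (auto simp: \<sigma>_def)
      qed
      obtain s where s: "s \<in> S" "?b s \<ge> 1" using root_support[OF b] by blast
      have "\<sigma> \<alpha> = (\<lambda>v. \<sigma> (act x v)) ?b" using xc by simp
      also have "\<dots> = (\<Sum>s\<in>S. ?b s * \<sigma> (act x (srt s)))"
        by (rule lin_expand[OF lin_act[OF lin'(1)] b(1)])
      also have "\<dots> > 0"
        using s p b(2) finite_simple by (intro sum_pos2[of _ s]) (auto simp: nonneg_def less_imp_le)
      finally show False using \<alpha>0 by (simp add: \<sigma>_def)
    qed
    then obtain s where s: "s \<in> S" "act (inv x) \<alpha> = srt s" by blast
    have \<alpha>s: "\<alpha> = act x (srt s)" using s(2) xc by (metis act_inv_act(2))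
    have cr: "crosses \<sigma> x s"
      unfolding crosses_def
      using pos[of _ "t \<alpha>"] t_pos[OF \<alpha>(1)] c(1) \<alpha>0 lin' s xc inch_pos_iff[OF x] \<alpha>s
      by (auto simp: \<sigma>_def)
    have x': "inch (x \<otimes> s) \<pi>'"
      unfolding inch_def
    proof (intro conjI ballI impI)
      fix \<beta> assume b: "\<beta> \<in> roots" "nonneg (act (inv (x \<otimes> s)) \<beta>)"
      define \<gamma> where "\<gamma> = act (inv x) \<beta>"
      have \<gamma>: "\<gamma> \<in> roots" "nonneg (refl s \<gamma>)" "\<beta> = act x \<gamma>"
        using b xc s by (auto simp: \<gamma>_def inv_mult_group act_mult act_simple)
      show "\<pi>' \<beta> > 0"
      proof (cases "refl s \<gamma> = srt s")
        case True
        then have "\<gamma> = negv (srt s)" using refl_self[OF s(1) s(1), of \<gamma>] s by (metis refl_srt)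
        then have "\<beta> = negv \<alpha>" using \<gamma>(3) \<alpha>s by (simp add: act_uminus)
        then show ?thesis using lin_negv[OF lin'(2), of \<alpha>] \<alpha>0 by (simp add: \<pi>'_def)
      next
        case False
        then have "nonneg \<gamma>"
          using refl_nonneg[of "refl s \<gamma>" s] refl_root \<gamma> s refl_self[OF s(1) s(1), of \<gamma>] by metis
        moreover have "\<beta> \<noteq> \<alpha>"
        proof
          assume "\<beta> = \<alpha>"
          then have "\<gamma> = srt s" using \<gamma>_def s by simp
          then show False using \<gamma>(2) s by (auto simp: nonneg_def dest: spec[of _ s])
        qed
        ultimately show ?thesis
          using pos[of \<beta> c] b c(1) t_pos[OF \<alpha>(1)] inch_pos_iff[OF x b(1)] by (auto simp: \<pi>'_def \<gamma>_def)
      qed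
    qed (use xc s lin' in auto)
    have sub: "sep \<pi>' \<rho> \<subseteq> sep \<pi> \<rho> - {\<alpha>}"
    proof
      fix \<beta> assume "\<beta> \<in> sep \<pi>' \<rho>"
      then have b: "\<beta> \<in> roots" "\<pi> \<beta> + c * \<rho> \<beta> > 0" "\<rho> \<beta> < 0" by (auto simp: sep_def \<pi>'_def)
      have "c > 0" using c(1) t_pos[OF \<alpha>(1)] by simp
      then have "c * \<rho> \<beta> < 0" using b by (simp add: mult_pos_neg)
      then show "\<beta> \<in> sep \<pi> \<rho> - {\<alpha>}" using b \<alpha>0 by (auto simp: sep_def)
    qed
    then have "card (sep \<pi>' \<rho>) < card (sep \<pi> \<rho>)"
      using \<alpha>(1) fin by (intro psubset_card_mono) auto
    moreover have "\<pi>' \<beta> * \<rho> \<gamma> \<noteq> \<pi>' \<gamma> * \<rho> \<beta>"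
      if "\<beta> \<in> sep \<pi>' \<rho>" "\<gamma> \<in> sep \<pi>' \<rho>" "\<beta> \<noteq> \<gamma>" for \<beta> \<gamma>
      using less.prems(2)[of \<beta> \<gamma>] that sub by (auto simp: \<pi>'_def algebra_simps)
    ultimately have "(gallery_step \<pi>' \<rho>)\<^sup>*\<^sup>* (x \<otimes> s) y"
      using less.hyps[OF _ x'] by blast
    moreover have btw: "between \<pi> \<rho> \<tau>" if "between \<pi>' \<rho> \<tau>" for \<tau>
    proof -
      from that obtain a b where ab: "a > 0" "b > 0" "\<tau> = (\<lambda>v. a * \<pi>' v + b * \<rho> v)"
        unfolding between_def by blast
      have "a * c + b > 0" using ab c t_pos[OF \<alpha>(1)] by (simp add: add_pos_pos)
      then show ?thesis
        unfolding between_def using ab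
        by (intro exI[of _ a] conjI exI[of _ "a * c + b"]) (auto simp: \<pi>'_def algebra_simps)
    qed
    then have "gallery_step \<pi>' \<rho> \<le> gallery_step \<pi> \<rho>"
      unfolding gallery_step_def by blast
    ultimately have path: "(gallery_step \<pi> \<rho>)\<^sup>*\<^sup>* (x \<otimes> s) y"
      using rtranclp_mono by blast
    have "between \<pi> \<rho> \<sigma>"
      unfolding between_def \<sigma>_def using t_pos[OF \<alpha>(1)]
      by (intro exI[of _ 1] conjI exI[of _ "t \<alpha>"]) auto
    moreover have "between \<pi> \<rho> \<pi>'"
      unfolding between_def \<pi>'_def using t_pos[OF \<alpha>(1)] c(1)
      by (intro exI[of _ 1] conjI exI[of _ c]) auto
    ultimately have "gallery_step \<pi> \<rho> x (x \<otimes> s)"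
      unfolding gallery_step_def using cr x' by blast
    then show ?thesis using path by (rule converse_rtranclp_into_rtranclp)
  qed
qed

section \<open>Conjugation steps\<close>

definition cj :: "'a \<Rightarrow> 'a \<Rightarrow> 'a" where
  "cj x w = inv x \<otimes> w \<otimes> x"

lemma cj_closed [simp, intro]: "\<lbrakk>x \<in> carrier W; w \<in> carrier W\<rbrakk> \<Longrightarrow> cj x w \<in> carrier W"
  by (simp add: cj_def)

lemma cj_one [simp]: "w \<in> carrier W \<Longrightarrow> cj \<one> w = w"
  by (simp add: cj_def)

lemma cj_mult: "\<lbrakk>x \<in> carrier W; y \<in> carrier W; w \<in> carrier W\<rbrakk> \<Longrightarrow> cj (x \<otimes> y) w = cj y (cj x w)"
  by (simp add: cj_def inv_mult_group m_assoc)

lemma cj_simple: "\<lbrakk>s \<in> S; v \<in> carrier W\<rbrakk> \<Longrightarrow> cj s v = s \<otimes> v \<otimes> s"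
  by (simp add: cj_def)

definition cyc :: "'a \<Rightarrow> 'a \<Rightarrow> 'a \<Rightarrow> bool" where
  "cyc v u v' \<longleftrightarrow> (\<exists>y\<in>carrier W. v = u \<otimes> y \<and> v' = y \<otimes> u \<and>
     len v = len u + len y \<and> len v' = len y + len u)"

definition slide :: "'a \<Rightarrow> 'a \<Rightarrow> 'a \<Rightarrow> bool" where
  "slide v u v' \<longleftrightarrow> v \<otimes> u = u \<otimes> v' \<and> len (v \<otimes> u) = len v + len u \<and> len (u \<otimes> v') = len u + len v'"

definition good :: "'a \<Rightarrow> 'a \<Rightarrow> 'a \<Rightarrow> bool" where
  "good w x y \<longleftrightarrow> x \<in> carrier W \<and> y \<in> carrier W \<and>
    (cyc (cj x w) (inv x \<otimes> y) (cj y w) \<or> cyc (cj y w) (inv y \<otimes> x) (cj x w) \<or>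
     slide (cj x w) (inv x \<otimes> y) (cj y w) \<or> slide (cj y w) (inv y \<otimes> x) (cj x w))"

lemma good_sym: "good w x y \<Longrightarrow> good w y x"
  by (auto simp: good_def)

lemma good_len: "good w x y \<Longrightarrow> len (cj x w) = len (cj y w)"
  unfolding good_def cyc_def slide_def by (elim conjE disjE bexE) (simp_all; linarith)+

lemma good_carrier: "good w x y \<Longrightarrow> x \<in> carrier W \<and> y \<in> carrier W"
  by (auto simp: good_def)

lemma commute_if_srt_fixed:
  assumes "v \<in> carrier W" "s \<in> S" "act v (srt s) = srt s \<or> act v (srt s) = negv (srt s)"
  shows "s \<otimes> v = v \<otimes> s"
  using assms(3)
proof
  assume "act v (srt s) = srt s"
  then show ?thesis using exchange assms by blast
next
  assume "act v (srt s) = negv (srt s)"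
  then have "act (v \<otimes> s) (srt s) = srt s"
    using assms by (simp add: act_mult act_simple act_uminus)
  then have "s \<otimes> (v \<otimes> s) = (v \<otimes> s) \<otimes> s" using exchange[of "v \<otimes> s" s s] assms by blast
  then have "s \<otimes> v \<otimes> s = v" using assms by (simp add: m_assoc)
  then show ?thesis using assms by (metis S_carrier m_closed simple_cancel(2))
qed

text \<open>Here v sends the simple root to a positive root that the reflection s makes negative,
  and the only such root is the simple one itself.\<close>

lemma commute_if_up:
  assumes "v \<in> carrier W" "s \<in> S" "len (v \<otimes> s) = len v + 1" "len (s \<otimes> v \<otimes> s) = len v"
    "len (s \<otimes> v) = len v + 1"
  shows "s \<otimes> v = v \<otimes> s"
proof -
  have 1: "nonneg (act v (srt s))" using assms nonneg_act_srt_iff by simp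
  have "nonneg (negv (act (s \<otimes> v) (srt s)))"
    using assms nonneg_act_srt_iff(2)[of "s \<otimes> v" s] by simp
  then have "\<not> nonneg (refl s (act v (srt s)))"
    using assms root_sign[of "act (s \<otimes> v) (srt s)"] refl_root[of s "act v (srt s)"]
    by (auto simp: act_mult act_simple)
  then have "act v (srt s) = srt s"
    using refl_nonneg[of "act v (srt s)" s] 1 assms by blast
  then show ?thesis using commute_if_srt_fixed assms by blast
qed

text \<open>If s is a left or right descent of v, conjugation by s is a cyclic shift in one
  direction or the other. If it is neither, s commutes with v and the step is a trivial
  slide.\<close>

lemma equal_length_step:
  assumes v: "v \<in> carrier W" and s: "s \<in> S" and eq: "len (s \<otimes> v \<otimes> s) = len v"
  shows "cyc v s (s \<otimes> v \<otimes> s) \<or> cyc (s \<otimes> v \<otimes> s) s v \<or> slide v s (s \<otimes> v \<otimes> s)"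
proof -
  have ls: "len s = 1" by (rule len_simple[OF s])
  consider (du) "len v = len (s \<otimes> v) + 1" | (ud) "len v = len (v \<otimes> s) + 1"
    | (uu) "len (s \<otimes> v) = len v + 1" "len (v \<otimes> s) = len v + 1"
    using len_simple_mult[OF v s] len_mult_simple[OF v s] by blast
  then show ?thesis
  proof cases
    case du
    then have "cyc v s (s \<otimes> v \<otimes> s)"
      unfolding cyc_def using v s eq ls by (intro bexI[of _ "s \<otimes> v"]) auto
    then show ?thesis by simp
  next
    case ud
    then have "cyc (s \<otimes> v \<otimes> s) s v"
      unfolding cyc_def using v s eq ls by (intro bexI[of _ "v \<otimes> s"]) (auto simp: m_assoc)
    then show ?thesis by simp
  next
    case uu
    then have "s \<otimes> v = v \<otimes> s" using commute_if_up v s eq by blast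
    moreover from this have "s \<otimes> v \<otimes> s = v" using v s by simp
    ultimately have "slide v s (s \<otimes> v \<otimes> s)"
      unfolding slide_def using uu ls by simp
    then show ?thesis by simp
  qed
qed

lemma good_simple:
  assumes "x \<in> carrier W" "w \<in> carrier W" "s \<in> S" "len (cj (x \<otimes> s) w) = len (cj x w)"
  shows "good w x (x \<otimes> s)"
proof -
  have eq: "cj (x \<otimes> s) w = s \<otimes> cj x w \<otimes> s"
    using assms by (simp add: cj_mult cj_simple)
  have u: "inv x \<otimes> (x \<otimes> s) = s" "inv (x \<otimes> s) \<otimes> x = s"
    using assms by (simp_all add: inv_mult_group m_assoc flip: m_assoc[of "inv x"])
  show ?thesis
    using equal_length_step[of "cj x w" s] assms unfolding good_def u eq by auto
qed

text \<open>Let the crossed wall have root \<alpha>. Opposite signs of \<sigma> on w \<alpha> and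
  w^-1 \<alpha> mean that s is a descent of the conjugate on exactly one side, so conjugation by s
  keeps the length. If \<alpha> is fixed up to sign, s commutes with the conjugate.\<close>

lemma crossing_len:
  assumes cr: "crosses \<sigma> z s" and w: "w \<in> carrier W"
    and sg: "\<sigma> (act w (act z (srt s))) * \<sigma> (act (inv w) (act z (srt s))) < 0 \<or>
      act (inv w) (act z (srt s)) = act z (srt s) \<or> act (inv w) (act z (srt s)) = negv (act z (srt s))"
  shows "len (cj (z \<otimes> s) w) = len (cj z w)"
proof -
  define v where "v = cj z w"
  have z: "z \<in> carrier W" "s \<in> S" "lin \<sigma>" using cr by (auto simp: crosses_def)
  have v: "v \<in> carrier W" using z w by (simp add: v_def)
  have eq: "cj (z \<otimes> s) w = s \<otimes> v \<otimes> s"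
    using z w by (simp add: cj_mult cj_simple v_def)
  have av: "act v (srt s) = act (inv z) (act w (act z (srt s)))"
    "act (inv v) (srt s) = act (inv z) (act (inv w) (act z (srt s)))"
    using z w by (simp_all add: v_def cj_def act_mult inv_mult_group)
  \<comment> \<open>The point lies on a single wall of z, so wherever it does not vanish its sign is
    that of the chamber.\<close>
  have sign: "nonneg (act (inv z) \<beta>) \<longleftrightarrow> \<sigma> \<beta> > 0" if b: "\<beta> \<in> roots" "\<sigma> \<beta> \<noteq> 0" for \<beta>
  proof
    assume "nonneg (act (inv z) \<beta>)"
    moreover have "\<beta> \<noteq> act z (srt s)" using b cr by (auto simp: crosses_def)
    ultimately show "\<sigma> \<beta> > 0" using cr b by (auto simp: crosses_def)
  next
    assume pos: "\<sigma> \<beta> > 0"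
    show "nonneg (act (inv z) \<beta>)"
    proof (rule ccontr)
      assume "\<not> nonneg (act (inv z) \<beta>)"
      then have "nonneg (act (inv z) (negv \<beta>))"
        using root_sign[of "act (inv z) \<beta>"] b z by (auto simp: act_uminus)
      moreover have n: "\<sigma> (negv \<beta>) = - \<sigma> \<beta>" by (rule lin_negv[OF z(3)])
      moreover have "negv \<beta> \<noteq> act z (srt s)"
      proof
        assume "negv \<beta> = act z (srt s)"
        then have "\<sigma> (negv \<beta>) = 0" using cr by (simp add: crosses_def)
        then show False using n pos by simp
      qed
      ultimately have "\<sigma> (negv \<beta>) > 0" using cr b unfolding crosses_def by blast
      then show False using n pos by simp
    qed
  qed
  from sg show ?thesis
  proof (elim disjE)
    assume lt: "\<sigma> (act w (act z (srt s))) * \<sigma> (act (inv w) (act z (srt s))) < 0"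
    have r: "act w (act z (srt s)) \<in> roots" "act (inv w) (act z (srt s)) \<in> roots"
      using z w by auto
    have "nonneg (act v (srt s)) \<longleftrightarrow> \<not> nonneg (act (inv v) (srt s))"
      using lt sign[OF r(1)] sign[OF r(2)] unfolding av by (auto simp: mult_less_0_iff)
    moreover have "len (inv v \<otimes> s) = len (s \<otimes> v)"
      using len_inv[of "s \<otimes> v"] v z by (simp add: inv_mult_group)
    ultimately have *: "len v < len (v \<otimes> s) \<longleftrightarrow> \<not> len v < len (s \<otimes> v)"
      using nonneg_act_srt_iff(1)[of v s] nonneg_act_srt_iff(1)[of "inv v" s] v z by simp
    have "len (s \<otimes> v \<otimes> s) = len (s \<otimes> v) + 1 \<or> len (s \<otimes> v) = len (s \<otimes> v \<otimes> s) + 1"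
      using len_mult_simple[of "s \<otimes> v" s] v z by simp
    moreover have "len (s \<otimes> v \<otimes> s) = len (v \<otimes> s) + 1 \<or> len (v \<otimes> s) = len (s \<otimes> v \<otimes> s) + 1"
      using len_simple_mult[of "v \<otimes> s" s] v z by (simp add: m_assoc)
    ultimately show ?thesis
      using * len_mult_simple[of v s] len_simple_mult[of v s] v z unfolding eq v_def[symmetric] by linarith
  next
    assume "act (inv w) (act z (srt s)) = act z (srt s)"
    then have "act (inv v) (srt s) = srt s" unfolding av using z by simp
    then have "act v (srt s) = srt s" using v by (metis act_inv_act(2))
    then have "s \<otimes> v = v \<otimes> s" using commute_if_srt_fixed v z by blast
    then show ?thesis unfolding eq using v z by (simp add: v_def)
  next
    assume "act (inv w) (act z (srt s)) = negv (act z (srt s))"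
    then have "act (inv v) (srt s) = negv (srt s)" unfolding av using z by (simp add: act_uminus)
    then have "srt s = act v (negv (srt s))" using v by (metis act_inv_act(2))
    then have "act v (srt s) = negv (srt s)" by (simp add: act_uminus fun_eq_iff)
    then have "s \<otimes> v = v \<otimes> s" using commute_if_srt_fixed v z by blast
    then show ?thesis unfolding eq using v z by (simp add: v_def)
  qed
qed

section \<open>Orbits of a cyclic group\<close>

text \<open>The exponent is negated so that composing a point with \<open>sh w 1\<close> gives \<pi>
  o w^-1, a point of the chamber \<open>w \<otimes> x\<close> when \<pi> is in the chamber
  x.\<close>

definition sh :: "'a \<Rightarrow> int \<Rightarrow> ('a \<Rightarrow> real) \<Rightarrow> 'a \<Rightarrow> real" where
  "sh w n v = act (w [^] (- n)) v"

context
  fixes w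
  assumes w: "w \<in> carrier W"
begin

lemma sh_0 [simp]: "sh w 0 v = v"
  by (simp add: sh_def)

lemma sh_sh [simp]: "sh w m (sh w n v) = sh w (m + n) v"
  using int_pow_mult[OF w, of "-m" "-n"] w by (simp add: sh_def act_mult[symmetric])

lemma sh_1: "sh w 1 v = act (inv w) v"
  using w by (simp add: sh_def int_pow_neg)

lemma sh_m1: "sh w (-1) v = act w v"
  using w by (simp add: sh_def)

lemma sh_root [intro, simp]: "\<alpha> \<in> roots \<Longrightarrow> sh w n \<alpha> \<in> roots"
  using w by (auto simp: sh_def)

lemma sh_negv: "sh w n (negv v) = negv (sh w n v)"
  by (simp add: sh_def act_uminus)

lemma sh_linear: "sh w n (\<lambda>r. a * u r + b * v r) = (\<lambda>r. a * sh w n u r + b * sh w n v r)"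
  by (simp add: sh_def act_linear)

lemma sh_sum: "sh w n (\<lambda>r. \<Sum>i\<in>A. c i * v i r) = (\<lambda>r. \<Sum>i\<in>A. c i * sh w n (v i) r)"
  by (simp add: sh_def act_sum)

lemma sh_inj: "sh w n u = sh w n v \<Longrightarrow> u = v"
  by (metis sh_sh sh_0 add.left_inverse)

lemma intvec_sh: "intvec v \<Longrightarrow> intvec (sh w n v)"
  using w by (simp add: sh_def intvec_act)

text \<open>The operator 2 + w^-1 on vectors; composing a point with it is the replacement. With the
  iteration on the vector side \<pi> stays fixed, and genericity becomes a condition on its values
  at lattice vectors.\<close>

definition smv :: "('a \<Rightarrow> real) \<Rightarrow> 'a \<Rightarrow> real" where
  "smv v = (\<lambda>r. 2 * v r + 1 * sh w 1 v r)"

lemma smv_linear: "smv (\<lambda>r. a * u r + b * v r) = (\<lambda>r. a * smv u r + b * smv v r)"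
  by (simp add: smv_def sh_linear[of 1] algebra_simps)

lemma smvs_linear:
  "(smv ^^ m) (\<lambda>r. a * u r + b * v r) = (\<lambda>r. a * (smv ^^ m) u r + b * (smv ^^ m) v r)"
  by (induction m) (simp_all add: smv_linear)

lemma intvec_smvs: "intvec v \<Longrightarrow> intvec ((smv ^^ m) v)"
proof (induction m)
  case (Suc m)
  then show ?case unfolding funpow.simps o_apply smv_def[of "(smv ^^ m) v"]
    by (intro intvec_combine intvec_sh) auto
qed simp

lemma smvs_smooths:
  assumes "lin \<pi>"
  shows "\<pi> ((smv ^^ m) (sh w n v)) = smooths m (\<lambda>n. \<pi> (sh w n v)) n"
proof (induction m arbitrary: n)
  case (Suc m)
  have "(smv ^^ Suc m) (sh w n v) = (smv ^^ m) (\<lambda>r. 2 * sh w n v r + 1 * sh w (n + 1) v r)"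
    by (simp add: funpow_swap1 smv_def add.commute)
  then have "\<pi> ((smv ^^ Suc m) (sh w n v)) =
      2 * \<pi> ((smv ^^ m) (sh w n v)) + 1 * \<pi> ((smv ^^ m) (sh w (n + 1) v))"
    by (simp only: smvs_linear linD[OF assms])
  then show ?case by (simp add: Suc smooth_def)
qed simp

text \<open>The operator \<open>2 + w\<^sup>-\<^sup>1\<close> is injective on the root lattice, since an eigenvector of \<open>w\<close> in the
  lattice with eigenvalue \<open>-1/2\<close> would be infinitely divisible by 2.\<close>

lemma smv_nonzero:
  assumes "intvec v" "v \<noteq> (\<lambda>r. 0)"
  shows "smv v \<noteq> (\<lambda>r. 0)"
proof
  assume zero: "smv v = (\<lambda>r. 0)"
  have eig: "sh w 1 v = (\<lambda>r. (-2) * v r)"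
    using zero by (auto simp: smv_def fun_eq_iff) (metis add.commute add_eq_0_iff)
  have pow: "v = (\<lambda>r. (-2) ^ n * sh w (- int n) v r)" for n
  proof (induction n)
    case (Suc n)
    have "sh w (- int n) v = sh w (- int (Suc n)) (sh w 1 v)" by simp
    also have "\<dots> = (\<lambda>r. (-2) * sh w (- int (Suc n)) v r)"
      unfolding eig by (simp only: sh_def act_scale)
    finally have step: "sh w (- int n) v = (\<lambda>r. (-2) * sh w (- int (Suc n)) v r)" .
    show ?case
    proof
      fix r
      have "v r = (-2) ^ n * sh w (- int n) v r" using fun_cong[OF Suc] .
      also have "\<dots> = (-2) ^ n * ((-2) * sh w (- int (Suc n)) v r)" using fun_cong[OF step, of r] by (simp only:)
      also have "\<dots> = (-2) ^ Suc n * sh w (- int (Suc n)) v r" by (simp only: power_Suc ac_simps)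
      finally show "v r = (-2) ^ Suc n * sh w (- int (Suc n)) v r" .
    qed
  qed simp
  obtain r where r: "v r \<noteq> 0" using assms(2) by auto
  obtain k where k: "\<bar>v r\<bar> < 2 ^ k" using real_arch_pow[of 2 "\<bar>v r\<bar>"] by auto
  have int: "sh w (- int k) v r \<in> \<int>" using intvec_sh[OF assms(1)] by (simp add: intvec_def)
  have "v r = (-2) ^ k * sh w (- int k) v r" using fun_cong[OF pow[of k]] .
  then have eq: "\<bar>v r\<bar> = 2 ^ k * \<bar>sh w (- int k) v r\<bar>" by (metis abs_mult abs_neg_numeral power_abs)
  then have "sh w (- int k) v r \<noteq> 0" using r by auto
  then have "\<bar>sh w (- int k) v r\<bar> \<ge> 1" using int by (auto elim!: Ints_cases)
  then have "\<bar>v r\<bar> \<ge> 2 ^ k * 1" unfolding eq by (intro mult_left_mono) auto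
  then show False using k by simp
qed

lemma smvs_nonzero: "\<lbrakk>intvec v; v \<noteq> (\<lambda>r. 0)\<rbrakk> \<Longrightarrow> (smv ^^ m) v \<noteq> (\<lambda>r. 0)"
  by (induction m) (auto simp: smv_nonzero intvec_smvs)

lemma inch_shift: "inch x \<pi> \<Longrightarrow> inch (w \<otimes> x) (\<lambda>v. \<pi> (sh w 1 v))"
proof -
  assume x: "inch x \<pi>"
  have xc: "x \<in> carrier W" using inchD[OF x] by simp
  show ?thesis
    unfolding inch_def
  proof (intro conjI ballI impI)
    fix \<alpha> assume a: "\<alpha> \<in> roots" "nonneg (act (inv (w \<otimes> x)) \<alpha>)"
    then show "\<pi> (sh w 1 \<alpha>) > 0"
      using xc w by (intro inchD(3)[OF x]) (auto simp: sh_1 inv_mult_group act_mult)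
  qed (use xc w inchD(2)[OF x] lin_act[of \<pi> "inv w"] in \<open>auto simp: sh_1\<close>)
qed

lemma inch_shift_nat: "inch x \<pi> \<Longrightarrow> \<exists>y. inch y (\<lambda>v. \<pi> (sh w (int n) v))"
proof (induction n)
  case (Suc n)
  then obtain y where "inch y (\<lambda>v. \<pi> (sh w (int n) v))" by blast
  from inch_shift[OF this] show ?case by (auto simp: add.commute)
qed auto

lemma len_cj:
  assumes "inch x \<pi>"
  shows "finite (sep \<pi> (\<lambda>v. \<pi> (sh w 1 v)))" "len (cj x w) = card (sep \<pi> (\<lambda>v. \<pi> (sh w 1 v)))"
  using sep_card[OF assms inch_shift[OF assms]] inchD(1)[OF assms] w by (simp_all add: cj_def m_assoc)

text \<open>A point is moved towards its image: the number of sign changes along the orbits of \<open>w\<close>, which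
  is the length of the conjugate of \<open>w\<close> at the chamber, does not increase.\<close>

lemma len_cj_mono:
  assumes x: "inch x \<pi>" and y: "inch y (\<lambda>v. a * \<pi> v + b * \<pi> (sh w 1 v))" and ab: "a > 0" "b > 0"
  shows "len (cj y w) \<le> len (cj x w)"
proof -
  let ?T = "sh w 1"
  let ?\<rho> = "\<lambda>v. a * \<pi> v + b * \<pi> (?T v)"
  \<comment> \<open>A descent of the new point at \<alpha> is charged to a descent of \<pi> at
    \<alpha> or at the next root of the orbit. The charge is injective because the new point cannot
    descend at two consecutive roots.\<close>
  let ?f = "\<lambda>\<alpha>. if \<pi> (?T \<alpha>) < 0 then \<alpha> else ?T \<alpha>"
  let ?A = "sep ?\<rho> (\<lambda>v. ?\<rho> (?T v))" and ?B = "sep \<pi> (\<lambda>v. \<pi> (?T v))"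
  have nz: "\<pi> \<alpha> \<noteq> 0" if "\<alpha> \<in> roots" for \<alpha> using inch_nonzero[OF x that] .
  have A: "\<alpha> \<in> roots" "a * \<pi> \<alpha> + b * \<pi> (?T \<alpha>) > 0" "a * \<pi> (?T \<alpha>) + b * \<pi> (?T (?T \<alpha>)) < 0"
    if "\<alpha> \<in> ?A" for \<alpha> using that by (auto simp: sep_def)
  have maps: "?f ` ?A \<subseteq> ?B"
  proof
    fix \<beta> assume "\<beta> \<in> ?f ` ?A"
    then obtain \<alpha> where \<alpha>: "\<alpha> \<in> ?A" "\<beta> = ?f \<alpha>" by blast
    note a = A[OF \<alpha>(1)]
    show "\<beta> \<in> ?B"
    proof (cases "\<pi> (?T \<alpha>) < 0")
      case True
      then have "b * \<pi> (?T \<alpha>) < 0" using ab by (simp add: mult_pos_neg)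
      then have "a * \<pi> \<alpha> > 0" using a(2) by linarith
      then show ?thesis using True \<alpha>(2) a(1) ab by (simp add: sep_def zero_less_mult_iff)
    next
      case False
      then have pos: "\<pi> (?T \<alpha>) > 0" using nz[of "?T \<alpha>"] a(1) by force
      then have "a * \<pi> (?T \<alpha>) > 0" using ab by simp
      then have "b * \<pi> (?T (?T \<alpha>)) < 0" using a(3) by linarith
      then show ?thesis using pos \<alpha>(2) a(1) ab by (simp add: sep_def mult_less_0_iff)
    qed
  qed
  have no: False if "\<alpha> \<in> ?A" "\<beta> \<in> ?A" "\<alpha> = ?T \<beta>" for \<alpha> \<beta>
    using A(2)[OF that(1)] A(3)[OF that(2)] that(3) by simp
  have "inj_on ?f ?A"
  proof (rule inj_onI)
    fix \<alpha> \<beta> assume *: "\<alpha> \<in> ?A" "\<beta> \<in> ?A" "?f \<alpha> = ?f \<beta>"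
    have "\<alpha> = \<beta> \<or> \<alpha> = ?T \<beta> \<or> \<beta> = ?T \<alpha> \<or> ?T \<alpha> = ?T \<beta>"
      using *(3) by argo
    then show "\<alpha> = \<beta>"
      using no[OF *(1,2)] no[OF *(2,1)] sh_inj[of 1 \<alpha> \<beta>] by argo
  qed
  then have "card ?A \<le> card ?B"
    using card_inj_on_le maps len_cj(1)[OF x] by blast
  then show ?thesis using len_cj(2)[OF x] len_cj(2)[OF y] by simp
qed

definition eqstep :: "'a \<Rightarrow> 'a \<Rightarrow> bool" where
  "eqstep z z' \<longleftrightarrow> z \<in> carrier W \<and> (\<exists>s\<in>S. z' = z \<otimes> s \<and> len (cj z' w) = len (cj z w))"

definition drops :: "'a \<Rightarrow> bool" where
  "drops x \<longleftrightarrow> (\<exists>z s. eqstep\<^sup>*\<^sup>* x z \<and> s \<in> S \<and> len (cj (z \<otimes> s) w) < len (cj z w))"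

lemma eqsteps: "\<lbrakk>eqstep\<^sup>*\<^sup>* x z; x \<in> carrier W\<rbrakk> \<Longrightarrow> z \<in> carrier W \<and> len (cj z w) = len (cj x w) \<and> (good w)\<^sup>*\<^sup>* x z"
proof (induction rule: rtranclp_induct)
  case (step y z)
  then obtain s where "s \<in> S" "z = y \<otimes> s" "len (cj z w) = len (cj y w)" by (auto simp: eqstep_def)
  then have "good w y z" using good_simple step w by blast
  then show ?case using step good_carrier good_len by (metis rtranclp.rtrancl_into_rtrancl)
qed auto

text \<open>The bound at points of the segment excludes an increase of the length, and the absence
  of drops excludes a decrease.\<close>

lemma gallery_no_drop:
  assumes "\<not> drops x" "x \<in> carrier W" "(gallery_step \<pi> \<rho>)\<^sup>*\<^sup>* x y"
    and le: "\<And>\<tau> z. \<lbrakk>between \<pi> \<rho> \<tau>; inch z \<tau>\<rbrakk> \<Longrightarrow> len (cj z w) \<le> len (cj x w)"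
  shows "eqstep\<^sup>*\<^sup>* x y"
  using assms(3)
proof (induction rule: rtranclp_induct)
  case (step y z)
  from step(2) obtain s \<sigma> \<tau> where z: "z = y \<otimes> s" "crosses \<sigma> y s" "between \<pi> \<rho> \<tau>" "inch z \<tau>"
    unfolding gallery_step_def by blast
  have y: "y \<in> carrier W" "s \<in> S" using z by (auto simp: crosses_def)
  have eq: "len (cj y w) = len (cj x w)" using eqsteps[OF step(3) assms(2)] by simp
  have "len (cj z w) \<le> len (cj y w)" using le z eq by simp
  moreover have "\<not> len (cj z w) < len (cj y w)"
    using assms(1) step(3) y z unfolding drops_def by blast
  ultimately have "eqstep y z" using y z unfolding eqstep_def by auto
  then show ?case using step(3) by simp
qed simp

text \<open>The segment from one iterate to the next consists of combinations of the iterate and its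
  translate, to which \<open>len_cj_mono\<close> applies; the hypothesis \<open>gen\<close> says
  that two walls on it are never met at the same time.\<close>

lemma smooth_path:
  assumes x: "inch x \<pi>" and nd: "\<not> drops x"
    and nz: "\<And>m \<alpha>. \<alpha> \<in> roots \<Longrightarrow> \<pi> ((smv ^^ m) \<alpha>) \<noteq> 0"
    and gen: "\<And>m \<alpha> \<beta>. \<lbrakk>\<alpha> \<in> roots; \<beta> \<in> roots; \<alpha> \<noteq> \<beta>; \<alpha> \<noteq> negv \<beta>; sh w 1 \<alpha> \<noteq> \<alpha>; sh w 1 \<alpha> \<noteq> negv \<alpha>\<rbrakk> \<Longrightarrow>
      \<pi> ((smv ^^ m) \<alpha>) * \<pi> ((smv ^^ m) (sh w 1 \<beta>)) \<noteq> \<pi> ((smv ^^ m) \<beta>) * \<pi> ((smv ^^ m) (sh w 1 \<alpha>))"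
  shows "\<exists>y. inch y (\<lambda>v. \<pi> ((smv ^^ m) v)) \<and> eqstep\<^sup>*\<^sup>* x y"
proof (induction m)
  case 0
  then show ?case using x by auto
next
  case (Suc m)
  then obtain y where y: "inch y (\<lambda>v. \<pi> ((smv ^^ m) v))" "eqstep\<^sup>*\<^sup>* x y" by blast
  let ?P = "\<lambda>v. \<pi> ((smv ^^ m) v)"
  let ?T = "sh w 1"
  have xc: "x \<in> carrier W" using inchD(1)[OF x] .
  have lin: "lin ?P" using inchD(2)[OF y(1)] .
  have next_eq: "(\<lambda>v. \<pi> ((smv ^^ Suc m) v)) = (\<lambda>v. 2 * ?P v + 1 * ?P (?T v))"
  proof
    fix v
    have "?P (smv v) = 2 * ?P v + 1 * ?P (?T v)" unfolding smv_def[of v] by (rule linD[OF lin])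
    then show "\<pi> ((smv ^^ Suc m) v) = 2 * ?P v + 1 * ?P (?T v)" by (simp add: funpow_swap1)
  qed
  have "\<exists>z. inch z (\<lambda>v. 2 * ?P v + 1 * ?P (?T v))"
  proof (rule inch_combine[OF y(1) inch_shift[OF y(1)]])
    fix \<alpha> assume "\<alpha> \<in> roots"
    then show "2 * ?P \<alpha> + 1 * ?P (?T \<alpha>) \<noteq> 0" using nz[of \<alpha> "Suc m"] fun_cong[OF next_eq, of \<alpha>] by simp
  qed auto
  then obtain z where z: "inch z (\<lambda>v. 2 * ?P v + 1 * ?P (?T v))" by blast
  have ndy: "\<not> drops y" using nd y(2) unfolding drops_def by (meson rtranclp_trans)
  have yc: "y \<in> carrier W" using eqsteps y xc by blast
  have "(gallery_step ?P (\<lambda>v. 2 * ?P v + 1 * ?P (?T v)))\<^sup>*\<^sup>* y z"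
  proof (rule gallery[OF y(1) z])
    fix \<alpha> \<beta>
    assume *: "\<alpha> \<in> sep ?P (\<lambda>v. 2 * ?P v + 1 * ?P (?T v))" "\<beta> \<in> sep ?P (\<lambda>v. 2 * ?P v + 1 * ?P (?T v))" "\<alpha> \<noteq> \<beta>"
    then have a: "\<alpha> \<in> roots" "?P \<alpha> > 0" "2 * ?P \<alpha> + ?P (?T \<alpha>) < 0" "\<beta> \<in> roots" "?P \<beta> > 0"
      by (auto simp: sep_def)
    have "?T \<alpha> \<noteq> \<alpha>" using a by auto
    moreover have "?T \<alpha> \<noteq> negv \<alpha>" using a lin_negv[OF lin, of \<alpha>] by auto
    moreover have "\<alpha> \<noteq> negv \<beta>" using a lin_negv[OF lin, of \<beta>] by auto
    ultimately have "?P \<alpha> * ?P (?T \<beta>) \<noteq> ?P \<beta> * ?P (?T \<alpha>)" using gen a * by blast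
    then show "?P \<alpha> * (2 * ?P \<beta> + 1 * ?P (?T \<beta>)) \<noteq> ?P \<beta> * (2 * ?P \<alpha> + 1 * ?P (?T \<alpha>))"
      by (simp add: algebra_simps)
  qed
  then have "eqstep\<^sup>*\<^sup>* y z"
  proof (rule gallery_no_drop[OF ndy yc])
    fix \<tau> z' assume t: "between ?P (\<lambda>v. 2 * ?P v + 1 * ?P (?T v)) \<tau>" "inch z' \<tau>"
    then obtain a b where ab: "a > 0" "b > 0" "\<tau> = (\<lambda>v. a * ?P v + b * (2 * ?P v + 1 * ?P (?T v)))"
      unfolding between_def by blast
    have "\<tau> = (\<lambda>v. (a + 2 * b) * ?P v + b * ?P (?T v))" unfolding ab by (simp add: algebra_simps)
    then show "len (cj z' w) \<le> len (cj y w)"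
      using len_cj_mono[OF y(1), of z' "a + 2 * b" b] t ab by simp
  qed
  then show ?case using z y(2) unfolding next_eq by (meson rtranclp_trans)
qed

end

end

section \<open>Sign patterns along orbits\<close>

definition const_seq :: "(int \<Rightarrow> real) \<Rightarrow> bool" where
  "const_seq a \<longleftrightarrow> (\<forall>n. a n > 0) \<or> (\<forall>n. a n < 0)"

text \<open>The switching index is an argument because later steps compare the indices of different
  points on one orbit.\<close>

definition inc_seq :: "(int \<Rightarrow> real) \<Rightarrow> int \<Rightarrow> bool" where
  "inc_seq a \<tau> \<longleftrightarrow> (\<forall>n. (\<tau> \<le> n \<longrightarrow> a n > 0) \<and> (n < \<tau> \<longrightarrow> a n < 0))"

lemma sign_const_right:
  fixes a :: "int \<Rightarrow> real"
  assumes "\<And>n. a n \<noteq> 0" "\<And>n. n \<ge> N \<Longrightarrow> \<not> (a n > 0 \<and> a (n + 1) < 0)" "\<And>n. n \<ge> N \<Longrightarrow> \<not> (a n < 0 \<and> a (n + 1) > 0)"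
  shows "(\<forall>n\<ge>N. a n > 0) \<or> (\<forall>n\<ge>N. a n < 0)"
proof -
  have "a N > 0 \<longrightarrow> a n > 0" "a N < 0 \<longrightarrow> a n < 0" if "n \<ge> N" for n
    using that
  proof (induction n rule: int_ge_induct)
    case (step i)
    { case 1 then show ?case using step assms(2)[of i] assms(1)[of "i + 1"] by force }
    { case 2 then show ?case using step assms(3)[of i] assms(1)[of "i + 1"] by force }
  qed auto
  then show ?thesis using assms(1)[of N] by (metis linorder_neqE_linordered_idom)
qed

lemma sign_const_left:
  fixes a :: "int \<Rightarrow> real"
  assumes "\<And>n. a n \<noteq> 0" "\<And>n. n < N \<Longrightarrow> \<not> (a n > 0 \<and> a (n + 1) < 0)" "\<And>n. n < N \<Longrightarrow> \<not> (a n < 0 \<and> a (n + 1) > 0)"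
  shows "(\<forall>n\<le>N. a n > 0) \<or> (\<forall>n\<le>N. a n < 0)"
proof -
  have *: "\<not> (a (- n) > 0 \<and> a (- (n + 1)) < 0)" "\<not> (a (- n) < 0 \<and> a (- (n + 1)) > 0)" if "n \<ge> - N" for n
    using assms(2,3)[of "- (n + 1)"] that by auto
  have "(\<forall>n\<ge>-N. a (- n) > 0) \<or> (\<forall>n\<ge>-N. a (- n) < 0)"
    using assms(1) * by (intro sign_const_right) blast+
  then show ?thesis by (metis le_minus_iff minus_minus)
qed

lemma sign_change_ex:
  fixes a :: "int \<Rightarrow> real"
  assumes "\<And>n. a n \<noteq> 0" "\<not> const_seq a"
  shows "\<exists>n. a n > 0 \<and> a (n + 1) < 0 \<or> a n < 0 \<and> a (n + 1) > 0"
proof (rule ccontr)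
  assume no: "\<not> ?thesis"
  have "(\<forall>n\<ge>N. a n > 0) \<or> (\<forall>n\<ge>N. a n < 0)" "(\<forall>n\<le>N. a n > 0) \<or> (\<forall>n\<le>N. a n < 0)" for N
    using assms(1) no by (intro sign_const_right sign_const_left; blast)+
  from this[of 0] have "const_seq a"
    unfolding const_seq_def by (metis linorder_linear order_less_asym)
  then show False using assms by blast
qed

lemma sign_const_at_ends:
  fixes a :: "int \<Rightarrow> real"
  assumes nz: "\<And>n. a n \<noteq> 0" and fin: "finite {n. a n > 0 \<and> a (n + 1) < 0}" "finite {n. a n < 0 \<and> a (n + 1) > 0}"
  shows "\<exists>N::nat. ((\<forall>n\<ge>int N. a n > 0) \<or> (\<forall>n\<ge>int N. a n < 0)) \<and> ((\<forall>n\<le>-int N. a n > 0) \<or> (\<forall>n\<le>-int N. a n < 0))"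
proof -
  let ?X = "{n. a n > 0 \<and> a (n + 1) < 0} \<union> {n. a n < 0 \<and> a (n + 1) > 0}"
  have "finite ((\<lambda>n. nat \<bar>n\<bar>) ` ?X)" using fin by blast
  then obtain N where "\<forall>k\<in>(\<lambda>n. nat \<bar>n\<bar>) ` ?X. k < N"
    unfolding finite_nat_set_iff_bounded by blast
  then have N: "\<And>n. n \<in> ?X \<Longrightarrow> nat \<bar>n\<bar> < N" by blast
  have out: "\<not> (a n > 0 \<and> a (n + 1) < 0)" "\<not> (a n < 0 \<and> a (n + 1) > 0)" if "int N \<le> \<bar>n\<bar>" for n
  proof -
    have "n \<notin> ?X" using N[of n] that by auto
    then show "\<not> (a n > 0 \<and> a (n + 1) < 0)" "\<not> (a n < 0 \<and> a (n + 1) > 0)" by auto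
  qed
  have "(\<forall>n\<ge>int N. a n > 0) \<or> (\<forall>n\<ge>int N. a n < 0)"
    by (rule sign_const_right[OF nz]; rule out; simp)
  moreover have "(\<forall>n\<le>-int N. a n > 0) \<or> (\<forall>n\<le>-int N. a n < 0)"
    by (rule sign_const_left[OF nz]; rule out; simp)
  ultimately show ?thesis by blast
qed

lemma inc_seq_ex:
  fixes A :: "int \<Rightarrow> real"
  assumes up: "\<And>n. A n > 0 \<Longrightarrow> A (n + 1) > 0" and nz: "\<And>n. A n \<noteq> 0"
    and right: "\<exists>n. A n > 0" and left: "\<And>n. n \<le> M \<Longrightarrow> A n < 0"
  shows "\<exists>\<tau>. inc_seq A \<tau>"
proof -
  obtain n1 where n1: "A n1 > 0" using right by blast
  have "n1 > M" using n1 left[of n1] by force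
  then have "A (M + int (nat (n1 - M))) > 0" using n1 by simp
  then have ex: "\<exists>k. A (M + int k) > 0" by blast
  define k0 where "k0 = (LEAST k. A (M + int k) > 0)"
  have k0: "A (M + int k0) > 0" using LeastI_ex[OF ex] by (simp add: k0_def)
  have below: "\<not> A (M + int k) > 0" if "k < k0" for k
    using not_less_Least that by (auto simp: k0_def)
  have "A n > 0" if "n \<ge> M + int k0" for n
    using that by (induction n rule: int_ge_induct) (use k0 up in auto)
  moreover have "A n < 0" if "n < M + int k0" for n
  proof (cases "n \<le> M")
    case False
    then have "n = M + int (nat (n - M))" "nat (n - M) < k0" using that by auto
    then have "\<not> A n > 0" using below by metis
    then show ?thesis using nz[of n] by linarith
  qed (rule left)
  ultimately show ?thesis unfolding inc_seq_def by blast
qed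

lemma inc_seq_unique: "inc_seq a \<tau> \<Longrightarrow> inc_seq a \<tau>' \<Longrightarrow> \<tau> = \<tau>'"
  unfolding inc_seq_def by (meson linorder_neqE_linordered_idom not_less_iff_gr_or_eq order_refl)

lemma smooths_uminus:
  fixes a :: "int \<Rightarrow> real"
  shows "smooths m (\<lambda>n. - a n) n = - smooths m a n"
  using fun_cong[OF smooths_add[of m "-1" a 0 a]] by simp

lemma smooths_pos:
  fixes a :: "int \<Rightarrow> real"
  shows "(\<And>n. a n > 0) \<Longrightarrow> smooths m a n > 0"
  by (induction m arbitrary: n) (auto simp: smooth_def add_pos_pos)

lemma smooths_const_seq:
  assumes "const_seq a"
  shows "const_seq (smooths m a)"
  using assms smooths_pos[of a m] smooths_pos[of "\<lambda>n. - a n" m]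
  unfolding const_seq_def smooths_uminus by auto

lemma smooths_window_pos:
  fixes a :: "int \<Rightarrow> real"
  assumes "\<And>j. n \<le> j \<Longrightarrow> j \<le> n + int m \<Longrightarrow> a j > 0"
  shows "smooths m a n > 0"
  using assms by (induction m arbitrary: n) (auto simp: smooth_def intro!: add_pos_pos)

text \<open>Finitely many sign changes leave a constant sign at each end. Equal signs lead to
  \<open>smooths_even_pos\<close>; opposite signs lead to \<open>smooths_odd\<close>, after which a
  sequence that has become positive stays so.\<close>

lemma smooths_eventually_tame:
  fixes a :: "int \<Rightarrow> real"
  assumes \<delta>: "\<delta> > 0" "\<And>n. \<bar>a n\<bar> \<ge> \<delta>" and nz: "\<And>m n. smooths m a n \<noteq> 0"
    and fin: "finite {n. a n > 0 \<and> a (n + 1) < 0}" "finite {n. a n < 0 \<and> a (n + 1) > 0}"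
  shows "\<exists>m0. \<forall>m\<ge>m0. const_seq (smooths m a) \<or> (\<exists>\<tau>. inc_seq (smooths m a) \<tau>) \<or> (\<exists>\<tau>. inc_seq (\<lambda>n. - smooths m a n) \<tau>)"
proof -
  have odd: "\<exists>m0. \<forall>m\<ge>m0. \<exists>\<tau>. inc_seq (smooths m b) \<tau>"
    if b: "\<And>n. \<bar>b n\<bar> \<ge> \<delta>" "\<And>m n. smooths m b n \<noteq> 0" "\<And>n. n \<ge> int N \<Longrightarrow> b n > 0" "\<And>n. n \<le> - int N \<Longrightarrow> b n < 0" for b and N :: nat
  proof -
    have "\<exists>m0. \<forall>m\<ge>m0. \<forall>n. smooths m b n \<ge> 0 \<longrightarrow> smooths m b (n + 1) > 0"
    proof (rule smooths_odd[OF \<delta>(1)])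
      show "b n \<ge> \<delta>" if "int N \<le> n" for n using b(1)[of n] b(3)[of n] that by simp
      show "b n \<le> - \<delta>" if "n \<le> - int N" for n using b(1)[of n] b(4)[of n] that by simp
    qed
    then obtain m0 where m0: "\<And>m n. m \<ge> m0 \<Longrightarrow> smooths m b n \<ge> 0 \<Longrightarrow> smooths m b (n + 1) > 0" by blast
    have "\<exists>\<tau>. inc_seq (smooths m b) \<tau>" if m: "m \<ge> m0" for m
    proof (rule inc_seq_ex[where M = "- int N - int m"])
      have "smooths m b (int N) > 0" by (rule smooths_window_pos) (auto intro: b(3))
      then show "\<exists>n. smooths m b n > 0" by blast
      fix n assume "n \<le> - int N - int m"
      then have "smooths m (\<lambda>n. - b n) n > 0" by (intro smooths_window_pos) (auto intro: b(4))
      then show "smooths m b n < 0" by (simp add: smooths_uminus)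
    qed (use m0[OF m] b(2) in auto)
    then show ?thesis by blast
  qed
  have even: "\<exists>m0. \<forall>m\<ge>m0. \<forall>n. smooths m b n > 0"
    if b: "\<And>n. \<bar>b n\<bar> \<ge> \<delta>" "\<And>n. n \<ge> int N \<Longrightarrow> b n > 0" "\<And>n. n \<le> - int N \<Longrightarrow> b n > 0" for b and N :: nat
  proof (rule smooths_even_pos[OF \<delta>(1)])
    fix n assume "int N \<le> \<bar>n\<bar>"
    then have "b n > 0" using b(2,3)[of n] by linarith
    then show "\<delta> \<le> b n" using b(1)[of n] by simp
  qed
  have an: "a n \<noteq> 0" for n using nz[of 0 n] by simp
  obtain N :: nat where N: "(\<forall>n\<ge>int N. a n > 0) \<or> (\<forall>n\<ge>int N. a n < 0)" "(\<forall>n\<le>-int N. a n > 0) \<or> (\<forall>n\<le>-int N. a n < 0)"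
    using sign_const_at_ends[OF an fin] by blast
  have neg: "\<And>n. \<bar>- a n\<bar> \<ge> \<delta>" "\<And>m n. smooths m (\<lambda>n. - a n) n \<noteq> 0"
    using \<delta> nz by (auto simp: smooths_uminus)
  consider "\<forall>n\<ge>int N. a n > 0" "\<forall>n\<le>-int N. a n > 0" | "\<forall>n\<ge>int N. a n > 0" "\<forall>n\<le>-int N. a n < 0"
    | "\<forall>n\<ge>int N. a n < 0" "\<forall>n\<le>-int N. a n > 0" | "\<forall>n\<ge>int N. a n < 0" "\<forall>n\<le>-int N. a n < 0"
    using N by blast
  then show ?thesis
  proof cases
    case 1
    then have "\<exists>m0. \<forall>m\<ge>m0. \<forall>n. smooths m a n > 0" using even[of a N] \<delta> by blast
    then show ?thesis unfolding const_seq_def by blast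
  next
    case 2
    then show ?thesis using odd[of a N] \<delta>(2) nz by blast
  next
    case 3
    then have "\<exists>m0. \<forall>m\<ge>m0. \<exists>\<tau>. inc_seq (smooths m (\<lambda>n. - a n)) \<tau>"
      using odd[of "\<lambda>n. - a n" N, OF neg] by simp
    moreover have "smooths m (\<lambda>n. - a n) = (\<lambda>n. - smooths m a n)" for m
      by (auto simp: smooths_uminus)
    ultimately show ?thesis by metis
  next
    case 4
    then have "\<exists>m0. \<forall>m\<ge>m0. \<forall>n. smooths m (\<lambda>n. - a n) n > 0"
      using even[of "\<lambda>n. - a n" N, OF neg(1)] by simp
    then show ?thesis unfolding const_seq_def smooths_uminus by fastforce
  qed
qed

section \<open>Generic points\<close>

context crystallographic_coxeter_system
begin

definition indep :: "('a \<Rightarrow> real) \<Rightarrow> ('a \<Rightarrow> real) \<Rightarrow> bool" where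
  "indep u v \<longleftrightarrow> (\<forall>a b. (\<lambda>r. a * u r + b * v r) = (\<lambda>r. 0) \<longrightarrow> a = 0 \<and> b = 0)"

text \<open>The second clause keeps crossing times distinct. Independence of g1 from g3 and from g4
  ensures that the form g1 g2 - g3 g4 is nonzero: some functional kills g1 but neither g3 nor g4. As
  the vectors range over a lattice, the conditions are countable.\<close>

definition generic :: "(('a \<Rightarrow> real) \<Rightarrow> real) \<Rightarrow> bool" where
  "generic \<pi> \<longleftrightarrow> (\<forall>v. intvec v \<longrightarrow> v \<noteq> (\<lambda>r. 0) \<longrightarrow> \<pi> v \<noteq> 0) \<and>
    (\<forall>g1 g2 g3 g4. intvec g1 \<longrightarrow> intvec g2 \<longrightarrow> intvec g3 \<longrightarrow> intvec g4 \<longrightarrow> indep g1 g3 \<longrightarrow> indep g1 g4 \<longrightarrow>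
      \<pi> g1 * \<pi> g2 \<noteq> \<pi> g3 * \<pi> g4)"

lemma indep_act: "\<lbrakk>x \<in> carrier W; indep u v\<rbrakk> \<Longrightarrow> indep (act x u) (act x v)"
  unfolding indep_def
proof (intro allI impI)
  fix a b assume x: "x \<in> carrier W"
    and ind: "\<forall>a b. (\<lambda>r. a * u r + b * v r) = (\<lambda>r. 0) \<longrightarrow> a = 0 \<and> b = 0"
    and "(\<lambda>r. a * act x u r + b * act x v r) = (\<lambda>r. 0)"
  then have "act x (\<lambda>r. a * u r + b * v r) = (\<lambda>r. 0)" by (simp add: act_linear)
  then have "act (inv x) (act x (\<lambda>r. a * u r + b * v r)) = (\<lambda>r. 0)" by simp
  then have "(\<lambda>r. a * u r + b * v r) = (\<lambda>r. 0)" using x by simp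
  then show "a = 0 \<and> b = 0" using ind by blast
qed

lemma act_support:
  assumes "x \<in> carrier W" "\<And>r. r \<notin> S \<Longrightarrow> v r = 0" "r \<notin> S"
  shows "act x v r = 0"
proof -
  obtain xs where xs: "xs \<in> lists S" "wprod xs = x" using wprod_surj assms by blast
  have "\<forall>r. r \<notin> S \<longrightarrow> wact xs v r = 0"
    using xs(1) by (induction xs) (auto simp: assms refl_def)
  then show ?thesis using act_wprod[OF xs(1)] xs(2) assms by simp
qed

lemma act_nonzero: "\<lbrakk>x \<in> carrier W; v \<noteq> (\<lambda>r. 0)\<rbrakk> \<Longrightarrow> act x v \<noteq> (\<lambda>r. 0)"
  by (metis act_inv_act(1) act_zero)

lemma countable_intvec: "countable {v. intvec v}"
proof -
  obtain xs where xs: "set xs = S" using finite_list[OF finite_simple] by blast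
  let ?f = "\<lambda>ns r. case map_of (zip xs ns) r of None \<Rightarrow> 0 | Some k \<Rightarrow> real_of_int k"
  have "{v. intvec v} \<subseteq> range ?f"
  proof
    fix v assume "v \<in> {v. intvec v}"
    then have v: "\<And>r. v r \<in> \<int>" "\<And>r. r \<notin> S \<Longrightarrow> v r = 0" by (auto simp: intvec_def)
    have "v r = ?f (map (\<lambda>r. \<lfloor>v r\<rfloor>) xs) r" for r
      using v[of r] xs by (auto simp: map_of_zip_map elim!: Ints_cases)
    then have "v = ?f (map (\<lambda>r. \<lfloor>v r\<rfloor>) xs)" by blast
    then show "v \<in> range ?f" by blast
  qed
  then show ?thesis by (rule countable_subset) (intro countable_image countableI_type)
qed

lemma pt_form: "(\<Sum>r\<in>S. \<Sum>s\<in>S. (u r * v s) * t r * t s) = pt t u * pt t v"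
  unfolding pt_def sum_product by (intro sum.cong refl) (simp add: algebra_simps)

lemma separating_vector:
  assumes sup: "\<And>r. r \<notin> S \<Longrightarrow> u r = 0" "\<And>r. r \<notin> S \<Longrightarrow> v r = 0" and ind: "indep u v"
  shows "\<exists>t. pt t u = 0 \<and> pt t v \<noteq> 0"
proof -
  have "\<exists>i j. u i * v j \<noteq> u j * v i"
  proof (rule ccontr)
    assume no: "\<nexists>i j. u i * v j \<noteq> u j * v i"
    obtain i where i: "u i \<noteq> 0"
    proof (rule ccontr)
      assume "\<not> thesis"
      then have "u i = 0" for i using that by blast
      then have "(\<lambda>r. 1 * u r + 0 * v r) = (\<lambda>r. 0)" by simp
      then show False using ind unfolding indep_def by (metis zero_neq_one)
    qed
    have "(\<lambda>r. v i * u r + (- u i) * v r) = (\<lambda>r. 0)" using no by (auto simp: algebra_simps)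
    then show False using ind i unfolding indep_def by (metis neg_equal_0_iff_equal)
  qed
  then obtain i j where ij: "u i * v j \<noteq> u j * v i" by blast
  then have S: "i \<in> S" "j \<in> S" using sup by (metis mult_zero_left mult_zero_right)+
  have ne: "i \<noteq> j" using ij by auto
  \<comment> \<open>Supported on two coordinates and orthogonal to u; its value on v is a nonzero 2
    x 2 minor.\<close>
  define t where "t r = (if r = j then u i else if r = i then - u j else 0)" for r
  have pt: "pt t z = z j * u i - z i * u j" for z
  proof -
    have "pt t z = (\<Sum>r\<in>{i, j}. z r * t r)"
      unfolding pt_def using S finite_simple by (intro sum.mono_neutral_right) (auto simp: t_def)
    then show ?thesis using ne by (simp add: t_def)
  qed
  have "pt t u = 0" "pt t v \<noteq> 0" using ij by (simp_all add: pt mult.commute)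
  then show ?thesis by blast
qed

text \<open>All conditions become non-vanishing of quadratic forms in t, linear ones after squaring.
  The set \<G> leaves room for vectors outside the lattice, such as Fourier modes.\<close>

lemma generic_point_exists:
  assumes x: "x \<in> carrier W" and cnt: "countable \<G>"
    and G: "\<And>\<xi>. \<xi> \<in> \<G> \<Longrightarrow> \<xi> \<noteq> (\<lambda>r. 0) \<and> (\<forall>r. r \<notin> S \<longrightarrow> \<xi> r = 0)"
  shows "\<exists>t. (\<forall>s. t s > 0) \<and> generic (\<lambda>v. pt t (act (inv x) v)) \<and> (\<forall>\<xi>\<in>\<G>. pt t (act (inv x) \<xi>) \<noteq> 0)"
proof -
  let ?I = "{v. intvec v}"
  define \<F>1 where "\<F>1 = (\<lambda>\<xi> r s. act (inv x) \<xi> r * act (inv x) \<xi> s) ` (\<G> \<union> (?I - {\<lambda>r. 0}))"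
  define J where "J = {(g1, g2, g3, g4). g1 \<in> ?I \<and> g2 \<in> ?I \<and> g3 \<in> ?I \<and> g4 \<in> ?I \<and> indep g1 g3 \<and> indep g1 g4}"
  define \<F>2 where "\<F>2 = (\<lambda>(g1, g2, g3, g4) r s. act (inv x) g1 r * act (inv x) g2 s - act (inv x) g3 r * act (inv x) g4 s) ` J"
  have xi: "inv x \<in> carrier W" using x by simp
  have "J \<subseteq> ?I \<times> ?I \<times> ?I \<times> ?I" by (auto simp: J_def)
  then have "countable J"
    using countable_intvec by (meson countable_SIGMA countable_subset)
  then have cF: "countable (\<F>1 \<union> \<F>2)"
    unfolding \<F>1_def \<F>2_def using cnt countable_intvec by (intro countable_Un countable_image) auto
  have sum_eq1: "(\<Sum>r\<in>S. \<Sum>s\<in>S. (act (inv x) \<xi> r * act (inv x) \<xi> s) * t r * t s) = pt t (act (inv x) \<xi>) ^ 2" for \<xi> t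
    by (simp only: pt_form power2_eq_square)
  have sum_eq2: "(\<Sum>r\<in>S. \<Sum>s\<in>S. (act (inv x) g1 r * act (inv x) g2 s - act (inv x) g3 r * act (inv x) g4 s) * t r * t s)
     = pt t (act (inv x) g1) * pt t (act (inv x) g2) - pt t (act (inv x) g3) * pt t (act (inv x) g4)" for g1 g2 g3 g4 t
    by (simp only: left_diff_distrib sum_subtractf pt_form)
  have sup: "act (inv x) g r = 0" if "intvec g" "r \<notin> S" for g r
    using act_support[OF xi, of g r] that by (auto simp: intvec_def)
  have "\<exists>t. (\<forall>s. t s > 0) \<and> (\<forall>Q\<in>\<F>1 \<union> \<F>2. (\<Sum>r\<in>S. \<Sum>s\<in>S. Q r s * t r * t s) \<noteq> 0)"
  proof (rule generic_vector_exists[OF finite_simple cF])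
    fix Q assume "Q \<in> \<F>1 \<union> \<F>2"
    then show "\<exists>t. (\<Sum>r\<in>S. \<Sum>s\<in>S. Q r s * t r * t s) \<noteq> 0"
    proof
      assume "Q \<in> \<F>1"
      then obtain \<xi> where \<xi>: "\<xi> \<in> \<G> \<union> (?I - {\<lambda>r. 0})" "Q = (\<lambda>r s. act (inv x) \<xi> r * act (inv x) \<xi> s)"
        unfolding \<F>1_def by blast
      have nz: "\<xi> \<noteq> (\<lambda>r. 0)" "\<forall>r. r \<notin> S \<longrightarrow> \<xi> r = 0" using \<xi>(1) G by (auto simp: intvec_def)
      have "act (inv x) \<xi> \<noteq> (\<lambda>r. 0)" using act_nonzero[OF xi nz(1)] .
      then obtain r where r: "act (inv x) \<xi> r \<noteq> 0" by auto
      then have rS: "r \<in> S" using act_support[OF xi] nz(2) by blast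
      have "pt (srt r) (act (inv x) \<xi>) = (\<Sum>s\<in>S. if s = r then act (inv x) \<xi> r else 0)"
        unfolding pt_def by (rule sum.cong) (auto simp: srt_def)
      then have "pt (srt r) (act (inv x) \<xi>) \<noteq> 0" using r rS finite_simple by simp
      then show ?thesis unfolding \<xi>(2) sum_eq1 by (intro exI[of _ "srt r"]) simp
    next
      assume "Q \<in> \<F>2"
      then obtain g1 g2 g3 g4 where g: "intvec g1" "intvec g2" "intvec g3" "intvec g4" "indep g1 g3" "indep g1 g4"
        and Q: "Q = (\<lambda>r s. act (inv x) g1 r * act (inv x) g2 s - act (inv x) g3 r * act (inv x) g4 s)"
        unfolding \<F>2_def J_def by auto
      obtain t where t: "pt t (act (inv x) g1) = 0" "pt t (act (inv x) g3) \<noteq> 0"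
        using separating_vector[of "act (inv x) g1" "act (inv x) g3"] sup g indep_act[OF xi] by blast
      obtain t' where t': "pt t' (act (inv x) g1) = 0" "pt t' (act (inv x) g4) \<noteq> 0"
        using separating_vector[of "act (inv x) g1" "act (inv x) g4"] sup g indep_act[OF xi] by blast
      have add: "pt (\<lambda>r. t r + t' r) z = pt t z + pt t' z" for z
        by (simp add: pt_def algebra_simps sum.distrib)
      \<comment> \<open>If t kills g4 and t' kills g3, their sum kills neither; otherwise one of
        them already serves.\<close>
      obtain t0 where "pt t0 (act (inv x) g1) = 0" "pt t0 (act (inv x) g3) \<noteq> 0" "pt t0 (act (inv x) g4) \<noteq> 0"
      proof (cases "pt t (act (inv x) g4) = 0")
        case True
        show thesis
        proof (cases "pt t' (act (inv x) g3) = 0")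
          case True
          then show thesis
            using that[of "\<lambda>r. t r + t' r"] \<open>pt t (act (inv x) g4) = 0\<close> t t' by (simp add: add)
        qed (use that t' in blast)
      qed (use that t in blast)
      then show ?thesis unfolding Q sum_eq2 by (intro exI[of _ t0]) simp
    qed
  qed
  then obtain t where t: "\<forall>s. t s > 0" "\<And>Q. Q \<in> \<F>1 \<union> \<F>2 \<Longrightarrow> (\<Sum>r\<in>S. \<Sum>s\<in>S. Q r s * t r * t s) \<noteq> 0" by blast
  have 1: "pt t (act (inv x) \<xi>) \<noteq> 0" if "\<xi> \<in> \<G> \<union> (?I - {\<lambda>r. 0})" for \<xi>
    using t(2)[of "\<lambda>r s. act (inv x) \<xi> r * act (inv x) \<xi> s"] that unfolding \<F>1_def sum_eq1 by auto
  have 2: "pt t (act (inv x) g1) * pt t (act (inv x) g2) \<noteq> pt t (act (inv x) g3) * pt t (act (inv x) g4)"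
    if "intvec g1" "intvec g2" "intvec g3" "intvec g4" "indep g1 g3" "indep g1 g4" for g1 g2 g3 g4
  proof -
    have "(\<lambda>r s. act (inv x) g1 r * act (inv x) g2 s - act (inv x) g3 r * act (inv x) g4 s) \<in> \<F>2"
      unfolding \<F>2_def J_def using that by (intro image_eqI[of _ _ "(g1, g2, g3, g4)"]) auto
    from t(2)[OF UnI2[OF this]] show ?thesis unfolding sum_eq2 by simp
  qed
  show ?thesis
    using t(1) 1 2 unfolding generic_def by (intro exI[of _ t] conjI allI impI ballI) auto
qed

lemma root_vec_nonzero: "\<alpha> \<in> roots \<Longrightarrow> \<alpha> \<noteq> (\<lambda>r. 0)"
  using root_nonzero by auto

lemma indep_roots:
  assumes "\<alpha> \<in> roots" "\<beta> \<in> roots" "\<alpha> \<noteq> \<beta>" "\<alpha> \<noteq> negv \<beta>"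
  shows "indep \<alpha> \<beta>"
  unfolding indep_def
proof (intro allI impI)
  fix a b assume eq: "(\<lambda>r. a * \<alpha> r + b * \<beta> r) = (\<lambda>r. 0)"
  have a0: "a = 0"
  proof (rule ccontr)
    assume "a \<noteq> 0"
    have "\<alpha> = (\<lambda>r. (- b / a) * \<beta> r)"
    proof
      fix r show "\<alpha> r = (- b / a) * \<beta> r"
        using fun_cong[OF eq, of r] \<open>a \<noteq> 0\<close> by (simp add: field_simps eq_neg_iff_add_eq_0)
    qed
    then obtain c where c: "\<alpha> = (\<lambda>r. c * \<beta> r)" by blast
    then have "c = 1 \<or> c = -1" using root_multiple assms by blast
    then show False using c assms(3,4) by auto
  qed
  obtain r where "\<beta> r \<noteq> 0" using root_nonzero assms by blast
  then have "b = 0" using fun_cong[OF eq, of r] a0 by simp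
  then show "a = 0 \<and> b = 0" using a0 by simp
qed

end

text \<open>Moving the window by one replaces its leftmost term by a new one on the right. While the
  leftmost term is negative, a positive sum requires the window to reach the positive part, so
  moving increases it. From \<tau> on all terms are positive, so the switch comes no later.\<close>

lemma window_inc_seq:
  fixes a :: "int \<Rightarrow> real"
  assumes inc: "inc_seq a \<tau>" and nz: "\<And>n. (\<Sum>j<L. a (n + int j)) \<noteq> 0"
  shows "\<exists>\<tau>'\<le>\<tau>. inc_seq (\<lambda>n. \<Sum>j<L. a (n + int j)) \<tau>'"
proof -
  let ?b = "\<lambda>n. \<Sum>j<L. a (n + int j)"
  have L: "L > 0" using nz[of 0] by (cases L) auto
  have pos: "a n > 0 \<longleftrightarrow> \<tau> \<le> n" and neg: "a n < 0 \<longleftrightarrow> n < \<tau>" for n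
    using inc unfolding inc_seq_def by (metis not_le not_less_iff_gr_or_eq)+
  have up: "?b (n + 1) > 0" if "?b n > 0" for n
  proof -
    have shift: "?b (n + 1) = ?b n + a (n + int L) - a n"
    proof -
      have "(\<Sum>j<Suc L. a (n + int j)) = a n + (\<Sum>j<L. a (n + int (Suc j)))"
        by (subst sum.lessThan_Suc_shift) simp
      then show ?thesis by (simp add: algebra_simps)
    qed
    show ?thesis
    proof (cases "\<tau> \<le> n")
      case True
      then show ?thesis using L pos by (intro sum_pos) auto
    next
      case False
      then have "a n < 0" using neg by simp
      have "\<tau> \<le> n + int L"
      proof (rule ccontr)
        assume "\<not> \<tau> \<le> n + int L"
        then have "?b n \<le> 0" using neg by (intro sum_nonpos) (force intro: less_imp_le)
        then show False using that by simp
      qed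
      then have "a (n + int L) > 0" using pos by simp
      then show ?thesis using shift that \<open>a n < 0\<close> by linarith
    qed
  qed
  have ge: "?b n > 0" if "\<tau> \<le> n" for n using L pos that by (intro sum_pos) auto
  have "\<exists>\<tau>'. inc_seq ?b \<tau>'"
  proof (rule inc_seq_ex[where M = "\<tau> - int L"])
    show "\<exists>n. ?b n > 0" using ge by blast
    fix n assume "n \<le> \<tau> - int L"
    then have "?b n \<le> 0" using neg by (intro sum_nonpos) (force intro: less_imp_le)
    then show "?b n < 0" using nz[of n] by linarith
  qed (use up nz in auto)
  then obtain \<tau>' where t: "inc_seq ?b \<tau>'" by blast
  have "\<tau>' \<le> \<tau>"
  proof (rule ccontr)
    assume "\<not> \<tau>' \<le> \<tau>"
    then have "?b \<tau> < 0" using t unfolding inc_seq_def by simp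
    then show False using ge[of \<tau>] by simp
  qed
  then show ?thesis using t by blast
qed

lemma sum_split_nat:
  fixes f :: "nat \<Rightarrow> 'b::comm_monoid_add"
  shows "(\<Sum>j<a + b. f j) = (\<Sum>j<a. f j) + (\<Sum>j<b. f (a + j))"
  by (induction b) (auto simp: add.assoc)

lemma inc_not_const: "inc_seq a \<tau> \<Longrightarrow> \<not> const_seq a"
  unfolding inc_seq_def const_seq_def by (metis less_asym lt_ex order_refl)

context crystallographic_coxeter_system
begin

context
  fixes w
  assumes w [simp]: "w \<in> carrier W"
begin

abbreviation T where "T \<equiv> sh w"
abbreviation smo where "smo m \<equiv> (smv w ^^ m)"

text \<open>Injectivity of 2 + w^-1 is known on the lattice only, so a real relation between the
  images has to be replaced by an integral one.\<close>

lemma indep_smvs: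
  assumes "intvec u" "intvec v" "indep u v"
  shows "indep (smo m u) (smo m v)"
  unfolding indep_def
proof (intro allI impI)
  fix a b assume eq: "(\<lambda>r. a * smo m u r + b * smo m v r) = (\<lambda>r. 0)"
  have nz: "u \<noteq> (\<lambda>r. 0)" "v \<noteq> (\<lambda>r. 0)"
    using assms(3) unfolding indep_def by (force dest: spec[of _ 1] spec[of _ 0])+
  have int: "intvec (smo m u)" "intvec (smo m v)" using assms intvec_smvs by auto
  obtain i where i: "smo m u i \<noteq> 0" using smvs_nonzero[OF w assms(1) nz(1), of m] by auto
  obtain j where j: "smo m v j \<noteq> 0" using smvs_nonzero[OF w assms(2) nz(2), of m] by auto
  have ab: "a * smo m u r = - b * smo m v r" for r
    using fun_cong[OF eq, of r] by (simp add: eq_neg_iff_add_eq_0)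
  show "a = 0 \<and> b = 0"
  proof (rule ccontr)
    assume ne: "\<not> (a = 0 \<and> b = 0)"
    have a0: "a \<noteq> 0"
    proof
      assume "a = 0"
      then have "b = 0" using ab[of j] j by simp
      then show False using ne \<open>a = 0\<close> by simp
    qed
    \<comment> \<open>The images are proportional, so two of their own integer coordinates give the
      coefficients of the relation.\<close>
    let ?c = "smo m v j" and ?d = "- smo m u j"
    have "a * (?c * smo m u r + ?d * smo m v r) = 0" for r
    proof -
      have "a * (?c * smo m u r + ?d * smo m v r) = ?c * (a * smo m u r) - (a * smo m u j) * smo m v r"
        by (simp add: algebra_simps)
      also have "\<dots> = 0" unfolding ab by (simp add: algebra_simps)
      finally show ?thesis .
    qed
    then have "(\<lambda>r. ?c * smo m u r + ?d * smo m v r) = (\<lambda>r. 0)" using a0 by auto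
    then have "smo m (\<lambda>r. ?c * u r + ?d * v r) = (\<lambda>r. 0)" by (simp only: smvs_linear[OF w])
    moreover have "?c \<in> \<int>" "?d \<in> \<int>" using int by (simp_all add: intvec_def)
    then have "intvec (\<lambda>r. ?c * u r + ?d * v r)" by (rule intvec_combine[OF assms(1,2)])
    ultimately have "(\<lambda>r. ?c * u r + ?d * v r) = (\<lambda>r. 0)" using smvs_nonzero[OF w] by blast
    then show False using assms(3) j unfolding indep_def by blast
  qed
qed

lemma generic_nonzero: "\<lbrakk>generic \<pi>; intvec v; v \<noteq> (\<lambda>r. 0)\<rbrakk> \<Longrightarrow> \<pi> v \<noteq> 0"
  by (simp add: generic_def)

lemma generic_quadratic:
  "\<lbrakk>generic \<pi>; intvec g1; intvec g2; intvec g3; intvec g4; indep g1 g3; indep g1 g4\<rbrakk>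
    \<Longrightarrow> \<pi> g1 * \<pi> g2 \<noteq> \<pi> g3 * \<pi> g4"
  by (simp add: generic_def)

lemma generic_smvs_nonzero: "\<lbrakk>generic \<pi>; \<alpha> \<in> roots\<rbrakk> \<Longrightarrow> \<pi> (smo m \<alpha>) \<noteq> 0"
  by (rule generic_nonzero[OF _ intvec_smvs[OF w root_intvec] smvs_nonzero[OF w root_intvec root_vec_nonzero]])

lemma generic_smooth_path:
  assumes "inch x \<pi>" "generic \<pi>" "\<not> drops w x"
  shows "\<exists>y. inch y (\<lambda>v. \<pi> (smo m v)) \<and> (eqstep w)\<^sup>*\<^sup>* x y"
proof (rule smooth_path[OF w assms(1,3)])
  fix m \<alpha> \<beta> assume a: "\<alpha> \<in> roots" "\<beta> \<in> roots" "\<alpha> \<noteq> \<beta>" "\<alpha> \<noteq> negv \<beta>" "T 1 \<alpha> \<noteq> \<alpha>" "T 1 \<alpha> \<noteq> negv \<alpha>"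
  have ne: "\<alpha> \<noteq> negv (T 1 \<alpha>)"
  proof
    assume "\<alpha> = negv (T 1 \<alpha>)"
    then have "T 1 \<alpha> r = - \<alpha> r" for r using fun_cong[of \<alpha> "negv (T 1 \<alpha>)" r] by simp
    then show False using a(6) by blast
  qed
  have r: "T 1 \<alpha> \<in> roots" "T 1 \<beta> \<in> roots" using a by simp_all
  have "indep (smo m \<alpha>) (smo m \<beta>)"
    by (intro indep_smvs root_intvec indep_roots a)
  moreover have "indep (smo m \<alpha>) (smo m (T 1 \<alpha>))"
    by (intro indep_smvs root_intvec indep_roots a r a(5)[symmetric] ne)
  moreover have "intvec (smo m \<alpha>)" "intvec (smo m \<beta>)" "intvec (smo m (T 1 \<alpha>))" "intvec (smo m (T 1 \<beta>))"
    by (intro intvec_smvs[OF w] root_intvec a r)+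
  ultimately show "\<pi> (smo m \<alpha>) * \<pi> (smo m (T 1 \<beta>)) \<noteq> \<pi> (smo m \<beta>) * \<pi> (smo m (T 1 \<alpha>))"
    by (intro generic_quadratic[OF assms(2)])
qed (rule generic_smvs_nonzero[OF assms(2)])

section \<open>Roots with vanishing orbit sum\<close>

text \<open>On such an orbit the values of any point sum to zero over a period, so no point has
  constant sign there. All other orbits become tame under smoothing.\<close>

definition zero_sum_roots :: "('a \<Rightarrow> real) set" where
  "zero_sum_roots = {\<alpha> \<in> roots. \<exists>d>0. T (int d) \<alpha> = \<alpha> \<and> (\<lambda>r. \<Sum>j<d. T (int j) \<alpha> r) = (\<lambda>r. 0)}"

abbreviation "\<Phi>0 \<equiv> zero_sum_roots"

lemma T_sum: "T n (\<lambda>r. \<Sum>i\<in>A. v i r) = (\<lambda>r. \<Sum>i\<in>A. T n (v i) r)"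
  using sh_sum[OF w, of n "\<lambda>_. 1" v A] by simp

lemma T_zero [simp]: "T n (\<lambda>r. 0) = (\<lambda>r. 0)"
  by (simp add: sh_def)

lemma zero_sum_T [intro, simp]: "\<alpha> \<in> \<Phi>0 \<Longrightarrow> T n \<alpha> \<in> \<Phi>0"
proof -
  assume "\<alpha> \<in> \<Phi>0"
  then obtain d where d: "\<alpha> \<in> roots" "d > 0" "T (int d) \<alpha> = \<alpha>" "(\<lambda>r. \<Sum>j<d. T (int j) \<alpha> r) = (\<lambda>r. 0)"
    by (auto simp: zero_sum_roots_def)
  have "T (int d) (T n \<alpha>) = T n (T (int d) \<alpha>)" by (simp add: add.commute)
  moreover have "(\<lambda>r. \<Sum>j<d. T (int j) (T n \<alpha>) r) = T n (\<lambda>r. \<Sum>j<d. T (int j) \<alpha> r)"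
    unfolding T_sum by (simp add: add.commute)
  ultimately show ?thesis
    using d unfolding zero_sum_roots_def by (auto intro!: exI[of _ d])
qed

lemma zero_sum_T_iff: "T n \<alpha> \<in> \<Phi>0 \<longleftrightarrow> \<alpha> \<in> \<Phi>0"
  using zero_sum_T[of \<alpha> n] zero_sum_T[of "T n \<alpha>" "-n"] by auto

lemma zero_sum_negv: "\<alpha> \<in> \<Phi>0 \<Longrightarrow> negv \<alpha> \<in> \<Phi>0"
proof -
  assume "\<alpha> \<in> \<Phi>0"
  then obtain d where d: "\<alpha> \<in> roots" "d > 0" "T (int d) \<alpha> = \<alpha>" "(\<lambda>r. \<Sum>j<d. T (int j) \<alpha> r) = (\<lambda>r. 0)"
    by (auto simp: zero_sum_roots_def)
  have "(\<lambda>r. \<Sum>j<d. T (int j) (negv \<alpha>) r) = negv (\<lambda>r. \<Sum>j<d. T (int j) \<alpha> r)"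
    by (simp add: sh_negv[OF w] sum_negf)
  then have "(\<lambda>r. \<Sum>j<d. T (int j) (negv \<alpha>) r) = (\<lambda>r. 0)" using d(4) by (simp add: fun_eq_iff)
  moreover have "T (int d) (negv \<alpha>) = negv \<alpha>" using d(3) by (simp add: sh_negv[OF w])
  ultimately show ?thesis
    using d(1,2) unfolding zero_sum_roots_def by blast
qed

lemma zero_sum_negv_iff: "negv \<alpha> \<in> \<Phi>0 \<longleftrightarrow> \<alpha> \<in> \<Phi>0"
  using zero_sum_negv[of \<alpha>] zero_sum_negv[of "negv \<alpha>"] by auto

lemma zero_sum_root: "\<alpha> \<in> \<Phi>0 \<Longrightarrow> \<alpha> \<in> roots"
  by (simp add: zero_sum_roots_def)

section \<open>Sign changes along the orbits of w\<close>

definition descents where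
  "descents \<pi> = sep \<pi> (\<lambda>v. \<pi> (T 1 v)) \<union> negv ` sep \<pi> (\<lambda>v. \<pi> (T 1 v))"

lemma finite_descents: "inch x \<pi> \<Longrightarrow> finite (descents \<pi>)"
  using len_cj(1)[OF w] by (simp add: descents_def)

lemma descents_iff:
  assumes "inch x \<pi>"
  shows "\<alpha> \<in> descents \<pi> \<longleftrightarrow> \<alpha> \<in> roots \<and> (\<pi> \<alpha> > 0 \<and> \<pi> (T 1 \<alpha>) < 0 \<or> \<pi> \<alpha> < 0 \<and> \<pi> (T 1 \<alpha>) > 0)"
proof -
  have n: "\<pi> (negv v) = - \<pi> v" for v by (rule lin_negv[OF inchD(2)[OF assms]])
  show ?thesis
  proof
    assume "\<alpha> \<in> descents \<pi>"
    then show "\<alpha> \<in> roots \<and> (\<pi> \<alpha> > 0 \<and> \<pi> (T 1 \<alpha>) < 0 \<or> \<pi> \<alpha> < 0 \<and> \<pi> (T 1 \<alpha>) > 0)"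
      unfolding descents_def sep_def by (auto simp: n sh_negv[OF w])
  next
    assume a: "\<alpha> \<in> roots \<and> (\<pi> \<alpha> > 0 \<and> \<pi> (T 1 \<alpha>) < 0 \<or> \<pi> \<alpha> < 0 \<and> \<pi> (T 1 \<alpha>) > 0)"
    show "\<alpha> \<in> descents \<pi>"
    proof (cases "\<pi> \<alpha> > 0")
      case True
      then show ?thesis using a by (auto simp: descents_def sep_def)
    next
      case False
      then have "negv \<alpha> \<in> sep \<pi> (\<lambda>v. \<pi> (T 1 v))"
        using a by (auto simp: sep_def n sh_negv[OF w])
      then have "negv (negv \<alpha>) \<in> negv ` sep \<pi> (\<lambda>v. \<pi> (T 1 v))" by (rule imageI)
      then show ?thesis by (simp add: descents_def)
    qed
  qed
qed

lemma descents_iff_seq: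
  assumes "inch x \<pi>" "\<alpha> \<in> roots"
  shows "T n \<alpha> \<in> descents \<pi> \<longleftrightarrow> \<pi> (T n \<alpha>) > 0 \<and> \<pi> (T (n + 1) \<alpha>) < 0 \<or> \<pi> (T n \<alpha>) < 0 \<and> \<pi> (T (n + 1) \<alpha>) > 0"
  using descents_iff[OF assms(1)] assms(2) by (simp add: add.commute)

lemma aperiodic_inj:
  assumes "\<And>d. d > 0 \<Longrightarrow> T (int d) \<alpha> \<noteq> \<alpha>" "T i \<alpha> = T j \<alpha>"
  shows "i = j"
proof (rule ccontr)
  assume "i \<noteq> j"
  have per: "T (j - i) \<alpha> = \<alpha>" if "T i \<alpha> = T j \<alpha>" for i j
  proof -
    have "T (- i) (T j \<alpha>) = T (- i) (T i \<alpha>)" using that by simp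
    then show ?thesis by simp
  qed
  show False
  proof (cases "i < j")
    case True
    then show False using per[OF assms(2)] assms(1)[of "nat (j - i)"] by simp
  next
    case False
    then show False using per[OF assms(2)[symmetric]] assms(1)[of "nat (i - j)"] \<open>i \<noteq> j\<close> by simp
  qed
qed

lemma finite_sign_changes:
  assumes "inch x \<pi>" "\<alpha> \<in> roots" "\<And>d. d > 0 \<Longrightarrow> T (int d) \<alpha> \<noteq> \<alpha>"
  shows "finite {n. \<pi> (T n \<alpha>) > 0 \<and> \<pi> (T (n + 1) \<alpha>) < 0}" "finite {n. \<pi> (T n \<alpha>) < 0 \<and> \<pi> (T (n + 1) \<alpha>) > 0}"
proof -
  have "finite {n. T n \<alpha> \<in> descents \<pi>}"
    using finite_vimageI[OF finite_descents[OF assms(1)], of "\<lambda>n. T n \<alpha>"] aperiodic_inj[OF assms(3)]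
    by (auto simp: vimage_def inj_on_def)
  then show "finite {n. \<pi> (T n \<alpha>) > 0 \<and> \<pi> (T (n + 1) \<alpha>) < 0}" "finite {n. \<pi> (T n \<alpha>) < 0 \<and> \<pi> (T (n + 1) \<alpha>) > 0}"
    by (rule rev_finite_subset; use descents_iff_seq[OF assms(1,2)] in auto)+
qed

lemma periodic_seq:
  assumes "T (int d) \<alpha> = \<alpha>"
  shows "T (n + int d) \<alpha> = T n \<alpha>"
proof -
  have "T n (T (int d) \<alpha>) = T n \<alpha>" using assms by simp
  then show ?thesis by simp
qed

lemma sum_T_point:
  assumes "lin \<pi>"
  shows "\<pi> (\<lambda>r. \<Sum>j<d. T (int j) \<alpha> r) = (\<Sum>j<d. \<pi> (T (int j) \<alpha>))"
  using lin_sum[OF assms, of "\<lambda>_. 1"] by simp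

lemma zero_sum_not_const:
  assumes "inch x \<pi>" "\<alpha> \<in> \<Phi>0"
  shows "\<not> const_seq (\<lambda>n. \<pi> (T n \<alpha>))"
proof
  assume c: "const_seq (\<lambda>n. \<pi> (T n \<alpha>))"
  obtain d where d: "\<alpha> \<in> roots" "d > 0" "T (int d) \<alpha> = \<alpha>" "(\<lambda>r. \<Sum>j<d. T (int j) \<alpha> r) = (\<lambda>r. 0)"
    using assms(2) by (auto simp: zero_sum_roots_def)
  have lin: "lin \<pi>" using inchD assms by blast
  have "(\<Sum>j<d. \<pi> (T (int j) \<alpha>)) = 0"
    using sum_T_point[OF lin, where d = d and \<alpha> = \<alpha>] d(4) lin_zero[OF lin] by simp
  moreover from c have "(\<Sum>j<d. \<pi> (T (int j) \<alpha>)) \<noteq> 0"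
    unfolding const_seq_def
  proof
    assume "\<forall>n. \<pi> (T n \<alpha>) > 0"
    then have "(\<Sum>j<d. \<pi> (T (int j) \<alpha>)) > 0" using d(2) by (intro sum_pos) auto
    then show ?thesis by simp
  next
    assume "\<forall>n. \<pi> (T n \<alpha>) < 0"
    then have "(\<Sum>j<d. - \<pi> (T (int j) \<alpha>)) > 0" using d(2) by (intro sum_pos) auto
    then show ?thesis by (simp add: sum_negf)
  qed
  ultimately show False by simp
qed

text \<open>Each of these orbits is finite and contains a sign change of a fixed base point, and a
  point has only finitely many sign changes.\<close>

lemma finite_zero_sum_roots: "finite \<Phi>0"
proof -
  have ib: "inch \<one> (pt (\<lambda>_. 1))" using inch_base[of "\<one>" "\<lambda>_. 1"] by simp
  let ?\<pi> = "pt (\<lambda>_. 1)"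
  have "\<exists>p. \<forall>\<alpha>\<in>\<Phi>0. p \<alpha> > 0 \<and> T (int (p \<alpha>)) \<alpha> = \<alpha>"
    by (rule bchoice) (auto simp: zero_sum_roots_def)
  then obtain p where p: "\<And>\<alpha>. \<alpha> \<in> \<Phi>0 \<Longrightarrow> p \<alpha> > 0 \<and> T (int (p \<alpha>)) \<alpha> = \<alpha>" by blast
  have "\<Phi>0 \<subseteq> (\<Union>\<beta>\<in>descents ?\<pi> \<inter> \<Phi>0. (\<lambda>n. T n \<beta>) ` {0..<int (p \<beta>)})"
  proof
    fix \<alpha> assume a: "\<alpha> \<in> \<Phi>0"
    have "\<exists>n. ?\<pi> (T n \<alpha>) > 0 \<and> ?\<pi> (T (n + 1) \<alpha>) < 0 \<or> ?\<pi> (T n \<alpha>) < 0 \<and> ?\<pi> (T (n + 1) \<alpha>) > 0"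
      by (rule sign_change_ex[OF _ zero_sum_not_const[OF ib a]])
        (use inch_nonzero[OF ib] zero_sum_root[OF a] in auto)
    then obtain n where "T n \<alpha> \<in> descents ?\<pi>"
      using descents_iff_seq[OF ib zero_sum_root[OF a]] by blast
    moreover have b: "T n \<alpha> \<in> \<Phi>0" using a by simp
    moreover have "\<alpha> \<in> (\<lambda>m. T m (T n \<alpha>)) ` {0..<int (p (T n \<alpha>))}"
    proof
      let ?d = "int (p (T n \<alpha>))"
      show "(- n) mod ?d \<in> {0..<?d}" using p[OF b] by simp
      have "T (m + ?d) (T n \<alpha>) = T m (T n \<alpha>)" for m
        using p[OF b] by (intro periodic_seq) blast
      note per = this
      have "T ((- n) mod ?d) (T n \<alpha>) = T ((- n) mod ?d + ?d * ((- n) div ?d)) (T n \<alpha>)"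
        by (rule sym, rule periodic_int[of "\<lambda>m. T m (T n \<alpha>)"], rule per)
      also have "\<dots> = \<alpha>" by (simp only: mod_mult_div_eq) simp
      finally show "\<alpha> = T ((- n) mod ?d) (T n \<alpha>)" by simp
    qed
    ultimately show "\<alpha> \<in> (\<Union>\<beta>\<in>descents ?\<pi> \<inter> \<Phi>0. (\<lambda>n. T n \<beta>) ` {0..<int (p \<beta>)})" by blast
  qed
  then show ?thesis
    by (rule finite_subset) (use finite_descents[OF ib] in auto)
qed

definition tame_at where
  "tame_at \<pi> \<alpha> \<longleftrightarrow> const_seq (\<lambda>n. \<pi> (T n \<alpha>)) \<or> (\<exists>\<tau>. inc_seq (\<lambda>n. \<pi> (T n \<alpha>)) \<tau>) \<or> (\<exists>\<tau>. inc_seq (\<lambda>n. - \<pi> (T n \<alpha>)) \<tau>)"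

lemma inc_seq_shift: "inc_seq (\<lambda>n. a (n + k)) \<tau> \<longleftrightarrow> inc_seq a (\<tau> + k)"
proof
  assume h: "inc_seq (\<lambda>n. a (n + k)) \<tau>"
  show "inc_seq a (\<tau> + k)"
    unfolding inc_seq_def
  proof
    fix n show "(\<tau> + k \<le> n \<longrightarrow> a n > 0) \<and> (n < \<tau> + k \<longrightarrow> a n < 0)"
      using h[unfolded inc_seq_def, rule_format, of "n - k"] by auto
  qed
qed (auto simp: inc_seq_def)

lemma tame_at_T:
  assumes "tame_at \<pi> (T k \<alpha>)"
  shows "tame_at \<pi> \<alpha>"
proof -
  have "const_seq (\<lambda>n. a (n + k)) \<Longrightarrow> const_seq a" for a :: "int \<Rightarrow> real"
    unfolding const_seq_def by (metis diff_add_cancel)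
  then show ?thesis
    using assms inc_seq_shift[of "\<lambda>n. \<pi> (T n \<alpha>)" k] inc_seq_shift[of "\<lambda>n. - \<pi> (T n \<alpha>)" k]
    unfolding tame_at_def by auto
qed

text \<open>For a single root the threshold comes from smoothing a periodic sequence with nonzero
  mean or an aperiodic one with constant signs at its ends. It can be made uniform because orbits of
  constant sign stay so and every other orbit passes through a finite set of sign changes.\<close>

lemma tame_eventually:
  assumes gen: "generic \<pi>" and x: "inch x \<pi>" and \<delta>: "\<delta> > 0" "\<And>\<beta>. \<beta> \<in> roots \<Longrightarrow> \<bar>\<pi> \<beta>\<bar> \<ge> \<delta>"
  shows "\<exists>m0. \<forall>m\<ge>m0. \<forall>\<alpha>\<in>roots - \<Phi>0. tame_at (\<lambda>v. \<pi> (smo m v)) \<alpha>"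
proof -
  have lin: "lin \<pi>" using inchD x by blast
  have seq: "(\<lambda>n. \<pi> (smo m (T n \<alpha>))) = smooths m (\<lambda>n. \<pi> (T n \<alpha>))" for m \<alpha>
    by (rule ext) (rule smvs_smooths[OF w lin])
  have single: "\<exists>m0. \<forall>m\<ge>m0. tame_at (\<lambda>v. \<pi> (smo m v)) \<alpha>" if a: "\<alpha> \<in> roots - \<Phi>0" for \<alpha>
  proof (cases "\<exists>d>0. T (int d) \<alpha> = \<alpha>")
    case False
    have nz: "smooths m (\<lambda>n. \<pi> (T n \<alpha>)) n \<noteq> 0" for m n
      using generic_smvs_nonzero[OF gen, of "T n \<alpha>" m] a smvs_smooths[OF w lin, of m n \<alpha>] by simp
    have "\<bar>\<pi> (T n \<alpha>)\<bar> \<ge> \<delta>" for n using \<delta>(2) a by simp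
    note bound = this
    have "\<And>d. d > 0 \<Longrightarrow> T (int d) \<alpha> \<noteq> \<alpha>" "\<alpha> \<in> roots" using False a by blast+
    note fin = finite_sign_changes[OF x this(2) this(1)]
    show ?thesis
      unfolding tame_at_def smvs_smooths[OF w lin]
      by (rule smooths_eventually_tame[OF \<delta>(1) bound nz fin])
  next
    case True
    then obtain d where d: "d > 0" "T (int d) \<alpha> = \<alpha>" by blast
    define a where "a n = \<pi> (T n \<alpha>)" for n
    have per: "a (n + int d) = a n" for n using periodic_seq[OF d(2)] by (simp add: a_def)
    have "(\<lambda>r. \<Sum>j<d. T (int j) \<alpha> r) \<noteq> (\<lambda>r. 0)"
      using that d by (auto simp: zero_sum_roots_def)
    moreover have "intvec (\<lambda>r. \<Sum>j<d. T (int j) \<alpha> r)"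
      using that root_intvec by (intro intvec_sum intvec_sh) auto
    ultimately have "(\<Sum>j<d. a (int j)) \<noteq> 0"
      using generic_nonzero[OF gen] sum_T_point[OF lin, where d = d and \<alpha> = \<alpha>] unfolding a_def by metis
    then consider "(\<Sum>j<d. a (int j)) > 0" | "(\<Sum>j<d. - a (int j)) > 0"
      by (auto simp: sum_negf linorder_neq_iff)
    then show ?thesis
    proof cases
      case 1
      from smooths_periodic_pos[of d a, OF d(1) per 1] show ?thesis
        unfolding tame_at_def const_seq_def seq a_def by blast
    next
      case 2
      have "\<exists>m0. \<forall>m\<ge>m0. \<forall>n. smooths m (\<lambda>n. - a n) n > 0"
        using per by (intro smooths_periodic_pos[OF d(1) _ 2]) simp
      then have "\<exists>m0. \<forall>m\<ge>m0. \<forall>n. smooths m a n < 0"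
        unfolding smooths_uminus by simp
      then show ?thesis
        unfolding tame_at_def const_seq_def seq a_def by blast
    qed
  qed
  \<comment> \<open>One representative at a sign change for each non-constant orbit; tameness does
    not depend on the representative.\<close>
  let ?F = "descents \<pi> - \<Phi>0"
  have "\<exists>m0. \<forall>\<alpha>\<in>?F. \<forall>m\<ge>m0 \<alpha>. tame_at (\<lambda>v. \<pi> (smo m v)) \<alpha>"
    by (rule bchoice) (use single descents_iff[OF x] in blast)
  then obtain m0 where m0: "\<And>\<alpha> m. \<alpha> \<in> ?F \<Longrightarrow> m \<ge> m0 \<alpha> \<Longrightarrow> tame_at (\<lambda>v. \<pi> (smo m v)) \<alpha>" by blast
  have fin: "finite (m0 ` ?F)" using finite_descents[OF x] by simp
  show ?thesis
  proof (intro exI[of _ "Max (insert 0 (m0 ` ?F))"] allI impI ballI)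
    fix m \<alpha> assume m: "Max (insert 0 (m0 ` ?F)) \<le> m" and a: "\<alpha> \<in> roots - \<Phi>0"
    show "tame_at (\<lambda>v. \<pi> (smo m v)) \<alpha>"
    proof (cases "const_seq (\<lambda>n. \<pi> (T n \<alpha>))")
      case True
      then show ?thesis unfolding tame_at_def seq using smooths_const_seq by blast
    next
      case False
      have "\<exists>n. T n \<alpha> \<in> descents \<pi>"
        using sign_change_ex[OF _ False] inch_nonzero[OF x] descents_iff_seq[OF x] a by simp
      then obtain n where n: "T n \<alpha> \<in> ?F" using a zero_sum_T_iff by blast
      then have "m0 (T n \<alpha>) \<le> m" using m fin by simp
      then show ?thesis using m0[OF n] tame_at_T by blast
    qed
  qed
qed

lemma cancel_inv:
  "\<lbrakk>a \<in> carrier W; b \<in> carrier W\<rbrakk> \<Longrightarrow> a \<otimes> (inv a \<otimes> b) = b"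
  "\<lbrakk>a \<in> carrier W; b \<in> carrier W\<rbrakk> \<Longrightarrow> inv a \<otimes> (a \<otimes> b) = b"
  by (simp_all flip: m_assoc)

text \<open>By \<open>J1\<close> the walls between x and w x persist up to w y, and by
  \<open>J2\<close> so do those between x and y. The length of x^-1 w y therefore splits additively
  through w x and also through y, which is a slide.\<close>

lemma jump:
  assumes x: "inch x \<pi>" and y: "inch y \<rho>"
    and J1: "\<And>\<alpha>. \<lbrakk>\<alpha> \<in> roots; \<pi> \<alpha> > 0; \<pi> (T 1 \<alpha>) < 0\<rbrakk> \<Longrightarrow> \<rho> (T 1 \<alpha>) < 0"
    and J2: "\<And>\<alpha>. \<lbrakk>\<alpha> \<in> roots; \<pi> \<alpha> > 0; \<rho> \<alpha> < 0\<rbrakk> \<Longrightarrow> \<rho> (T 1 \<alpha>) < 0"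
  shows "good w x y"
proof -
  have c: "x \<in> carrier W" "y \<in> carrier W" using x y inchD by auto
  have "len (inv x \<otimes> (w \<otimes> y)) = len (inv x \<otimes> (w \<otimes> x)) + len (inv (w \<otimes> x) \<otimes> (w \<otimes> y))"
    by (rule inch_additive[OF x inch_shift[OF w x] inch_shift[OF w y] J1])
  moreover have "len (inv x \<otimes> (w \<otimes> y)) = len (inv x \<otimes> y) + len (inv y \<otimes> (w \<otimes> y))"
    by (rule inch_additive[OF x y inch_shift[OF w y] J2])
  moreover have "inv (w \<otimes> x) \<otimes> (w \<otimes> y) = inv x \<otimes> y"
    using c by (simp add: inv_mult_group m_assoc cancel_inv)
  moreover have "cj x w \<otimes> (inv x \<otimes> y) = inv x \<otimes> (w \<otimes> y)" "(inv x \<otimes> y) \<otimes> cj y w = inv x \<otimes> (w \<otimes> y)"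
    using c by (simp_all add: cj_def m_assoc cancel_inv)
  moreover have "inv x \<otimes> (w \<otimes> x) = cj x w" "inv y \<otimes> (w \<otimes> y) = cj y w"
    using c by (simp_all add: cj_def m_assoc)
  ultimately have "slide (cj x w) (inv x \<otimes> y) (cj y w)"
    unfolding slide_def by simp
  then show ?thesis using c by (simp add: good_def)
qed

subsection \<open>Fourier modes of a root\<close>

text \<open>Vector-valued real and imaginary parts of a Fourier coefficient of the orbit; evaluating
  a point on them gives the coefficient of its sequence of values.\<close>

definition re_mode where
  "re_mode d k \<alpha> = (\<lambda>r. \<Sum>j<d. cos (2 * pi * real k / real d * real j) * T (int j) \<alpha> r)"

definition im_mode where
  "im_mode d k \<alpha> = (\<lambda>r. \<Sum>j<d. (- sin (2 * pi * real k / real d * real j)) * T (int j) \<alpha> r)"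

lemma dft_modes:
  assumes "lin \<pi>"
  shows "dft d (\<lambda>n. \<pi> (T n \<alpha>)) k = Complex (\<pi> (re_mode d k \<alpha>)) (\<pi> (im_mode d k \<alpha>))"
  unfolding re_mode_def im_mode_def lin_sum[OF assms] dft_def
  by (simp add: complex_eq_iff sum_negf algebra_simps)

lemma modes_shift:
  fixes d k :: nat
  assumes per: "T (int d) \<alpha> = \<alpha>" and d: "d > 0"
  defines "\<phi> \<equiv> 2 * pi * real k / real d"
  shows "T 1 (re_mode d k \<alpha>) = (\<lambda>r. cos \<phi> * re_mode d k \<alpha> r - sin \<phi> * im_mode d k \<alpha> r)"
    and "T 1 (im_mode d k \<alpha>) = (\<lambda>r. cos \<phi> * im_mode d k \<alpha> r + sin \<phi> * re_mode d k \<alpha> r)"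
proof -
  have wrap: "(\<Sum>j<d. f (Suc j)) = (\<Sum>j<d. f j)" if "f d = f 0" for f :: "nat \<Rightarrow> real"
  proof -
    have "f 0 + (\<Sum>j<d. f (Suc j)) = (\<Sum>j<d. f j) + f d"
      by (metis sum.lessThan_Suc sum.lessThan_Suc_shift)
    then show ?thesis using that by simp
  qed
  have \<phi>d: "\<phi> * real d = 2 * pi * real k" using d by (simp add: \<phi>_def)
  have c2: "cos (2 * pi * real k) = 1" "sin (2 * pi * real k) = 0"
    using cos_int_2pin[of "int k"] sin_int_2pin[of "int k"] by (simp_all add: mult.commute mult.left_commute)
  have c: "cos (\<phi> * real d - \<phi>) = cos (- \<phi>)" "sin (\<phi> * real d - \<phi>) = sin (- \<phi>)"
    unfolding \<phi>d by (simp_all add: cos_diff sin_diff c2)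
  have e: "\<phi> * real (Suc j) - \<phi> = \<phi> * real j" for j by (simp add: algebra_simps)
  show "T 1 (re_mode d k \<alpha>) = (\<lambda>r. cos \<phi> * re_mode d k \<alpha> r - sin \<phi> * im_mode d k \<alpha> r)"
  proof
    fix r
    have "T 1 (re_mode d k \<alpha>) r = (\<Sum>j<d. cos (\<phi> * real (Suc j) - \<phi>) * T (int (Suc j)) \<alpha> r)"
      unfolding re_mode_def sh_sum[OF w] e by (simp add: \<phi>_def add.commute)
    also have "\<dots> = (\<Sum>j<d. cos (\<phi> * real j - \<phi>) * T (int j) \<alpha> r)"
      by (rule wrap) (simp add: c per)
    also have "\<dots> = (\<Sum>j<d. cos \<phi> * (cos (\<phi> * real j) * T (int j) \<alpha> r) - sin \<phi> * ((- sin (\<phi> * real j)) * T (int j) \<alpha> r))"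
      by (intro sum.cong refl) (simp add: cos_diff algebra_simps)
    also have "\<dots> = cos \<phi> * re_mode d k \<alpha> r - sin \<phi> * im_mode d k \<alpha> r"
      unfolding re_mode_def im_mode_def \<phi>_def sum_subtractf sum_distrib_left[symmetric] ..
    finally show "T 1 (re_mode d k \<alpha>) r = cos \<phi> * re_mode d k \<alpha> r - sin \<phi> * im_mode d k \<alpha> r" .
  qed
  show "T 1 (im_mode d k \<alpha>) = (\<lambda>r. cos \<phi> * im_mode d k \<alpha> r + sin \<phi> * re_mode d k \<alpha> r)"
  proof
    fix r
    have "T 1 (im_mode d k \<alpha>) r = (\<Sum>j<d. (- sin (\<phi> * real (Suc j) - \<phi>)) * T (int (Suc j)) \<alpha> r)"
      unfolding im_mode_def sh_sum[OF w] e by (simp add: \<phi>_def add.commute)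
    also have "\<dots> = (\<Sum>j<d. (- sin (\<phi> * real j - \<phi>)) * T (int j) \<alpha> r)"
      by (rule wrap) (simp add: c per)
    also have "\<dots> = (\<Sum>j<d. cos \<phi> * ((- sin (\<phi> * real j)) * T (int j) \<alpha> r) + sin \<phi> * (cos (\<phi> * real j) * T (int j) \<alpha> r))"
      by (intro sum.cong refl) (simp add: sin_diff algebra_simps)
    also have "\<dots> = cos \<phi> * im_mode d k \<alpha> r + sin \<phi> * re_mode d k \<alpha> r"
      unfolding re_mode_def im_mode_def \<phi>_def sum.distrib sum_distrib_left[symmetric] ..
    finally show "T 1 (im_mode d k \<alpha>) r = cos \<phi> * im_mode d k \<alpha> r + sin \<phi> * re_mode d k \<alpha> r" .
  qed
qed

text \<open>The translation rotates the pair by an angle with nonzero sine. Applied to a linear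
  relation it yields a second one, and a nontrivial relation would make both vectors zero.\<close>

lemma modes_indep:
  assumes per: "T (int d) \<alpha> = \<alpha>" and k: "0 < k" "2 * k < d"
    and nz: "re_mode d k \<alpha> \<noteq> (\<lambda>r. 0) \<or> im_mode d k \<alpha> \<noteq> (\<lambda>r. 0)"
  shows "indep (re_mode d k \<alpha>) (im_mode d k \<alpha>)"
  unfolding indep_def
proof (intro allI impI)
  fix a b
  let ?R = "re_mode d k \<alpha>" and ?I = "im_mode d k \<alpha>"
  define \<phi> where "\<phi> = 2 * pi * real k / real d"
  assume eq: "(\<lambda>r. a * ?R r + b * ?I r) = (\<lambda>r. 0)"
  have d: "d > 0" using k by simp
  have "0 < \<phi>" "\<phi> < pi" using k by (auto simp: \<phi>_def field_simps simp flip: of_nat_mult)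
  then have sin: "sin \<phi> > 0" by (rule sin_gt_zero)
  have "T 1 (\<lambda>r. a * ?R r + b * ?I r) = (\<lambda>r. 0)" unfolding eq using w by (simp add: sh_def)
  then have "a * (cos \<phi> * ?R r - sin \<phi> * ?I r) + b * (cos \<phi> * ?I r + sin \<phi> * ?R r) = 0" for r
    unfolding sh_linear[OF w] modes_shift[OF per d] \<phi>_def[symmetric] by (rule fun_cong)
  then have "cos \<phi> * (a * ?R r + b * ?I r) + sin \<phi> * (b * ?R r - a * ?I r) = 0" for r
    by (simp add: algebra_simps)
  then have h1: "b * ?R r - a * ?I r = 0" for r
    using fun_cong[OF eq, of r] sin by (metis add_0 less_irrefl mult_eq_0_iff mult_zero_right)
  have h2: "a * ?R r + b * ?I r = 0" for r using fun_cong[OF eq, of r] .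
  have "(a\<^sup>2 + b\<^sup>2) * ?R r = a * (a * ?R r + b * ?I r) + b * (b * ?R r - a * ?I r)" for r
    by (simp add: algebra_simps power2_eq_square)
  moreover have "(a\<^sup>2 + b\<^sup>2) * ?I r = b * (a * ?R r + b * ?I r) - a * (b * ?R r - a * ?I r)" for r
    by (simp add: algebra_simps power2_eq_square)
  ultimately have z: "(a\<^sup>2 + b\<^sup>2) * ?R r = 0" "(a\<^sup>2 + b\<^sup>2) * ?I r = 0" for r
    unfolding h1 h2 by simp_all
  show "a = 0 \<and> b = 0"
  proof (rule ccontr)
    assume "\<not> (a = 0 \<and> b = 0)"
    then have "a\<^sup>2 + b\<^sup>2 \<noteq> 0" by (simp add: sum_power2_eq_zero_iff)
    then have "?R = (\<lambda>r. 0)" "?I = (\<lambda>r. 0)" using z by auto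
    then show False using nz by blast
  qed
qed

lemma lin_coordinate: "lin (\<lambda>v. v r)"
  by (simp add: lin_def)

text \<open>The mode 0 vanishes because the orbit sum does. If some mode below d/2 survives, the
  lowest such mode leads, and the hypothesis on \<pi> and \<rho> makes its two coefficients
  independent over the reals. If none survives, only the mode d/2 is left.\<close>

lemma zero_sum_crossing:
  assumes \<alpha>: "\<alpha> \<in> roots" "d > 0" "T (int d) \<alpha> = \<alpha>" "(\<lambda>r. \<Sum>j<d. T (int j) \<alpha> r) = (\<lambda>r. 0)"
    and lin: "lin \<pi>" "lin \<rho>"
    and gen: "\<And>k. \<lbrakk>0 < k; 2 * k < d; indep (re_mode d k \<alpha>) (im_mode d k \<alpha>)\<rbrakk> \<Longrightarrow>
      \<pi> (im_mode d k \<alpha>) * \<rho> (re_mode d k \<alpha>) \<noteq> \<pi> (re_mode d k \<alpha>) * \<rho> (im_mode d k \<alpha>)"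
  shows "T 1 \<alpha> = negv \<alpha> \<or> (\<exists>m0. \<forall>m\<ge>m0. \<forall>x y. (x, y) \<noteq> (0, 0) \<longrightarrow> x * \<pi> (smo m \<alpha>) + y * \<rho> (smo m \<alpha>) = 0 \<longrightarrow>
     (x * \<pi> (smo m (T (-1) \<alpha>)) + y * \<rho> (smo m (T (-1) \<alpha>))) * (x * \<pi> (smo m (T 1 \<alpha>)) + y * \<rho> (smo m (T 1 \<alpha>))) < 0)"
proof -
  have per: "(T (n + int d) \<alpha>) = T n \<alpha>" for n using periodic_seq[OF \<alpha>(3)] .
  define nzm where "nzm k \<longleftrightarrow> re_mode d k \<alpha> \<noteq> (\<lambda>r. 0) \<or> im_mode d k \<alpha> \<noteq> (\<lambda>r. 0)" for k
  have zero_dft: "dft d (\<lambda>n. \<sigma> (T n \<alpha>)) k = 0" if "\<not> nzm k" "lin \<sigma>" for k \<sigma>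
  proof -
    have "re_mode d k \<alpha> = (\<lambda>r. 0)" "im_mode d k \<alpha> = (\<lambda>r. 0)" using that(1) by (auto simp: nzm_def)
    then show ?thesis unfolding dft_modes[OF that(2)] using lin_zero[OF that(2)] by (simp add: complex_eq_iff)
  qed
  have nz0: "\<not> nzm 0"
    using \<alpha>(4) by (simp add: nzm_def re_mode_def im_mode_def)
  show ?thesis
  proof (cases "\<exists>k. 2 * k < d \<and> nzm k")
    case False
    \<comment> \<open>Only the mode d/2 can remain, and its character is (-1)^n; for odd d nothing
      remains and both sides are 0.\<close>
    have "T 1 \<alpha> r = - \<alpha> r" for r
    proof -
      let ?a = "\<lambda>n. T n \<alpha> r"
      have low: "dft d ?a k = 0" if "2 * k < d" for k
        using zero_dft[OF _ lin_coordinate, of k r] False that by blast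
      have high: "dft d ?a k = 0" if "k < d" "2 * k > d" for k
      proof -
        have "dft d ?a k = cnj (dft d ?a (d - k))" using dft_cnj[of k d ?a] that by simp
        moreover have "dft d ?a (d - k) = 0" using that by (intro low) auto
        ultimately show ?thesis by simp
      qed
      have "complex_of_real (?a n) = (if even d then dft d ?a (d div 2) / of_nat d * cis (pi * of_int n) else 0)" for n
      proof -
        have p: "?a (i + int d) = ?a i" for i using per by simp
        have "complex_of_real (?a n) = (\<Sum>k<d. dft d ?a k / of_nat d * cis ((2 * pi * real k / real d) * real_of_int n))"
          by (rule dft_inversion[of d ?a, OF \<alpha>(2) p])
        also have "\<dots> = (\<Sum>k<d. if k = d div 2 then (if even d then dft d ?a (d div 2) / of_nat d * cis (pi * of_int n) else 0) else 0)"
        proof (rule sum.cong[OF refl])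
          fix k assume "k \<in> {..<d}"
          then have kd: "k < d" by simp
          consider "2 * k < d" | "2 * k > d" | "2 * k = d" by linarith
          then show "dft d ?a k / of_nat d * cis ((2 * pi * real k / real d) * real_of_int n)
              = (if k = d div 2 then (if even d then dft d ?a (d div 2) / of_nat d * cis (pi * of_int n) else 0) else 0)"
          proof cases
            case 1
            then have "even d \<longrightarrow> k \<noteq> d div 2" by auto
            then show ?thesis using low[OF 1] by auto
          next
            case 2
            then have "k \<noteq> d div 2" by auto
            then show ?thesis using high[OF kd 2] by simp
          next
            case 3
            then have "real d = 2 * real k" by simp
            then have "2 * pi * real k / real d = pi" using \<alpha>(2) by simp
            then show ?thesis using 3 by auto
          qed
        qed
        also have "\<dots> = (if even d then dft d ?a (d div 2) / of_nat d * cis (pi * of_int n) else 0)"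
          using \<alpha>(2) by simp
        finally show ?thesis .
      qed
      from this[of 1] this[of 0] have "complex_of_real (T 1 \<alpha> r) = complex_of_real (- \<alpha> r)"
        by (auto simp: w)
      then show ?thesis using of_real_eq_iff by blast
    qed
    then show ?thesis by blast
  next
    case True
    define k where "k = (LEAST k. 2 * k < d \<and> nzm k)"
    have k: "2 * k < d" "nzm k" using LeastI_ex[OF True] by (auto simp: k_def)
    have below: "\<not> nzm j" if "j < k" for j
      using not_less_Least[of j "\<lambda>k. 2 * k < d \<and> nzm k"] that k(1) by (auto simp: k_def)
    have k0: "0 < k" using nz0 k(2) by (cases k) auto
    have ind: "indep (re_mode d k \<alpha>) (im_mode d k \<alpha>)"
      using modes_indep[OF \<alpha>(3) k0 k(1)] k(2) by (simp add: nzm_def)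
    have im: "Im (dft d (\<lambda>n. \<pi> (T n \<alpha>)) k * cnj (dft d (\<lambda>n. \<rho> (T n \<alpha>)) k)) \<noteq> 0"
      unfolding dft_modes[OF lin(1)] dft_modes[OF lin(2)] using gen[OF k0 k(1) ind] by simp
    have p: "\<pi> (T (n + int d) \<alpha>) = \<pi> (T n \<alpha>)" "\<rho> (T (n + int d) \<alpha>) = \<rho> (T n \<alpha>)" for n
      using per by simp_all
    have z: "dft d (\<lambda>n. \<pi> (T n \<alpha>)) j = 0" "dft d (\<lambda>n. \<rho> (T n \<alpha>)) j = 0" if "j < k" for j
      using zero_dft below that lin by auto
    have "\<exists>m0. \<forall>m\<ge>m0. \<forall>x y. (x, y) \<noteq> (0, 0) \<longrightarrow>
        x * smooths m (\<lambda>n. \<pi> (T n \<alpha>)) 0 + y * smooths m (\<lambda>n. \<rho> (T n \<alpha>)) 0 = 0 \<longrightarrow>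
        (x * smooths m (\<lambda>n. \<pi> (T n \<alpha>)) (-1) + y * smooths m (\<lambda>n. \<rho> (T n \<alpha>)) (-1)) *
        (x * smooths m (\<lambda>n. \<pi> (T n \<alpha>)) 1 + y * smooths m (\<lambda>n. \<rho> (T n \<alpha>)) 1) < 0"
      by (rule smooths_periodic_crossing[of d "\<lambda>n. \<pi> (T n \<alpha>)" "\<lambda>n. \<rho> (T n \<alpha>)", OF \<alpha>(2) p(1) p(2) k0 k(1) z(1) z(2) im])
    then show ?thesis
      unfolding smvs_smooths[OF w lin(1), symmetric] smvs_smooths[OF w lin(2), symmetric] sh_0[OF w] by blast
  qed
qed

lemma base_point_bound:
  assumes x: "x \<in> carrier W" and t: "\<And>s. t s > 0"
  shows "\<exists>\<delta>>0. \<forall>\<beta>\<in>roots. \<bar>pt t (act (inv x) \<beta>)\<bar> \<ge> \<delta>"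
proof -
  obtain \<delta> where \<delta>: "\<delta> > 0" "\<And>\<alpha>. \<lbrakk>\<alpha> \<in> roots; nonneg \<alpha>\<rbrakk> \<Longrightarrow> pt t \<alpha> \<ge> \<delta>"
    using pt_delta[of t, OF t] by blast
  have "\<bar>pt t (act (inv x) \<beta>)\<bar> \<ge> \<delta>" if b: "\<beta> \<in> roots" for \<beta>
  proof -
    have r: "act (inv x) \<beta> \<in> roots" using x b by auto
    show ?thesis
    proof (cases "nonneg (act (inv x) \<beta>)")
      case True
      then show ?thesis using \<delta>(2)[OF r] by simp
    next
      case False
      then have "nonneg (negv (act (inv x) \<beta>))" using root_sign[OF r] by simp
      then have "pt t (negv (act (inv x) \<beta>)) \<ge> \<delta>" using r by (intro \<delta>(2)) auto
      then show ?thesis by (simp add: lin_negv[OF lin_pt])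
    qed
  qed
  then show ?thesis using \<delta>(1) by blast
qed

lemma mode_support:
  assumes "\<alpha> \<in> roots" "r \<notin> S"
  shows "re_mode d k \<alpha> r = 0" "im_mode d k \<alpha> r = 0"
proof -
  have "T n \<alpha> r = 0" for n
    using root_intvec[of "T n \<alpha>"] assms by (simp add: intvec_def)
  then show "re_mode d k \<alpha> r = 0" "im_mode d k \<alpha> r = 0"
    by (simp_all add: re_mode_def im_mode_def)
qed

text \<open>The point \<pi> is fixed before \<rho>, so each mixed condition is a linear condition on
  \<rho> with coefficients depending on \<pi>, and there are countably many of them.\<close>

lemma generic_pair_exists:
  assumes x: "x \<in> carrier W" and y: "y \<in> carrier W"
  obtains \<pi> \<rho> \<delta> where "inch x \<pi>" "inch y \<rho>" "generic \<pi>" "generic \<rho>"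
    "\<delta> > 0" "\<And>\<beta>. \<beta> \<in> roots \<Longrightarrow> \<bar>\<pi> \<beta>\<bar> \<ge> \<delta>" "\<And>\<beta>. \<beta> \<in> roots \<Longrightarrow> \<bar>\<rho> \<beta>\<bar> \<ge> \<delta>"
    "\<And>m \<alpha> \<beta>. \<lbrakk>\<alpha> \<in> roots; \<beta> \<in> roots; indep \<alpha> \<beta>\<rbrakk> \<Longrightarrow>
      \<pi> (smo m \<alpha>) * \<rho> (smo m \<beta>) \<noteq> \<pi> (smo m \<beta>) * \<rho> (smo m \<alpha>)"
    "\<And>d k \<alpha>. \<lbrakk>\<alpha> \<in> roots; indep (re_mode d k \<alpha>) (im_mode d k \<alpha>)\<rbrakk> \<Longrightarrow>
      \<pi> (im_mode d k \<alpha>) * \<rho> (re_mode d k \<alpha>) \<noteq> \<pi> (re_mode d k \<alpha>) * \<rho> (im_mode d k \<alpha>)"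
proof -
  let ?z = "\<lambda>r::'a. 0::real"
  let ?N = "UNIV :: nat set"
  define G1 where "G1 = (\<lambda>(d, k, \<alpha>). re_mode d k \<alpha>) ` (?N \<times> ?N \<times> roots) - {?z}"
  have cN: "countable ?N" by simp
  have "countable ((\<lambda>(d, k, \<alpha>). re_mode d k \<alpha>) ` (?N \<times> ?N \<times> roots))"
    by (intro countable_image countable_SIGMA cN countable_roots)
  then have c1: "countable G1" unfolding G1_def by (rule countable_Diff)
  have g1: "\<xi> \<noteq> ?z \<and> (\<forall>r. r \<notin> S \<longrightarrow> \<xi> r = 0)" if "\<xi> \<in> G1" for \<xi>
    using that mode_support unfolding G1_def by auto
  obtain t where t: "\<And>s. t s > 0" "generic (\<lambda>v. pt t (act (inv x) v))"
      "\<And>\<xi>. \<xi> \<in> G1 \<Longrightarrow> pt t (act (inv x) \<xi>) \<noteq> 0"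
    using generic_point_exists[OF x c1 g1] by blast
  define \<pi> where "\<pi> = (\<lambda>v. pt t (act (inv x) v))"
  have ix: "inch x \<pi>" unfolding \<pi>_def using inch_base[OF x t(1)] .
  have gp: "generic \<pi>" unfolding \<pi>_def by (rule t(2))
  \<comment> \<open>The value of \<rho> on this vector is the determinant of the values of \<pi> and
    \<rho> on u and v.\<close>
  define comb where "comb u v = (\<lambda>r. \<pi> u * v r + (- \<pi> v) * u r)" for u v
  have comb_nz: "comb u v \<noteq> ?z" if ind: "indep u v" and nz: "\<pi> u \<noteq> 0" for u v
  proof
    assume "comb u v = ?z"
    then have "(\<lambda>r. (- \<pi> v) * u r + \<pi> u * v r) = ?z" by (simp add: comb_def add.commute)
    then show False using ind nz unfolding indep_def by blast
  qed
  define G2a where "G2a = (\<lambda>(m, \<alpha>, \<beta>). comb (smo m \<alpha>) (smo m \<beta>)) ` (?N \<times> roots \<times> roots) - {?z}"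
  define G2b where "G2b = (\<lambda>(d, k, \<alpha>). comb (re_mode d k \<alpha>) (im_mode d k \<alpha>)) ` (?N \<times> ?N \<times> roots) - {?z}"
  have "countable ((\<lambda>(m, \<alpha>, \<beta>). comb (smo m \<alpha>) (smo m \<beta>)) ` (?N \<times> roots \<times> roots))"
    by (intro countable_image countable_SIGMA cN countable_roots)
  moreover have "countable ((\<lambda>(d, k, \<alpha>). comb (re_mode d k \<alpha>) (im_mode d k \<alpha>)) ` (?N \<times> ?N \<times> roots))"
    by (intro countable_image countable_SIGMA cN countable_roots)
  ultimately have c2: "countable (G2a \<union> G2b)"
    unfolding G2a_def G2b_def by (intro countable_Un countable_Diff)
  have sup: "smo m \<alpha> r = 0" if "\<alpha> \<in> roots" "r \<notin> S" for m \<alpha> r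
    using intvec_smvs[OF w root_intvec[OF that(1)]] that(2) by (simp add: intvec_def)
  have g2: "\<xi> \<noteq> ?z \<and> (\<forall>r. r \<notin> S \<longrightarrow> \<xi> r = 0)" if "\<xi> \<in> G2a \<union> G2b" for \<xi>
    using that sup mode_support unfolding G2a_def G2b_def by (auto simp: comb_def)
  obtain u where u: "\<And>s. u s > 0" "generic (\<lambda>v. pt u (act (inv y) v))"
      "\<And>\<xi>. \<xi> \<in> G2a \<union> G2b \<Longrightarrow> pt u (act (inv y) \<xi>) \<noteq> 0"
    using generic_point_exists[OF y c2 g2] by blast
  define \<rho> where "\<rho> = (\<lambda>v. pt u (act (inv y) v))"
  have iy: "inch y \<rho>" unfolding \<rho>_def using inch_base[OF y u(1)] .
  have gr: "generic \<rho>" unfolding \<rho>_def by (rule u(2))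
  have lin: "lin \<rho>" using inchD[OF iy] by blast
  obtain \<delta>1 where \<delta>1: "\<delta>1 > 0" "\<And>\<beta>. \<beta> \<in> roots \<Longrightarrow> \<bar>\<pi> \<beta>\<bar> \<ge> \<delta>1"
    using base_point_bound[of x t, OF x t(1)] unfolding \<pi>_def by blast
  obtain \<delta>2 where \<delta>2: "\<delta>2 > 0" "\<And>\<beta>. \<beta> \<in> roots \<Longrightarrow> \<bar>\<rho> \<beta>\<bar> \<ge> \<delta>2"
    using base_point_bound[of y u, OF y u(1)] unfolding \<rho>_def by blast
  have rho_comb: "\<rho> (comb a b) = \<pi> a * \<rho> b - \<pi> b * \<rho> a" for a b
    unfolding comb_def linD[OF lin] by simp
  have A: "\<pi> (smo m \<alpha>) * \<rho> (smo m \<beta>) \<noteq> \<pi> (smo m \<beta>) * \<rho> (smo m \<alpha>)"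
    if r: "\<alpha> \<in> roots" "\<beta> \<in> roots" "indep \<alpha> \<beta>" for m \<alpha> \<beta>
  proof -
    have "indep (smo m \<alpha>) (smo m \<beta>)" using r root_intvec by (intro indep_smvs)
    moreover have "\<pi> (smo m \<alpha>) \<noteq> 0" using generic_smvs_nonzero[OF gp r(1)] .
    ultimately have "comb (smo m \<alpha>) (smo m \<beta>) \<in> G2a"
      unfolding G2a_def using comb_nz r by (intro DiffI image_eqI[of _ _ "(m, \<alpha>, \<beta>)"]) auto
    then have "\<rho> (comb (smo m \<alpha>) (smo m \<beta>)) \<noteq> 0" unfolding \<rho>_def by (intro u(3)) blast
    then show ?thesis unfolding rho_comb by simp
  qed
  have B: "\<pi> (im_mode d k \<alpha>) * \<rho> (re_mode d k \<alpha>) \<noteq> \<pi> (re_mode d k \<alpha>) * \<rho> (im_mode d k \<alpha>)"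
    if r: "\<alpha> \<in> roots" and ind: "indep (re_mode d k \<alpha>) (im_mode d k \<alpha>)" for d k \<alpha>
  proof -
    have "re_mode d k \<alpha> \<noteq> ?z"
    proof
      assume z: "re_mode d k \<alpha> = ?z"
      have "(\<lambda>s. 1 * re_mode d k \<alpha> s + 0 * im_mode d k \<alpha> s) = ?z" unfolding z by simp
      then show False using ind unfolding indep_def by (metis zero_neq_one)
    qed
    then have "re_mode d k \<alpha> \<in> G1"
      unfolding G1_def using r by (intro DiffI image_eqI[of _ _ "(d, k, \<alpha>)"]) auto
    then have "\<pi> (re_mode d k \<alpha>) \<noteq> 0" unfolding \<pi>_def by (rule t(3))
    then have "comb (re_mode d k \<alpha>) (im_mode d k \<alpha>) \<in> G2b"
      unfolding G2b_def using comb_nz ind r by (intro DiffI image_eqI[of _ _ "(d, k, \<alpha>)"]) auto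
    then have "\<rho> (comb (re_mode d k \<alpha>) (im_mode d k \<alpha>)) \<noteq> 0" unfolding \<rho>_def by (intro u(3)) blast
    then show ?thesis unfolding rho_comb by simp
  qed
  show thesis
  proof (rule that[of \<pi> \<rho> "min \<delta>1 \<delta>2"])
    show "min \<delta>1 \<delta>2 > 0" using \<delta>1 \<delta>2 by simp
    show "min \<delta>1 \<delta>2 \<le> \<bar>\<pi> \<beta>\<bar>" if "\<beta> \<in> roots" for \<beta> using \<delta>1(2)[OF that] by simp
    show "min \<delta>1 \<delta>2 \<le> \<bar>\<rho> \<beta>\<bar>" if "\<beta> \<in> roots" for \<beta> using \<delta>2(2)[OF that] by simp
  qed (use ix iy gp gr A B in auto)
qed

text \<open>The product of the finitely many periods; over a multiple of a period the sum is still
  zero.\<close>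

lemma zero_sum_common_period:
  "\<exists>L>0. \<forall>\<alpha>\<in>\<Phi>0. T (int L) \<alpha> = \<alpha> \<and> (\<lambda>r. \<Sum>j<L. T (int j) \<alpha> r) = (\<lambda>r. 0)"
proof -
  have "\<exists>p. \<forall>\<alpha>\<in>\<Phi>0. p \<alpha> > 0 \<and> T (int (p \<alpha>)) \<alpha> = \<alpha> \<and> (\<lambda>r. \<Sum>j<p \<alpha>. T (int j) \<alpha> r) = (\<lambda>r. 0)"
    by (rule bchoice) (auto simp: zero_sum_roots_def)
  then obtain p where p: "\<And>\<alpha>. \<alpha> \<in> \<Phi>0 \<Longrightarrow> p \<alpha> > 0 \<and> T (int (p \<alpha>)) \<alpha> = \<alpha> \<and>
      (\<lambda>r. \<Sum>j<p \<alpha>. T (int j) \<alpha> r) = (\<lambda>r. 0)" by blast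
  let ?L = "prod p \<Phi>0"
  have fin: "finite \<Phi>0" by (rule finite_zero_sum_roots)
  have mult: "T (int (p \<alpha> * c)) \<alpha> = \<alpha> \<and> (\<lambda>r. \<Sum>j<p \<alpha> * c. T (int j) \<alpha> r) = (\<lambda>r. 0)" if a: "\<alpha> \<in> \<Phi>0" for \<alpha> c
  proof (induction c)
    case (Suc c)
    have per: "T (int (p \<alpha> * c) + int j) \<alpha> = T (int j) \<alpha>" for j
    proof -
      have "T (int j) (T (int (p \<alpha> * c)) \<alpha>) = T (int j) \<alpha>" using Suc by simp
      then show ?thesis by (simp add: add.commute)
    qed
    have "(\<Sum>j<p \<alpha> * Suc c. T (int j) \<alpha> r) = (\<Sum>j<p \<alpha> * c. T (int j) \<alpha> r) + (\<Sum>j<p \<alpha>. T (int j) \<alpha> r)" for r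
      using sum_split_nat[of "\<lambda>j. T (int j) \<alpha> r" "p \<alpha> * c" "p \<alpha>"] per by (simp add: add.commute)
    moreover have "(\<Sum>j<p \<alpha>. T (int j) \<alpha> r) = 0" "(\<Sum>j<p \<alpha> * c. T (int j) \<alpha> r) = 0" for r
      using p[OF a] Suc by (meson fun_cong)+
    moreover have "T (int (p \<alpha> * Suc c)) \<alpha> = \<alpha>"
      using per[of "p \<alpha>"] p[OF a] by (simp add: algebra_simps)
    ultimately show ?case by simp
  qed simp
  have "?L > 0" using p by (intro prod_pos) blast
  moreover have "T (int ?L) \<alpha> = \<alpha> \<and> (\<lambda>r. \<Sum>j<?L. T (int j) \<alpha> r) = (\<lambda>r. 0)" if "\<alpha> \<in> \<Phi>0" for \<alpha>
    using mult[OF that, of "prod p (\<Phi>0 - {\<alpha>})"] prod.remove[OF fin that, of p] by simp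
  ultimately show ?thesis by blast
qed

lemma inc_aperiodic:
  assumes "inc_seq (\<lambda>n. \<pi> (T n \<alpha>)) \<tau>" "d > 0"
  shows "T (int d) \<alpha> \<noteq> \<alpha>"
proof
  assume "T (int d) \<alpha> = \<alpha>"
  then have "T (\<tau> - 1 + int d) \<alpha> = T (\<tau> - 1) \<alpha>" by (rule periodic_seq)
  moreover have "\<pi> (T (\<tau> - 1 + int d) \<alpha>) > 0" "\<pi> (T (\<tau> - 1) \<alpha>) < 0"
    using assms unfolding inc_seq_def by auto
  ultimately show False by simp
qed

text \<open>Two points of chambers differ in sign at finitely many roots only. On an aperiodic orbit
  they thus have the same signs far out on both sides, and tameness of \<rho> leaves a single switch
  upwards.\<close>

lemma inc_transfer:
  assumes x: "inch x \<pi>" and y: "inch y \<rho>" and \<alpha>: "\<alpha> \<in> roots" and inc: "inc_seq (\<lambda>n. \<pi> (T n \<alpha>)) \<tau>"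
    and tame: "tame_at \<rho> \<alpha>"
  shows "\<exists>\<tau>'. inc_seq (\<lambda>n. \<rho> (T n \<alpha>)) \<tau>'"
proof -
  have "finite (sep \<pi> \<rho> \<union> sep \<rho> \<pi>)" using sep_card(1)[OF x y] sep_card(1)[OF y x] by simp
  then have fin: "finite {n. T n \<alpha> \<in> sep \<pi> \<rho> \<union> sep \<rho> \<pi>}"
    using finite_vimageI[of _ "\<lambda>n. T n \<alpha>"] aperiodic_inj[OF inc_aperiodic[OF inc]]
    by (auto simp: vimage_def inj_on_def)
  have same: "\<rho> (T n \<alpha>) > 0 \<longleftrightarrow> \<pi> (T n \<alpha>) > 0" if "T n \<alpha> \<notin> sep \<pi> \<rho> \<union> sep \<rho> \<pi>" for n
  proof -
    have "T n \<alpha> \<in> roots" using \<alpha> by simp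
    then show ?thesis
      using that inch_nonzero[OF x] inch_nonzero[OF y] unfolding sep_def by (auto simp: neq_iff)
  qed
  define B where "B = Max (insert 0 (abs ` {n. T n \<alpha> \<in> sep \<pi> \<rho> \<union> sep \<rho> \<pi>}))"
  have B: "\<bar>n\<bar> \<le> B" if "T n \<alpha> \<in> sep \<pi> \<rho> \<union> sep \<rho> \<pi>" for n
    unfolding B_def using fin that by (intro Max_ge) auto
  have right: "\<exists>n\<ge>M. \<rho> (T n \<alpha>) > 0" for M
  proof -
    define n where "n = max (max M \<tau>) (B + 1)"
    have "T n \<alpha> \<notin> sep \<pi> \<rho> \<union> sep \<rho> \<pi>" using B[of n] by (auto simp: n_def)
    moreover have "\<pi> (T n \<alpha>) > 0" using inc unfolding inc_seq_def n_def by auto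
    ultimately have "\<rho> (T n \<alpha>) > 0" using same by blast
    moreover have "M \<le> n" by (simp add: n_def)
    ultimately show ?thesis by blast
  qed
  have left: "\<exists>n\<le>M. \<rho> (T n \<alpha>) < 0" for M
  proof -
    define n where "n = min (min M (\<tau> - 1)) (- B - 1)"
    have n: "n \<le> M" "T n \<alpha> \<notin> sep \<pi> \<rho> \<union> sep \<rho> \<pi>" using B[of n] by (auto simp: n_def)
    have "\<pi> (T n \<alpha>) < 0" using inc unfolding inc_seq_def n_def by auto
    then have "\<not> \<rho> (T n \<alpha>) > 0" using same[OF n(2)] by auto
    then have "\<rho> (T n \<alpha>) < 0" using inch_nonzero[OF y, of "T n \<alpha>"] \<alpha> by (simp add: neq_iff)
    then show ?thesis using n(1) by auto
  qed
  have "\<not> const_seq (\<lambda>n. \<rho> (T n \<alpha>))"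
    using right[of 0] left[of 0] unfolding const_seq_def by (meson less_asym)
  moreover have "\<not> inc_seq (\<lambda>n. - \<rho> (T n \<alpha>)) \<tau>'" for \<tau>'
    using right[of \<tau>'] unfolding inc_seq_def by force
  ultimately show ?thesis using tame unfolding tame_at_def by blast
qed

text \<open>Both points are first moved to the common axis region of \<open>w\<close>, represented by a large multiple of
  a sum \<open>g\<close> of consecutive translates.  The remaining walls that separate them belong to roots
  with vanishing orbit sum; there every crossing is a cyclic shift or a commutation.\<close>

lemma good_path_core:
  assumes P: "inch x P" and Q: "inch y Q"
    and tP: "\<And>\<alpha>. \<alpha> \<in> roots - \<Phi>0 \<Longrightarrow> tame_at P \<alpha>" and tQ: "\<And>\<alpha>. \<alpha> \<in> roots - \<Phi>0 \<Longrightarrow> tame_at Q \<alpha>"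
    and nzP: "\<And>v. intvec v \<Longrightarrow> v \<noteq> (\<lambda>r. 0) \<Longrightarrow> P v \<noteq> 0"
    and sepgen: "\<And>\<alpha> \<beta>. \<alpha> \<in> \<Phi>0 \<Longrightarrow> \<beta> \<in> \<Phi>0 \<Longrightarrow> indep \<alpha> \<beta> \<Longrightarrow> P \<alpha> * Q \<beta> \<noteq> P \<beta> * Q \<alpha>"
    and cross: "\<And>\<alpha>. \<alpha> \<in> \<Phi>0 \<Longrightarrow> T 1 \<alpha> = negv \<alpha> \<or> (\<forall>a b. (a, b) \<noteq> (0, 0) \<longrightarrow> a * P \<alpha> + b * Q \<alpha> = 0 \<longrightarrow>
      (a * P (T (-1) \<alpha>) + b * Q (T (-1) \<alpha>)) * (a * P (T 1 \<alpha>) + b * Q (T 1 \<alpha>)) < 0)"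
  shows "(good w)\<^sup>*\<^sup>* x y"
proof -
  have lin: "lin P" "lin Q" using inchD P Q by auto
  have TR: "T n \<alpha> \<in> roots" if "\<alpha> \<in> roots" for n \<alpha> using that by simp
  have \<Phi>root: "\<alpha> \<in> roots" if "\<alpha> \<in> \<Phi>0" for \<alpha> using zero_sum_root[OF that] .
  have ng: "T n (negv \<alpha>) = negv (T n \<alpha>)" for n \<alpha> by (rule sh_negv[OF w])
  obtain L where L: "L > 0" "\<And>\<alpha>. \<alpha> \<in> \<Phi>0 \<Longrightarrow> T (int L) \<alpha> = \<alpha> \<and> (\<lambda>r. \<Sum>j<L. T (int j) \<alpha> r) = (\<lambda>r. 0)"
    using zero_sum_common_period by blast
  \<comment> \<open>Summing over the common period L kills the roots in \<open>\<Phi>0\<close>; k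
    moves the window forward along the orbits.\<close>
  define G where "G k v = (\<Sum>j<L. P (T (k + int j) v))" for k v
  have linG: "lin (G k)" for k
    unfolding G_def by (rule lin_sum_points) (simp add: sh_def lin_act[OF lin(1)])
  have G_vec: "G k v = P (\<lambda>r. \<Sum>j<L. T (k + int j) v r)" for k v
    unfolding G_def
    using lin_sum[OF lin(1), where c = "\<lambda>_. 1" and v = "\<lambda>j. T (k + int j) v" and A = "{..<L}"] by simp
  have shift_sum: "(\<lambda>r. \<Sum>j<L. T (k + int j) v r) = T k (\<lambda>r. \<Sum>j<L. T (int j) v r)" for k v
    unfolding T_sum by simp
  have G0: "G k \<alpha> = 0" if "\<alpha> \<in> \<Phi>0" for k \<alpha>
    unfolding G_vec shift_sum using L(2)[OF that] lin_zero[OF lin(1)] by (simp add: T_zero)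
  have Gnz: "G k \<alpha> \<noteq> 0" if a: "\<alpha> \<in> roots - \<Phi>0" for k \<alpha>
    unfolding G_vec
  proof (rule nzP)
    show "intvec (\<lambda>r. \<Sum>j<L. T (k + int j) \<alpha> r)"
      using a root_intvec by (intro intvec_sum intvec_sh[OF w]) auto
    \<comment> \<open>Consecutive window sums differ by T^L \<alpha> - \<alpha>. If they vanish,
      \<alpha> is periodic with zero sum.\<close>
    show "(\<lambda>r. \<Sum>j<L. T (k + int j) \<alpha> r) \<noteq> (\<lambda>r. 0)"
    proof
      assume "(\<lambda>r. \<Sum>j<L. T (k + int j) \<alpha> r) = (\<lambda>r. 0)"
      then have "T (-k) (T k (\<lambda>r. \<Sum>j<L. T (int j) \<alpha> r)) = (\<lambda>r. 0)"
        unfolding shift_sum by (simp add: T_zero)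
      then have s0: "(\<lambda>r. \<Sum>j<L. T (int j) \<alpha> r) = (\<lambda>r. 0)" by simp
      have "(\<lambda>r. \<Sum>j<L. T (1 + int j) \<alpha> r) = (\<lambda>r. 0)"
        unfolding shift_sum s0 by (rule T_zero)
      then have h: "(\<Sum>j<L. T (1 + int j) \<alpha> r) = 0" "(\<Sum>j<L. T (int j) \<alpha> r) = 0" for r
        using s0 by (meson fun_cong)+
      have h3: "(\<Sum>j<L. T (int j) \<alpha> r) + T (int L) \<alpha> r = \<alpha> r + (\<Sum>j<L. T (1 + int j) \<alpha> r)" for r
        using sum.lessThan_Suc_shift[of "\<lambda>j. T (int j) \<alpha> r" L] by simp
      have "T (int L) \<alpha> r = \<alpha> r" for r using h[of r] h3[of r] by linarith
      then have "T (int L) \<alpha> = \<alpha>" by blast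
      then have "\<alpha> \<in> \<Phi>0" using a L(1) s0 unfolding zero_sum_roots_def by blast
      then show False using a by simp
    qed
  qed
  have Gseq: "(\<lambda>n. G k (T n \<alpha>)) = (\<lambda>n. \<Sum>j<L. P (T (n + k + int j) \<alpha>))" for k \<alpha>
    unfolding G_def by (simp add: add.commute add.left_commute)
  have G_const: "const_seq (\<lambda>n. G k (T n \<alpha>))" if "const_seq (\<lambda>n. P (T n \<alpha>))" for k \<alpha>
    using that unfolding const_seq_def Gseq
  proof (elim disjE)
    assume "\<forall>n. P (T n \<alpha>) > 0"
    then have "(\<Sum>j<L. P (T (n + k + int j) \<alpha>)) > 0" for n using L(1) by (intro sum_pos) auto
    then show "(\<forall>n. (\<Sum>j<L. P (T (n + k + int j) \<alpha>)) > 0) \<or> (\<forall>n. (\<Sum>j<L. P (T (n + k + int j) \<alpha>)) < 0)" by blast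
  next
    assume "\<forall>n. P (T n \<alpha>) < 0"
    then have "(\<Sum>j<L. - P (T (n + k + int j) \<alpha>)) > 0" for n using L(1) by (intro sum_pos) auto
    then show "(\<forall>n. (\<Sum>j<L. P (T (n + k + int j) \<alpha>)) > 0) \<or> (\<forall>n. (\<Sum>j<L. P (T (n + k + int j) \<alpha>)) < 0)"
      by (simp add: sum_negf)
  qed
  have G_inc: "\<exists>\<tau>'\<le>\<tau> - k. inc_seq (\<lambda>n. G k (T n \<alpha>)) \<tau>'"
    if a: "\<alpha> \<in> roots - \<Phi>0" and inc: "inc_seq (\<lambda>n. P (T n \<alpha>)) \<tau>" for \<alpha> \<tau> k
  proof -
    have "(\<Sum>j<L. P (T (n + int j) \<alpha>)) \<noteq> 0" for n
      using Gnz[OF a, of n] unfolding G_def by simp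
    then obtain \<tau>0 where t: "\<tau>0 \<le> \<tau>" "inc_seq (\<lambda>n. \<Sum>j<L. P (T (n + int j) \<alpha>)) \<tau>0"
      using window_inc_seq[OF inc] by blast
    then have "inc_seq (\<lambda>n. G k (T n \<alpha>)) (\<tau>0 - k)"
      unfolding Gseq inc_seq_shift[where a = "\<lambda>n. \<Sum>j<L. P (T (n + int j) \<alpha>)" and k = k] by simp
    then show ?thesis using t(1) by (intro exI[of _ "\<tau>0 - k"]) simp
  qed
  have "\<exists>D. \<forall>\<beta>\<in>descents P. \<forall>\<tau> \<tau>'. inc_seq (\<lambda>n. P (T n \<beta>)) \<tau> \<longrightarrow> inc_seq (\<lambda>n. Q (T n \<beta>)) \<tau>' \<longrightarrow> \<tau> - \<tau>' \<le> D \<beta>"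
  proof (rule bchoice, rule ballI)
    fix \<beta>
    show "\<exists>d. \<forall>\<tau> \<tau>'. inc_seq (\<lambda>n. P (T n \<beta>)) \<tau> \<longrightarrow> inc_seq (\<lambda>n. Q (T n \<beta>)) \<tau>' \<longrightarrow> \<tau> - \<tau>' \<le> d"
    proof (cases "\<exists>\<tau> \<tau>'. inc_seq (\<lambda>n. P (T n \<beta>)) \<tau> \<and> inc_seq (\<lambda>n. Q (T n \<beta>)) \<tau>'")
      case True
      then obtain \<tau> \<tau>' where "inc_seq (\<lambda>n. P (T n \<beta>)) \<tau>" "inc_seq (\<lambda>n. Q (T n \<beta>)) \<tau>'" by blast
      then show ?thesis by (intro exI[of _ "\<tau> - \<tau>'"]) (auto dest: inc_seq_unique)
    qed blast
  qed
  then obtain D where D: "\<And>\<beta> \<tau> \<tau>'. \<lbrakk>\<beta> \<in> descents P; inc_seq (\<lambda>n. P (T n \<beta>)) \<tau>; inc_seq (\<lambda>n. Q (T n \<beta>)) \<tau>'\<rbrakk> \<Longrightarrow> \<tau> - \<tau>' \<le> D \<beta>"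
    by blast
  \<comment> \<open>Bounds how much later P switches than Q; representatives at the sign changes of
    P reduce this to finitely many orbits. With this shift g switches no later than P and no later
    than Q.\<close>
  define k where "k = Max (insert 0 (D ` descents P))"
  have finD: "finite (D ` descents P)" using finite_descents[OF P] by simp
  have k0: "k \<ge> 0" using finD by (simp add: k_def)
  have k_ge: "\<tau> - k \<le> \<tau>'" if a: "\<alpha> \<in> roots" and inc: "inc_seq (\<lambda>n. P (T n \<alpha>)) \<tau>" "inc_seq (\<lambda>n. Q (T n \<alpha>)) \<tau>'" for \<alpha> \<tau> \<tau>'
  proof -
    let ?\<beta> = "T (\<tau> - 1) \<alpha>"
    have "P (T (\<tau> - 1) \<alpha>) < 0" "P (T (\<tau> - 1 + 1) \<alpha>) > 0"
      using inc(1) unfolding inc_seq_def by auto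
    then have b: "?\<beta> \<in> descents P" using descents_iff_seq[OF P a] by blast
    have "inc_seq (\<lambda>n. P (T n ?\<beta>)) 1" "inc_seq (\<lambda>n. Q (T n ?\<beta>)) (\<tau>' - (\<tau> - 1))"
      using inc_seq_shift[where a = "\<lambda>n. P (T n \<alpha>)" and k = "\<tau> - 1" and \<tau> = 1] inc_seq_shift[where a = "\<lambda>n. Q (T n \<alpha>)" and k = "\<tau> - 1" and \<tau> = "\<tau>' - (\<tau> - 1)"] inc
      by simp_all
    from D[OF b this] have "\<tau> - \<tau>' \<le> D ?\<beta>" by simp
    also have "\<dots> \<le> k" unfolding k_def using finD b by (intro Max_ge) auto
    finally show ?thesis by simp
  qed
  define g where "g = G k"
  have ling: "lin g" unfolding g_def by (rule linG)
  have shiftP: "\<exists>z. inch z (\<lambda>v. P (T (k + int j) v))" for j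
    using inch_shift_nat[OF w P, of "nat k + j"] k0 by simp
  define E where "E = {\<alpha> \<in> roots. g \<alpha> > 0 \<and> (P \<alpha> < 0 \<or> Q \<alpha> < 0)}"
  have "E \<subseteq> (\<Union>j<L. sep (\<lambda>v. P (T (k + int j) v)) P \<union> sep (\<lambda>v. P (T (k + int j) v)) Q)"
  proof
    fix \<alpha> assume a: "\<alpha> \<in> E"
    have "\<exists>j<L. P (T (k + int j) \<alpha>) > 0"
    proof (rule ccontr)
      assume "\<not> ?thesis"
      then have "g \<alpha> \<le> 0" unfolding g_def G_def by (intro sum_nonpos) (metis lessThan_iff not_less)
      then show False using a by (simp add: E_def)
    qed
    then show "\<alpha> \<in> (\<Union>j<L. sep (\<lambda>v. P (T (k + int j) v)) P \<union> sep (\<lambda>v. P (T (k + int j) v)) Q)"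
      using a by (auto simp: E_def sep_def)
  qed
  moreover have "finite (sep (\<lambda>v. P (T (k + int j) v)) P \<union> sep (\<lambda>v. P (T (k + int j) v)) Q)" for j
    using shiftP[of j] sep_card(1) P Q by blast
  ultimately have finE: "finite E" using finite_subset[OF _ finite_UN_I[of "{..<L}"]] by blast
  \<comment> \<open>Only finitely many roots have g positive and P or Q negative; K is large enough
    for K g to dominate on each of them.\<close>
  define K where "K = 1 + (\<Sum>\<alpha>\<in>E. (\<bar>P \<alpha>\<bar> + \<bar>Q \<alpha>\<bar>) / g \<alpha>)"
  have sum0: "(\<Sum>\<alpha>\<in>E. (\<bar>P \<alpha>\<bar> + \<bar>Q \<alpha>\<bar>) / g \<alpha>) \<ge> 0" by (intro sum_nonneg) (auto simp: E_def)
  then have K1: "K \<ge> 1" by (simp add: K_def)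
  have pos: "P \<alpha> + K * g \<alpha> > 0" "Q \<alpha> + K * g \<alpha> > 0" if a: "\<alpha> \<in> roots" "g \<alpha> > 0" for \<alpha>
  proof -
    have "P \<alpha> + K * g \<alpha> > 0 \<and> Q \<alpha> + K * g \<alpha> > 0"
    proof (cases "\<alpha> \<in> E")
      case True
      have "(\<bar>P \<alpha>\<bar> + \<bar>Q \<alpha>\<bar>) / g \<alpha> \<le> (\<Sum>\<alpha>\<in>E. (\<bar>P \<alpha>\<bar> + \<bar>Q \<alpha>\<bar>) / g \<alpha>)"
        using finE True by (intro member_le_sum) (auto simp: E_def)
      then have "(\<bar>P \<alpha>\<bar> + \<bar>Q \<alpha>\<bar>) / g \<alpha> < K" by (simp add: K_def)
      then have "\<bar>P \<alpha>\<bar> + \<bar>Q \<alpha>\<bar> < K * g \<alpha>" using a(2) by (simp add: pos_divide_less_eq)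
      then show ?thesis by linarith
    next
      case False
      have "K * g \<alpha> > 0" using a K1 by simp
      then show ?thesis using False a by (auto simp: E_def not_less)
    qed
    then show "P \<alpha> + K * g \<alpha> > 0" "Q \<alpha> + K * g \<alpha> > 0" by auto
  qed
  have neg: "P \<alpha> + K * g \<alpha> < 0" "Q \<alpha> + K * g \<alpha> < 0" if a: "\<alpha> \<in> roots" "g \<alpha> < 0" for \<alpha>
    using pos[of "negv \<alpha>"] negv_root[OF a(1)] a(2)
    by (simp_all add: lin_negv[OF ling] lin_negv[OF lin(1)] lin_negv[OF lin(2)])
  have gnz: "g \<alpha> \<noteq> 0" if "\<alpha> \<in> roots - \<Phi>0" for \<alpha> using Gnz[OF that] by (simp add: g_def)
  have g0: "g \<alpha> = 0" if "\<alpha> \<in> \<Phi>0" for \<alpha> using G0[OF that] by (simp add: g_def)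
  have gneg: "finite {\<alpha> \<in> roots. nonneg \<alpha> \<and> g \<alpha> < 0}"
  proof -
    have "{\<alpha> \<in> roots. nonneg \<alpha> \<and> g \<alpha> < 0} \<subseteq> (\<Union>j<L. {\<alpha> \<in> roots. nonneg \<alpha> \<and> P (T (k + int j) \<alpha>) < 0})"
    proof
      fix \<alpha> assume a: "\<alpha> \<in> {\<alpha> \<in> roots. nonneg \<alpha> \<and> g \<alpha> < 0}"
      have "\<exists>j<L. P (T (k + int j) \<alpha>) < 0"
      proof (rule ccontr)
        assume "\<not> ?thesis"
        then have "g \<alpha> \<ge> 0" unfolding g_def G_def by (intro sum_nonneg) (metis lessThan_iff not_less)
        then show False using a by simp
      qed
      then show "\<alpha> \<in> (\<Union>j<L. {\<alpha> \<in> roots. nonneg \<alpha> \<and> P (T (k + int j) \<alpha>) < 0})" using a by blast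
    qed
    moreover have "finite {\<alpha> \<in> roots. nonneg \<alpha> \<and> P (T (k + int j) \<alpha>) < 0}" for j
      using shiftP[of j] inch_finite_neg by blast
    ultimately show ?thesis using finite_subset[OF _ finite_UN_I[of "{..<L}"]] by blast
  qed
  have axis: "\<exists>z. inch z (\<lambda>v. R v + K * g v)"
    if R: "inch z R" and Rp: "\<And>\<alpha>. \<alpha> \<in> roots \<Longrightarrow> g \<alpha> > 0 \<Longrightarrow> R \<alpha> + K * g \<alpha> > 0"
      and Rn: "\<And>\<alpha>. \<alpha> \<in> roots \<Longrightarrow> g \<alpha> < 0 \<Longrightarrow> R \<alpha> + K * g \<alpha> < 0" for R z
  proof (rule chamber_exists)
    show "lin (\<lambda>v. R v + K * g v)" using lin_combine[OF inchD(2)[OF R] ling, of 1 K] by simp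
    show "R \<alpha> + K * g \<alpha> \<noteq> 0" if a: "\<alpha> \<in> roots" for \<alpha>
    proof (cases "g \<alpha>" "0 :: real" rule: linorder_cases)
      case equal
      then show ?thesis using inch_nonzero[OF R a] by simp
    qed (use Rp[OF a] Rn[OF a] in auto)
    have "{\<alpha> \<in> roots. nonneg \<alpha> \<and> R \<alpha> + K * g \<alpha> < 0} \<subseteq> {\<alpha> \<in> roots. nonneg \<alpha> \<and> R \<alpha> < 0} \<union> {\<alpha> \<in> roots. nonneg \<alpha> \<and> g \<alpha> < 0}"
    proof
      fix \<alpha> assume a: "\<alpha> \<in> {\<alpha> \<in> roots. nonneg \<alpha> \<and> R \<alpha> + K * g \<alpha> < 0}"
      then have "\<not> g \<alpha> > 0" using Rp[of \<alpha>] by auto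
      then show "\<alpha> \<in> {\<alpha> \<in> roots. nonneg \<alpha> \<and> R \<alpha> < 0} \<union> {\<alpha> \<in> roots. nonneg \<alpha> \<and> g \<alpha> < 0}"
        using a by (cases "g \<alpha> = 0") auto
    qed
    then show "finite {\<alpha> \<in> roots. nonneg \<alpha> \<and> R \<alpha> + K * g \<alpha> < 0}"
      by (rule finite_subset) (simp add: gneg inch_finite_neg[OF R])
  qed
  \<comment> \<open>Off \<open>\<Phi>0\<close> the point R + K g has the sign of g, and g switches
    no later than R; on \<open>\<Phi>0\<close> it has the sign of R. Both hypotheses of
    \<open>jump\<close> follow, so one slide reaches the axis region.\<close>
  have to_axis: "good w xR z"
    if R: "inch xR R" and z: "inch z (\<lambda>v. R v + K * g v)"
      and Rp: "\<And>\<alpha>. \<alpha> \<in> roots \<Longrightarrow> g \<alpha> > 0 \<Longrightarrow> R \<alpha> + K * g \<alpha> > 0"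
      and Rn: "\<And>\<alpha>. \<alpha> \<in> roots \<Longrightarrow> g \<alpha> < 0 \<Longrightarrow> R \<alpha> + K * g \<alpha> < 0"
      and pat: "\<And>\<alpha>. \<alpha> \<in> roots - \<Phi>0 \<Longrightarrow>
        const_seq (\<lambda>n. R (T n \<alpha>)) \<and> const_seq (\<lambda>n. g (T n \<alpha>)) \<or>
        (\<exists>\<tau> \<tau>'. inc_seq (\<lambda>n. R (T n \<alpha>)) \<tau> \<and> inc_seq (\<lambda>n. g (T n \<alpha>)) \<tau>' \<and> \<tau>' \<le> \<tau>) \<or>
        (\<exists>\<tau> \<tau>'. inc_seq (\<lambda>n. - R (T n \<alpha>)) \<tau> \<and> inc_seq (\<lambda>n. - g (T n \<alpha>)) \<tau>' \<and> \<tau>' \<le> \<tau>)" for xR R z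
  proof (rule jump[OF R z])
    fix \<alpha> assume a: "\<alpha> \<in> roots" "R \<alpha> > 0" "R (T 1 \<alpha>) < 0"
    show "R (T 1 \<alpha>) + K * g (T 1 \<alpha>) < 0"
    proof (cases "\<alpha> \<in> \<Phi>0")
      case True
      then show ?thesis using a g0[of "T 1 \<alpha>"] zero_sum_T[OF True, of 1] by simp
    next
      case False
      have seq: "R (T 0 \<alpha>) > 0" "R (T 1 \<alpha>) < 0" using a by simp_all
      have "\<not> const_seq (\<lambda>n. R (T n \<alpha>))"
        using seq unfolding const_seq_def by (meson less_asym)
      moreover have "\<not> inc_seq (\<lambda>n. R (T n \<alpha>)) \<tau>" for \<tau>
      proof
        assume h: "inc_seq (\<lambda>n. R (T n \<alpha>)) \<tau>"
        have "\<tau> \<le> 0" using h[unfolded inc_seq_def, rule_format, of 0] seq(1) by linarith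
        then show False using h[unfolded inc_seq_def, rule_format, of 1] seq(2) by linarith
      qed
      ultimately obtain \<tau> \<tau>' where t: "inc_seq (\<lambda>n. - R (T n \<alpha>)) \<tau>" "inc_seq (\<lambda>n. - g (T n \<alpha>)) \<tau>'" "\<tau>' \<le> \<tau>"
        using pat[of \<alpha>] a False by blast
      have "\<tau> \<le> 1" using t(1)[unfolded inc_seq_def, rule_format, of 1] seq(2) by linarith
      then have "- g (T 1 \<alpha>) > 0" using t(3) t(2)[unfolded inc_seq_def, rule_format, of 1] by linarith
      then show ?thesis using Rn[of "T 1 \<alpha>"] TR[OF a(1)] by simp
    qed
  next
    fix \<alpha> assume a: "\<alpha> \<in> roots" "R \<alpha> > 0" "R \<alpha> + K * g \<alpha> < 0"
    have F: "\<alpha> \<notin> \<Phi>0" using a g0[of \<alpha>] by auto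
    have gn: "g \<alpha> < 0" using Rp[OF a(1)] gnz[of \<alpha>] a F by force
    have seq: "R (T 0 \<alpha>) > 0" "g (T 0 \<alpha>) < 0" using a gn by simp_all
    have "g (T 1 \<alpha>) < 0"
      using pat[of \<alpha>, OF DiffI[OF a(1) F]]
    proof (elim disjE exE conjE)
      assume "const_seq (\<lambda>n. g (T n \<alpha>))"
      then show ?thesis using seq(2) unfolding const_seq_def by (meson less_asym)
    next
      fix \<tau> \<tau>' assume t: "inc_seq (\<lambda>n. R (T n \<alpha>)) \<tau>" "inc_seq (\<lambda>n. g (T n \<alpha>)) \<tau>'" "\<tau>' \<le> \<tau>"
      have "\<tau> \<le> 0" using t(1)[unfolded inc_seq_def, rule_format, of 0] seq(1) by linarith
      then show ?thesis using t(3) t(2)[unfolded inc_seq_def, rule_format, of 0] seq(2) by linarith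
    next
      fix \<tau> \<tau>' assume t: "inc_seq (\<lambda>n. - R (T n \<alpha>)) \<tau>" "inc_seq (\<lambda>n. - g (T n \<alpha>)) \<tau>'" "\<tau>' \<le> \<tau>"
      have "\<tau>' \<le> 0" using t(2)[unfolded inc_seq_def, rule_format, of 0] seq(2) by linarith
      then show ?thesis using t(2)[unfolded inc_seq_def, rule_format, of 1] by linarith
    qed
    then show "R (T 1 \<alpha>) + K * g (T 1 \<alpha>) < 0" using Rn[of "T 1 \<alpha>"] TR[OF a(1)] by simp
  qed
  have uminus_seq: "(\<lambda>n. R (T n (negv \<alpha>))) = (\<lambda>n. - R (T n \<alpha>))" if "lin R" for R \<alpha>
    unfolding ng by (simp add: lin_negv[OF that])
  have negF: "negv \<alpha> \<in> roots - \<Phi>0" if "\<alpha> \<in> roots - \<Phi>0" for \<alpha>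
    using that zero_sum_negv_iff by auto
  have patP: "const_seq (\<lambda>n. P (T n \<alpha>)) \<and> const_seq (\<lambda>n. g (T n \<alpha>)) \<or>
        (\<exists>\<tau> \<tau>'. inc_seq (\<lambda>n. P (T n \<alpha>)) \<tau> \<and> inc_seq (\<lambda>n. g (T n \<alpha>)) \<tau>' \<and> \<tau>' \<le> \<tau>) \<or>
        (\<exists>\<tau> \<tau>'. inc_seq (\<lambda>n. - P (T n \<alpha>)) \<tau> \<and> inc_seq (\<lambda>n. - g (T n \<alpha>)) \<tau>' \<and> \<tau>' \<le> \<tau>)"
    if a: "\<alpha> \<in> roots - \<Phi>0" for \<alpha>
    using tP[OF a] unfolding tame_at_def
  proof (elim disjE exE)
    assume "const_seq (\<lambda>n. P (T n \<alpha>))"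
    then show ?thesis using G_const[of \<alpha> k] unfolding g_def by blast
  next
    fix \<tau> assume "inc_seq (\<lambda>n. P (T n \<alpha>)) \<tau>"
    then show ?thesis using G_inc[OF a, of \<tau> k] k0 unfolding g_def by fastforce
  next
    fix \<tau> assume i: "inc_seq (\<lambda>n. - P (T n \<alpha>)) \<tau>"
    then have "inc_seq (\<lambda>n. P (T n (negv \<alpha>))) \<tau>" unfolding uminus_seq[OF lin(1)] .
    from G_inc[OF negF[OF a] this, of k] obtain \<tau>' where "\<tau>' \<le> \<tau> - k" "inc_seq (\<lambda>n. g (T n (negv \<alpha>))) \<tau>'"
      unfolding g_def by blast
    then show ?thesis using i k0 unfolding uminus_seq[OF ling] by fastforce
  qed
  have patQ: "const_seq (\<lambda>n. Q (T n \<alpha>)) \<and> const_seq (\<lambda>n. g (T n \<alpha>)) \<or>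
        (\<exists>\<tau> \<tau>'. inc_seq (\<lambda>n. Q (T n \<alpha>)) \<tau> \<and> inc_seq (\<lambda>n. g (T n \<alpha>)) \<tau>' \<and> \<tau>' \<le> \<tau>) \<or>
        (\<exists>\<tau> \<tau>'. inc_seq (\<lambda>n. - Q (T n \<alpha>)) \<tau> \<and> inc_seq (\<lambda>n. - g (T n \<alpha>)) \<tau>' \<and> \<tau>' \<le> \<tau>)"
    if a: "\<alpha> \<in> roots - \<Phi>0" for \<alpha>
  proof -
    have incQ: "\<exists>\<tau>'. inc_seq (\<lambda>n. g (T n \<beta>)) \<tau>' \<and> \<tau>' \<le> \<tau>"
      if b: "\<beta> \<in> roots - \<Phi>0" and i: "inc_seq (\<lambda>n. Q (T n \<beta>)) \<tau>" for \<beta> \<tau>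
    proof -
      have br: "\<beta> \<in> roots" using b by simp
      obtain \<tau>P where p: "inc_seq (\<lambda>n. P (T n \<beta>)) \<tau>P" using inc_transfer[OF Q P br i tP[OF b]] by blast
      have "\<tau>P - k \<le> \<tau>" by (rule k_ge[OF br p i])
      then show ?thesis using G_inc[OF b p, of k] unfolding g_def by fastforce
    qed
    show ?thesis
      using tQ[OF a] unfolding tame_at_def
    proof (elim disjE exE)
      assume cQ: "const_seq (\<lambda>n. Q (T n \<alpha>))"
      have no: "\<not> inc_seq (\<lambda>n. P (T n \<beta>)) \<tau>" if b: "\<beta> \<in> roots - \<Phi>0" "const_seq (\<lambda>n. Q (T n \<beta>))" for \<beta> \<tau>
        using inc_transfer[OF P Q _ _ tQ[OF b(1)]] b inc_not_const by blast
      have "const_seq (\<lambda>n. Q (T n (negv \<alpha>)))"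
        unfolding uminus_seq[OF lin(2)] using cQ by (auto simp: const_seq_def)
      then have "\<not> inc_seq (\<lambda>n. - P (T n \<alpha>)) \<tau>" for \<tau>
        using no[OF negF[OF a], of \<tau>] unfolding uminus_seq[OF lin(1)] by blast
      then have "const_seq (\<lambda>n. P (T n \<alpha>))"
        using tP[OF a] no[OF a cQ] unfolding tame_at_def by blast
      then show ?thesis using cQ G_const[of \<alpha> k] unfolding g_def by blast
    next
      fix \<tau> assume "inc_seq (\<lambda>n. Q (T n \<alpha>)) \<tau>"
      then show ?thesis using incQ[OF a] by blast
    next
      fix \<tau> assume i: "inc_seq (\<lambda>n. - Q (T n \<alpha>)) \<tau>"
      then have "inc_seq (\<lambda>n. Q (T n (negv \<alpha>))) \<tau>" unfolding uminus_seq[OF lin(2)] .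
      from incQ[OF negF[OF a] this] show ?thesis using i unfolding uminus_seq[OF ling] by blast
    qed
  qed
  define rP where "rP = (\<lambda>v. P v + K * g v)"
  define rQ where "rQ = (\<lambda>v. Q v + K * g v)"
  obtain zP where zP: "inch zP rP" using axis[OF P pos(1) neg(1)] unfolding rP_def by blast
  obtain zQ where zQ: "inch zQ rQ" using axis[OF Q pos(2) neg(2)] unfolding rQ_def by blast
  have goodP: "good w x zP" by (rule to_axis[OF P _ pos(1) neg(1) patP]) (use zP rP_def in auto)
  have goodQ: "good w y zQ" by (rule to_axis[OF Q _ pos(2) neg(2) patQ]) (use zQ rQ_def in auto)
  have onPhi: "rP \<alpha> = P \<alpha>" "rQ \<alpha> = Q \<alpha>" if "\<alpha> \<in> \<Phi>0" for \<alpha> using g0[OF that] by (simp_all add: rP_def rQ_def)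
  have same: "rP \<alpha> > 0 \<and> rQ \<alpha> > 0 \<or> rP \<alpha> < 0 \<and> rQ \<alpha> < 0" if a: "\<alpha> \<in> roots" "\<alpha> \<notin> \<Phi>0" for \<alpha>
    using gnz[of \<alpha>] a pos[of \<alpha>] neg[of \<alpha>] unfolding rP_def rQ_def by (auto simp: neq_iff)
  have "(gallery_step rP rQ)\<^sup>*\<^sup>* zP zQ"
  proof (rule gallery[OF zP zQ])
    fix \<alpha> \<beta> assume *: "\<alpha> \<in> sep rP rQ" "\<beta> \<in> sep rP rQ" "\<alpha> \<noteq> \<beta>"
    then have r: "\<alpha> \<in> roots" "\<beta> \<in> roots" "rP \<alpha> > 0" "rQ \<alpha> < 0" "rP \<beta> > 0" "rQ \<beta> < 0" by (auto simp: sep_def)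
    then have m: "\<alpha> \<in> \<Phi>0" "\<beta> \<in> \<Phi>0" using same[of \<alpha>] same[of \<beta>] by force+
    have "\<alpha> \<noteq> negv \<beta>"
    proof
      assume "\<alpha> = negv \<beta>"
      then have "P \<alpha> = - P \<beta>" by (simp add: lin_negv[OF lin(1)])
      then show False using r onPhi m by simp
    qed
    then have "indep \<alpha> \<beta>" using r * by (intro indep_roots)
    then show "rP \<alpha> * rQ \<beta> \<noteq> rP \<beta> * rQ \<alpha>" using sepgen m by (simp add: onPhi)
  qed
  moreover have "gallery_step rP rQ \<le> good w"
  proof (intro predicate2I)
    fix z z' assume "gallery_step rP rQ z z'"
    then obtain s \<sigma> where s: "z' = z \<otimes> s" "between rP rQ \<sigma>" "crosses \<sigma> z s"
      unfolding gallery_step_def by blast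
    obtain a b where ab: "a > 0" "b > 0" "\<sigma> = (\<lambda>v. a * rP v + b * rQ v)" using s(2) unfolding between_def by blast
    let ?\<alpha> = "act z (srt s)"
    have z: "z \<in> carrier W" "s \<in> S" "\<sigma> ?\<alpha> = 0" using s(3) by (auto simp: crosses_def)
    have r: "?\<alpha> \<in> roots" using z by auto
    \<comment> \<open>On other roots \<open>rP\<close> and \<open>rQ\<close> have the same sign, so
      no positive combination vanishes there.\<close>
    have m: "?\<alpha> \<in> \<Phi>0"
    proof (rule ccontr)
      assume "?\<alpha> \<notin> \<Phi>0"
      then have "\<sigma> ?\<alpha> > 0 \<or> \<sigma> ?\<alpha> < 0"
        using same[OF r] ab by (auto simp: add_pos_pos add_neg_neg mult_pos_neg)
      then show False using z by simp
    qed
    have val: "\<sigma> (T n ?\<alpha>) = a * P (T n ?\<alpha>) + b * Q (T n ?\<alpha>)" for n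
      using onPhi[OF zero_sum_T[OF m, of n]] by (simp add: ab)
    have zero: "a * P ?\<alpha> + b * Q ?\<alpha> = 0" using val[of 0] z by simp
    have "len (cj (z \<otimes> s) w) = len (cj z w)"
    proof (rule crossing_len[OF s(3) w])
      show "\<sigma> (act w ?\<alpha>) * \<sigma> (act (inv w) ?\<alpha>) < 0 \<or> act (inv w) ?\<alpha> = ?\<alpha> \<or> act (inv w) ?\<alpha> = negv ?\<alpha>"
        using cross[OF m] zero ab(1) val[of 1] val[of "-1"] unfolding sh_1[OF w] sh_m1[OF w] by fastforce
    qed
    then show "good w z z'" using good_simple z s w by blast
  qed
  ultimately have "(good w)\<^sup>*\<^sup>* zP zQ" using rtranclp_mono by blast
  then have "(good w)\<^sup>*\<^sup>* x zQ" using goodP by (rule converse_rtranclp_into_rtranclp[rotated])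
  then show ?thesis using good_sym[OF goodQ] by (rule rtranclp.rtrancl_into_rtrancl)
qed

text \<open>Without drops each chamber is joined, at constant length, to the chamber of an
  arbitrarily smoothed generic point. One amount of smoothing makes both points tame and all
  crossings in the finite set \<open>\<Phi>0\<close> harmless.\<close>

theorem good_path_or_drop:
  assumes x: "x \<in> carrier W" and y: "y \<in> carrier W"
  shows "drops w x \<or> drops w y \<or> (good w)\<^sup>*\<^sup>* x y"
proof (rule ccontr)
  assume "\<not> ?thesis"
  then have nd: "\<not> drops w x" "\<not> drops w y" and no: "\<not> (good w)\<^sup>*\<^sup>* x y" by auto
  obtain \<pi> \<rho> \<delta> where g: "inch x \<pi>" "inch y \<rho>" "generic \<pi>" "generic \<rho>"
    "\<delta> > 0" "\<And>\<beta>. \<beta> \<in> roots \<Longrightarrow> \<bar>\<pi> \<beta>\<bar> \<ge> \<delta>" "\<And>\<beta>. \<beta> \<in> roots \<Longrightarrow> \<bar>\<rho> \<beta>\<bar> \<ge> \<delta>"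
    "\<And>m \<alpha> \<beta>. \<lbrakk>\<alpha> \<in> roots; \<beta> \<in> roots; indep \<alpha> \<beta>\<rbrakk> \<Longrightarrow>
      \<pi> (smo m \<alpha>) * \<rho> (smo m \<beta>) \<noteq> \<pi> (smo m \<beta>) * \<rho> (smo m \<alpha>)"
    "\<And>d k \<alpha>. \<lbrakk>\<alpha> \<in> roots; indep (re_mode d k \<alpha>) (im_mode d k \<alpha>)\<rbrakk> \<Longrightarrow>
      \<pi> (im_mode d k \<alpha>) * \<rho> (re_mode d k \<alpha>) \<noteq> \<pi> (re_mode d k \<alpha>) * \<rho> (im_mode d k \<alpha>)"
    using generic_pair_exists[OF x y] by blast
  have lin: "lin \<pi>" "lin \<rho>" using g inchD by auto
  obtain m1 where m1: "\<And>m \<alpha>. m \<ge> m1 \<Longrightarrow> \<alpha> \<in> roots - \<Phi>0 \<Longrightarrow> tame_at (\<lambda>v. \<pi> (smo m v)) \<alpha>"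
    using tame_eventually[OF g(3,1,5,6)] by blast
  obtain m2 where m2: "\<And>m \<alpha>. m \<ge> m2 \<Longrightarrow> \<alpha> \<in> roots - \<Phi>0 \<Longrightarrow> tame_at (\<lambda>v. \<rho> (smo m v)) \<alpha>"
    using tame_eventually[OF g(4,2,5,7)] by blast
  define cr where "cr m \<alpha> \<longleftrightarrow> T 1 \<alpha> = negv \<alpha> \<or> (\<forall>a b. (a, b) \<noteq> (0, 0) \<longrightarrow> a * \<pi> (smo m \<alpha>) + b * \<rho> (smo m \<alpha>) = 0 \<longrightarrow>
      (a * \<pi> (smo m (T (-1) \<alpha>)) + b * \<rho> (smo m (T (-1) \<alpha>))) * (a * \<pi> (smo m (T 1 \<alpha>)) + b * \<rho> (smo m (T 1 \<alpha>))) < 0)" for m \<alpha>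
  have "\<exists>m0. \<forall>m\<ge>m0. cr m \<alpha>" if a: "\<alpha> \<in> \<Phi>0" for \<alpha>
  proof -
    obtain d where d: "\<alpha> \<in> roots" "d > 0" "T (int d) \<alpha> = \<alpha>" "(\<lambda>r. \<Sum>j<d. T (int j) \<alpha> r) = (\<lambda>r. 0)"
      using a unfolding zero_sum_roots_def by blast
    show ?thesis
      using zero_sum_crossing[OF d lin g(9)[OF d(1)]] unfolding cr_def by blast
  qed
  then have "\<exists>m0. \<forall>\<alpha>\<in>\<Phi>0. \<forall>m\<ge>m0 \<alpha>. cr m \<alpha>" by (intro bchoice) blast
  then obtain m0 where m0: "\<And>\<alpha> m. \<alpha> \<in> \<Phi>0 \<Longrightarrow> m \<ge> m0 \<alpha> \<Longrightarrow> cr m \<alpha>" by blast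
  define m where "m = max (max m1 m2) (Max (insert 0 (m0 ` \<Phi>0)))"
  have mm: "m \<ge> m1" "m \<ge> m2" by (auto simp: m_def)
  have m0': "m \<ge> m0 \<alpha>" if "\<alpha> \<in> \<Phi>0" for \<alpha>
  proof -
    have "m0 \<alpha> \<le> Max (insert 0 (m0 ` \<Phi>0))"
      using that finite_zero_sum_roots by (intro Max_ge) auto
    then show ?thesis by (simp add: m_def)
  qed
  obtain x' where x': "inch x' (\<lambda>v. \<pi> (smo m v))" "(eqstep w)\<^sup>*\<^sup>* x x'"
    using generic_smooth_path[OF g(1,3) nd(1)] by blast
  obtain y' where y': "inch y' (\<lambda>v. \<rho> (smo m v))" "(eqstep w)\<^sup>*\<^sup>* y y'"
    using generic_smooth_path[OF g(2,4) nd(2)] by blast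
  have "(good w)\<^sup>*\<^sup>* x' y'"
  proof (rule good_path_core[OF x'(1) y'(1) m1[OF mm(1)] m2[OF mm(2)]])
    fix v :: "'a \<Rightarrow> real" assume "intvec v" "v \<noteq> (\<lambda>r. 0)"
    then show "\<pi> (smo m v) \<noteq> 0"
      using generic_nonzero[OF g(3)] intvec_smvs[OF w] smvs_nonzero[OF w] by blast
  next
    fix \<alpha> \<beta> assume "\<alpha> \<in> \<Phi>0" "\<beta> \<in> \<Phi>0" "indep \<alpha> \<beta>"
    then show "\<pi> (smo m \<alpha>) * \<rho> (smo m \<beta>) \<noteq> \<pi> (smo m \<beta>) * \<rho> (smo m \<alpha>)"
      using g(8) zero_sum_root by blast
  next
    fix \<alpha> assume "\<alpha> \<in> \<Phi>0"
    then have "cr m \<alpha>" using m0 m0' by blast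
    then show "T 1 \<alpha> = negv \<alpha> \<or> (\<forall>a b. (a, b) \<noteq> (0, 0) \<longrightarrow> a * \<pi> (smo m \<alpha>) + b * \<rho> (smo m \<alpha>) = 0 \<longrightarrow>
      (a * \<pi> (smo m (T (-1) \<alpha>)) + b * \<rho> (smo m (T (-1) \<alpha>))) * (a * \<pi> (smo m (T 1 \<alpha>)) + b * \<rho> (smo m (T 1 \<alpha>))) < 0)"
      unfolding cr_def .
  qed
  moreover have "(good w)\<^sup>*\<^sup>* x x'" "(good w)\<^sup>*\<^sup>* y y'" using eqsteps[OF w] x' y' x y by blast+
  moreover have "(good w)\<^sup>*\<^sup>* y' y"
  proof -
    have "symp ((good w)\<^sup>*\<^sup>*)" by (rule symp_rtranclp) (auto intro: sympI good_sym)
    then show ?thesis using \<open>(good w)\<^sup>*\<^sup>* y y'\<close> by (rule sympD)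
  qed
  ultimately have "(good w)\<^sup>*\<^sup>* x y" by (meson rtranclp_trans)
  then show False using no by blast
qed

end

end

section \<open>The free algebra and the Hecke ideal\<close>

lemma scalar_mult_single: "scalar c * Poly_Mapping.single u d = Poly_Mapping.single u (c * d)"
  by (simp add: scalar_def mult_single)

lemma single_eq_scalar: "Poly_Mapping.single u c = scalar c * monomial (letters u)"
  by (simp add: monomial_def scalar_mult_single)

lemma scalar_simps [simp]:
  "scalar 0 = 0" "scalar 1 = 1" "scalar (a + b) = scalar a + scalar b"
  "scalar (a - b) = scalar a - scalar b" "scalar (- a) = - scalar a"
  "scalar (a * b) = scalar a * scalar b"
  by (simp_all add: scalar_def single_add single_diff single_uminus mult_single)

lemma monomial_Nil [simp]: "monomial [] = 1"
  by (simp add: monomial_def flip: zero_free_word_def)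

lemma monomial_append: "monomial (xs @ ys) = monomial xs * monomial ys"
  by (simp add: monomial_def mult_single plus_free_word_def)

lemma monomial_Cons: "monomial (s # xs) = monomial [s] * monomial xs"
  using monomial_append[of "[s]" xs] by simp

lemma poly_mapping_sum_induct [consumes 1, case_names zero add single]:
  fixes x :: "'k \<Rightarrow>\<^sub>0 'b::comm_monoid_add"
  assumes "Poly_Mapping.keys x \<subseteq> K" "P 0" "\<And>x y. \<lbrakk>P x; P y\<rbrakk> \<Longrightarrow> P (x + y)"
    "\<And>c u. u \<in> K \<Longrightarrow> P (Poly_Mapping.single u c)"
  shows "P x"
proof -
  have eq: "x = (\<Sum>u\<in>Poly_Mapping.keys x. Poly_Mapping.single u (Poly_Mapping.lookup x u))"
    by (rule poly_mapping_eqI) (auto simp: lookup_sum lookup_single when_def in_keys_iff sum.delta)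
  have "P (\<Sum>u\<in>A. Poly_Mapping.single u (Poly_Mapping.lookup x u))" if "finite A" "A \<subseteq> K" for A
    using that by (induction A) (auto intro: assms)
  from this[OF finite_keys assms(1)] show ?thesis by (simp only: eq[symmetric])
qed

lemma free_induct [consumes 1, case_names zero add single]:
  fixes x :: "'a free_word \<Rightarrow>\<^sub>0 laurent"
  assumes "x \<in> carrier (free_algebra S)" "P 0" "\<And>x y. \<lbrakk>P x; P y\<rbrakk> \<Longrightarrow> P (x + y)"
    "\<And>c xs. xs \<in> lists S \<Longrightarrow> P (scalar c * monomial xs)"
  shows "P x"
proof -
  have "Poly_Mapping.keys x \<subseteq> {u. letters u \<in> lists S}" using assms(1) by (auto simp: free_algebra_def)
  then show ?thesis
    by (rule poly_mapping_sum_induct) (use assms(2-4) in \<open>auto simp: single_eq_scalar\<close>)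
qed

lemma scalar_commute: "x * scalar c = scalar c * x"
proof -
  have "x \<in> carrier (free_algebra UNIV)" by (simp add: free_algebra_def)
  then show ?thesis
  proof (induction rule: free_induct)
    case (single d xs)
    then show ?case
      by (simp add: scalar_def monomial_def mult_single mult.commute)
  qed (simp_all add: algebra_simps)
qed

lemma scalar_left_commute: "x * (scalar c * y) = scalar c * (x * y)"
  by (metis mult.assoc scalar_commute)

lemma free_closed [simp, intro]:
  "0 \<in> carrier (free_algebra S)" "1 \<in> carrier (free_algebra S)" "scalar c \<in> carrier (free_algebra S)"
  "xs \<in> lists S \<Longrightarrow> monomial xs \<in> carrier (free_algebra S)"
  "x \<in> carrier (free_algebra S) \<Longrightarrow> - x \<in> carrier (free_algebra S)"
  "\<lbrakk>x \<in> carrier (free_algebra S); y \<in> carrier (free_algebra S)\<rbrakk> \<Longrightarrow> x + y \<in> carrier (free_algebra S)"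
  "\<lbrakk>x \<in> carrier (free_algebra S); y \<in> carrier (free_algebra S)\<rbrakk> \<Longrightarrow> x - y \<in> carrier (free_algebra S)"
  "\<lbrakk>x \<in> carrier (free_algebra S); y \<in> carrier (free_algebra S)\<rbrakk> \<Longrightarrow> x * y \<in> carrier (free_algebra S)"
proof -
  let ?C = "carrier (free_algebra S)"
  show "0 \<in> ?C" "1 \<in> ?C" "scalar c \<in> ?C" "xs \<in> lists S \<Longrightarrow> monomial xs \<in> ?C"
    by (auto simp: free_algebra_def scalar_def monomial_def zero_free_word_def)
  show u: "- x \<in> ?C" if "x \<in> ?C" for x
    using that by (simp add: free_algebra_def in_keys_iff)
  show p: "x + y \<in> ?C" if "x \<in> ?C" "y \<in> ?C" for x y
    using that keys_add[of x y] by (auto simp: free_algebra_def)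
  show "x - y \<in> ?C" if "x \<in> ?C" "y \<in> ?C"
    using p[OF that(1) u[OF that(2)]] by simp
  show "x * y \<in> ?C" if xy: "x \<in> ?C" "y \<in> ?C"
  proof -
    have "letters u \<in> lists S" if "u \<in> Poly_Mapping.keys (x * y)" for u
    proof -
      obtain a b where "a \<in> Poly_Mapping.keys x" "b \<in> Poly_Mapping.keys y" "u = a + b"
        using \<open>u \<in> _\<close> keys_mult[of x y] by blast
      then show ?thesis using xy by (auto simp: free_algebra_def plus_free_word_def)
    qed
    then show ?thesis by (simp add: free_algebra_def)
  qed
qed

lemma free_sum [intro]: "(\<And>i. i \<in> A \<Longrightarrow> f i \<in> carrier (free_algebra S)) \<Longrightarrow> sum f A \<in> carrier (free_algebra S)"
  by (induction A rule: infinite_finite_induct) auto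

lemma free_algebra_simps [simp]:
  "x \<otimes>\<^bsub>free_algebra S\<^esub> y = x * y" "x \<oplus>\<^bsub>free_algebra S\<^esub> y = x + y"
  "\<zero>\<^bsub>free_algebra S\<^esub> = 0" "\<one>\<^bsub>free_algebra S\<^esub> = 1" "c \<odot>\<^bsub>free_algebra S\<^esub> x = scalar c * x"
  by (simp_all add: free_algebra_def)

lemma ring_free_algebra: "ring (free_algebra S)"
proof (intro ringI abelian_groupI monoidI)
  fix x assume "x \<in> carrier (free_algebra S)"
  then show "\<exists>y\<in>carrier (free_algebra S). y \<oplus>\<^bsub>free_algebra S\<^esub> x = \<zero>\<^bsub>free_algebra S\<^esub>"
    by (intro bexI[of _ "- x"]) auto
qed (auto simp: algebra_simps)

lemma free_minus [simp]:
  assumes "x \<in> carrier (free_algebra S)"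
  shows "\<ominus>\<^bsub>free_algebra S\<^esub> x = - x"
proof -
  interpret ring "free_algebra S" by (rule ring_free_algebra)
  show ?thesis using assms minus_equality[of "- x" x] by simp
qed

context crystallographic_coxeter_system
begin

abbreviation FS :: "('a free_word \<Rightarrow>\<^sub>0 laurent) set" where "FS \<equiv> carrier (free_algebra S)"
abbreviation HI :: "('a free_word \<Rightarrow>\<^sub>0 laurent) set" where "HI \<equiv> hecke_ideal W S"

lemma ideal_freeI:
  assumes "J \<subseteq> FS" "0 \<in> J" "\<And>x y. \<lbrakk>x \<in> J; y \<in> J\<rbrakk> \<Longrightarrow> x + y \<in> J"
    and m: "\<And>x y. \<lbrakk>x \<in> J; y \<in> FS\<rbrakk> \<Longrightarrow> y * x \<in> J" "\<And>x y. \<lbrakk>x \<in> J; y \<in> FS\<rbrakk> \<Longrightarrow> x * y \<in> J"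
  shows "ideal J (free_algebra S)"
proof (rule idealI[OF ring_free_algebra])
  interpret F: ring "free_algebra S" by (rule ring_free_algebra)
  have inv: "inv\<^bsub>add_monoid (free_algebra S)\<^esub> a = - a" if "a \<in> FS" for a
    using free_minus[OF that] by (simp only: a_inv_def)
  show "subgroup J (add_monoid (free_algebra S))"
  proof (rule group.subgroupI[OF F.a_group])
    fix a assume "a \<in> J"
    then show "inv\<^bsub>add_monoid (free_algebra S)\<^esub> a \<in> J"
      using inv assms(1) m(1)[of a "- 1"] by auto
  qed (use assms in auto)
qed (use m in auto)

lemma relators_FS: "hecke_relators W S \<subseteq> FS"
  using alternating_in_lists by (auto simp: hecke_relators_def)

lemma ideal_HI: "ideal HI (free_algebra S)"
  unfolding hecke_ideal_def using ring.genideal_ideal[OF ring_free_algebra] relators_FS by blast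

lemma relators_HI: "hecke_relators W S \<subseteq> HI"
  unfolding hecke_ideal_def using ring.genideal_self[OF ring_free_algebra] relators_FS by blast

lemma HI_minimal: "\<lbrakk>ideal J (free_algebra S); hecke_relators W S \<subseteq> J\<rbrakk> \<Longrightarrow> HI \<subseteq> J"
  unfolding hecke_ideal_def by (rule ring.genideal_minimal[OF ring_free_algebra])

lemma HI_FS: "x \<in> HI \<Longrightarrow> x \<in> FS"
  using ideal.axioms(1)[OF ideal_HI] additive_subgroup.a_subset by blast

lemma HI_mult: "\<lbrakk>x \<in> HI; y \<in> FS\<rbrakk> \<Longrightarrow> y * x \<in> HI" "\<lbrakk>x \<in> HI; y \<in> FS\<rbrakk> \<Longrightarrow> x * y \<in> HI"
  using ideal.I_l_closed[OF ideal_HI, of x y] ideal.I_r_closed[OF ideal_HI, of x y] by simp_all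

lemma HI_zero: "0 \<in> HI"
  using additive_subgroup.zero_closed[OF ideal.axioms(1)[OF ideal_HI]] by simp

lemma HI_add: "\<lbrakk>x \<in> HI; y \<in> HI\<rbrakk> \<Longrightarrow> x + y \<in> HI"
  using additive_subgroup.a_closed[OF ideal.axioms(1)[OF ideal_HI], of x y] by simp

lemma HI_minus: "x \<in> HI \<Longrightarrow> - x \<in> HI"
  using HI_mult(1)[of x "- 1"] by simp

lemma HI_diff: "\<lbrakk>x \<in> HI; y \<in> HI\<rbrakk> \<Longrightarrow> x - y \<in> HI"
  using HI_add[of x "- y"] HI_minus[of y] by simp

end

section \<open>Congruences modulo additive subgroups\<close>

definition subgrp :: "'b::ab_group_add set \<Rightarrow> bool" where
  "subgrp N \<longleftrightarrow> 0 \<in> N \<and> (\<forall>x\<in>N. \<forall>y\<in>N. x - y \<in> N)"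

lemma subgrpD:
  assumes "subgrp N"
  shows "0 \<in> N" "\<lbrakk>x \<in> N; y \<in> N\<rbrakk> \<Longrightarrow> x - y \<in> N" "x \<in> N \<Longrightarrow> - x \<in> N" "\<lbrakk>x \<in> N; y \<in> N\<rbrakk> \<Longrightarrow> x + y \<in> N"
proof -
  show *: "0 \<in> N" "\<And>x y. \<lbrakk>x \<in> N; y \<in> N\<rbrakk> \<Longrightarrow> x - y \<in> N" using assms by (auto simp: subgrp_def)
  show m: "- x \<in> N" if "x \<in> N" for x using *(2)[OF *(1) that] by simp
  show "\<lbrakk>x \<in> N; y \<in> N\<rbrakk> \<Longrightarrow> x + y \<in> N" using *(2)[of x "- y"] m[of y] by simp
qed

lemma cong_trans: "\<lbrakk>subgrp N; x - y \<in> N; y - z \<in> N\<rbrakk> \<Longrightarrow> x - z \<in> N"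
  using subgrpD(4)[of N "x - y" "y - z"] by simp

lemma cong_sym: "\<lbrakk>subgrp N; x - y \<in> N\<rbrakk> \<Longrightarrow> y - x \<in> N"
  using subgrpD(3)[of N "x - y"] by simp

lemma cong_add: "\<lbrakk>subgrp N; a - b \<in> N; c - d \<in> N\<rbrakk> \<Longrightarrow> (a + c) - (b + d) \<in> N"
  using subgrpD(4)[of N "a - b" "c - d"] by (simp add: algebra_simps)

lemma cong_diff: "\<lbrakk>subgrp N; a - b \<in> N; c - d \<in> N\<rbrakk> \<Longrightarrow> (a - c) - (b - d) \<in> N"
  using subgrpD(2)[of N "a - b" "c - d"] by (simp add: algebra_simps)

context crystallographic_coxeter_system
begin

lemma subgrp_HI: "subgrp HI"
  using HI_zero HI_diff by (auto simp: subgrp_def)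

section \<open>Matsumoto's theorem\<close>

text \<open>Split a word in s and t off the right end of w^-1 as far as possible. Were it shorter
  than the order of st, rank two positivity would turn one of the two descents into an ascent; so it
  contains the full alternating word.\<close>

lemma braid_factor:
  assumes w: "w \<in> carrier W" and st: "s \<in> S" "t \<in> S" "s \<noteq> t"
    and desc: "len (s \<otimes> w) < len w" "len (t \<otimes> w) < len w"
  shows "\<exists>v\<in>carrier W. w = wprod (alternating (coxeter_order W s t) s t) \<otimes> v \<and>
    len w = coxeter_order W s t + len v \<and> coxeter_order W s t \<noteq> 0"
proof -
  let ?x = "inv w"
  have x: "?x \<in> carrier W" using w by simp
  have down: "len (?x \<otimes> u) < len ?x" if "u \<in> {s, t}" for u
  proof -
    have "u \<in> S" using that st by auto
    then have "?x \<otimes> u = inv (u \<otimes> w)" "u \<otimes> w \<in> carrier W"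
      using w by (simp_all add: inv_mult_group)
    then have "len (?x \<otimes> u) = len (u \<otimes> w)" by simp
    then show ?thesis using that desc w by auto
  qed
  obtain y z where yz: "y \<in> carrier W" "z \<in> lists {s, t}" "?x = y \<otimes> wprod z" "len ?x = len y + length z"
    "distinct_adj (rev z)" "len y < len (y \<otimes> s)" "len y < len (y \<otimes> t)"
    using dihedral_quotient[OF x st(1,2)] by blast
  have zS: "z \<in> lists S" "rev z \<in> lists S" using yz(2) st by auto
  have *: "\<exists>v\<in>carrier W. w = wprod (alternating (coxeter_order W a b) b a) \<otimes> v \<and>
     len w = coxeter_order W a b + len v \<and> coxeter_order W a b \<noteq> 0"
    if ab: "{a, b} = {s, t}" "a \<noteq> b" "rev z = alternating (length z) b a" for a b
  proof -
    let ?m = "coxeter_order W a b"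
    have abS: "a \<in> S" "b \<in> S" using ab(1) st by auto
    have y: "len y < len (y \<otimes> a)" "len y < len (y \<otimes> b)" using ab(1) yz(6,7) by auto
    have za: "z = rev (alternating (length z) b a)" using ab(3) by (metis rev_rev_ident)
    have m: "?m \<noteq> 0 \<and> ?m \<le> length z"
    proof (rule ccontr)
      assume "\<not> ?thesis"
      then have "?m = 0 \<or> length z < ?m" by auto
      from rank_two_positive[OF abS ab(2) this] za
      obtain c d where cd: "0 \<le> c" "0 \<le> d" "wact z (srt a) = (\<lambda>r. c * srt a r + d * srt b r)" by metis
      have "act ?x (srt a) = act y (wact z (srt a))"
        using yz zS act_mult act_wprod by simp
      then have "act ?x (srt a) = (\<lambda>r. c * act y (srt a) r + d * act y (srt b) r)"
        by (simp add: cd act_linear)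
      moreover have "nonneg (act y (srt a))" "nonneg (act y (srt b))"
        using nonneg_act_srt_iff(1) y yz(1) abS by auto
      ultimately have "nonneg (act ?x (srt a))" using cd by (simp add: nonneg_def)
      then show False
        using nonneg_act_srt_iff(1)[OF x abS(1)] down[of a] ab(1) by auto
    qed
    then obtain zs where zs: "rev z = alternating ?m b a @ zs" "set zs \<subseteq> {a, b}"
      using alternating_append[of ?m "length z - ?m" b a] ab(3) by auto
    have l: "zs \<in> lists S" "alternating ?m b a \<in> lists S"
      using zs(2) abS alternating_in_lists by auto
    have "w = inv (y \<otimes> wprod z)" using yz(3) w by (metis inv_inv)
    then have eq: "w = wprod (alternating ?m b a) \<otimes> (wprod zs \<otimes> inv y)"
      using yz(1) zS l zs(1) wprod_rev[OF zS(1)] by (simp add: inv_mult_group wprod_append flip: m_assoc)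
    have "len (wprod zs \<otimes> inv y) \<le> length zs + len y"
      using len_mult_le[of "wprod zs" "inv y"] len_le[OF l(1)] yz(1) l(1) by simp
    moreover have "length z = ?m + length zs"
      using arg_cong[OF zs(1), of length] by simp
    moreover have "len w \<le> ?m + len (wprod zs \<otimes> inv y)"
      using len_mult_le[of "wprod (alternating ?m b a)" "wprod zs \<otimes> inv y"] len_le[OF l(2)] eq l yz(1) by simp
    ultimately have "len w = ?m + len (wprod zs \<otimes> inv y)" using yz(4) w by simp
    then show ?thesis using eq m l yz(1) by blast
  qed
  have hd: "set (rev z) \<subseteq> {s, t}" "z = [] \<or> hd (rev z) = s \<or> hd (rev z) = t"
    using yz(2) hd_in_set[of "rev z"] by (auto simp: in_lists_conv_set)
  then consider "rev z = alternating (length z) t s" | "rev z = alternating (length z) s t"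
    using alternating_char[of "rev z" s t] alternating_char[of "rev z" t s] yz(5)
    by (auto simp: insert_commute)
  then show ?thesis
  proof cases
    case 1
    show ?thesis using *[OF refl st(3) 1] unfolding wprod_braid[OF st(1,2)] .
  next
    case 2
    show ?thesis using *[OF insert_commute st(3)[symmetric] 2] unfolding coxeter_order_sym[OF st(2,1)] .
  qed
qed

text \<open>A lift of T_w to the free algebra; by \<open>matsumoto\<close> its class modulo
  \<open>HI\<close> does not depend on the reduced word.\<close>

definition M :: "'a \<Rightarrow> 'a free_word \<Rightarrow>\<^sub>0 laurent" where
  "M w = monomial (SOME xs. xs \<in> reduced_words W S w)"

lemma reduced_wordsI: "\<lbrakk>xs \<in> lists S; wprod xs = w; length xs = len w\<rbrakk> \<Longrightarrow> xs \<in> reduced_words W S w"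
  by (simp add: reduced_words_def)

lemma M_reduced:
  assumes "w \<in> carrier W"
  obtains xs where "xs \<in> lists S" "wprod xs = w" "length xs = len w" "M w = monomial xs"
proof -
  have "\<exists>xs. xs \<in> reduced_words W S w"
    using reduced_word_ex[OF assms] by (metis reduced_wordsI)
  from someI_ex[OF this] show ?thesis using that by (auto simp: reduced_words_def M_def)
qed

lemma M_FS [simp, intro]: "w \<in> carrier W \<Longrightarrow> M w \<in> FS"
  by (rule M_reduced) auto

lemma braid_HI:
  assumes "s \<in> S" "t \<in> S" "s \<noteq> t"
  shows "monomial (alternating (coxeter_order W s t) s t) - monomial (alternating (coxeter_order W s t) t s) \<in> HI"
  using relators_HI assms unfolding hecke_relators_def by blast

text \<open>Two reduced words with different initial letters s and t are compared through words
  starting with the two alternating words of full length, available by \<open>braid_factor\<close>.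
  Each comparison shares an initial letter and is left to the induction.\<close>

theorem matsumoto:
  assumes "xs \<in> lists S" "length xs = len (wprod xs)"
  shows "monomial xs - M (wprod xs) \<in> HI"
  using assms
proof (induction "length xs" arbitrary: xs rule: less_induct)
  case less
  define w where "w = wprod xs"
  have w: "w \<in> carrier W" using less.prems by (auto simp: w_def)
  obtain ys where ys: "ys \<in> lists S" "wprod ys = w" "length ys = len w" "M w = monomial ys"
    using M_reduced[OF w] by blast
  show ?case
  proof (cases xs)
    case Nil
    then show ?thesis using ys less.prems HI_zero by (simp add: w_def)
  next
    case (Cons s xs')
    then obtain t ys' where yst: "ys = t # ys'" using ys less.prems by (cases ys) (auto simp: w_def)
    have shorter: "a \<in> S \<and> as \<in> lists S \<and> wprod as = a \<otimes> w \<and> length as = len (a \<otimes> w) \<and> len (a \<otimes> w) < len w"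
      if "a # as \<in> lists S" "wprod (a # as) = w" "length (a # as) = len w" for a as
    proof -
      have *: "a \<in> S" "as \<in> lists S" "w = a \<otimes> wprod as" using that by auto
      then have e: "wprod as = a \<otimes> w" by auto
      have "len (a \<otimes> w) \<le> length as" using len_le[OF *(2)] e by simp
      moreover have "Suc (length as) = len w" using that(3) by simp
      ultimately have "length as = len (a \<otimes> w) \<and> len (a \<otimes> w) < len w"
        using len_simple_mult[OF w *(1)] by linarith
      then show ?thesis using * e by blast
    qed
    note 1 = shorter[of s xs'] and 2 = shorter[of t ys']
    have xw: "wprod (s # xs') = w" "length (s # xs') = len w" "s # xs' \<in> lists S"
      using less.prems unfolding w_def Cons by blast+
    note 1 = 1[OF xw(3,1,2)] and 2 = 2[OF ys(1,2,3)[unfolded yst]]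
    have IH: "monomial zs - M (wprod zs) \<in> HI" if "zs \<in> lists S" "length zs = len (wprod zs)" "len (wprod zs) < len w" for zs
      using less.hyps[of zs] that xw(2) Cons by simp
    have left: "monomial (a # as) - monomial (alternating m a b @ zs) \<in> HI"
      if h: "as \<in> lists S" "a \<in> S" "b \<in> S" "wprod as = a \<otimes> w" "length as = len (a \<otimes> w)" "len (a \<otimes> w) < len w"
       "zs \<in> lists S" "w = wprod (alternating m a b) \<otimes> wprod zs" "len w = m + length zs" "m \<noteq> 0" for a b as zs m
    proof -
      obtain m' where m': "m = Suc m'" using h by (cases m) auto
      have l: "alternating m' b a \<in> lists S" using h alternating_in_lists by auto
      have e: "wprod (alternating m' b a @ zs) = a \<otimes> w"
        using h l m' by (simp add: wprod_append m_assoc)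
      have "length (alternating m' b a @ zs) = len (a \<otimes> w)"
        using h(5,6,9) m' len_simple_mult[OF w \<open>a \<in> S\<close>] by simp
      then have "monomial (alternating m' b a @ zs) - M (a \<otimes> w) \<in> HI"
        using IH[of "alternating m' b a @ zs"] h(6,7) l unfolding e by simp
      moreover have "monomial as - M (a \<otimes> w) \<in> HI"
        using IH[OF h(1)] h(5,6) unfolding h(4) by simp
      ultimately have "monomial as - monomial (alternating m' b a @ zs) \<in> HI"
        using cong_trans[OF subgrp_HI] cong_sym[OF subgrp_HI] by blast
      then have "monomial [a] * (monomial as - monomial (alternating m' b a @ zs)) \<in> HI"
        using HI_mult h by auto
      then show ?thesis using m' monomial_Cons[of a] by (metis alternating.simps(2) append_Cons right_diff_distrib)
    qed
    have "monomial xs - monomial ys \<in> HI"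
    proof (cases "s = t")
      case True
      have "monomial xs' - M (s \<otimes> w) \<in> HI" "monomial ys' - M (s \<otimes> w) \<in> HI"
        using IH[of xs'] IH[of ys'] 1 2 unfolding True by simp_all
      then have "monomial xs' - monomial ys' \<in> HI"
        using cong_trans[OF subgrp_HI] cong_sym[OF subgrp_HI] by blast
      then have "monomial [s] * (monomial xs' - monomial ys') \<in> HI"
        using HI_mult 1 by auto
      then show ?thesis using Cons yst True monomial_Cons[of s] by (metis right_diff_distrib)
    next
      case False
      let ?m = "coxeter_order W s t"
      obtain v where v: "v \<in> carrier W" "w = wprod (alternating ?m s t) \<otimes> v" "len w = ?m + len v" "?m \<noteq> 0"
        using braid_factor[of w s t] w 1 2 False by blast
      obtain zs where zs: "zs \<in> lists S" "wprod zs = v" "length zs = len v"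
        using reduced_word_ex[OF v(1)] by metis
      have "monomial (alternating ?m s t @ zs) - monomial (alternating ?m t s @ zs) \<in> HI"
        using HI_mult(2)[OF braid_HI[of s t], of "monomial zs"] 1 2 False zs by (simp add: monomial_append algebra_simps)
      moreover have "monomial xs - monomial (alternating ?m s t @ zs) \<in> HI"
        unfolding Cons using 1 2 v zs by (intro left) auto
      moreover have "monomial ys - monomial (alternating ?m t s @ zs) \<in> HI"
        unfolding yst using 1 2 v zs wprod_braid[of s t] by (intro left) auto
      ultimately show ?thesis using cong_trans[OF subgrp_HI] cong_sym[OF subgrp_HI] by blast
    qed
    then show ?thesis using ys by (simp add: w_def)
  qed
qed

section \<open>The standard basis of the Hecke algebra\<close>

lemma M_one [simp]: "M \<one> = 1"
  by (rule M_reduced[OF one_closed]) simp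

lemma M_simple: "s \<in> S \<Longrightarrow> M s = monomial [s]"
proof -
  assume s: "s \<in> S"
  obtain xs where xs: "xs \<in> lists S" "wprod xs = s" "length xs = len s" "M s = monomial xs"
    using M_reduced[of s] s by blast
  then obtain a where "xs = [a]" using len_simple[OF s] by (metis One_nat_def length_0_conv length_Suc_conv)
  then show ?thesis using xs by auto
qed

lemma M_mult:
  assumes "u \<in> carrier W" "v \<in> carrier W" "len (u \<otimes> v) = len u + len v"
  shows "M u * M v - M (u \<otimes> v) \<in> HI"
proof -
  obtain xs where xs: "xs \<in> lists S" "wprod xs = u" "length xs = len u" "M u = monomial xs"
    using M_reduced[OF assms(1)] by blast
  obtain ys where ys: "ys \<in> lists S" "wprod ys = v" "length ys = len v" "M v = monomial ys"
    using M_reduced[OF assms(2)] by blast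
  show ?thesis
    using matsumoto[of "xs @ ys"] xs ys assms by (simp add: wprod_append monomial_append)
qed

lemma quadratic_HI:
  assumes "s \<in> S"
  shows "M s * M s - (scalar (laurent_q - 1) * M s + scalar laurent_q) \<in> HI"
proof -
  have "(monomial [s] + 1) * (monomial [s] - scalar laurent_q) \<in> HI"
    using relators_HI assms unfolding hecke_relators_def by blast
  then show ?thesis
    using scalar_commute[of "monomial [s]" laurent_q] by (simp add: M_simple[OF assms] algebra_simps)
qed

lemma M_simple_mult_down:
  assumes "w \<in> carrier W" "s \<in> S" "len (s \<otimes> w) < len w"
  shows "M s * M w - (scalar laurent_q * M (s \<otimes> w) + scalar (laurent_q - 1) * M w) \<in> HI"
proof -
  let ?v = "s \<otimes> w"
  have v: "?v \<in> carrier W" "s \<otimes> ?v = w" "len w = len s + len ?v"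
    using assms len_simple_mult[OF assms(1,2)] by (auto simp: len_simple)
  have 1: "M s * M ?v - M w \<in> HI" using M_mult[of s ?v] assms v by simp
  have "M s * (M s * M ?v - M w) \<in> HI"
    by (rule HI_mult(1)[OF 1]) (use assms in auto)
  moreover have "(M s * M s - (scalar (laurent_q - 1) * M s + scalar laurent_q)) * M ?v \<in> HI"
    by (rule HI_mult(2)[OF quadratic_HI]) (use assms in auto)
  moreover have "scalar (laurent_q - 1) * (M s * M ?v - M w) \<in> HI"
    by (rule HI_mult(1)[OF 1]) auto
  ultimately have "(M s * M s - (scalar (laurent_q - 1) * M s + scalar laurent_q)) * M ?v - M s * (M s * M ?v - M w)
      + scalar (laurent_q - 1) * (M s * M ?v - M w) \<in> HI"
    using HI_add HI_diff by blast
  then show ?thesis by (simp add: algebra_simps del: scalar_simps)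
qed

lemma exchange_commute:
  assumes w: "w \<in> carrier W" "s \<in> S" "t \<in> S"
    and up: "len w < len (w \<otimes> t)" and down: "len (s \<otimes> w \<otimes> t) < len (s \<otimes> w)"
  shows "s \<otimes> w = w \<otimes> t"
proof -
  have n: "nonneg (act w (srt t))" using up w nonneg_act_srt_iff(1) by blast
  have "nonneg (negv (act (s \<otimes> w) (srt t)))"
    using down w nonneg_act_srt_iff(2)[of "s \<otimes> w" t] by simp
  then have "\<not> nonneg (refl s (act w (srt t)))"
    using w root_sign[of "act (s \<otimes> w) (srt t)"] by (simp add: act_mult act_simple act_root refl_root srt_root)
  then have "act w (srt t) = srt s"
    using refl_nonneg[of "act w (srt t)" s] n w by blast
  then show ?thesis using exchange w by blast
qed

text \<open>Multiplication by t on the right leaves the left descent s unaffected, and conversely,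
  unless both multiplications agree. A change of descent forces w to map the simple root of t, up to
  sign, to that of s.\<close>

lemma left_right_signs:
  assumes w: "w \<in> carrier W" "s \<in> S" "t \<in> S"
  shows "s \<otimes> w = w \<otimes> t \<or>
    ((len (w \<otimes> t) < len w \<longleftrightarrow> len (s \<otimes> w \<otimes> t) < len (s \<otimes> w)) \<and>
     (len (s \<otimes> w) < len w \<longleftrightarrow> len (s \<otimes> (w \<otimes> t)) < len (w \<otimes> t)))"
proof (rule disjCI)
  let ?v = "s \<otimes> w"
  assume no: "\<not> ((len (w \<otimes> t) < len w \<longleftrightarrow> len (?v \<otimes> t) < len ?v) \<and>
     (len ?v < len w \<longleftrightarrow> len (s \<otimes> (w \<otimes> t)) < len (w \<otimes> t)))"
  have v: "?v \<in> carrier W" using w by simp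
  have vt: "s \<otimes> (w \<otimes> t) = ?v \<otimes> t" using w by (simp add: m_assoc)
  have l: "len ?v = len w + 1 \<or> len w = len ?v + 1" "len (w \<otimes> t) = len w + 1 \<or> len w = len (w \<otimes> t) + 1"
    "len (?v \<otimes> t) = len ?v + 1 \<or> len ?v = len (?v \<otimes> t) + 1"
    "len (?v \<otimes> t) = len (w \<otimes> t) + 1 \<or> len (w \<otimes> t) = len (?v \<otimes> t) + 1"
    using len_simple_mult[OF w(1,2)] len_mult_simple[OF w(1,3)] len_mult_simple[OF v w(3)]
      len_simple_mult[of "w \<otimes> t" s] w vt by auto
  then consider "len w < len (w \<otimes> t)" "len (?v \<otimes> t) < len ?v"
    | "len ?v < len (?v \<otimes> t)" "len (w \<otimes> t) < len w"
    using no vt by fastforce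
  then show "?v = w \<otimes> t"
  proof cases
    case 1
    then show ?thesis using exchange_commute w by blast
  next
    case 2
    then have "s \<otimes> ?v = ?v \<otimes> t" using exchange_commute[of ?v s t] w by simp
    then have "w = ?v \<otimes> t" using w by simp
    then have "w \<otimes> t = ?v \<otimes> t \<otimes> t" by simp
    then show ?thesis using w v by simp
  qed
qed

text \<open>Left multiplication by T_s in coordinates: the coefficient at w of T_s times the sum of
  m(v) T_v. The formula makes sense for functions of infinite support as well.\<close>

definition lact :: "'a \<Rightarrow> ('a \<Rightarrow> laurent) \<Rightarrow> 'a \<Rightarrow> laurent" where
  "lact s m w = (if w \<notin> carrier W then 0 else
    if len (s \<otimes> w) < len w then m (s \<otimes> w) + (laurent_q - 1) * m w else laurent_q * m (s \<otimes> w))"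

definition ract :: "'a \<Rightarrow> ('a \<Rightarrow> laurent) \<Rightarrow> 'a \<Rightarrow> laurent" where
  "ract t m w = (if w \<notin> carrier W then 0 else
    if len (w \<otimes> t) < len w then m (w \<otimes> t) + (laurent_q - 1) * m w else laurent_q * m (w \<otimes> t))"

text \<open>By \<open>left_right_signs\<close> either both sides use the same descent cases, or sw =
  wt and the two sides coincide by symmetry.\<close>

lemma lact_ract:
  assumes "s \<in> S" "t \<in> S"
  shows "lact s (ract t m) = ract t (lact s m)"
proof
  fix w
  show "lact s (ract t m) w = ract t (lact s m) w"
  proof (cases "w \<in> carrier W")
    case True
    have c: "s \<otimes> w \<in> carrier W" "w \<otimes> t \<in> carrier W" "s \<otimes> (w \<otimes> t) = s \<otimes> w \<otimes> t"
      using True assms by (simp_all add: m_assoc)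
    show ?thesis
    proof (cases "s \<otimes> w = w \<otimes> t")
      case eq: True
      have "w \<otimes> t \<otimes> t = w" "s \<otimes> (w \<otimes> t) = w" using True assms by simp (simp flip: eq add: True assms)
      then show ?thesis using True c eq by (simp add: lact_def ract_def)
    next
      case False
      then have "len (w \<otimes> t) < len w \<longleftrightarrow> len (s \<otimes> w \<otimes> t) < len (s \<otimes> w)"
        "len (s \<otimes> w) < len w \<longleftrightarrow> len (s \<otimes> w \<otimes> t) < len (w \<otimes> t)"
        using left_right_signs[OF True assms] c by auto
      then show ?thesis using True c by (simp add: lact_def ract_def algebra_simps)
    qed
  qed (simp add: lact_def ract_def)
qed

fun wop :: "'a list \<Rightarrow> ('a \<Rightarrow> laurent) \<Rightarrow> 'a \<Rightarrow> laurent" where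
  "wop [] m = m" | "wop (s # xs) m = lact s (wop xs m)"

fun rop :: "'a list \<Rightarrow> ('a \<Rightarrow> laurent) \<Rightarrow> 'a \<Rightarrow> laurent" where
  "rop [] m = m" | "rop (s # xs) m = rop xs (ract s m)"

definition bas :: "'a \<Rightarrow> 'a \<Rightarrow> laurent" where
  "bas w v = (if v = w then 1 else 0)"

lemma lact_linear:
  "lact s (\<lambda>v. a v + b v) = (\<lambda>v. lact s a v + lact s b v)"
  "lact s (\<lambda>v. c * a v) = (\<lambda>v. c * lact s a v)" "lact s (\<lambda>v. 0) = (\<lambda>v. 0)"
  by (auto simp: lact_def fun_eq_iff algebra_simps)

lemma ract_linear:
  "ract s (\<lambda>v. a v + b v) = (\<lambda>v. ract s a v + ract s b v)"
  "ract s (\<lambda>v. c * a v) = (\<lambda>v. c * ract s a v)" "ract s (\<lambda>v. 0) = (\<lambda>v. 0)"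
  by (auto simp: ract_def fun_eq_iff algebra_simps)

lemma wop_append: "wop (xs @ ys) m = wop xs (wop ys m)"
  by (induction xs) auto

lemma wop_linear:
  "wop xs (\<lambda>v. a v + b v) = (\<lambda>v. wop xs a v + wop xs b v)"
  "wop xs (\<lambda>v. c * a v) = (\<lambda>v. c * wop xs a v)" "wop xs (\<lambda>v. 0) = (\<lambda>v. 0)"
  by (induction xs) (simp_all add: lact_linear)

lemma rop_linear:
  "rop xs (\<lambda>v. a v + b v) = (\<lambda>v. rop xs a v + rop xs b v)"
  "rop xs (\<lambda>v. c * a v) = (\<lambda>v. c * rop xs a v)" "rop xs (\<lambda>v. 0) = (\<lambda>v. 0)"
  by (induction xs arbitrary: a b) (simp_all add: ract_linear)

lemma lact_rop: "\<lbrakk>s \<in> S; xs \<in> lists S\<rbrakk> \<Longrightarrow> lact s (rop xs m) = rop xs (lact s m)"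
  by (induction xs arbitrary: m) (auto simp: lact_ract)

lemma wop_rop: "\<lbrakk>ys \<in> lists S; xs \<in> lists S\<rbrakk> \<Longrightarrow> wop ys (rop xs m) = rop xs (wop ys m)"
  by (induction ys) (auto simp: lact_rop)

lemma lact_bas:
  assumes "s \<in> S" "v \<in> carrier W" "len v < len (s \<otimes> v)"
  shows "lact s (bas v) = bas (s \<otimes> v)"
proof
  fix w
  have "s \<otimes> w = v \<longleftrightarrow> w = s \<otimes> v" if "w \<in> carrier W" using that assms by auto
  then show "lact s (bas v) w = bas (s \<otimes> v) w"
    using assms by (auto simp: lact_def bas_def)
qed

lemma ract_bas_one: "s \<in> S \<Longrightarrow> ract s (bas \<one>) = lact s (bas \<one>)"
proof
  fix w assume s: "s \<in> S"
  have "s \<otimes> w = \<one> \<longleftrightarrow> w = s" "w \<otimes> s = \<one> \<longleftrightarrow> w = s" if "w \<in> carrier W"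
    using that s by (metis S_carrier inv_equality inv_inv simple_inv simple_sq)+
  then show "ract s (bas \<one>) w = lact s (bas \<one>) w"
    using s by (auto simp: lact_def ract_def bas_def len_simple)
qed

text \<open>On the unit vector a left and a right generator agree; commuting left operators past
  right ones then extends this to words.\<close>

lemma wop_bas_one: "xs \<in> lists S \<Longrightarrow> wop xs (bas \<one>) = rop xs (bas \<one>)"
proof (induction xs)
  case (Cons s xs)
  then show ?case by (simp add: ract_bas_one lact_rop)
qed simp

lemma wop_reduced: "\<lbrakk>xs \<in> lists S; length xs = len (wprod xs)\<rbrakk> \<Longrightarrow> wop xs (bas \<one>) = bas (wprod xs)"
proof (induction xs)
  case (Cons s xs)
  have s: "s \<in> S" "xs \<in> lists S" using Cons by auto
  have "len (s \<otimes> wprod xs) \<le> 1 + len (wprod xs)" "len (wprod xs) \<le> length xs"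
    using len_simple_mult[of "wprod xs" s] len_le[OF s(2)] s by auto
  then have "length xs = len (wprod xs)" "len (wprod xs) < len (s \<otimes> wprod xs)" using Cons.prems by auto
  then show ?case using Cons.IH s lact_bas by auto
qed simp

definition evl :: "('a free_word \<Rightarrow>\<^sub>0 laurent) \<Rightarrow> ('a \<Rightarrow> laurent) \<Rightarrow> 'a \<Rightarrow> laurent" where
  "evl x m v = (\<Sum>u\<in>Poly_Mapping.keys x. Poly_Mapping.lookup x u * wop (letters u) m v)"

lemma evl_add: "evl (x + y) m = (\<lambda>v. evl x m v + evl y m v)"
  unfolding evl_def by (intro ext setsum_keys_plus_distrib) (simp_all add: algebra_simps)

lemma evl_0 [simp]: "evl 0 m = (\<lambda>v. 0)"
  by (simp add: evl_def fun_eq_iff)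

lemma evl_scalar_monomial [simp]: "evl (scalar c * monomial xs) m = (\<lambda>v. c * wop xs m v)"
  by (auto simp: evl_def monomial_def scalar_mult_single fun_eq_iff)

lemma evl_monomial [simp]: "evl (monomial xs) m = wop xs m"
  using evl_scalar_monomial[of 1 xs m] by simp

lemma evl_linear:
  "evl x (\<lambda>v. a v + b v) = (\<lambda>v. evl x a v + evl x b v)"
  "evl x (\<lambda>v. c * a v) = (\<lambda>v. c * evl x a v)" "evl x (\<lambda>v. 0) = (\<lambda>v. 0)"
  by (simp_all add: evl_def fun_eq_iff wop_linear sum.distrib sum_distrib_left algebra_simps)

lemma evl_mult:
  assumes "x \<in> FS" "y \<in> FS"
  shows "evl (x * y) m = evl x (evl y m)"
  using assms(1)
proof (induction rule: free_induct)
  case (add x x')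
  then show ?case by (simp add: distrib_right evl_add)
next
  case (single c xs)
  from assms(2) show ?case
  proof (induction rule: free_induct)
    case (single d ys)
    have "scalar c * monomial xs * (scalar d * monomial ys) = scalar (c * d) * monomial (xs @ ys)"
      by (simp add: monomial_append mult.assoc scalar_left_commute[of "monomial xs"])
    then have "evl (scalar c * monomial xs * (scalar d * monomial ys)) m = (\<lambda>v. (c * d) * wop (xs @ ys) m v)"
      by (simp only: evl_scalar_monomial)
    then show ?case by (simp add: wop_append wop_linear mult.assoc)
  qed (simp_all add: distrib_left evl_add evl_linear wop_linear algebra_simps)
qed simp

lemma evl_rop:
  assumes "x \<in> FS" "xs \<in> lists S"
  shows "evl x (rop xs m) = rop xs (evl x m)"
  using assms(1)
proof (induction rule: free_induct)
  case (single c ys)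
  then show ?case using assms by (simp add: wop_rop rop_linear)
qed (simp_all add: evl_add rop_linear)

abbreviation coord :: "('a free_word \<Rightarrow>\<^sub>0 laurent) \<Rightarrow> 'a \<Rightarrow> laurent" where
  "coord x \<equiv> evl x (bas \<one>)"

text \<open>Left and right multiplication commute, so the vectors killed by the left action on the
  cyclic vector form a two-sided ideal.\<close>

lemma coord_mult_zero:
  assumes "x \<in> FS" "y \<in> FS" "coord x = (\<lambda>v. 0)"
  shows "coord (x * y) = (\<lambda>v. 0)"
proof -
  have "evl x (coord y) = (\<lambda>v. 0)"
    using assms(2)
  proof (induction rule: free_induct)
    case (single c ys)
    have "evl x (wop ys (bas \<one>)) = rop ys (coord x)" using wop_bas_one evl_rop assms single by metis
    then show ?case using assms(3) by (simp add: rop_linear evl_linear)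
  qed (simp_all add: evl_add evl_linear)
  then show ?thesis using evl_mult assms by simp
qed

text \<open>The preceding alternating product sends the next simple root to a positive root, so each
  added letter lengthens it until the order is reached.\<close>

lemma alternating_reduced:
  assumes "s \<in> S" "t \<in> S" "s \<noteq> t" "k \<le> coxeter_order W s t"
  shows "len (wprod (alternating k s t)) = k"
  using assms
proof (induction k arbitrary: s t)
  case (Suc k)
  let ?z = "wprod (rev (alternating k t s))"
  have l: "alternating k t s \<in> lists S" "rev (alternating k t s) \<in> lists S"
    using alternating_in_lists[OF Suc.prems(2,1), of k] by (simp_all add: in_lists_conv_set)
  have "k \<le> coxeter_order W t s" using Suc.prems(4) coxeter_order_sym[OF Suc.prems(1,2)] by simp
  from Suc.IH[OF Suc.prems(2,1) Suc.prems(3)[symmetric] this]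
  have z: "?z \<in> carrier W" "inv ?z = wprod (alternating k t s)" "len ?z = k"
    unfolding wprod_rev[OF l(1)] using l(1) by (simp_all add: wprod_closed_S)
  have "coxeter_order W s t = 0 \<or> k < coxeter_order W s t" using Suc.prems by simp
  from rank_two_positive[OF Suc.prems(1-3) this] obtain a b where ab: "0 \<le> a" "0 \<le> b"
    "wact (rev (alternating k t s)) (srt s) = (\<lambda>r. a * srt s r + b * srt t r)" by blast
  have "nonneg (act ?z (srt s))"
    unfolding act_wprod[OF l(2)] ab(3) using ab(1,2) nonneg_srt[of s] nonneg_srt[of t] unfolding nonneg_def by simp
  then have "len (?z \<otimes> s) = Suc k"
    using nonneg_act_srt_iff(1)[OF z(1)] len_mult_simple[OF z(1)] Suc.prems z(3) by force
  moreover have "wprod (alternating (Suc k) s t) = inv (?z \<otimes> s)"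
    using z Suc.prems by (simp add: inv_mult_group)
  ultimately show ?case using z(1) Suc.prems by simp
qed simp

lemma coord_relators: "x \<in> hecke_relators W S \<Longrightarrow> coord x = (\<lambda>v. 0)"
proof -
  assume "x \<in> hecke_relators W S"
  then consider s where "s \<in> S" "x = (monomial [s] + 1) * (monomial [s] - scalar laurent_q)"
    | s t where "s \<in> S" "t \<in> S" "s \<noteq> t"
      "x = monomial (alternating (coxeter_order W s t) s t) - monomial (alternating (coxeter_order W s t) t s)"
    unfolding hecke_relators_def by blast
  then show ?thesis
  proof cases
    case 1
    have c: "scalar c * monomial [] = scalar c" for c by simp
    have "x = scalar 1 * monomial [s, s] + scalar (1 - laurent_q) * monomial [s] + scalar (- laurent_q) * monomial []"
      using 1 scalar_commute[of "monomial [s]" laurent_q] by (simp add: algebra_simps monomial_Cons[of s "[s]"])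
    then have "coord x = (\<lambda>v. lact s (lact s (bas \<one>)) v + (1 - laurent_q) * lact s (bas \<one>) v + (- laurent_q) * bas \<one> v)"
      by (simp only: evl_add evl_scalar_monomial) simp
    moreover have "lact s (bas \<one>) = bas s" using lact_bas[of s \<one>] 1 by (simp add: len_simple)
    moreover have "lact s (bas s) v = (laurent_q - 1) * bas s v + laurent_q * bas \<one> v" for v
    proof (cases "v \<in> carrier W")
      case True
      have "s \<otimes> v = s \<longleftrightarrow> v = \<one>" using simple_cancel(1)[OF 1(1) True] simple_sq[OF 1(1)] 1(1) by auto
      moreover have "s \<noteq> \<one>" using len_simple[OF 1(1)] by auto
      ultimately show ?thesis using True 1(1) by (auto simp: lact_def bas_def len_simple)
    qed (use 1 in \<open>auto simp: lact_def bas_def\<close>)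
    ultimately show ?thesis by (simp add: fun_eq_iff algebra_simps)
  next
    case 2
    let ?m = "coxeter_order W s t"
    have "wop (alternating ?m s t) (bas \<one>) = bas (wprod (alternating ?m s t))"
      using alternating_reduced[OF 2(1-3) order_refl] alternating_in_lists[OF 2(1,2)] by (simp add: wop_reduced)
    moreover have "wop (alternating ?m t s) (bas \<one>) = bas (wprod (alternating ?m t s))"
      unfolding coxeter_order_sym[OF 2(1,2)]
      using alternating_reduced[OF 2(2,1) 2(3)[symmetric] order_refl] alternating_in_lists[OF 2(2,1)] by (simp add: wop_reduced)
    moreover have "x = scalar 1 * monomial (alternating ?m s t) + scalar (- 1) * monomial (alternating ?m t s)"
      using 2 by simp
    then have "coord x = (\<lambda>v. wop (alternating ?m s t) (bas \<one>) v + (- 1) * wop (alternating ?m t s) (bas \<one>) v)"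
      by (simp only: evl_add evl_scalar_monomial mult_1)
    ultimately show ?thesis using wprod_braid[OF 2(1,2)] by simp
  qed
qed

lemma ideal_coord: "ideal {x \<in> FS. coord x = (\<lambda>v. 0)} (free_algebra S)"
proof (rule ideal_freeI)
  fix x y assume "x \<in> {x \<in> FS. coord x = (\<lambda>v. 0)}" "y \<in> FS"
  then show "y * x \<in> {x \<in> FS. coord x = (\<lambda>v. 0)}" "x * y \<in> {x \<in> FS. coord x = (\<lambda>v. 0)}"
    by (simp add: evl_mult evl_linear, simp add: coord_mult_zero)
qed (auto simp: evl_add)

lemma coord_HI: "x \<in> HI \<Longrightarrow> coord x = (\<lambda>v. 0)"
  using HI_minimal[OF ideal_coord] coord_relators relators_FS by blast

lemma coord_M: "w \<in> carrier W \<Longrightarrow> coord (M w) = bas w"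
  using wop_reduced M_reduced[of w] by (metis evl_monomial)

definition lincomb :: "'a set \<Rightarrow> ('a \<Rightarrow> laurent) \<Rightarrow> 'a free_word \<Rightarrow>\<^sub>0 laurent" where
  "lincomb A c = (\<Sum>w\<in>A. scalar (c w) * M w)"

lemma lincomb_add:
  assumes "finite A" "finite B"
  shows "lincomb A c + lincomb B d =
    lincomb (A \<union> B) (\<lambda>w. (if w \<in> A then c w else 0) + (if w \<in> B then d w else 0))"
proof -
  have "(\<Sum>w\<in>A. scalar (c w) * M w) = (\<Sum>w\<in>A \<union> B. scalar (if w \<in> A then c w else 0) * M w)"
    "(\<Sum>w\<in>B. scalar (d w) * M w) = (\<Sum>w\<in>A \<union> B. scalar (if w \<in> B then d w else 0) * M w)"
    using assms by (auto intro!: sum.mono_neutral_cong_left)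
  then show ?thesis by (simp add: lincomb_def sum.distrib distrib_right)
qed

lemma coord_lincomb:
  assumes "finite A" "A \<subseteq> carrier W"
  shows "coord (lincomb A c) v = (if v \<in> A then c v else 0)"
  using assms
proof (induction A)
  case (insert w A)
  have w: "coord (scalar (c w) * M w) = (\<lambda>v. c w * bas w v)"
    using evl_scalar_monomial M_reduced[of w] coord_M[of w] insert.prems
    by (metis evl_monomial insert_subset)
  have "coord (lincomb (insert w A) c) v = c w * bas w v + coord (lincomb A c) v"
    using insert.hyps by (simp add: lincomb_def evl_add w)
  also have "coord (lincomb A c) v = (if v \<in> A then c v else 0)" using insert by blast
  finally show ?case using insert.hyps by (auto simp: bas_def)
qed (simp add: lincomb_def)

definition spanned :: "('a free_word \<Rightarrow>\<^sub>0 laurent) \<Rightarrow> bool" where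
  "spanned x \<longleftrightarrow> (\<exists>A c. finite A \<and> A \<subseteq> carrier W \<and> x - lincomb A c \<in> HI)"

lemma spanned_add: "\<lbrakk>spanned x; spanned y\<rbrakk> \<Longrightarrow> spanned (x + y)"
proof -
  assume "spanned x" "spanned y"
  then obtain A c B d where AB: "finite A" "A \<subseteq> carrier W" "x - lincomb A c \<in> HI"
    "finite B" "B \<subseteq> carrier W" "y - lincomb B d \<in> HI" unfolding spanned_def by blast
  then have "(x + y) - (lincomb A c + lincomb B d) \<in> HI" by (intro cong_add[OF subgrp_HI])
  from this[unfolded lincomb_add[OF AB(1,4)]] show ?thesis
    unfolding spanned_def by (intro exI conjI) (use AB in auto)
qed

lemma spanned_cong: "\<lbrakk>x - y \<in> HI; spanned y\<rbrakk> \<Longrightarrow> spanned x"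
  unfolding spanned_def using cong_trans[OF subgrp_HI] by blast

lemma spanned_0: "spanned 0"
  unfolding spanned_def by (intro exI[of _ "{}"]) (simp add: lincomb_def HI_zero)

lemma spanned_M: "w \<in> carrier W \<Longrightarrow> spanned (scalar c * M w)"
  unfolding spanned_def by (intro exI[of _ "{w}"] exI[of _ "\<lambda>w. c"]) (simp add: lincomb_def HI_zero)

lemma spanned_simple_mult: "\<lbrakk>s \<in> S; w \<in> carrier W\<rbrakk> \<Longrightarrow> spanned (scalar c * (M s * M w))"
proof (cases "len (s \<otimes> w) < len w")
  case True
  assume s: "s \<in> S" "w \<in> carrier W"
  have "scalar c * (M s * M w - (scalar laurent_q * M (s \<otimes> w) + scalar (laurent_q - 1) * M w)) \<in> HI"
    using HI_mult(1)[OF M_simple_mult_down[OF s(2,1) True]] by blast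
  then have "scalar c * (M s * M w) - (scalar (c * laurent_q) * M (s \<otimes> w) + scalar (c * (laurent_q - 1)) * M w) \<in> HI"
    unfolding scalar_simps(6) by (simp only: right_diff_distrib distrib_left mult.assoc)
  then show ?thesis
    by (rule spanned_cong) (intro spanned_add spanned_M, use s in simp_all)
next
  case False
  assume s: "s \<in> S" "w \<in> carrier W"
  have "M s * M w - M (s \<otimes> w) \<in> HI"
    using M_mult[of s w] len_simple_mult[of w s] len_simple s False by simp
  then have "scalar c * (M s * M w - M (s \<otimes> w)) \<in> HI" using HI_mult by blast
  then show ?thesis
    unfolding right_diff_distrib by (rule spanned_cong) (intro spanned_M, use s in simp)
qed

lemma M_spans: "x \<in> FS \<Longrightarrow> spanned x"
proof (induction rule: free_induct)
  case (single c xs)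
  then show ?case
  proof (induction xs arbitrary: c)
    case Nil
    then show ?case using spanned_M[of \<one> c] by simp
  next
    case (Cons s xs)
    then have s: "s \<in> S" "xs \<in> lists S" by auto
    obtain A d where A: "finite A" "A \<subseteq> carrier W" "scalar c * monomial xs - lincomb A d \<in> HI"
      using Cons.IH unfolding spanned_def by blast
    have "M s * (scalar c * monomial xs - lincomb A d) \<in> HI" using HI_mult A(3) s by blast
    then have "scalar c * monomial (s # xs) - M s * lincomb A d \<in> HI"
      using s by (simp add: M_simple monomial_Cons[of s xs] scalar_left_commute right_diff_distrib)
    moreover have "spanned (M s * lincomb A d)"
      using A(1,2)
    proof (induction A)
      case (insert w A)
      then show ?case
        using spanned_add spanned_simple_mult[OF s(1), of w "d w"]
        by (simp add: lincomb_def distrib_left scalar_left_commute)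
    qed (simp add: lincomb_def spanned_0)
    ultimately show ?case by (rule spanned_cong)
  qed
qed (auto intro: spanned_0 spanned_add)

lemma laurent_q_neq_1: "laurent_q - 1 \<noteq> 0"
proof
  assume "laurent_q - 1 = 0"
  then have "Poly_Mapping.lookup laurent_q 1 = Poly_Mapping.lookup (1 :: laurent) 1" by simp
  then show False by (simp add: laurent_q_def lookup_one)
qed

text \<open>The T_w span H, and \<open>coord\<close> reads off their coefficients, so H is free over
  the Laurent ring and q - 1 can be cancelled.\<close>

theorem HI_saturated:
  assumes "x \<in> FS" "scalar (laurent_q - 1) * x \<in> HI"
  shows "x \<in> HI"
proof -
  obtain A c where A: "finite A" "A \<subseteq> carrier W" "x - lincomb A c \<in> HI"
    using M_spans[OF assms(1)] unfolding spanned_def by blast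
  have "evl (scalar (laurent_q - 1) * monomial [] * x) (bas \<one>) = (\<lambda>v. (laurent_q - 1) * coord x v)"
    using evl_mult[of "scalar (laurent_q - 1) * monomial []" x] assms(1) by (simp only: evl_scalar_monomial wop.simps) simp
  then have x0: "coord x v = 0" for v
    using coord_HI[OF assms(2)] laurent_q_neq_1 by (simp add: fun_eq_iff)
  have "coord (x - lincomb A c + lincomb A c) v = coord (lincomb A c) v" for v
    unfolding evl_add using coord_HI[OF A(3)] by simp
  then have "c v = 0" if "v \<in> A" for v
    using x0[of v] coord_lincomb[OF A(1,2), of c v] that by simp
  then have "lincomb A c = 0" by (simp add: lincomb_def)
  then show ?thesis using A(3) by simp
qed

end

definition brk :: "'b::ring \<Rightarrow> 'b \<Rightarrow> 'b" where
  "brk a b = a * b - b * a"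

lemma brk_simps:
  "brk (a + a') b = brk a b + brk a' b" "brk a (b + b') = brk a b + brk a b'"
  "brk (a - a') b = brk a b - brk a' b" "brk a (b - b') = brk a b - brk a b'"
  "brk 0 b = 0" "brk a 0 = 0"
  by (simp_all add: brk_def algebra_simps)

lemma brk_swap: "brk a b = - brk b a"
  by (simp add: brk_def)

text \<open>With c chosen to complete a factorisation abc of a group element, this is the cocycle
  identity for conjugation by a and then by b.\<close>

lemma brk_mult: "brk (a * b) c = brk a (b * c) + brk b (c * a)"
  by (simp add: brk_def algebra_simps)

lemma brk_scalar: "brk (scalar c * a) b = scalar c * brk a b" "brk a (scalar c * b) = scalar c * brk a b"
  by (simp_all add: brk_def right_diff_distrib mult.assoc scalar_left_commute[of a] scalar_left_commute[of b])

context crystallographic_coxeter_system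
begin

section \<open>Commutators\<close>

text \<open>\<open>ZZ\<close> is the preimage of \<open>[H, H]\<close> in the free algebra; \<open>NN\<close> is the preimage of \<open>(q - 1) H\<close>
  and \<open>YY\<close> that of \<open>(q - 1) [H, H]\<close>.\<close>

inductive_set ZZ :: "('a free_word \<Rightarrow>\<^sub>0 laurent) set" where
  HI: "x \<in> HI \<Longrightarrow> x \<in> ZZ"
| brk: "\<lbrakk>a \<in> FS; b \<in> FS\<rbrakk> \<Longrightarrow> brk a b \<in> ZZ"
| add: "\<lbrakk>x \<in> ZZ; y \<in> ZZ\<rbrakk> \<Longrightarrow> x + y \<in> ZZ"

definition NN :: "('a free_word \<Rightarrow>\<^sub>0 laurent) set" where
  "NN = {i + scalar (laurent_q - 1) * x | i x. i \<in> HI \<and> x \<in> FS}"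

definition YY :: "('a free_word \<Rightarrow>\<^sub>0 laurent) set" where
  "YY = {i + scalar (laurent_q - 1) * x | i x. i \<in> HI \<and> x \<in> ZZ}"

lemma ZZ_FS: "x \<in> ZZ \<Longrightarrow> x \<in> FS"
  by (induction rule: ZZ.induct) (auto simp: HI_FS brk_def)

lemma ZZ_scalar: "x \<in> ZZ \<Longrightarrow> scalar c * x \<in> ZZ"
proof (induction rule: ZZ.induct)
  case (HI x)
  then show ?case using HI_mult(1) ZZ.HI by blast
next
  case (brk a b)
  then show ?case using ZZ.brk[of "scalar c * a" b] by (auto simp: brk_scalar)
next
  case (add x y)
  then show ?case using ZZ.add by (simp add: distrib_left)
qed

lemma subgrp_ZZ: "subgrp ZZ"
proof -
  have "- x \<in> ZZ" if "x \<in> ZZ" for x using ZZ_scalar[OF that, of "- 1"] by simp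
  then have "x - y \<in> ZZ" if "x \<in> ZZ" "y \<in> ZZ" for x y
    using ZZ.add[of x "- y"] that by simp
  then show ?thesis using ZZ.HI[OF HI_zero] by (auto simp: subgrp_def)
qed

lemma subgrp_shift:
  fixes c :: "'z::ring"
  assumes "subgrp A" "subgrp B"
  shows "subgrp {i + c * x | i x. i \<in> A \<and> x \<in> B}"
proof -
  have "(i + c * x) - (j + c * y) = (i - j) + c * (x - y)" for i j x y
    by (simp add: algebra_simps)
  moreover have "0 = 0 + c * 0" by simp
  ultimately show ?thesis
    using subgrpD(1,2)[OF assms(1)] subgrpD(1,2)[OF assms(2)] unfolding subgrp_def by blast
qed

lemma subgrp_NN: "subgrp NN" and subgrp_YY: "subgrp YY"
proof -
  have "subgrp FS" by (auto simp: subgrp_def)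
  then show "subgrp NN" unfolding NN_def by (rule subgrp_shift[OF subgrp_HI])
  show "subgrp YY" unfolding YY_def by (rule subgrp_shift[OF subgrp_HI subgrp_ZZ])
qed

lemma HI_NN: "x \<in> HI \<Longrightarrow> x \<in> NN"
  unfolding NN_def by (intro CollectI exI[of _ x] exI[of _ 0]) auto

lemma HI_YY: "x \<in> HI \<Longrightarrow> x \<in> YY"
  unfolding YY_def using subgrpD(1)[OF subgrp_ZZ] by (intro CollectI exI[of _ x] exI[of _ 0]) auto

lemma shift_YY: "x \<in> ZZ \<Longrightarrow> scalar (laurent_q - 1) * x \<in> YY"
  unfolding YY_def using HI_zero by (intro CollectI exI[of _ 0] exI[of _ x]) auto

lemma YY_ZZ: "x \<in> YY \<Longrightarrow> x \<in> ZZ"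
  unfolding YY_def using ZZ.add ZZ.HI ZZ_scalar by blast

lemma NN_mult: "\<lbrakk>x \<in> NN; y \<in> FS\<rbrakk> \<Longrightarrow> y * x \<in> NN" "\<lbrakk>x \<in> NN; y \<in> FS\<rbrakk> \<Longrightarrow> x * y \<in> NN"
proof -
  assume "x \<in> NN" and y: "y \<in> FS"
  then obtain i a where "i \<in> HI" "a \<in> FS" "x = i + scalar (laurent_q - 1) * a"
    unfolding NN_def by blast
  moreover from this have "y * x = y * i + scalar (laurent_q - 1) * (y * a)"
    "x * y = i * y + scalar (laurent_q - 1) * (a * y)"
    by (simp_all only: distrib_left distrib_right scalar_left_commute mult.assoc)
  ultimately show "y * x \<in> NN" "x * y \<in> NN"
    using HI_mult y unfolding NN_def by blast+
qed

lemma brk_NN: "\<lbrakk>n \<in> NN; b \<in> FS\<rbrakk> \<Longrightarrow> brk n b \<in> YY"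
proof -
  assume "n \<in> NN" and b: "b \<in> FS"
  then obtain i a where *: "i \<in> HI" "a \<in> FS" "n = i + scalar (laurent_q - 1) * a"
    unfolding NN_def by blast
  then have eq: "brk n b = brk i b + scalar (laurent_q - 1) * brk a b"
    by (simp only: brk_simps brk_scalar)
  have "brk i b \<in> HI" using HI_mult * b HI_diff unfolding brk_def by blast
  then show ?thesis using ZZ.brk[OF *(2) b] unfolding eq YY_def by blast
qed

text \<open>A bracket with one entry in (q - 1)H lies in (q - 1)[H, H], so brackets modulo
  \<open>YY\<close> depend on their entries at q = 1 only.\<close>

lemma brk_cong:
  assumes "a - a' \<in> NN" "b - b' \<in> NN" "a' \<in> FS" "b \<in> FS"
  shows "brk a b - brk a' b' \<in> YY"
proof -
  have "brk a b - brk a' b' = brk (a - a') b + (- brk (b - b') a')"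
    by (simp add: brk_simps brk_swap[of b a'] brk_swap[of b' a'])
  then show ?thesis
    using brk_NN assms subgrpD[OF subgrp_YY] by metis
qed

text \<open>Modulo q - 1 the Hecke algebra is the group ring, so any word, reduced or not,
  represents T of its product.\<close>

lemma monomial_cong: "xs \<in> lists S \<Longrightarrow> monomial xs - M (wprod xs) \<in> NN"
proof (induction xs)
  case Nil
  then show ?case by (simp add: subgrpD(1)[OF subgrp_NN])
next
  case (Cons s xs)
  define w where "w = wprod xs"
  have s: "s \<in> S" "w \<in> carrier W" "s \<otimes> w \<in> carrier W" using Cons by (auto simp: w_def)
  have "M s * (monomial xs - M w) \<in> NN" using Cons s NN_mult unfolding w_def by auto
  then have 1: "monomial (s # xs) - M s * M w \<in> NN"
    by (simp add: right_diff_distrib M_simple[OF s(1)] monomial_Cons[of s xs])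
  have "M s * M w - M (s \<otimes> w) \<in> NN"
  proof (cases "len (s \<otimes> w) < len w")
    case True
    have "(M s * M w - (scalar laurent_q * M (s \<otimes> w) + scalar (laurent_q - 1) * M w))
       + scalar (laurent_q - 1) * (M (s \<otimes> w) + M w) \<in> NN"
      unfolding NN_def using M_simple_mult_down[OF s(2,1) True] s by blast
    then show ?thesis by (simp add: algebra_simps)
  next
    case False
    then show ?thesis
      using M_mult[of s w] len_simple_mult[of w s] len_simple s HI_NN by auto
  qed
  with 1 have "monomial (s # xs) - M (s \<otimes> w) \<in> NN" by (rule cong_trans[OF subgrp_NN])
  then show ?case by (simp add: w_def)
qed

lemma M_mult_NN:
  assumes "u \<in> carrier W" "v \<in> carrier W"
  shows "M u * M v - M (u \<otimes> v) \<in> NN"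
proof -
  obtain xs where xs: "xs \<in> lists S" "wprod xs = u" "M u = monomial xs"
    using M_reduced[OF assms(1)] by blast
  obtain ys where ys: "ys \<in> lists S" "wprod ys = v" "M v = monomial ys"
    using M_reduced[OF assms(2)] by blast
  show ?thesis
    using monomial_cong[of "xs @ ys"] xs ys by (simp add: wprod_append monomial_append)
qed

section \<open>Invertibility of the standard generators\<close>

lemma HI_inverse_simple:
  assumes "s \<in> S"
  shows "\<exists>b\<in>FS. M s * b - 1 \<in> HI \<and> b * M s - 1 \<in> HI"
proof -
  define r :: laurent where "r = Poly_Mapping.single (-1) 1"
  have r: "scalar r * scalar laurent_q = 1"
    by (simp add: r_def laurent_q_def mult_single flip: scalar_simps(6))
  \<comment> \<open>The inverse of T_s given by the quadratic relation, with r = q^-1.\<close>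
  let ?b = "scalar r * (M s - scalar (laurent_q - 1))"
  have "scalar r * (M s * M s - (scalar (laurent_q - 1) * M s + scalar laurent_q)) \<in> HI"
    using HI_mult(1)[OF quadratic_HI[OF assms]] by blast
  moreover have "scalar r * (M s * M s - (scalar (laurent_q - 1) * M s + scalar laurent_q)) = ?b * M s - 1"
    unfolding right_diff_distrib distrib_left left_diff_distrib r by (simp add: mult.assoc)
  moreover have "M s * ?b = ?b * M s"
    by (simp only: scalar_left_commute[of "M s"] scalar_commute[of "M s"] right_diff_distrib left_diff_distrib mult.assoc)
  ultimately show ?thesis using assms by (intro bexI[of _ ?b]) auto
qed

lemma HI_inverse:
  assumes "xs \<in> lists S"
  shows "\<exists>b\<in>FS. monomial xs * b - 1 \<in> HI \<and> b * monomial xs - 1 \<in> HI"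
  using assms
proof induction
  case Nil
  show ?case by (intro bexI[of _ 1]) (auto simp: HI_zero)
next
  case (Cons s xs)
  obtain b where b: "b \<in> FS" "monomial xs * b - 1 \<in> HI" "b * monomial xs - 1 \<in> HI"
    using Cons by blast
  obtain d where d: "d \<in> FS" "M s * d - 1 \<in> HI" "d * M s - 1 \<in> HI"
    using HI_inverse_simple[OF Cons(1)] by blast
  have x: "monomial xs \<in> FS" "M s \<in> FS" using Cons by auto
  have "M s * (monomial xs * b - 1) * d + (M s * d - 1) \<in> HI"
    "b * (d * M s - 1) * monomial xs + (b * monomial xs - 1) \<in> HI"
    using b d x by (blast intro: HI_add HI_mult)+
  moreover have "M s * (monomial xs * b - 1) * d + (M s * d - 1) = monomial (s # xs) * (b * d) - 1"
    "b * (d * M s - 1) * monomial xs + (b * monomial xs - 1) = (b * d) * monomial (s # xs) - 1"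
    by (simp_all add: algebra_simps monomial_Cons[of s xs] M_simple[OF Cons(1)])
  ultimately show ?case using b d by (intro bexI[of _ "b * d"]) auto
qed

lemma M_inverse:
  assumes u: "u \<in> carrier W"
  shows "\<exists>b\<in>FS. M u * b - 1 \<in> HI \<and> b * M u - 1 \<in> HI \<and> b - M (inv u) \<in> NN"
proof -
  obtain xs where "xs \<in> lists S" "M u = monomial xs" using M_reduced[OF u] by blast
  then obtain b where b: "b \<in> FS" "M u * b - 1 \<in> HI" "b * M u - 1 \<in> HI"
    using HI_inverse by metis
  have 1: "b * (M u * M (inv u) - 1) \<in> NN"
    using M_mult_NN[OF u inv_closed[OF u]] b(1) u by (auto intro: NN_mult)
  have 2: "(b * M u - 1) * M (inv u) \<in> NN" using b(3) u by (intro HI_NN HI_mult) auto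
  have "(b * M u - 1) * M (inv u) - b * (M u * M (inv u) - 1) = b - M (inv u)"
    by (simp add: algebra_simps)
  then show ?thesis using b subgrpD(2)[OF subgrp_NN 2 1] by auto
qed

text \<open>The value on the arrow from g to z^-1 g z. At q = 1 it becomes g - z^-1 g z, but it is
  kept modulo (q - 1)[H, H], which is finer.\<close>

definition cocycle :: "'a \<Rightarrow> 'a \<Rightarrow> 'a free_word \<Rightarrow>\<^sub>0 laurent" where
  "cocycle g z = brk (M z) (M (inv z \<otimes> g))"

lemma cocycle_ZZ: "\<lbrakk>g \<in> carrier W; z \<in> carrier W\<rbrakk> \<Longrightarrow> cocycle g z \<in> ZZ"
  unfolding cocycle_def by (intro ZZ.brk) auto

lemma cocycle_mult:
  assumes c: "g \<in> carrier W" "y \<in> carrier W" "z \<in> carrier W"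
  shows "cocycle g (y \<otimes> z) - (cocycle g y + cocycle (cj y g) z) \<in> YY"
proof -
  let ?b = "inv z \<otimes> (inv y \<otimes> g)"
  have b: "?b \<in> carrier W" "inv (y \<otimes> z) \<otimes> g = ?b" "inv z \<otimes> cj y g = ?b \<otimes> y" "z \<otimes> ?b = inv y \<otimes> g"
    using c by (simp_all add: cj_def inv_mult_group m_assoc) (simp add: inv_solve_left' flip: m_assoc)
  have "brk (M (y \<otimes> z)) (M ?b) - brk (M y * M z) (M ?b) \<in> YY"
    using cong_sym[OF subgrp_NN M_mult_NN[OF c(2,3)]] subgrpD(1)[OF subgrp_NN] c b(1)
    by (intro brk_cong) auto
  moreover have "brk (M y) (M z * M ?b) - brk (M y) (M (inv y \<otimes> g)) \<in> YY"
    using M_mult_NN[OF c(3) b(1)] subgrpD(1)[OF subgrp_NN] c b by (intro brk_cong) auto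
  moreover have "brk (M z) (M ?b * M y) - brk (M z) (M (?b \<otimes> y)) \<in> YY"
    using M_mult_NN[OF b(1) c(2)] subgrpD(1)[OF subgrp_NN] c b by (intro brk_cong) auto
  ultimately have "(brk (M (y \<otimes> z)) (M ?b) - brk (M y * M z) (M ?b)) +
    ((brk (M y) (M z * M ?b) - brk (M y) (M (inv y \<otimes> g))) +
     (brk (M z) (M ?b * M y) - brk (M z) (M (?b \<otimes> y)))) \<in> YY"
    using subgrpD(4)[OF subgrp_YY] by blast
  then show ?thesis unfolding cocycle_def b(2,3) by (simp add: brk_mult algebra_simps)
qed

lemma cocycle_cyc:
  assumes "cyc v u v'" "v \<in> carrier W" "u \<in> carrier W"
  shows "cocycle v u - (M v - M v') \<in> HI"
proof -
  obtain y where y: "y \<in> carrier W" "v = u \<otimes> y" "v' = y \<otimes> u" "len v = len u + len y" "len v' = len y + len u"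
    using assms(1) unfolding cyc_def by blast
  have "inv u \<otimes> v = y" using y assms by (simp flip: m_assoc)
  moreover have "M u * M y - M v \<in> HI" "M y * M u - M v' \<in> HI"
    using M_mult[of u y] M_mult[of y u] y assms by simp_all
  ultimately show ?thesis
    using cong_diff[OF subgrp_HI] by (simp add: cocycle_def brk_def)
qed

text \<open>Additive lengths give T_v T_u = T_u T_v' in H, so T_v is conjugate to T_v' by the
  invertible element T_u, and a difference of conjugates is a single commutator.\<close>

lemma slide_bracket:
  assumes "slide v u v'" "v \<in> carrier W" "u \<in> carrier W" "v' \<in> carrier W"
  shows "\<exists>b\<in>FS. (M v - M v') - brk (M u) (M v' * b) \<in> HI \<and> b - M (inv u) \<in> NN"
proof -
  obtain b where b: "b \<in> FS" "M u * b - 1 \<in> HI" "b * M u - 1 \<in> HI" "b - M (inv u) \<in> NN"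
    using M_inverse[OF assms(3)] by blast
  have "M v * M u - M (v \<otimes> u) \<in> HI" "M u * M v' - M (v \<otimes> u) \<in> HI"
    using M_mult[OF assms(2,3)] M_mult[OF assms(3,4)] assms(1) unfolding slide_def by metis+
  then have "M v * M u - M u * M v' \<in> HI" using cong_trans[OF subgrp_HI] cong_sym[OF subgrp_HI] by blast
  then have "(M v * M u - M u * M v') * b \<in> HI" "M v * (M u * b - 1) \<in> HI" "M v' * (b * M u - 1) \<in> HI"
    using b assms by (auto intro: HI_mult)
  then have "(M v * M u - M u * M v') * b - M v * (M u * b - 1) + M v' * (b * M u - 1) \<in> HI"
    using HI_add HI_diff by blast
  then show ?thesis using b by (intro bexI[of _ b]) (auto simp: brk_def algebra_simps)
qed

text \<open>The inverse of T_u agrees with T of u^-1 modulo q - 1, and \<open>brk_cong\<close>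
  allows the replacement.\<close>

lemma cocycle_slide:
  assumes "slide v u v'" "v \<in> carrier W" "u \<in> carrier W" "v' \<in> carrier W"
  shows "cocycle v u - (M v - M v') \<in> YY"
proof -
  obtain b where b: "b \<in> FS" "(M v - M v') - brk (M u) (M v' * b) \<in> HI" "b - M (inv u) \<in> NN"
    using slide_bracket[OF assms] by blast
  have "v' = inv u \<otimes> (v \<otimes> u)" using assms by (simp add: slide_def flip: m_assoc)
  then have eq: "v' \<otimes> inv u = inv u \<otimes> v" using assms by (simp add: m_assoc)
  have "M v' * (b - M (inv u)) \<in> NN" using b assms by (auto intro: NN_mult)
  then have "M v' * b - M (inv u \<otimes> v) \<in> NN"
    using cong_trans[OF subgrp_NN, of "M v' * b" "M v' * M (inv u)"] M_mult_NN[of v' "inv u"] assms eq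
    by (simp add: right_diff_distrib)
  then have "brk (M u) (M v' * b) - cocycle v u \<in> YY"
    unfolding cocycle_def using subgrpD(1)[OF subgrp_NN] b assms by (intro brk_cong) auto
  then show ?thesis
    using cong_trans[OF subgrp_YY HI_YY[OF b(2)]] cong_sym[OF subgrp_YY] by blast
qed

lemma cocycle_one: "g \<in> carrier W \<Longrightarrow> cocycle g \<one> = 0"
  by (simp add: cocycle_def brk_def)

lemma cj_cj_inv: "\<lbrakk>x \<in> carrier W; y \<in> carrier W; w \<in> carrier W\<rbrakk> \<Longrightarrow> cj (inv x \<otimes> y) (cj x w) = cj y w"
  by (simp flip: cj_mult add: m_assoc[symmetric])

text \<open>A step used backwards is reduced to the forward case by applying additivity to an arrow
  followed by its inverse.\<close>

lemma cocycle_good: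
  assumes g: "good w x y" and w: "w \<in> carrier W"
  shows "cocycle (cj x w) (inv x \<otimes> y) - (M (cj x w) - M (cj y w)) \<in> YY"
proof -
  have step: "cocycle (cj x w) (inv x \<otimes> y) - (M (cj x w) - M (cj y w)) \<in> YY"
    if "x \<in> carrier W" "y \<in> carrier W" "cyc (cj x w) (inv x \<otimes> y) (cj y w) \<or> slide (cj x w) (inv x \<otimes> y) (cj y w)" for x y
    using that w cocycle_cyc cocycle_slide HI_YY by (meson cj_closed inv_closed m_closed)
  have c: "x \<in> carrier W" "y \<in> carrier W" using good_carrier[OF g] by auto
  then consider "cyc (cj x w) (inv x \<otimes> y) (cj y w) \<or> slide (cj x w) (inv x \<otimes> y) (cj y w)"
    | "cyc (cj y w) (inv y \<otimes> x) (cj x w) \<or> slide (cj y w) (inv y \<otimes> x) (cj x w)"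
    using g unfolding good_def by blast
  then show ?thesis
  proof cases
    case 1
    then show ?thesis using step c by blast
  next
    case 2
    have "inv x \<otimes> y \<otimes> (inv y \<otimes> x) = \<one>" using c by (simp add: m_assoc) (simp flip: m_assoc add: c)
    then have "0 - (cocycle (cj x w) (inv x \<otimes> y) + cocycle (cj y w) (inv y \<otimes> x)) \<in> YY"
      using cocycle_mult[of "cj x w" "inv x \<otimes> y" "inv y \<otimes> x"] c w cj_cj_inv cocycle_one by simp
    from subgrpD(4)[OF subgrp_YY this step[OF c(2,1) 2]] have "- (cocycle (cj x w) (inv x \<otimes> y) - (M (cj x w) - M (cj y w))) \<in> YY"
      by (simp add: algebra_simps)
    from subgrpD(3)[OF subgrp_YY this] show ?thesis by simp
  qed
qed

text \<open>Along a path the differences of the T_v telescope. A path that returns to the same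
  conjugate therefore has cocycle 0, even when its end is a different chamber.\<close>

lemma cocycle_good_path:
  assumes "(good w)\<^sup>*\<^sup>* \<one> y" and w: "w \<in> carrier W"
  shows "y \<in> carrier W \<and> cocycle w y - (M w - M (cj y w)) \<in> YY"
  using assms(1)
proof (induction rule: rtranclp_induct)
  case base
  show ?case using w subgrpD(1)[OF subgrp_YY] by (simp add: cocycle_one)
next
  case (step y z)
  have c: "y \<in> carrier W" "z \<in> carrier W" using good_carrier[OF step(2)] by auto
  have "y \<otimes> (inv y \<otimes> z) = z" using c by (simp flip: m_assoc)
  then have 1: "cocycle w z - (cocycle w y + cocycle (cj y w) (inv y \<otimes> z)) \<in> YY"
    using cocycle_mult[of w y "inv y \<otimes> z"] c w by simp
  have "cocycle w y + cocycle (cj y w) (inv y \<otimes> z) - ((M w - M (cj y w)) + (M (cj y w) - M (cj z w))) \<in> YY"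
    using cong_add[OF subgrp_YY] step(3) cocycle_good[OF step(2) w] by blast
  from cong_trans[OF subgrp_YY 1 this] show ?case using c by simp
qed

lemma M_good_path: "\<lbrakk>(good w)\<^sup>*\<^sup>* \<one> y; w \<in> carrier W\<rbrakk> \<Longrightarrow> M w - M (cj y w) \<in> ZZ"
proof -
  assume a: "(good w)\<^sup>*\<^sup>* \<one> y" "w \<in> carrier W"
  have "y \<in> carrier W" and 1: "cocycle w y - (M w - M (cj y w)) \<in> YY" using cocycle_good_path[OF a] by auto
  then have "cocycle w y \<in> ZZ" using cocycle_ZZ a by blast
  from subgrpD(2)[OF subgrp_ZZ this YY_ZZ[OF 1]] show ?thesis by simp
qed

section \<open>Conjugacy classes\<close>

definition cls :: "'a \<Rightarrow> 'a set" where
  "cls g = (\<lambda>x. cj x g) ` carrier W"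

definition min_len :: "'a \<Rightarrow> bool" where
  "min_len g \<longleftrightarrow> (\<forall>x\<in>carrier W. len g \<le> len (cj x g))"

definition rep :: "'a set \<Rightarrow> 'a" where
  "rep C = (SOME v. v \<in> min_length_elements W S C)"

lemma cls_self: "g \<in> carrier W \<Longrightarrow> g \<in> cls g"
  unfolding cls_def by (rule image_eqI[of _ _ \<one>]) auto

lemma clsD: "v \<in> cls g \<Longrightarrow> \<exists>y. y \<in> carrier W \<and> cj y g = v"
  unfolding cls_def by blast

lemma cls_carrier: "\<lbrakk>g \<in> carrier W; v \<in> cls g\<rbrakk> \<Longrightarrow> v \<in> carrier W"
  unfolding cls_def by auto

lemma cls_cj: "\<lbrakk>g \<in> carrier W; x \<in> carrier W\<rbrakk> \<Longrightarrow> cls (cj x g) = cls g"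
proof -
  assume c: "g \<in> carrier W" "x \<in> carrier W"
  have "cj y g \<in> cls (cj x g)" if "y \<in> carrier W" for y
    using c that cj_cj_inv[of x y g] unfolding cls_def by (intro image_eqI[of _ _ "inv x \<otimes> y"]) auto
  moreover have "cj y (cj x g) \<in> cls g" if "y \<in> carrier W" for y
    using c that unfolding cls_def by (intro image_eqI[of _ _ "x \<otimes> y"]) (auto simp: cj_mult)
  ultimately show ?thesis unfolding cls_def[of g] cls_def[of "cj x g"] by (auto simp: cls_def)
qed

lemma cls_eq: "\<lbrakk>g \<in> carrier W; v \<in> cls g\<rbrakk> \<Longrightarrow> cls v = cls g"
  using cls_cj unfolding cls_def by blast

lemma min_length_ex:
  assumes "g \<in> carrier W"
  shows "\<exists>v. v \<in> min_length_elements W S (cls g)"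
proof -
  from ex_has_least_nat[of "\<lambda>v. v \<in> cls g" g len] cls_self[OF assms] show ?thesis
    by (auto simp: min_length_elements_def)
qed

lemma min_length_min_len: "\<lbrakk>g \<in> carrier W; v \<in> min_length_elements W S (cls g)\<rbrakk> \<Longrightarrow> v \<in> cls g \<and> min_len v"
proof -
  assume g: "g \<in> carrier W" and v: "v \<in> min_length_elements W S (cls g)"
  then have "v \<in> cls g" by (simp add: min_length_elements_def)
  moreover have "cj x v \<in> cls g" if "x \<in> carrier W" for x
    using cls_eq[OF g calculation] that unfolding cls_def by blast
  ultimately show ?thesis using v by (simp add: min_length_elements_def min_len_def)
qed

lemma rep_cls: "g \<in> carrier W \<Longrightarrow> rep (cls g) \<in> min_length_elements W S (cls g)"
  unfolding rep_def using min_length_ex by (rule someI_ex)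

lemma min_len_not_drops:
  assumes w: "w \<in> carrier W" and x: "x \<in> carrier W" and m: "\<And>y. y \<in> carrier W \<Longrightarrow> len (cj x w) \<le> len (cj y w)"
  shows "\<not> drops w x"
proof
  assume "drops w x"
  then obtain z s where z: "(eqstep w)\<^sup>*\<^sup>* x z" "s \<in> S" "len (cj (z \<otimes> s) w) < len (cj z w)"
    unfolding drops_def[OF w] by blast
  have "z \<in> carrier W" "len (cj z w) = len (cj x w)" using eqsteps[OF w z(1) x] by auto
  then show False using m[of "z \<otimes> s"] z by simp
qed

text \<open>At minimal length there are no drops, so the dichotomy leaves a path. The element y is
  arbitrary, so every element centralising w is reached.\<close>

lemma min_len_good_path:
  assumes w: "w \<in> carrier W" "min_len w" and y: "y \<in> carrier W" "len (cj y w) = len w"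
  shows "(good w)\<^sup>*\<^sup>* \<one> y"
  using good_path_or_drop[OF w(1) one_closed y(1)] min_len_not_drops[OF w(1) one_closed] min_len_not_drops[OF w(1) y(1)] w y
  unfolding min_len_def by simp

lemma M_min_len:
  assumes "g \<in> carrier W" "u \<in> min_length_elements W S (cls g)" "v \<in> min_length_elements W S (cls g)"
  shows "M u - M v \<in> ZZ"
proof -
  have u: "u \<in> cls g" "min_len u" using min_length_min_len assms by blast+
  have uc: "u \<in> carrier W" "cls u = cls g" using u cls_carrier cls_eq assms(1) by blast+
  have "v \<in> cls u" using min_length_min_len assms uc by blast
  then obtain y where y: "y \<in> carrier W" "v = cj y u" by (auto simp: cls_def)
  have "len v = len u" using assms(2,3) by (auto simp: min_length_elements_def intro: antisym)
  then have "(good u)\<^sup>*\<^sup>* \<one> y" using min_len_good_path[OF uc(1) u(2) y(1)] y by simp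
  from M_good_path[OF this uc(1)] show ?thesis using y by simp
qed

definition to_rep :: "'a \<Rightarrow> 'a" where
  "to_rep g = (SOME y. y \<in> carrier W \<and> cj y g = rep (cls g))"

lemma to_rep: "g \<in> carrier W \<Longrightarrow> to_rep g \<in> carrier W \<and> cj (to_rep g) g = rep (cls g)"
proof -
  assume g: "g \<in> carrier W"
  have "rep (cls g) \<in> cls g" using min_length_min_len[OF g rep_cls[OF g]] by blast
  from someI_ex[OF clsD[OF this]] show ?thesis by (simp add: to_rep_def)
qed

text \<open>The cocycle on a chosen arrow from g to the representative of its class; different
  choices agree modulo \<open>YY\<close> because loops contribute nothing.\<close>

definition potential :: "'a \<Rightarrow> 'a free_word \<Rightarrow>\<^sub>0 laurent" where
  "potential g = cocycle g (to_rep g)"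

lemma potential_ZZ: "g \<in> carrier W \<Longrightarrow> potential g \<in> ZZ"
  unfolding potential_def using cocycle_ZZ to_rep by blast

text \<open>By the connecting paths the cocycle is trivial on loops of the conjugation groupoid.\<close>

lemma cocycle_coboundary:
  assumes g: "g \<in> carrier W" and z: "z \<in> carrier W"
  shows "cocycle g z - (potential g - potential (cj z g)) \<in> YY"
proof -
  let ?h = "cj z g" and ?r = "rep (cls g)"
  have h: "?h \<in> carrier W" "cls ?h = cls g" using g z cls_cj by auto
  \<comment> \<open>The element c closes up the two routes from g to the representative, directly
    and via the conjugate by z; it centralises the representative.\<close>
  define y y' c where "y = to_rep g" and "y' = to_rep ?h" and "c = inv y \<otimes> (z \<otimes> y')"
  have y: "y \<in> carrier W" "cj y g = ?r" and y': "y' \<in> carrier W" "cj y' ?h = ?r"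
    using to_rep[OF g] to_rep[OF h(1)] h by (auto simp: y_def y'_def)
  have c: "c \<in> carrier W" "y \<otimes> c = z \<otimes> y'" using y y' z by (auto simp: c_def simp flip: m_assoc)
  have r: "?r \<in> carrier W" "min_len ?r" using min_length_min_len[OF g rep_cls[OF g]] cls_carrier g by auto
  have "cj c ?r = cj (z \<otimes> y') g" using cj_mult[OF y(1) c(1) g] y(2) c(2) by simp
  then have cr: "cj c ?r = ?r" using cj_mult[OF z y'(1) g] y' by simp
  then have "(good ?r)\<^sup>*\<^sup>* \<one> c" using min_len_good_path[OF r c(1)] by simp
  from cocycle_good_path[OF this r(1)] have "cocycle ?r c \<in> YY" using cr by simp
  moreover have "cocycle g (z \<otimes> y') - (cocycle g y + cocycle ?r c) \<in> YY"
    using cocycle_mult[OF g y(1) c(1)] y c by simp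
  ultimately have "cocycle g (z \<otimes> y') - (cocycle g y + cocycle ?r c) + cocycle ?r c \<in> YY"
    using subgrpD(4)[OF subgrp_YY] by blast
  moreover have "cocycle g (z \<otimes> y') - (cocycle g z + cocycle ?h y') \<in> YY" using cocycle_mult[OF g z y'(1)] .
  ultimately have "(cocycle g (z \<otimes> y') - (cocycle g y + cocycle ?r c) + cocycle ?r c) - (cocycle g (z \<otimes> y') - (cocycle g z + cocycle ?h y')) \<in> YY"
    using subgrpD(2)[OF subgrp_YY] by blast
  then show ?thesis by (simp add: potential_def y_def y'_def algebra_simps)
qed

text \<open>The additive map that sees a word only through its product in W. The function \<chi> is
  merely additive in the coefficient, which covers Laurent-linear maps as well as integer-valued
  traces at q = 1.\<close>

definition wlin :: "(laurent \<Rightarrow> 'a \<Rightarrow> 'z::ab_group_add) \<Rightarrow> ('a free_word \<Rightarrow>\<^sub>0 laurent) \<Rightarrow> 'z" where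
  "wlin \<chi> x = (\<Sum>u\<in>Poly_Mapping.keys x. \<chi> (Poly_Mapping.lookup x u) (wprod (letters u)))"

context
  fixes \<chi> :: "laurent \<Rightarrow> 'a \<Rightarrow> 'z::ab_group_add"
  assumes \<chi>_add: "\<And>a b g. \<chi> (a + b) g = \<chi> a g + \<chi> b g"
begin

lemma \<chi>_zero: "\<chi> 0 g = 0"
  using \<chi>_add[of 0 0 g] by simp

lemma \<chi>_diff: "\<chi> (a - b) g = \<chi> a g - \<chi> b g"
  using \<chi>_add[of "a - b" b g] by simp

lemma wlin_add: "wlin \<chi> (x + y) = wlin \<chi> x + wlin \<chi> y"
  unfolding wlin_def by (intro setsum_keys_plus_distrib) (simp_all add: \<chi>_add \<chi>_zero)

lemma wlin_zero: "wlin \<chi> 0 = 0"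
  by (simp add: wlin_def)

lemma wlin_diff: "wlin \<chi> (x - y) = wlin \<chi> x - wlin \<chi> y"
  using wlin_add[of "x - y" y] by simp

lemma wlin_monomial: "wlin \<chi> (scalar c * monomial xs) = \<chi> c (wprod xs)"
  by (simp add: wlin_def monomial_def scalar_mult_single \<chi>_zero)

text \<open>At q = 1 the relators hold in the group. Braid relators contribute 0, and a quadratic
  relator contributes only terms with a factor q - 1, which lie in Y by hypothesis.\<close>

lemma wlin_HI:
  assumes Y: "subgrp Y" and \<chi>_shift: "\<And>c g. g \<in> carrier W \<Longrightarrow> \<chi> ((laurent_q - 1) * c) g \<in> Y" and "x \<in> HI"
  shows "wlin \<chi> x \<in> Y"
proof -
  \<comment> \<open>Multiplying on both sides makes this a two-sided ideal, so only the relators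
    have to be tested.\<close>
  define J where "J = {x \<in> FS. \<forall>a\<in>FS. \<forall>b\<in>FS. wlin \<chi> (a * x * b) \<in> Y}"
  have JI: "x \<in> J" if x: "x \<in> FS" "\<And>c xs ys. \<lbrakk>xs \<in> lists S; ys \<in> lists S\<rbrakk> \<Longrightarrow> wlin \<chi> (scalar c * (monomial xs * x * monomial ys)) \<in> Y" for x
  proof -
    have "wlin \<chi> (a * x * b) \<in> Y" if "a \<in> FS" "b \<in> FS" for a b
      using that(1)
    proof (induction rule: free_induct)
      case (single c xs)
      from that(2) show ?case
      proof (induction rule: free_induct)
        case (single d ys)
        have "scalar c * monomial xs * x * (scalar d * monomial ys) = scalar (d * c) * (monomial xs * x * monomial ys)"
          by (simp add: mult.assoc scalar_left_commute[of "monomial xs"] scalar_left_commute[of x] scalar_left_commute[of "scalar c"])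
        then show ?case using x(2)[OF \<open>xs \<in> lists S\<close> single, of "d * c"] by (simp only:)
      qed (use subgrpD[OF Y] in \<open>auto simp: wlin_zero wlin_add distrib_left\<close>)
    qed (use subgrpD[OF Y] in \<open>auto simp: wlin_zero wlin_add distrib_right\<close>)
    then show ?thesis using x(1) by (simp add: J_def)
  qed
  have "hecke_relators W S \<subseteq> J"
  proof
    fix x assume x: "x \<in> hecke_relators W S"
    show "x \<in> J"
    proof (rule JI)
      show "x \<in> FS" using x relators_FS by blast
      fix c xs ys assume l: "xs \<in> lists S" "ys \<in> lists S"
      from x consider s where "s \<in> S" "x = (monomial [s] + 1) * (monomial [s] - scalar laurent_q)"
        | s t where "s \<in> S" "t \<in> S" "s \<noteq> t"
          "x = monomial (alternating (coxeter_order W s t) s t) - monomial (alternating (coxeter_order W s t) t s)"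
        unfolding hecke_relators_def by blast
      then show "wlin \<chi> (scalar c * (monomial xs * x * monomial ys)) \<in> Y"
      proof cases
        case 1
        define d where "d = laurent_q - 1"
        have "x = monomial [s, s] - scalar d * monomial [s] - scalar laurent_q"
          using 1 scalar_commute[of "monomial [s]" laurent_q] by (simp add: d_def algebra_simps monomial_Cons[of s "[s]"])
        then have "scalar c * (monomial xs * x * monomial ys) = scalar c * monomial (xs @ [s, s] @ ys)
          - scalar (d * c) * monomial (xs @ [s] @ ys) - scalar (laurent_q * c) * monomial (xs @ ys)"
          by (simp only: right_diff_distrib left_diff_distrib monomial_append mult.assoc scalar_simps(6)
            scalar_left_commute[of "monomial xs"] scalar_left_commute[of "scalar c"])
        then have "wlin \<chi> (scalar c * (monomial xs * x * monomial ys)) = \<chi> c (wprod (xs @ [s, s] @ ys))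
          - \<chi> (d * c) (wprod (xs @ [s] @ ys)) - \<chi> (laurent_q * c) (wprod (xs @ ys))"
          by (simp only: wlin_diff wlin_monomial)
        moreover have "wprod (xs @ [s, s] @ ys) = wprod (xs @ ys)"
          using l 1(1) by (simp add: wprod_append)
        moreover have "\<chi> (laurent_q * c) g = \<chi> (d * c) g + \<chi> c g" for g
          by (simp add: d_def left_diff_distrib \<chi>_diff)
        ultimately have "wlin \<chi> (scalar c * (monomial xs * x * monomial ys)) =
          - \<chi> (d * c) (wprod (xs @ [s] @ ys)) - \<chi> (d * c) (wprod (xs @ ys))"
          by simp
        then show ?thesis using subgrpD(2,3)[OF Y] \<chi>_shift[folded d_def] l 1(1) by simp
      next
        case 2
        let ?m = "coxeter_order W s t"
        have a: "alternating ?m s t \<in> lists S" "alternating ?m t s \<in> lists S"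
          using 2 alternating_in_lists by auto
        have "scalar c * (monomial xs * x * monomial ys) = scalar c * monomial (xs @ alternating ?m s t @ ys)
           - scalar c * monomial (xs @ alternating ?m t s @ ys)"
          unfolding 2(4) by (simp only: right_diff_distrib left_diff_distrib monomial_append mult.assoc)
        then have "wlin \<chi> (scalar c * (monomial xs * x * monomial ys)) = 0"
          using l a wprod_braid[OF 2(1,2)] by (simp only: wlin_diff wlin_monomial) (simp add: wprod_append)
        then show ?thesis using subgrpD(1)[OF Y] by simp
      qed
    qed
  qed
  moreover have "ideal J (free_algebra S)"
  proof (rule ideal_freeI)
    fix x y assume x: "x \<in> J" and y: "y \<in> FS"
    have "wlin \<chi> (a * (y * x) * b) \<in> Y" "wlin \<chi> (a * (x * y) * b) \<in> Y" if "a \<in> FS" "b \<in> FS" for a b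
    proof -
      have "wlin \<chi> (a * y * x * b) \<in> Y" "wlin \<chi> (a * x * (y * b)) \<in> Y"
        using x y that free_closed(8) unfolding J_def by blast+
      then show "wlin \<chi> (a * (y * x) * b) \<in> Y" "wlin \<chi> (a * (x * y) * b) \<in> Y"
        by (simp_all only: mult.assoc)
    qed
    then show "y * x \<in> J" "x * y \<in> J" using x y by (auto simp: J_def)
  qed (auto simp: J_def wlin_zero wlin_add distrib_left distrib_right intro: subgrpD[OF Y])
  ultimately have "HI \<subseteq> J" by (rule HI_minimal[rotated])
  then have "wlin \<chi> (1 * x * 1) \<in> Y" using \<open>x \<in> HI\<close> unfolding J_def by blast
  then show ?thesis by simp
qed

end

end

section \<open>Laurent polynomials\<close>

definition ev1 :: "laurent \<Rightarrow> int" where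
  "ev1 c = (\<Sum>k\<in>Poly_Mapping.keys c. Poly_Mapping.lookup c k)"

lemma ev1_add: "ev1 (a + b) = ev1 a + ev1 b"
  unfolding ev1_def by (intro setsum_keys_plus_distrib) simp_all

lemma ev1_single: "ev1 (Poly_Mapping.single k a) = a"
  by (simp add: ev1_def)

lemma ev1_zero [simp]: "ev1 0 = 0"
  by (simp add: ev1_def)

lemma ev1_diff: "ev1 (a - b) = ev1 a - ev1 b"
  using ev1_add[of "a - b" b] by simp

lemma laurent_induct [case_names zero add single]:
  "\<lbrakk>P 0; \<And>x y. \<lbrakk>P x; P y\<rbrakk> \<Longrightarrow> P (x + y); \<And>k a. P (Poly_Mapping.single k a)\<rbrakk> \<Longrightarrow> P (c :: laurent)"
  by (rule poly_mapping_sum_induct[OF subset_UNIV])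

lemma ev1_mult_q: "ev1 (laurent_q * c) = ev1 c"
  by (induction c rule: laurent_induct) (simp_all add: distrib_left ev1_add laurent_q_def mult_single ev1_single)

lemma ev1_shift: "ev1 ((laurent_q - 1) * c) = 0"
  by (simp add: left_diff_distrib ev1_diff ev1_mult_q)

text \<open>The kernel of evaluation at 1 is generated by q - 1; it suffices to treat powers of q,
  negative ones included.\<close>

lemma q_minus_1_dvd: "laurent_q - 1 dvd c - of_int (ev1 c)"
proof (induction c rule: laurent_induct)
  case (add x y)
  then have "laurent_q - 1 dvd (x - of_int (ev1 x)) + (y - of_int (ev1 y))" by (rule dvd_add)
  then show ?case by (simp add: ev1_add algebra_simps)
next
  case (single k a)
  let ?X = "\<lambda>k. Poly_Mapping.single k 1 :: laurent"
  have X: "?X (k + 1) - 1 = (laurent_q - 1) * ?X k + (?X k - 1)" for k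
    by (simp add: laurent_q_def left_diff_distrib mult_single add.commute)
  have "laurent_q - 1 dvd ?X k - 1"
  proof (induction k rule: int_induct[where k = 0])
    case (step1 k)
    then show ?case unfolding X by simp
  next
    case (step2 k)
    have "?X k - 1 = (laurent_q - 1) * ?X (k - 1) + (?X (k - 1) - 1)"
      using X[of "k - 1"] by (metis diff_add_cancel)
    with step2(2) show ?case by (simp only: dvd_add_right_iff[OF dvd_triv_left])
  qed simp
  then have "laurent_q - 1 dvd (?X k - 1) * of_int a" by simp
  moreover have "(?X k - 1) * of_int a = Poly_Mapping.single k a - of_int a"
    by (simp add: left_diff_distrib mult_single flip: single_of_int)
  ultimately show ?case by (simp add: ev1_single)
qed simp

lemma lookup_q_minus_1_mult:
  "Poly_Mapping.lookup ((laurent_q - 1) * c) k = Poly_Mapping.lookup c (k - 1) - Poly_Mapping.lookup c k"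
proof -
  have "Poly_Mapping.lookup (laurent_q * c) k = Poly_Mapping.lookup c (k - 1)"
    by (induction c rule: laurent_induct)
      (auto simp: distrib_left lookup_add laurent_q_def mult_single lookup_single when_def)
  then show ?thesis by (simp add: left_diff_distrib lookup_minus)
qed

definition kspan :: "laurent \<Rightarrow> nat" where
  "kspan c = nat (Max (Poly_Mapping.keys c) - Min (Poly_Mapping.keys c))"

text \<open>The top exponent rises and the bottom one stays, so no nonzero Laurent polynomial is
  infinitely divisible by q - 1.\<close>

lemma kspan_shift:
  assumes "c \<noteq> 0"
  shows "kspan c < kspan ((laurent_q - 1) * c)"
proof -
  let ?d = "(laurent_q - 1) * c" and ?K = "Poly_Mapping.keys c"
  have K: "?K \<noteq> {}" using assms by simp
  have "Max ?K \<in> ?K" "Min ?K \<in> ?K" "Max ?K + 1 \<notin> ?K" "Min ?K - 1 \<notin> ?K"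
    using K Max_in[of ?K] Min_in[of ?K] Max_ge[of ?K "Max ?K + 1"] Min_le[of ?K "Min ?K - 1"] by auto
  then have "Max ?K + 1 \<in> Poly_Mapping.keys ?d" "Min ?K \<in> Poly_Mapping.keys ?d"
    by (simp_all add: in_keys_iff lookup_q_minus_1_mult)
  then have "Max ?K + 1 \<le> Max (Poly_Mapping.keys ?d)" "Min (Poly_Mapping.keys ?d) \<le> Min ?K"
    by simp_all
  moreover have "Min ?K \<le> Max ?K" using K by simp
  ultimately show ?thesis by (simp add: kspan_def)
qed

lemma nat_polys_add: "\<lbrakk>a \<in> nat_polys_q_minus_1; b \<in> nat_polys_q_minus_1\<rbrakk> \<Longrightarrow> a + b \<in> nat_polys_q_minus_1"
proof -
  have "map_poly of_nat (p + r) = (map_poly of_nat p + map_poly of_nat r :: laurent poly)" for p r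
    by (intro poly_eqI) (simp add: coeff_map_poly)
  then show "\<lbrakk>a \<in> nat_polys_q_minus_1; b \<in> nat_polys_q_minus_1\<rbrakk> \<Longrightarrow> a + b \<in> nat_polys_q_minus_1"
    unfolding nat_polys_q_minus_1_def by (metis (no_types, lifting) imageE poly_add rangeI)
qed

lemma nat_polys_shift: "a \<in> nat_polys_q_minus_1 \<Longrightarrow> (laurent_q - 1) * a \<in> nat_polys_q_minus_1"
proof -
  assume "a \<in> nat_polys_q_minus_1"
  then obtain p where "a = poly (map_poly of_nat p) (laurent_q - 1)"
    unfolding nat_polys_q_minus_1_def by blast
  then have "(laurent_q - 1) * a = poly (map_poly of_nat (pCons 0 p)) (laurent_q - 1)"
    by (simp add: map_poly_pCons)
  then show ?thesis unfolding nat_polys_q_minus_1_def by blast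
qed

lemma nat_polys_0: "0 \<in> nat_polys_q_minus_1"
  unfolding nat_polys_q_minus_1_def by (intro range_eqI[of _ _ 0]) simp

lemma nat_polys_1: "1 \<in> nat_polys_q_minus_1"
  unfolding nat_polys_q_minus_1_def by (intro range_eqI[of _ _ 1]) simp

lemma nat_polys_q: "a \<in> nat_polys_q_minus_1 \<Longrightarrow> laurent_q * a \<in> nat_polys_q_minus_1"
  using nat_polys_add[OF nat_polys_shift[of a], of a] by (simp add: algebra_simps)

context crystallographic_coxeter_system
begin

section \<open>The cocenter is torsion-free\<close>

lemma brk_induct:
  assumes "a \<in> FS" "b \<in> FS" "P 0" "\<And>x y. \<lbrakk>P x; P y\<rbrakk> \<Longrightarrow> P (x + y)"
    "\<And>c xs ys. \<lbrakk>xs \<in> lists S; ys \<in> lists S\<rbrakk> \<Longrightarrow> P (scalar c * monomial (xs @ ys) - scalar c * monomial (ys @ xs))"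
  shows "P (brk a b)"
  using assms(1)
proof (induction rule: free_induct)
  case (single c xs)
  from assms(2) show ?case
  proof (induction rule: free_induct)
    case (single d ys)
    have "brk (scalar c * monomial xs) (scalar d * monomial ys) =
        scalar (d * c) * monomial (xs @ ys) - scalar (d * c) * monomial (ys @ xs)"
      unfolding brk_scalar unfolding brk_def
      by (simp only: monomial_append scalar_simps(6) mult.assoc right_diff_distrib)
    then show ?case using assms(5) single \<open>xs \<in> lists S\<close> by metis
  qed (use assms in \<open>auto simp: brk_simps\<close>)
qed (use assms in \<open>auto simp: brk_simps\<close>)

lemma YY_scalar: "x \<in> YY \<Longrightarrow> scalar c * x \<in> YY"
proof -
  assume "x \<in> YY"
  then obtain i z where "i \<in> HI" "z \<in> ZZ" "x = i + scalar (laurent_q - 1) * z" unfolding YY_def by blast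
  moreover from this have "scalar c * x = scalar c * i + scalar (laurent_q - 1) * (scalar c * z)"
    by (simp only: distrib_left scalar_left_commute[of "scalar c" "laurent_q - 1" z])
  ultimately show ?thesis using HI_mult(1) ZZ_scalar unfolding YY_def by blast
qed

abbreviation potential_sum :: "('a free_word \<Rightarrow>\<^sub>0 laurent) \<Rightarrow> 'a free_word \<Rightarrow>\<^sub>0 laurent" where
  "potential_sum \<equiv> wlin (\<lambda>c g. scalar c * potential g)"

lemma potential_add: "scalar (a + b) * potential g = scalar a * potential g + scalar b * potential g"
  by (simp add: distrib_right)

lemmas potential_sum_add = wlin_add[where \<chi> = "\<lambda>c g. scalar c * potential g", OF potential_add]
lemmas potential_sum_diff = wlin_diff[where \<chi> = "\<lambda>c g. scalar c * potential g", OF potential_add]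
lemmas potential_sum_monomial = wlin_monomial[where \<chi> = "\<lambda>c g. scalar c * potential g", OF potential_add]
lemmas potential_sum_zero = wlin_zero[where \<chi> = "\<lambda>c g. scalar c * potential g", OF potential_add]

lemma potential_sum_scalar: "x \<in> FS \<Longrightarrow> potential_sum (scalar c * x) = scalar c * potential_sum x"
proof (induction rule: free_induct)
  case (single d xs)
  have "scalar c * (scalar d * monomial xs) = scalar (c * d) * monomial xs" by (simp add: mult.assoc)
  then show ?case by (simp only: potential_sum_monomial) (simp add: mult.assoc)
qed (simp_all add: potential_sum_zero potential_sum_add distrib_left)

lemma potential_sum_ZZ: "x \<in> FS \<Longrightarrow> potential_sum x \<in> ZZ"
proof (induction rule: free_induct)
  case (single d xs)
  then show ?case by (auto simp: potential_sum_monomial intro!: ZZ_scalar potential_ZZ)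
qed (auto simp: potential_sum_zero potential_sum_add intro: subgrpD[OF subgrp_ZZ])

lemma potential_sum_HI: "x \<in> HI \<Longrightarrow> potential_sum x \<in> YY"
proof (rule wlin_HI[OF _ subgrp_YY])
  fix c g assume "g \<in> carrier W"
  then have "scalar (laurent_q - 1) * (scalar c * potential g) \<in> YY" by (intro shift_YY ZZ_scalar potential_ZZ)
  then show "scalar ((laurent_q - 1) * c) * potential g \<in> YY" by (simp only: scalar_simps(6) mult.assoc)
qed (rule potential_add)

text \<open>Modulo \<open>YY\<close> a commutator of words is a value of the cocycle, hence a
  difference of potentials; so the potential sum reproduces each element of
  \<open>ZZ\<close>.\<close>

lemma ZZ_potential_sum: "z \<in> ZZ \<Longrightarrow> z - potential_sum z \<in> YY"
proof (induction rule: ZZ.induct)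
  case (HI x)
  then show ?case using potential_sum_HI HI_YY subgrpD(2)[OF subgrp_YY] by blast
next
  case (brk a b)
  then show ?case
  proof (rule brk_induct)
    fix c xs ys assume l: "xs \<in> lists S" "ys \<in> lists S"
    let ?u = "wprod xs" and ?v = "wprod ys"
    have c: "?u \<in> carrier W" "?v \<in> carrier W" using l by auto
    have eq: "inv ?u \<otimes> (?u \<otimes> ?v) = ?v" "cj ?u (?u \<otimes> ?v) = ?v \<otimes> ?u"
      using c by (simp_all add: cj_def flip: m_assoc)
    have "brk (monomial xs) (monomial ys) - cocycle (?u \<otimes> ?v) ?u \<in> YY"
      unfolding cocycle_def eq(1) using monomial_cong l c by (intro brk_cong) auto
    then have "brk (monomial xs) (monomial ys) - (potential (?u \<otimes> ?v) - potential (?v \<otimes> ?u)) \<in> YY"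
      using cong_trans[OF subgrp_YY _ cocycle_coboundary[of "?u \<otimes> ?v" ?u]] c eq(2) by simp
    from YY_scalar[OF this, of c]
    show "scalar c * monomial (xs @ ys) - scalar c * monomial (ys @ xs)
       - potential_sum (scalar c * monomial (xs @ ys) - scalar c * monomial (ys @ xs)) \<in> YY"
      unfolding potential_sum_diff potential_sum_monomial using l by (simp add: brk_def monomial_append wprod_append right_diff_distrib)
  next
    fix x y assume "x - potential_sum x \<in> YY" "y - potential_sum y \<in> YY"
    then show "x + y - potential_sum (x + y) \<in> YY" unfolding potential_sum_add by (rule cong_add[OF subgrp_YY])
  qed (simp add: potential_sum_zero subgrpD(1)[OF subgrp_YY])
next
  case (add x y)
  then show ?case using cong_add[OF subgrp_YY] by (simp add: potential_sum_add)
qed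

text \<open>For z = (q - 1)x in \<open>ZZ\<close> the potential sum is (q - 1) times an element of
  \<open>ZZ\<close>, hence in \<open>YY\<close>, and z is congruent to it modulo \<open>YY\<close>.
  It remains to cancel q - 1 in the free module H.\<close>

theorem ZZ_saturated:
  assumes x: "x \<in> FS" and "scalar (laurent_q - 1) * x \<in> ZZ"
  shows "x \<in> ZZ"
proof -
  have "scalar (laurent_q - 1) * x - scalar (laurent_q - 1) * potential_sum x \<in> YY"
    using ZZ_potential_sum[OF assms(2)] unfolding potential_sum_scalar[OF x] .
  from subgrpD(4)[OF subgrp_YY this shift_YY[OF potential_sum_ZZ[OF x]]]
  have "scalar (laurent_q - 1) * x \<in> YY" by simp
  then obtain i z where z: "i \<in> HI" "z \<in> ZZ" "scalar (laurent_q - 1) * x = i + scalar (laurent_q - 1) * z"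
    unfolding YY_def by blast
  then have "scalar (laurent_q - 1) * (x - z) = i" unfolding right_diff_distrib by (simp only:) simp
  then have "x - z \<in> HI" using HI_saturated[of "x - z"] z x ZZ_FS by auto
  from ZZ.add[OF ZZ.HI[OF this] z(2)] show ?thesis by simp
qed

section \<open>Linear independence\<close>

abbreviation class_trace :: "'a set \<Rightarrow> ('a free_word \<Rightarrow>\<^sub>0 laurent) \<Rightarrow> int" where
  "class_trace C \<equiv> wlin (\<lambda>c g. if g \<in> C then ev1 c else 0)"

lemma class_trace_add: "(if g \<in> C then ev1 (a + b) else 0) = (if g \<in> C then ev1 a else 0) + (if g \<in> C then ev1 b else 0)"
  by (simp add: ev1_add)

lemmas class_trace_linear = wlin_add[where \<chi> = "\<lambda>c g. if g \<in> C then ev1 c else 0" for C, OF class_trace_add]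
  wlin_diff[where \<chi> = "\<lambda>c g. if g \<in> C then ev1 c else 0" for C, OF class_trace_add]
  wlin_zero[where \<chi> = "\<lambda>c g. if g \<in> C then ev1 c else 0" for C, OF class_trace_add]
  wlin_monomial[where \<chi> = "\<lambda>c g. if g \<in> C then ev1 c else 0" for C, OF class_trace_add]

text \<open>The products uv and vu are conjugate, so the indicator function of a class is a trace on
  the group ring obtained at q = 1.\<close>

lemma class_trace_ZZ:
  assumes "g \<in> carrier W" "x \<in> ZZ"
  shows "class_trace (cls g) x = 0"
  using assms(2)
proof (induction rule: ZZ.induct)
  case (HI x)
  have "subgrp {0 :: int}" by (simp add: subgrp_def)
  from wlin_HI[where \<chi> = "\<lambda>c h. if h \<in> cls g then ev1 c else 0", OF class_trace_add this _ HI]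
  show ?case by (simp add: ev1_shift)
next
  case (brk a b)
  then show ?case
  proof (rule brk_induct)
    fix c xs ys assume l: "xs \<in> lists S" "ys \<in> lists S"
    let ?u = "wprod xs" and ?v = "wprod ys"
    have c: "?u \<in> carrier W" "?v \<in> carrier W" using l by auto
    have "cj ?u (?u \<otimes> ?v) = ?v \<otimes> ?u" using c by (simp add: cj_def flip: m_assoc)
    then have "cls (?v \<otimes> ?u) = cls (?u \<otimes> ?v)" using cls_cj[of "?u \<otimes> ?v" ?u] c by simp
    then have "?u \<otimes> ?v \<in> cls g \<longleftrightarrow> ?v \<otimes> ?u \<in> cls g"
      using cls_eq[OF assms(1)] cls_self c by (metis m_closed)
    then show "class_trace (cls g) (scalar c * monomial (xs @ ys) - scalar c * monomial (ys @ xs)) = 0"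
      using l by (simp add: class_trace_linear wprod_append)
  qed (simp_all add: class_trace_linear)
next
  case (add x y)
  then show ?case by (simp add: class_trace_linear)
qed

definition reps :: "'a set" where
  "reps = (\<lambda>g. rep (cls g)) ` carrier W"

lemma repsD: "v \<in> reps \<Longrightarrow> v \<in> carrier W \<and> rep (cls v) = v"
proof -
  assume "v \<in> reps"
  then obtain g where g: "g \<in> carrier W" "v = rep (cls g)" by (auto simp: reps_def)
  have "v \<in> cls g" using min_length_min_len[OF g(1) rep_cls[OF g(1)]] g by simp
  then show ?thesis using cls_eq[OF g(1)] cls_carrier[OF g(1)] g(2) by metis
qed

lemma class_trace_lincomb:
  assumes "finite A" "A \<subseteq> reps" "v \<in> reps"
  shows "class_trace (cls v) (lincomb A c) = (if v \<in> A then ev1 (c v) else 0)"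
  using assms(1,2)
proof (induction A)
  case empty
  then show ?case by (simp add: lincomb_def class_trace_linear)
next
  case (insert w A)
  have w: "w \<in> carrier W" "rep (cls w) = w" and v: "v \<in> carrier W" "rep (cls v) = v"
    using repsD insert assms(3) by auto
  then have wv: "w \<in> cls v \<longleftrightarrow> w = v" using cls_eq[OF v(1)] cls_self[OF v(1)] by metis
  obtain xs where xs: "wprod xs = w" "M w = monomial xs" using M_reduced[OF w(1)] by metis
  have "class_trace (cls v) (lincomb (insert w A) c) = (if w \<in> cls v then ev1 (c w) else 0) + class_trace (cls v) (lincomb A c)"
    using insert.hyps xs by (simp add: lincomb_def class_trace_linear)
  then show ?case using insert wv by auto
qed

lemma lincomb_FS: "A \<subseteq> carrier W \<Longrightarrow> lincomb A c \<in> FS"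
  unfolding lincomb_def by (intro free_sum) auto

lemma lincomb_scalar: "scalar d * lincomb A c = lincomb A (\<lambda>v. d * c v)"
  by (simp add: lincomb_def sum_distrib_left mult.assoc)

text \<open>The traces show that all coefficients vanish at q = 1; saturation keeps the quotient
  relation in \<open>ZZ\<close> after dividing by q - 1.\<close>

lemma lincomb_descent:
  assumes A: "finite A" "A \<subseteq> reps" and "lincomb A c \<in> ZZ"
  shows "\<exists>d. lincomb A d \<in> ZZ \<and> (\<forall>v\<in>A. c v = (laurent_q - 1) * d v)"
proof -
  have "\<exists>d. c v = (laurent_q - 1) * d" if "v \<in> A" for v
  proof -
    have "v \<in> reps" using that A by blast
    then have "class_trace (cls v) (lincomb A c) = 0" using class_trace_ZZ[OF _ assms(3)] repsD by blast
    then have "ev1 (c v) = 0" using class_trace_lincomb[OF A \<open>v \<in> reps\<close>] that by simp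
    then show ?thesis using q_minus_1_dvd[of "c v"] by (auto simp: dvd_def)
  qed
  then obtain d where d: "\<And>v. v \<in> A \<Longrightarrow> c v = (laurent_q - 1) * d v" by metis
  have "scalar (laurent_q - 1) * lincomb A d = lincomb A c"
    unfolding lincomb_scalar using d by (simp add: lincomb_def)
  then have dZ: "scalar (laurent_q - 1) * lincomb A d \<in> ZZ" using assms(3) by (simp only:)
  have "A \<subseteq> carrier W" using A(2) repsD by blast
  then have "lincomb A d \<in> ZZ" by (rule ZZ_saturated[OF lincomb_FS dZ])
  then show ?thesis using d by blast
qed

text \<open>Repeated division by q - 1 would shrink the exponent range of a nonzero coefficient
  indefinitely.\<close>

theorem lincomb_independent:
  assumes A: "finite A" "A \<subseteq> reps" and "lincomb A c \<in> ZZ" "v \<in> A"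
  shows "c v = 0"
proof (rule ccontr)
  have *: "n \<le> kspan (c v)" if "lincomb A c \<in> ZZ" "c v \<noteq> 0" for n c
    using that
  proof (induction n arbitrary: c)
    case (Suc n)
    then obtain d where d: "lincomb A d \<in> ZZ" "c v = (laurent_q - 1) * d v"
      using lincomb_descent[OF A] assms(4) by blast
    then have "d v \<noteq> 0" using Suc by auto
    then show ?case using Suc.IH[OF d(1)] kspan_shift[of "d v"] d(2) by simp
  qed simp
  assume "c v \<noteq> 0"
  from *[OF assms(3) this, of "Suc (kspan (c v))"] show False by simp
qed

section \<open>Class polynomials\<close>

definition expressible :: "('a free_word \<Rightarrow>\<^sub>0 laurent) \<Rightarrow> bool" where
  "expressible x \<longleftrightarrow> (\<exists>A c. finite A \<and> A \<subseteq> reps \<and> (\<forall>v. c v \<in> nat_polys_q_minus_1) \<and> x - lincomb A c \<in> ZZ)"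

lemma expressible_add: "\<lbrakk>expressible x; expressible y\<rbrakk> \<Longrightarrow> expressible (x + y)"
proof -
  assume "expressible x" "expressible y"
  then obtain A c B d where AB: "finite A" "A \<subseteq> reps" "\<And>v. c v \<in> nat_polys_q_minus_1" "x - lincomb A c \<in> ZZ"
    "finite B" "B \<subseteq> reps" "\<And>v. d v \<in> nat_polys_q_minus_1" "y - lincomb B d \<in> ZZ" unfolding expressible_def by blast
  have "(x + y) - (lincomb A c + lincomb B d) \<in> ZZ" using AB by (intro cong_add[OF subgrp_ZZ])
  from this[unfolded lincomb_add[OF AB(1,5)]] show ?thesis
    unfolding expressible_def by (intro exI conjI) (use AB in \<open>auto intro: nat_polys_add nat_polys_0\<close>)
qed

lemma expressible_cong: "\<lbrakk>x - y \<in> ZZ; expressible y\<rbrakk> \<Longrightarrow> expressible x"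
  unfolding expressible_def using cong_trans[OF subgrp_ZZ] by blast

lemma expressible_scale:
  assumes "expressible x" "\<And>a. a \<in> nat_polys_q_minus_1 \<Longrightarrow> p * a \<in> nat_polys_q_minus_1"
  shows "expressible (scalar p * x)"
proof -
  obtain A c where A: "finite A" "A \<subseteq> reps" "\<And>v. c v \<in> nat_polys_q_minus_1" "x - lincomb A c \<in> ZZ"
    using assms(1) unfolding expressible_def by blast
  have "scalar p * x - lincomb A (\<lambda>v. p * c v) \<in> ZZ"
    using ZZ_scalar[OF A(4), of p] by (simp add: right_diff_distrib lincomb_scalar)
  then show ?thesis unfolding expressible_def
    by (intro exI[of _ A] exI[of _ "\<lambda>v. p * c v"]) (use A assms(2) in auto)
qed

text \<open>With x = svs, in H one has T_v = T_s T_x T_s, which is congruent to T_x T_s^2 modulo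
  commutators; the quadratic relation gives the two shorter terms.\<close>

lemma reduction_step:
  assumes v: "v \<in> carrier W" and s: "s \<in> S" and less: "len (s \<otimes> v \<otimes> s) < len v"
  shows "M v - (scalar (laurent_q - 1) * M (s \<otimes> v) + scalar laurent_q * M (s \<otimes> v \<otimes> s)) \<in> ZZ"
    "len (s \<otimes> v) < len v"
proof -
  let ?u = "s \<otimes> v" and ?x = "s \<otimes> v \<otimes> s"
  have c: "?u \<in> carrier W" "?x \<in> carrier W" using v s by auto
  have l: "len v = len ?u + 1" "len ?u = len ?x + 1"
    using len_simple_mult[OF v s] len_mult_simple[OF c(1) s] less by auto
  then show "len ?u < len v" by simp
  have 1: "M s * M ?u - M v \<in> HI" using M_mult[of s ?u] v s l by (simp add: len_simple)
  have 2: "M ?x * M s - M ?u \<in> HI" using M_mult[of ?x s] v s l by (simp add: len_simple)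
  have 3: "M ?x * (M s * M s - (scalar (laurent_q - 1) * M s + scalar laurent_q)) \<in> HI"
    using HI_mult(1)[OF quadratic_HI[OF s]] c by blast
  have 4: "M s * (M ?x * M s - M ?u) \<in> HI" by (rule HI_mult(1)[OF 2]) (use s in auto)
  have 5: "scalar (laurent_q - 1) * (M ?x * M s - M ?u) \<in> HI" by (rule HI_mult(1)[OF 2]) auto
  have "brk (M s) (M ?x * M s) \<in> ZZ" using s c by (intro ZZ.brk) auto
  note Z = subgrpD(4)[OF subgrp_ZZ subgrpD(2)[OF subgrp_ZZ subgrpD(2)[OF subgrp_ZZ this ZZ.HI[OF 1]] ZZ.HI[OF 4]]
    subgrpD(4)[OF subgrp_ZZ ZZ.HI[OF 3] ZZ.HI[OF 5]]]
  have eq: "M ?x * (M s * M s - (scalar (laurent_q - 1) * M s + scalar laurent_q)) =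
      M ?x * (M s * M s) - (scalar (laurent_q - 1) * (M ?x * M s) + scalar laurent_q * M ?x)"
    by (simp only: right_diff_distrib distrib_left scalar_left_commute[of "M ?x"] scalar_commute[of "M ?x"])
  from Z[unfolded eq] show "M v - (scalar (laurent_q - 1) * M ?u + scalar laurent_q * M ?x) \<in> ZZ"
    by (simp add: brk_def algebra_simps del: scalar_simps)
qed

text \<open>Let y conjugate w to minimal length. There is no drop at y, and a good path from the
  unit to y would keep the length of w, which is not minimal; so there is a drop at the unit. The
  coefficients q - 1 and q preserve \<nat>[q - 1].\<close>

theorem expressible_M: "w \<in> carrier W \<Longrightarrow> expressible (M w)"
proof (induction "len w" arbitrary: w rule: less_induct)
  case less
  note w = less.prems
  show ?case
  proof (cases "min_len w")
    case True
    then have "w \<in> min_length_elements W S (cls w)"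
      using cls_self[OF w] by (auto simp: min_length_elements_def min_len_def cls_def)
    then have "M w - M (rep (cls w)) \<in> ZZ" using M_min_len[OF w _ rep_cls[OF w]] by blast
    then show ?thesis using w nat_polys_1 unfolding expressible_def
      by (intro exI[of _ "{rep (cls w)}"] exI[of _ "\<lambda>v. 1"]) (auto simp: lincomb_def reps_def)
  next
    case False
    obtain y where y: "y \<in> carrier W" "\<And>z. z \<in> carrier W \<Longrightarrow> len (cj y w) \<le> len (cj z w)"
      using ex_has_least_nat[of "\<lambda>y. y \<in> carrier W" \<one> "\<lambda>y. len (cj y w)"] by auto
    have "\<not> (good w)\<^sup>*\<^sup>* \<one> y"
    proof
      assume "(good w)\<^sup>*\<^sup>* \<one> y"
      then have "len (cj y w) = len (cj \<one> w)"
        by (induction rule: rtranclp_induct) (use good_len in auto)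
      then show False using False y(2) w by (auto simp: min_len_def)
    qed
    moreover have "\<not> drops w y" using min_len_not_drops[OF w y(1)] y(2) by blast
    ultimately have "drops w \<one>" using good_path_or_drop[OF w one_closed y(1)] by blast
    then obtain z s where z: "(eqstep w)\<^sup>*\<^sup>* \<one> z" "s \<in> S" "len (cj (z \<otimes> s) w) < len (cj z w)"
      unfolding drops_def[OF w] by blast
    have zc: "z \<in> carrier W" "len (cj z w) = len w" "(good w)\<^sup>*\<^sup>* \<one> z" using eqsteps[OF w z(1) one_closed] w by auto
    let ?v = "cj z w"
    have v: "?v \<in> carrier W" "len (s \<otimes> ?v \<otimes> s) < len ?v"
      using z zc w by (simp_all add: cj_mult cj_simple)
    note red = reduction_step[OF v(1) z(2) v(2)]
    have e: "expressible (M (s \<otimes> ?v))" "expressible (M (s \<otimes> ?v \<otimes> s))"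
      using less.hyps red(2) v zc(2) z(2) by simp_all
    have "expressible (scalar (laurent_q - 1) * M (s \<otimes> ?v) + scalar laurent_q * M (s \<otimes> ?v \<otimes> s))"
      by (intro expressible_add expressible_scale e nat_polys_shift nat_polys_q)
    then have "expressible (M ?v)" by (rule expressible_cong[OF red(1)])
    then show ?thesis by (rule expressible_cong[OF M_good_path[OF zc(3) w]])
  qed
qed

section \<open>The cocenter as a quotient\<close>

abbreviation HA :: "(laurent, ('a free_word \<Rightarrow>\<^sub>0 laurent) set) module" where
  "HA \<equiv> hecke_algebra W S"

abbreviation CA :: "(laurent, ('a free_word \<Rightarrow>\<^sub>0 laurent) set set) module" where
  "CA \<equiv> hecke_cocenter W S"

definition cl :: "('a free_word \<Rightarrow>\<^sub>0 laurent) \<Rightarrow> ('a free_word \<Rightarrow>\<^sub>0 laurent) set" where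
  "cl x = HI +>\<^bsub>free_algebra S\<^esub> x"

lemma cl_alt: "cl x = (\<lambda>i. i + x) ` HI"
  by (auto simp: cl_def a_r_coset_def')

lemma cl_eq: "cl x = cl y \<longleftrightarrow> x - y \<in> HI"
proof
  assume "cl x = cl y"
  moreover have "x \<in> cl x" unfolding cl_alt using HI_zero by (intro image_eqI[of _ _ 0]) auto
  ultimately obtain i where "i \<in> HI" "x = i + y" by (auto simp: cl_alt)
  then show "x - y \<in> HI" by simp
next
  have *: "cl x \<subseteq> cl y" if "x - y \<in> HI" for x y
  proof
    fix z assume "z \<in> cl x"
    then obtain i where "i \<in> HI" "z = i + x" by (auto simp: cl_alt)
    then show "z \<in> cl y" unfolding cl_alt using HI_add[OF _ that]
      by (intro image_eqI[of _ _ "i + (x - y)"]) auto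
  qed
  assume "x - y \<in> HI"
  then show "cl x = cl y" using *[of x y] *[of y x] cong_sym[OF subgrp_HI] by blast
qed

lemma HA_simps:
  "carrier HA = cl ` FS" "\<zero>\<^bsub>HA\<^esub> = cl 0" "\<one>\<^bsub>HA\<^esub> = cl 1"
  "\<lbrakk>x \<in> FS; y \<in> FS\<rbrakk> \<Longrightarrow> cl x \<oplus>\<^bsub>HA\<^esub> cl y = cl (x + y)"
  "\<lbrakk>x \<in> FS; y \<in> FS\<rbrakk> \<Longrightarrow> cl x \<otimes>\<^bsub>HA\<^esub> cl y = cl (x * y)"
  "x \<in> FS \<Longrightarrow> c \<odot>\<^bsub>HA\<^esub> cl x = cl (scalar c * x)"
proof -
  interpret I: ideal HI "free_algebra S" by (rule ideal_HI)
  note d = hecke_algebra_def ring.extend_def module.fields_def FactRing_def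
  show "carrier HA = cl ` FS" by (auto simp: d A_RCOSETS_def' cl_def)
  show "\<zero>\<^bsub>HA\<^esub> = cl 0" by (auto simp: d cl_alt)
  show "\<one>\<^bsub>HA\<^esub> = cl 1" by (simp add: d cl_def)
  show "\<lbrakk>x \<in> FS; y \<in> FS\<rbrakk> \<Longrightarrow> cl x \<oplus>\<^bsub>HA\<^esub> cl y = cl (x + y)"
    using I.a_rcos_sum[of x y] by (simp add: d cl_def)
  show "\<lbrakk>x \<in> FS; y \<in> FS\<rbrakk> \<Longrightarrow> cl x \<otimes>\<^bsub>HA\<^esub> cl y = cl (x * y)"
    using I.rcoset_mult_add[of x y] by (simp add: d cl_def)
  assume x: "x \<in> FS"
  have "cl (scalar c * y) = cl (scalar c * x)" if "y \<in> cl x" for y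
  proof -
    from that obtain i where "i \<in> HI" "y = i + x" by (auto simp: cl_alt)
    then have "scalar c * y - scalar c * x \<in> HI" using HI_mult(1) by (simp add: distrib_left)
    then show ?thesis by (simp add: cl_eq)
  qed
  moreover have "x \<in> cl x" unfolding cl_alt using HI_zero by (intro image_eqI[of _ _ 0]) auto
  moreover have "c \<odot>\<^bsub>HA\<^esub> cl x = (\<Union>y\<in>cl x. cl (scalar c * y))"
    by (simp add: d coset_smult_def cl_def)
  ultimately show "c \<odot>\<^bsub>HA\<^esub> cl x = cl (scalar c * x)" by blast
qed

lemma abelian_group_HA: "abelian_group HA"
proof (rule abelian_groupI)
  fix x assume "x \<in> carrier HA"
  then obtain a where a: "a \<in> FS" "x = cl a" by (auto simp: HA_simps(1))
  then have "cl (- a) \<oplus>\<^bsub>HA\<^esub> x = \<zero>\<^bsub>HA\<^esub>" by (simp add: HA_simps)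
  then show "\<exists>y\<in>carrier HA. y \<oplus>\<^bsub>HA\<^esub> x = \<zero>\<^bsub>HA\<^esub>" using a by (intro bexI[of _ "cl (- a)"]) (auto simp: HA_simps)
qed (auto simp: HA_simps add_ac)

lemma HA_uminus: "x \<in> FS \<Longrightarrow> \<ominus>\<^bsub>HA\<^esub> cl x = cl (- x)"
  by (rule abelian_group.minus_equality[OF abelian_group_HA]) (auto simp: HA_simps)

lemma HA_minus: "\<lbrakk>x \<in> FS; y \<in> FS\<rbrakk> \<Longrightarrow> cl x \<ominus>\<^bsub>HA\<^esub> cl y = cl (x - y)"
  by (simp add: a_minus_def HA_uminus HA_simps)

text \<open>A scalar can be absorbed into one entry of a bracket, so additive closure of the
  brackets already gives the spanned submodule.\<close>

lemma hecke_commutators_eq: "hecke_commutators W S = cl ` ZZ"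
proof -
  let ?C = "{a \<otimes>\<^bsub>HA\<^esub> b \<ominus>\<^bsub>HA\<^esub> b \<otimes>\<^bsub>HA\<^esub> a | a b. a \<in> carrier HA \<and> b \<in> carrier HA}"
  interpret A: abelian_group HA by (rule abelian_group_HA)
  have C: "?C = {cl (brk a b) | a b. a \<in> FS \<and> b \<in> FS}"
  proof -
    have "cl a \<otimes>\<^bsub>HA\<^esub> cl b \<ominus>\<^bsub>HA\<^esub> cl b \<otimes>\<^bsub>HA\<^esub> cl a = cl (brk a b)" if "a \<in> FS" "b \<in> FS" for a b
      using that by (simp add: HA_simps HA_minus brk_def)
    then show ?thesis unfolding HA_simps(1) by fastforce
  qed
  have "subgroup (cl ` ZZ) (add_monoid HA)"
  proof (rule group.subgroupI[OF A.a_group])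
    fix a assume "a \<in> cl ` ZZ"
    then obtain x where "x \<in> ZZ" "a = cl x" by blast
    then show "inv\<^bsub>add_monoid HA\<^esub> a \<in> cl ` ZZ"
      using HA_uminus[of x] ZZ_FS subgrpD(3)[OF subgrp_ZZ] by (auto simp: a_inv_def)
  qed (use ZZ_FS subgrpD[OF subgrp_ZZ] in \<open>auto simp: HA_simps\<close>)
  then have "submodule (cl ` ZZ) laurent_ring HA"
    using ZZ_FS ZZ_scalar by (auto intro!: submodule.intro submodule_axioms.intro simp: HA_simps)
  moreover have "?C \<subseteq> cl ` ZZ" unfolding C using ZZ.brk by blast
  moreover have "cl ` ZZ \<subseteq> N" if N: "submodule N laurent_ring HA" "?C \<subseteq> N" for N
  proof
    interpret N: subgroup N "add_monoid HA" using N(1) by (rule submodule.axioms)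
    fix x assume "x \<in> cl ` ZZ"
    then obtain z where "z \<in> ZZ" "x = cl z" by blast
    have "cl z \<in> N" using \<open>z \<in> ZZ\<close>
    proof (induction rule: ZZ.induct)
      case (HI x)
      then have "cl x = \<zero>\<^bsub>HA\<^esub>" by (simp add: HA_simps cl_eq)
      then show ?case using N.one_closed by simp
    next
      case (brk a b)
      then show ?case using N(2) unfolding C by blast
    next
      case (add x y)
      then show ?case using N.m_closed[of "cl x" "cl y"] ZZ_FS by (simp add: HA_simps)
    qed
    then show "x \<in> N" using \<open>x = cl z\<close> by simp
  qed
  ultimately show ?thesis unfolding hecke_commutators_def module_span_def Let_def by blast
qed

definition pr :: "('a free_word \<Rightarrow>\<^sub>0 laurent) \<Rightarrow> ('a free_word \<Rightarrow>\<^sub>0 laurent) set set" where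
  "pr x = cocenter_proj W S (cl x)"

lemma pr_alt: "x \<in> FS \<Longrightarrow> pr x = (\<lambda>z. cl (z + x)) ` ZZ"
  unfolding pr_def cocenter_proj_def hecke_commutators_eq a_r_coset_def'
  using ZZ_FS by (auto simp: HA_simps)

lemma pr_eq:
  assumes "x \<in> FS" "y \<in> FS"
  shows "pr x = pr y \<longleftrightarrow> x - y \<in> ZZ"
proof
  assume "pr x = pr y"
  moreover have "cl x \<in> pr x" unfolding pr_alt[OF assms(1)]
    using subgrpD(1)[OF subgrp_ZZ] by (intro image_eqI[of _ _ 0]) auto
  ultimately obtain z where z: "z \<in> ZZ" "cl x = cl (z + y)" using pr_alt[OF assms(2)] by auto
  then have "x - (z + y) \<in> ZZ" using ZZ.HI cl_eq by blast
  from ZZ.add[OF this z(1)] show "x - y \<in> ZZ" by simp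
next
  have *: "pr x \<subseteq> pr y" if h: "x - y \<in> ZZ" "x \<in> FS" "y \<in> FS" for x y
  proof
    fix c assume "c \<in> pr x"
    then obtain z where "z \<in> ZZ" "c = cl (z + x)" using pr_alt[OF h(2)] by auto
    then show "c \<in> pr y" unfolding pr_alt[OF h(3)] using ZZ.add[OF _ h(1)]
      by (intro image_eqI[of _ _ "z + (x - y)"]) auto
  qed
  assume "x - y \<in> ZZ"
  then show "pr x = pr y" using *[of x y] *[of y x] cong_sym[OF subgrp_ZZ] assms by blast
qed

lemma CA_simps:
  "carrier CA = pr ` FS" "\<zero>\<^bsub>CA\<^esub> = pr 0"
  "\<lbrakk>x \<in> FS; y \<in> FS\<rbrakk> \<Longrightarrow> pr x \<oplus>\<^bsub>CA\<^esub> pr y = pr (x + y)"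
  "x \<in> FS \<Longrightarrow> c \<odot>\<^bsub>CA\<^esub> pr x = pr (scalar c * x)"
proof -
  note d = hecke_cocenter_def Let_def
  show "carrier CA = pr ` FS"
    by (auto simp: d A_RCOSETS_def' HA_simps(1) pr_def cocenter_proj_def)
  show "\<zero>\<^bsub>CA\<^esub> = pr 0" by (simp add: d pr_alt hecke_commutators_eq)
  show "pr x \<oplus>\<^bsub>CA\<^esub> pr y = pr (x + y)" if xy: "x \<in> FS" "y \<in> FS"
  proof -
    have "pr x \<oplus>\<^bsub>CA\<^esub> pr y = {h \<oplus>\<^bsub>HA\<^esub> k | h k. h \<in> pr x \<and> k \<in> pr y}"
      by (auto simp: d set_add_def')
    also have "\<dots> = {cl (z + x) \<oplus>\<^bsub>HA\<^esub> cl (z' + y) | z z'. z \<in> ZZ \<and> z' \<in> ZZ}"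
      unfolding pr_alt[OF xy(1)] pr_alt[OF xy(2)] by blast
    also have "\<dots> = {cl ((z + z') + (x + y)) | z z'. z \<in> ZZ \<and> z' \<in> ZZ}"
    proof -
      have "cl (z + x) \<oplus>\<^bsub>HA\<^esub> cl (z' + y) = cl ((z + z') + (x + y))" if "z \<in> ZZ" "z' \<in> ZZ" for z z'
        using that xy ZZ_FS by (simp add: HA_simps algebra_simps)
      then show ?thesis by fastforce
    qed
    also have "\<dots> = pr (x + y)"
    proof -
      have "cl (z + (x + y)) = cl ((z + 0) + (x + y))" for z by simp
      then show ?thesis
        unfolding pr_alt[OF free_closed(6)[OF xy]] using ZZ.add subgrpD(1)[OF subgrp_ZZ] by blast
    qed
    finally show ?thesis .
  qed
  assume x: "x \<in> FS"
  have "cocenter_proj W S (c \<odot>\<^bsub>HA\<^esub> h) = pr (scalar c * x)" if "h \<in> pr x" for h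
  proof -
    from that obtain z where z: "z \<in> ZZ" "h = cl (z + x)" using pr_alt[OF x] by blast
    then have "c \<odot>\<^bsub>HA\<^esub> h = cl (scalar c * (z + x))" using x ZZ_FS by (simp add: HA_simps)
    moreover have "pr (scalar c * (z + x)) = pr (scalar c * x)"
      using z(1) x ZZ_FS ZZ_scalar by (subst pr_eq) (auto simp: distrib_left)
    ultimately show ?thesis by (simp add: pr_def)
  qed
  moreover have "cl x \<in> pr x" unfolding pr_alt[OF x]
    using subgrpD(1)[OF subgrp_ZZ] by (intro image_eqI[of _ _ 0]) auto
  moreover have "c \<odot>\<^bsub>CA\<^esub> pr x = (\<Union>h\<in>pr x. cocenter_proj W S (c \<odot>\<^bsub>HA\<^esub> h))"
    by (simp add: d coset_smult_def cocenter_proj_def)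
  ultimately show "c \<odot>\<^bsub>CA\<^esub> pr x = pr (scalar c * x)" by auto
qed

lemma finsum_CA:
  assumes "finite A" "\<And>i. i \<in> A \<Longrightarrow> g i \<in> FS"
  shows "(\<Oplus>\<^bsub>CA\<^esub>i\<in>A. pr (g i)) = pr (sum g A)"
proof -
  interpret abelian_monoid CA
    by (rule abelian_monoidI) (auto simp: CA_simps add_ac)
  show ?thesis using assms
  proof (induction A)
    case (insert i A)
    then have "(\<Oplus>\<^bsub>CA\<^esub>i\<in>insert i A. pr (g i)) = pr (g i) \<oplus>\<^bsub>CA\<^esub> (\<Oplus>\<^bsub>CA\<^esub>i\<in>A. pr (g i))"
      by (intro finsum_insert) (auto simp: CA_simps(1))
    then show ?case using insert by (simp add: CA_simps free_sum)
  qed (simp add: CA_simps)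
qed

section \<open>Identification of T_w, the conjugacy classes and their images in the cocenter\<close>

lemma hecke_word: "xs \<in> lists S \<Longrightarrow> word_prod HA (map (hecke_gen W S) xs) = cl (monomial xs)"
proof (induction xs)
  case (Cons s xs)
  have "hecke_gen W S s = cl (monomial [s])" by (simp add: hecke_gen_def cl_def)
  then show ?case using Cons by (simp add: word_prod_def HA_simps monomial_Cons[of s xs])
qed (simp add: word_prod_def HA_simps)

lemma hecke_T_eq:
  assumes w: "w \<in> carrier W"
  shows "hecke_T W S w = cl (M w)"
proof -
  have "word_prod HA (map (hecke_gen W S) xs) = cl (M w)" if "xs \<in> reduced_words W S w" for xs
    using that matsumoto[of xs] by (auto simp: reduced_words_def hecke_word cl_eq)
  moreover obtain xs where "xs \<in> reduced_words W S w"
    using reduced_word_ex[OF w] by (metis reduced_wordsI)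
  ultimately have "(\<lambda>xs. word_prod HA (map (hecke_gen W S) xs)) ` reduced_words W S w = {cl (M w)}" by auto
  then show ?thesis by (simp add: hecke_T_def)
qed

lemma conj_classes_eq: "conj_classes W = cls ` carrier W"
proof -
  have "orbit W (\<lambda>g. \<lambda>h\<in>carrier W. g \<otimes> h \<otimes> inv g) x = cls x" if x: "x \<in> carrier W" for x
  proof -
    have "(\<lambda>g. g \<otimes> x \<otimes> inv g) ` carrier W = (\<lambda>g. inv g \<otimes> x \<otimes> g) ` carrier W"
      by (auto intro!: image_eqI[of _ _ "inv _"])
    then show ?thesis using x by (auto simp: orbit_def cls_def cj_def)
  qed
  then show ?thesis unfolding conj_classes_def orbits_def by auto
qed

lemma cocenter_T_eq:
  assumes g: "g \<in> carrier W"
  shows "cocenter_T W S (cls g) = pr (M (rep (cls g)))"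
proof -
  have c: "v \<in> carrier W" if "v \<in> min_length_elements W S (cls g)" for v
    using min_length_min_len[OF g that] cls_carrier[OF g] by blast
  have "cocenter_proj W S (hecke_T W S v) = pr (M (rep (cls g)))" if v: "v \<in> min_length_elements W S (cls g)" for v
    using M_min_len[OF g v rep_cls[OF g]] c[OF v] c[OF rep_cls[OF g]] hecke_T_eq pr_eq by (simp add: pr_def[symmetric])
  then have "(\<lambda>v. cocenter_proj W S (hecke_T W S v)) ` min_length_elements W S (cls g) = {pr (M (rep (cls g)))}"
    using rep_cls[OF g] by auto
  then show ?thesis by (simp add: cocenter_T_def)
qed

lemma rep_conj_class:
  assumes "C \<in> conj_classes W"
  shows "rep C \<in> reps" "cls (rep C) = C"
proof -
  obtain g where g: "g \<in> carrier W" "C = cls g" using assms by (auto simp: conj_classes_eq)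
  then show "rep C \<in> reps" by (auto simp: reps_def)
  have "rep C \<in> cls g" using min_length_min_len[OF g(1) rep_cls[OF g(1)]] g by blast
  then show "cls (rep C) = C" using cls_eq g by blast
qed

text \<open>The finite set B may exceed the support, so that two coefficient families can be summed
  over the same set of representatives.\<close>

lemma class_sum:
  assumes "finite B" "{C \<in> conj_classes W. f C \<noteq> 0} \<subseteq> B" "B \<subseteq> conj_classes W"
  shows "(\<Oplus>\<^bsub>CA\<^esub> C \<in> {C \<in> conj_classes W. f C \<noteq> 0}. f C \<odot>\<^bsub>CA\<^esub> cocenter_T W S C) = pr (lincomb (rep ` B) (\<lambda>v. f (cls v)))"
proof -
  let ?A = "{C \<in> conj_classes W. f C \<noteq> 0}"
  have fin: "finite ?A" using assms finite_subset by blast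
  have M: "M (rep C) \<in> FS" if "C \<in> conj_classes W" for C using rep_conj_class(1)[OF that] repsD by blast
  have eq: "f C \<odot>\<^bsub>CA\<^esub> cocenter_T W S C = pr (scalar (f C) * M (rep C))" if "C \<in> conj_classes W" for C
  proof -
    from that obtain g where "g \<in> carrier W" "C = cls g" by (auto simp: conj_classes_eq)
    then show ?thesis using cocenter_T_eq M[OF that] by (simp add: CA_simps)
  qed
  interpret abelian_monoid CA
    by (rule abelian_monoidI) (auto simp: CA_simps add_ac)
  have "(\<Oplus>\<^bsub>CA\<^esub> C \<in> ?A. f C \<odot>\<^bsub>CA\<^esub> cocenter_T W S C) = (\<Oplus>\<^bsub>CA\<^esub> C \<in> ?A. pr (scalar (f C) * M (rep C)))"
    using eq M by (intro finsum_cong') (auto simp: CA_simps(1))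
  also have "\<dots> = pr (\<Sum>C\<in>?A. scalar (f C) * M (rep C))"
    using fin M by (intro finsum_CA) auto
  also have "(\<Sum>C\<in>?A. scalar (f C) * M (rep C)) = (\<Sum>C\<in>B. scalar (f C) * M (rep C))"
    using assms by (intro sum.mono_neutral_left) auto
  also have "\<dots> = lincomb (rep ` B) (\<lambda>v. f (cls v))"
  proof -
    have "inj_on rep B" using rep_conj_class(2) assms(3) by (metis inj_onI subsetD)
    moreover have "f (cls (rep C)) = f C" if "C \<in> B" for C using rep_conj_class(2) assms(3) that by auto
    ultimately show ?thesis by (simp add: lincomb_def sum.reindex)
  qed
  finally show ?thesis .
qed

lemma reps_lincomb_FS: "A \<subseteq> reps \<Longrightarrow> lincomb A c \<in> FS"
  using repsD by (intro lincomb_FS) blast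

section \<open>Existence and uniqueness of the class polynomials\<close>

theorem class_polynomials_exist:
  assumes w: "w \<in> carrier W"
  shows "\<exists>f. f \<in> conj_classes W \<rightarrow>\<^sub>E nat_polys_q_minus_1 \<and> finite {C \<in> conj_classes W. f C \<noteq> 0} \<and>
    cocenter_proj W S (hecke_T W S w) =
      (\<Oplus>\<^bsub>CA\<^esub> C \<in> {C \<in> conj_classes W. f C \<noteq> 0}. f C \<odot>\<^bsub>CA\<^esub> cocenter_T W S C)"
proof -
  obtain A c where A: "finite A" "A \<subseteq> reps" "\<And>v. c v \<in> nat_polys_q_minus_1" "M w - lincomb A c \<in> ZZ"
    using expressible_M[OF w] unfolding expressible_def by blast
  let ?f = "\<lambda>C\<in>conj_classes W. if rep C \<in> A then c (rep C) else 0"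
  let ?B = "cls ` A"
  have B: "finite ?B" "?B \<subseteq> conj_classes W" "{C \<in> conj_classes W. ?f C \<noteq> 0} \<subseteq> ?B"
    using A(1,2) repsD rep_conj_class(2) by (auto simp: conj_classes_eq image_iff split: if_splits) metis
  have rep: "rep (cls v) = v" "cls v \<in> conj_classes W" if "v \<in> A" for v
    using that A(2) repsD by (auto simp: conj_classes_eq)
  have repB: "rep ` ?B = A" using rep(1) by force
  have lin: "lincomb (rep ` ?B) (\<lambda>v. ?f (cls v)) = lincomb A c"
    unfolding repB lincomb_def using rep by (intro sum.cong) auto
  have "cocenter_proj W S (hecke_T W S w) = pr (M w)" using hecke_T_eq[OF w] by (simp add: pr_def)
  also have "\<dots> = pr (lincomb A c)" using A w pr_eq reps_lincomb_FS by blast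
  also have "\<dots> = (\<Oplus>\<^bsub>CA\<^esub> C \<in> {C \<in> conj_classes W. ?f C \<noteq> 0}. ?f C \<odot>\<^bsub>CA\<^esub> cocenter_T W S C)"
    using class_sum[OF B(1,3,2)] lin by simp
  finally show ?thesis
    using A(3) nat_polys_0 finite_subset[OF B(3,1)] by (intro exI[of _ ?f] conjI) auto
qed

text \<open>Over the union of the two supports the difference becomes a single relation between
  representatives. Extensionality extends the equality of values on the classes to equality of
  functions.\<close>

theorem class_polynomials_unique:
  assumes f: "f \<in> extensional (conj_classes W)" "finite {C \<in> conj_classes W. f C \<noteq> 0}"
    and g: "g \<in> extensional (conj_classes W)" "finite {C \<in> conj_classes W. g C \<noteq> 0}"
    and eq: "(\<Oplus>\<^bsub>CA\<^esub> C \<in> {C \<in> conj_classes W. f C \<noteq> 0}. f C \<odot>\<^bsub>CA\<^esub> cocenter_T W S C) =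
      (\<Oplus>\<^bsub>CA\<^esub> C \<in> {C \<in> conj_classes W. g C \<noteq> 0}. g C \<odot>\<^bsub>CA\<^esub> cocenter_T W S C)"
  shows "f = g"
proof -
  let ?B = "{C \<in> conj_classes W. f C \<noteq> 0} \<union> {C \<in> conj_classes W. g C \<noteq> 0}"
  have B: "finite ?B" "?B \<subseteq> conj_classes W" using f g by auto
  have A: "finite (rep ` ?B)" "rep ` ?B \<subseteq> reps" using B rep_conj_class(1) by auto
  have "pr (lincomb (rep ` ?B) (\<lambda>v. f (cls v))) = pr (lincomb (rep ` ?B) (\<lambda>v. g (cls v)))"
    using class_sum[OF B(1) _ B(2), of f] class_sum[OF B(1) _ B(2), of g] eq by auto
  then have "lincomb (rep ` ?B) (\<lambda>v. f (cls v)) - lincomb (rep ` ?B) (\<lambda>v. g (cls v)) \<in> ZZ"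
    using pr_eq reps_lincomb_FS[OF A(2)] by blast
  then have ZZ: "lincomb (rep ` ?B) (\<lambda>v. f (cls v) - g (cls v)) \<in> ZZ"
    by (simp add: lincomb_def sum_subtractf left_diff_distrib)
  have "f C = g C" if "C \<in> conj_classes W" for C
  proof (cases "C \<in> ?B")
    case True
    then show ?thesis using lincomb_independent[OF A ZZ, of "rep C"] rep_conj_class(2)[OF that] by simp
  next
    case False
    then show ?thesis using that by simp
  qed
  then show ?thesis using f(1) g(1) by (intro extensionalityI)
qed

end

theorem proposition11p1:
  fixes W :: "('w, 'm) monoid_scheme" and S :: "'w set"
  assumes "crystallographic_coxeter_system W S"
  shows "\<forall>w\<in>carrier W. \<exists>!f :: 'w set \<Rightarrow> laurent.
    f \<in> conj_classes W \<rightarrow>\<^sub>E nat_polys_q_minus_1 \<and>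
    finite {C \<in> conj_classes W. f C \<noteq> 0} \<and>
    cocenter_proj W S (hecke_T W S w) =
      (\<Oplus>\<^bsub>hecke_cocenter W S\<^esub> C \<in> {C \<in> conj_classes W. f C \<noteq> 0}.
         f C \<odot>\<^bsub>hecke_cocenter W S\<^esub> cocenter_T W S C)"
proof
  interpret crystallographic_coxeter_system W S by fact
  fix w assume w: "w \<in> carrier W"
  show "\<exists>!f :: 'w set \<Rightarrow> laurent.
    f \<in> conj_classes W \<rightarrow>\<^sub>E nat_polys_q_minus_1 \<and>
    finite {C \<in> conj_classes W. f C \<noteq> 0} \<and>
    cocenter_proj W S (hecke_T W S w) =
      (\<Oplus>\<^bsub>hecke_cocenter W S\<^esub> C \<in> {C \<in> conj_classes W. f C \<noteq> 0}.
         f C \<odot>\<^bsub>hecke_cocenter W S\<^esub> cocenter_T W S C)" (is "\<exists>!f. ?P f")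
  proof (rule ex_ex1I)
    show "\<exists>f. ?P f" by (rule class_polynomials_exist[OF w])
    show "f = g" if "?P f" "?P g" for f g
      using that by (intro class_polynomials_unique) (auto simp: PiE_def)
  qed
qed

end
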